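(* The colored Kuperberg bracket $\langle\cdot\rangle_c$, which assigns to each closed web $w$ a Laurent polynomial $\langle w\rangle_c$ in $q$, satisfies the following, where $[n]=\frac{q^n-q^{-n}}{q-q^{-1}}$. (1) Multiplicativity: if a closed web $w$ is the disjoint union of two closed webs $w_1$ and $w_2$, then $\langle w\rangle_c=\langle w_1\rangle_c\cdot\langle w_2\rangle_c$. (2) Square relation: let $w,w',w''$ be closed webs which coincide outside a closed disc and which meet the boundary of the disc in the same four points, named in cyclic order $SW, SE, NE, NW$. Suppose that inside the disc: - $w$ consists of a square, with four vertices $a$ (near $SW$), $b$ (near $SE$), $c$ (near $NE$), $d$ (near $NW$), where $a$ and $c$ are sinks and $b$ and $d$ are sources. It has edges $b\to a$, $b\to c$, $d\to c$, $d\to a$ bounding the square, together with the (parts of) edges $SW\to a$, $NE\to c$, $b\to SE$, $d\to NW$; - $w'$ consists of two disjoint oriented strands without vertices, $SW\to SE$ and $NE\to NW$; - $w''$ consists of two disjoint oriented strands without vertices, $SW\to NW$ and $NE\to SE$. Then $\langle w\rangle_c=\langle w'\rangle_c+\langle w''\rangle_c$. (3) Digon relation: let $w,w'$ be closed webs which coincide outside a closed disc and which meet the boundary of the disc in the same two points $S$ and $N$. Suppose that inside the disc: - $w$ consists of a digon, with a sink $a$ and a source $b$, two edges $b\to a$ bounding the digon, and the (parts of) edges $S\to a$ and $b\to N$; - $w'$ consists of a single oriented strand $S\to N$ without vertices. Then $\langle w\rangle_c=[2]\cdot\langle w'\rangle_c$. (4) Circle relation: if $w$ is the closed web consisting of a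 single vertex-less circle, oriented either counterclockwise or clockwise, then $\langle w\rangle_c=[3]$.
   Context: A closed web is a finite 3-regular oriented multigraph, possibly with some vertex-less loops (oriented circles), smoothly embedded in $\mathbb{R}^2$, such that every vertex is either a sink or a source. Let $\mathbb{S}=\{\mathrm{red},\mathrm{green},\mathrm{blue}\}$ with the total order $\mathrm{red}<\mathrm{green}<\mathrm{blue}$. For $u\in\mathbb{S}$ let $\mathbb{S}_u=\mathbb{S}\setminus\{u\}$ with the induced order. An $\mathbb{S}_u$-colored cycle is either an oriented circle embedded in the plane and colored with one of the two colors of $\mathbb{S}_u$, or a connected plane oriented 2-regular graph whose vertices are all sinks or sources, with edges colored by $\mathbb{S}_u$ so that adjacent edges have different colors. It is positively oriented if, after reversing the orientation of the edges (or of the circle) colored with the greatest element of $\mathbb{S}_u$, the result is a counterclockwise oriented cycle. Otherwise it is negatively oriented. An $\mathbb{S}_u$-colored configuration $D$ is a finite disjoint union of $\mathbb{S}_u$-colored cycles. Its degree $d(D)$ is the number of its positively oriented cycles minus the number of its negatively oriented cycles. A coloring ($\mathbb{S}$-edge-coloring) of a closed web $w$ is a function from the set of edges and vertex-less circles of $w$ to $\mathbb{S}$ such that adjacent edges get different colors. Let $\mathrm{col}(w)$ be the set of colorings. For $c\in\mathrm{col}(w)$, $w_c$ denotes $w$ together with $c$. For $u\in\mathbb{S}$, $D_u(w_c)$ denotes the $\mathbb{S}_u$-colored configuration obtained from $w_c$ by deleting all edges and circles of color $u$. The total degree of $w_c$ is $d_t(w_c)=\sum_{u\in\mathbb{S}}d(D_u(w_c))$.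 The colored Kuperberg bracket is $\langle w\rangle_c=\sum_{c\in\mathrm{col}(w)}q^{d_t(w_c)}\in\mathbb{Z}[q,q^{-1}]$, where $q$ is an indeterminate. *)

theory Defs
  imports
    "HOL-Complex_Analysis.Winding_Numbers"
    "HOL-Library.Poly_Mapping"
    "HOL-Library.FuncSet"
    "HOL-Library.Disjoint_Sets"
begin

text \<open>The plane is \<^typ>\<open>complex\<close>.  An oriented smooth curve, taken up to orientation preserving
  reparametrization, is encoded as the set of all pairs (point, unit tangent vector pointing in the
  direction of the orientation).\<close>

type_synonym curve = "(complex \<times> complex) set"

definition locus :: "curve \<Rightarrow> complex set" where
  "locus A = fst ` A"

definition reverse_curve :: "curve \<Rightarrow> curve" where
  "reverse_curve A = (\<lambda>(z, v). (z, - v)) ` A"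

text \<open>Infinitely differentiable with nowhere vanishing derivative; \<open>F n\<close> is the \<open>n\<close>-th derivative,
  one-sided at the end points when \<open>I\<close> is a closed interval.\<close>

definition smooth_immersion :: "real set \<Rightarrow> (real \<Rightarrow> complex) \<Rightarrow> bool" where
  "smooth_immersion I \<gamma> \<longleftrightarrow>
    (\<exists>F :: nat \<Rightarrow> real \<Rightarrow> complex. F 0 = \<gamma> \<and>
      (\<forall>n. \<forall>t\<in>I. (F n has_vector_derivative F (Suc n) t) (at t within I)) \<and>
      (\<forall>t\<in>I. F 1 t \<noteq> 0))"

definition unit_tangent :: "(real \<Rightarrow> complex) \<Rightarrow> real \<Rightarrow> complex" where
  "unit_tangent \<gamma> t = sgn (vector_derivative \<gamma> (at t))"

text \<open>\<open>A\<close> is a smoothly embedded arc from \<open>x\<close> to \<open>y\<close>.  The arc is smooth up to its end points, but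
  \<open>A\<close> itself does not contain them.  Loops are excluded, as they cannot occur in a graph all of whose
  vertices are sinks or sources.\<close>

definition oriented_arc :: "curve \<Rightarrow> complex \<Rightarrow> complex \<Rightarrow> bool" where
  "oriented_arc A x y \<longleftrightarrow>
    (\<exists>\<gamma>. smooth_immersion {0..1} \<gamma> \<and> inj_on \<gamma> {0..1} \<and> \<gamma> 0 = x \<and> \<gamma> 1 = y \<and>
         A = (\<lambda>t. (\<gamma> t, unit_tangent \<gamma> t)) ` {0<..<1})"

definition oriented_circle :: "curve \<Rightarrow> bool" where
  "oriented_circle A \<longleftrightarrow>
    (\<exists>\<gamma>. smooth_immersion UNIV \<gamma> \<and> (\<forall>t. \<gamma> (t + 1) = \<gamma> t) \<and> inj_on \<gamma> {0..<1} \<and>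
         A = (\<lambda>t. (\<gamma> t, unit_tangent \<gamma> t)) ` {0..<1})"


section \<open>Plane oriented multigraphs with vertex-less circles\<close>

record plane_graph =
  verts :: "complex set"
  edges :: "curve set"
  circles :: "curve set"

definition curves :: "plane_graph \<Rightarrow> curve set" where
  "curves G = edges G \<union> circles G"

definition flow :: "plane_graph \<Rightarrow> curve" where
  "flow G = \<Union> (curves G)"

definition graph_locus :: "plane_graph \<Rightarrow> complex set" where
  "graph_locus G = verts G \<union> locus (flow G)"

definition embedded_graph :: "plane_graph \<Rightarrow> bool" where
  "embedded_graph G \<longleftrightarrow>
    finite (verts G) \<and> finite (edges G) \<and> finite (circles G) \<and>
    (\<forall>e\<in>edges G. \<exists>x\<in>verts G. \<exists>y\<in>verts G. oriented_arc e x y) \<and>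
    (\<forall>C\<in>circles G. oriented_circle C) \<and>
    disjoint_family_on locus (curves G) \<and>
    (\<forall>A\<in>curves G. locus A \<inter> verts G = {})"

definition leaves :: "curve \<Rightarrow> complex \<Rightarrow> bool" where
  "leaves e v \<longleftrightarrow> (\<exists>y. oriented_arc e v y)"

definition enters :: "curve \<Rightarrow> complex \<Rightarrow> bool" where
  "enters e v \<longleftrightarrow> (\<exists>x. oriented_arc e x v)"

definition vertex_degree :: "plane_graph \<Rightarrow> complex \<Rightarrow> nat" where
  "vertex_degree G v = card {e \<in> edges G. leaves e v} + card {e \<in> edges G. enters e v}"

definition regular_graph :: "nat \<Rightarrow> plane_graph \<Rightarrow> bool" where
  "regular_graph k G \<longleftrightarrow> (\<forall>v\<in>verts G. vertex_degree G v = k)"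

definition is_sink :: "plane_graph \<Rightarrow> complex \<Rightarrow> bool" where
  "is_sink G v \<longleftrightarrow> (\<forall>e\<in>edges G. \<not> leaves e v)"

definition is_source :: "plane_graph \<Rightarrow> complex \<Rightarrow> bool" where
  "is_source G v \<longleftrightarrow> (\<forall>e\<in>edges G. \<not> enters e v)"

definition sinks_and_sources :: "plane_graph \<Rightarrow> bool" where
  "sinks_and_sources G \<longleftrightarrow> (\<forall>v\<in>verts G. is_sink G v \<or> is_source G v)"

definition adjacent_edges :: "curve \<Rightarrow> curve \<Rightarrow> bool" where
  "adjacent_edges e f \<longleftrightarrow>
    e \<noteq> f \<and> (\<exists>v. (leaves e v \<or> enters e v) \<and> (leaves f v \<or> enters f v))"

definition subgraph :: "plane_graph \<Rightarrow> plane_graph \<Rightarrow> bool" where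
  "subgraph H G \<longleftrightarrow>
    verts H \<subseteq> verts G \<and> edges H \<subseteq> edges G \<and> circles H \<subseteq> circles G"

definition disjoint_union :: "plane_graph \<Rightarrow> plane_graph \<Rightarrow> plane_graph \<Rightarrow> bool" where
  "disjoint_union G G1 G2 \<longleftrightarrow>
    graph_locus G1 \<inter> graph_locus G2 = {} \<and>
    verts G = verts G1 \<union> verts G2 \<and> edges G = edges G1 \<union> edges G2 \<and>
    circles G = circles G1 \<union> circles G2"

definition closed_web :: "plane_graph \<Rightarrow> bool" where
  "closed_web w \<longleftrightarrow> embedded_graph w \<and> regular_graph 3 w \<and> sinks_and_sources w"


section \<open>Colors and colorings\<close>

datatype color = Red | Green | Blue

primrec color_rank :: "color \<Rightarrow> nat" where
  "color_rank Red = 0"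
| "color_rank Green = 1"
| "color_rank Blue = 2"

instantiation color :: linorder
begin

definition less_eq_color :: "color \<Rightarrow> color \<Rightarrow> bool" where
  "less_eq_color x y \<longleftrightarrow> color_rank x \<le> color_rank y"

definition less_color :: "color \<Rightarrow> color \<Rightarrow> bool" where
  "less_color x y \<longleftrightarrow> color_rank x < color_rank y"

instance
proof
  fix x y :: color
  show "x \<le> y \<Longrightarrow> y \<le> x \<Longrightarrow> x = y"
    by (cases x; cases y) (simp_all add: less_eq_color_def)
qed (auto simp: less_eq_color_def less_color_def)

end

lemma UNIV_color: "(UNIV :: color set) = {Red, Green, Blue}"
  using color.exhaust by auto

instance color :: finite
  by standard (simp add: UNIV_color)

definition colors_without :: "color \<Rightarrow> color set" where
  "colors_without u = UNIV - {u}"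

definition proper_on :: "plane_graph \<Rightarrow> (curve \<Rightarrow> color) \<Rightarrow> bool" where
  "proper_on G c \<longleftrightarrow> (\<forall>e\<in>edges G. \<forall>f\<in>edges G. adjacent_edges e f \<longrightarrow> c e \<noteq> c f)"

definition colorings :: "plane_graph \<Rightarrow> (curve \<Rightarrow> color) set" where
  "colorings w = {c \<in> curves w \<rightarrow>\<^sub>E UNIV. proper_on w c}"

definition delete_color :: "color \<Rightarrow> plane_graph \<Rightarrow> (curve \<Rightarrow> color) \<Rightarrow> plane_graph" where
  "delete_color u w c =
    w\<lparr>edges := {e \<in> edges w. c e \<noteq> u}, circles := {C \<in> circles w. c C \<noteq> u}\<rparr>"


section \<open>Colored cycles and degrees\<close>

definition colored_cycle :: "color \<Rightarrow> plane_graph \<Rightarrow> (curve \<Rightarrow> color) \<Rightarrow> bool" where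
  "colored_cycle u Z c \<longleftrightarrow>
    embedded_graph Z \<and> c ` curves Z \<subseteq> colors_without u \<and>
    ((\<exists>C. Z = \<lparr>verts = {}, edges = {}, circles = {C}\<rparr>) \<or>
     (circles Z = {} \<and> graph_locus Z \<noteq> {} \<and> connected (graph_locus Z) \<and>
      regular_graph 2 Z \<and> sinks_and_sources Z \<and> proper_on Z c))"

definition reverse_greatest :: "color \<Rightarrow> plane_graph \<Rightarrow> (curve \<Rightarrow> color) \<Rightarrow> plane_graph" where
  "reverse_greatest u Z c =
    (let r = (\<lambda>A. if c A = Max (colors_without u) then reverse_curve A else A)
     in Z\<lparr>edges := r ` edges Z, circles := r ` circles Z\<rparr>)"

text \<open>\<open>\<gamma>\<close> runs once around \<open>Z\<close> following its orientation; the finitely many exceptional parameters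
  allow for corners of \<open>\<gamma>\<close> at the vertices.\<close>

definition traverses :: "(real \<Rightarrow> complex) \<Rightarrow> plane_graph \<Rightarrow> bool" where
  "traverses \<gamma> Z \<longleftrightarrow>
    simple_path \<gamma> \<and> pathfinish \<gamma> = pathstart \<gamma> \<and> path_image \<gamma> = graph_locus Z \<and>
    (\<exists>T. finite T \<and>
      (\<forall>t\<in>{0..1} - T. \<exists>v. (\<gamma> has_vector_derivative v) (at t) \<and> (\<gamma> t, sgn v) \<in> flow Z))"

definition counterclockwise :: "plane_graph \<Rightarrow> bool" where
  "counterclockwise Z \<longleftrightarrow>
    (\<exists>\<gamma>. traverses \<gamma> Z \<and> (\<forall>z\<in>inside (path_image \<gamma>). winding_number \<gamma> z = 1))"

definition positively_oriented :: "color \<Rightarrow> plane_graph \<Rightarrow> (curve \<Rightarrow> color) \<Rightarrow> bool" where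
  "positively_oriented u Z c \<longleftrightarrow> counterclockwise (reverse_greatest u Z c)"

text \<open>The cycles of a configuration are the colored cycles contained in it: as a configuration is
  2-regular, these are precisely its connected components.\<close>

definition config_cycles :: "color \<Rightarrow> plane_graph \<Rightarrow> (curve \<Rightarrow> color) \<Rightarrow> plane_graph set" where
  "config_cycles u D c = {Z. subgraph Z D \<and> colored_cycle u Z c}"

definition config_degree :: "color \<Rightarrow> plane_graph \<Rightarrow> (curve \<Rightarrow> color) \<Rightarrow> int" where
  "config_degree u D c =
    int (card {Z \<in> config_cycles u D c. positively_oriented u Z c}) -
    int (card {Z \<in> config_cycles u D c. \<not> positively_oriented u Z c})"

definition total_degree :: "plane_graph \<Rightarrow> (curve \<Rightarrow> color) \<Rightarrow> int" where
  "total_degree w c = (\<Sum>u\<in>UNIV. config_degree u (delete_color u w c) c)"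


section \<open>Laurent polynomials and the bracket\<close>

text \<open>The Laurent polynomial ring over the integers is the group ring of the additive group
  \<^typ>\<open>int\<close>; multiplication of \<^type>\<open>poly_mapping\<close> is convolution.\<close>

type_synonym laurent = "int \<Rightarrow>\<^sub>0 int"

definition qpow :: "int \<Rightarrow> laurent" where
  "qpow k = Poly_Mapping.single k 1"

definition quantum_int :: "nat \<Rightarrow> laurent" where
  "quantum_int n = (THE p. p * (qpow 1 - qpow (- 1)) = qpow (int n) - qpow (- int n))"

lemma qpow_add: "qpow (j + k) = qpow j * qpow k"
  by (simp add: qpow_def mult_single)

lemma qpow_0: "qpow 0 = 1"
  by (simp add: qpow_def)

lemma qpow_eq_iff: "qpow j = qpow k \<longleftrightarrow> j = k"
  by (metis qpow_def lookup_single_eq lookup_single_not_eq zero_neq_one)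

lemma quantum_int_unique:
  "p * (qpow 1 - qpow (- 1)) = qpow (int n) - qpow (- int n) \<Longrightarrow> quantum_int n = p"
  unfolding quantum_int_def
proof (rule the_equality)
  fix p'
  assume "p' * (qpow 1 - qpow (- 1)) = qpow (int n) - qpow (- int n)"
    and "p * (qpow 1 - qpow (- 1)) = qpow (int n) - qpow (- int n)"
  then have "p' * (qpow 1 - qpow (- 1)) = p * (qpow 1 - qpow (- 1))" by metis
  moreover have "qpow 1 - qpow (- 1) \<noteq> 0" by (simp add: qpow_eq_iff)
  ultimately show "p' = p" using mult_right_cancel by blast
qed

lemma quantum_int_mult:
  "quantum_int n * (qpow 1 - qpow (- 1)) = qpow (int n) - qpow (- int n)"
proof -
  have "\<exists>p. p * (qpow 1 - qpow (- 1)) = qpow (int n) - qpow (- int n)"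
  proof (induction n)
    case 0
    then show ?case by (intro exI[of _ 0]) simp
  next
    case (Suc n)
    then obtain p where p: "p * (qpow 1 - qpow (- 1)) = qpow (int n) - qpow (- int n)" by blast
    have "(p * qpow (- 1) + qpow (int n)) * (qpow 1 - qpow (- 1)) =
        qpow (- 1) * (p * (qpow 1 - qpow (- 1))) + qpow (int n) * (qpow 1 - qpow (- 1))"
      by (simp add: algebra_simps)
    also have "\<dots> = qpow (int (Suc n)) - qpow (- int (Suc n))"
      unfolding p by (simp add: right_diff_distrib add.commute flip: qpow_add)
    finally show ?case by blast
  qed
  then show ?thesis using quantum_int_unique by metis
qed

definition bracket :: "plane_graph \<Rightarrow> laurent" where
  "bracket w = (\<Sum>c\<in>colorings w. qpow (total_degree w c))"


section \<open>Local modifications\<close>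

definition closed_disc :: "complex set \<Rightarrow> bool" where
  "closed_disc D \<longleftrightarrow> cball (0 :: complex) 1 homeomorphic D"

text \<open>The four points lie in this cyclic order on the boundary of the disc \<open>D\<close>.  The homeomorphism
  may reverse the orientation, so both directions are allowed.\<close>

definition cyclic_on_boundary ::
    "complex set \<Rightarrow> complex \<Rightarrow> complex \<Rightarrow> complex \<Rightarrow> complex \<Rightarrow> bool" where
  "cyclic_on_boundary D p1 p2 p3 p4 \<longleftrightarrow>
    (\<exists>h g \<theta>1 \<theta>2 \<theta>3 \<theta>4. homeomorphism (cball 0 1) D h g \<and>
       \<theta>1 < \<theta>2 \<and> \<theta>2 < \<theta>3 \<and> \<theta>3 < \<theta>4 \<and> \<theta>4 < \<theta>1 + 2 * pi \<and>
       p1 = h (cis \<theta>1) \<and> p2 = h (cis \<theta>2) \<and> p3 = h (cis \<theta>3) \<and> p4 = h (cis \<theta>4))"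

definition coincide_outside :: "complex set \<Rightarrow> plane_graph \<Rightarrow> plane_graph \<Rightarrow> bool" where
  "coincide_outside D w w' \<longleftrightarrow>
    verts w - D = verts w' - D \<and>
    {x \<in> flow w. fst x \<notin> D} = {x \<in> flow w'. fst x \<notin> D}"

text \<open>\<open>w\<close> meets the boundary of \<open>D\<close> exactly in the points \<open>P\<close>, and inside \<open>D\<close> it consists of the
  vertices \<open>V\<close> and pairwise disjoint oriented arcs, one for each pair (initial point, final point)
  in the list \<open>ends\<close>.  The end points in \<open>P\<close> are where edges or circles of \<open>w\<close> are cut by the
  boundary.\<close>

definition inside_disc ::
    "complex set \<Rightarrow> plane_graph \<Rightarrow> complex set \<Rightarrow> complex set \<Rightarrow> (complex \<times> complex) list \<Rightarrow> bool" where
  "inside_disc D w P V ends \<longleftrightarrow>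
    graph_locus w \<inter> frontier D = P \<and> verts w \<inter> D = V \<and> V \<subseteq> interior D \<and>
    (\<exists>As. list_all2 (\<lambda>A (x, y). oriented_arc A x y) As ends \<and>
          disjoint_family_on (\<lambda>i. locus (As ! i)) {..<length As} \<and>
          {x \<in> flow w. fst x \<in> interior D} = \<Union> (set As))"

end

theory Submission
  imports Defs "HOL-Complex_Analysis.Complex_Analysis"
begin

text \<open>A coloring of the curves of a web is the same as a locally constant coloring of its points, and
  the degree of the configuration \<open>D_u\<close> is a sum of signs over the components of the plane set of points
  not colored \<open>u\<close>.  A disc cuts such a coloring into a coloring \<open>g\<close> of the points outside and one
  color for each strand inside, so it suffices to compare, for each fixed \<open>g\<close>, the strand colorings
  inside the disc.  Exchanging crosscuts of the disc for crosscuts with the same ends does not affect the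
  degree of a configuration; joining the four ends of two crosscuts the other way changes it by
  \<open>1\<close> or \<open>-1\<close> according to the orientation of the boundary; and a cycle inside the disc contributes its
  sign.  The first two facts reduce to winding numbers of the loops closed up by the crosscuts.

  If \<open>g\<close> takes two colors at the four ends of the square, then exactly one coloring of the square and
  one of exactly one resolution extends \<open>g\<close>, with the same degrees.  If \<open>g\<close> takes only one color there,
  the square has two colorings, which alternate the other two colors around it, and their degrees are,
  in some order, those of the unique colorings of the two resolutions.  The two colorings of the digon
  that extend \<open>g\<close> differ in the sign of the cycle bounding it, whence the factor \<open>q + 1/q\<close>.\<close>

section \<open>Paths following a field of directions\<close>

text \<open>Edges are the wrong carrier for the comparison: the boundary of the disc may cut an edge
  several times, and the outer pieces may belong to other edges, or to circles, of the other web, so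
  that the colorings of two webs have no common domain. The points outside the disc are a common
  domain. The orientation rule is what makes cycles traversable: at a sink or source both remaining
  edges point the same way, and reversing the greater color turns one of them around. Reconnecting
  crosscuts may merge two loops or split one, depending on how the outside closes them up. The
  change of degree is nevertheless the same, since winding numbers jump across each crosscut by the
  orientation \<open>\<sigma>\<close> of the boundary. If all ends of the square have one color, the
  degrees of its two colorings exceed that of the first resolution by \<open>ex + ez\<close> and
  \<open>ey - ez\<close>, and the degree of the second resolution exceeds it by
  \<open>ex + ey\<close>, where all three terms are signs. These match in some order unless
  \<open>ez = ex = - ey\<close>, and that would make the order of the three colors cyclic.\<close>

definition follows :: "(real \<Rightarrow> complex) \<Rightarrow> curve \<Rightarrow> bool" where
  "follows p F \<longleftrightarrow>
    (\<exists>T. finite T \<and> (\<forall>t\<in>{0..1} - T. \<exists>v. (p has_vector_derivative v) (at t) \<and> (p t, sgn v) \<in> F))"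

text \<open>Single-valuedness gives every path that follows \<open>F\<close> its direction: two
  paths along the same points cannot run oppositely. Nonzero directions exclude parameters with
  vanishing derivative, as \<open>sgn 0 = 0\<close>.\<close>

definition direction_field :: "curve \<Rightarrow> bool" where
  "direction_field F \<longleftrightarrow> single_valued F \<and> (\<forall>(z, v)\<in>F. v \<noteq> 0)"

text \<open>Common core of joining, restricting, shifting and reversing. By the chain rule the
  derivative is multiplied by \<open>b\<close>, and after normalization only the sign of
  \<open>b\<close> remains. The open set \<open>S\<close> is there because joined and shifted paths
  are affine reparametrizations only piecewise.\<close>

lemma follows_affine_piece:
  assumes "follows p F" "b \<noteq> 0"
  obtains T where "finite T"
    "\<And>t r S. t \<notin> T \<Longrightarrow> a + b * t \<in> {0..1} \<Longrightarrow> open S \<Longrightarrow> t \<in> S \<Longrightarrow>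
      (\<And>s. s \<in> S \<Longrightarrow> r s = p (a + b * s)) \<Longrightarrow>
      \<exists>v. (r has_vector_derivative v) (at t) \<and> (r t, sgn b *\<^sub>R sgn v) \<in> F"
proof -
  obtain T where T: "finite T"
    "\<And>t. t \<in> {0..1} - T \<Longrightarrow> \<exists>v. (p has_vector_derivative v) (at t) \<and> (p t, sgn v) \<in> F"
    using assms unfolding follows_def by blast
  show ?thesis
  proof
    show "finite ((\<lambda>t. (t - a) / b) ` T)" using T by simp
    fix t r S assume t: "t \<notin> (\<lambda>t. (t - a) / b) ` T" "a + b * t \<in> {0..1}" "open S" "t \<in> S"
      and r: "\<And>s. s \<in> S \<Longrightarrow> r s = p (a + b * s)"
    have "a + b * t \<notin> T"
    proof
      assume "a + b * t \<in> T"
      then have "((a + b * t) - a) / b \<in> (\<lambda>t. (t - a) / b) ` T" by blast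
      then show False using t assms by simp
    qed
    then obtain v where v: "(p has_vector_derivative v) (at (a + b * t))" "(p (a + b * t), sgn v) \<in> F"
      using T t by blast
    have "((\<lambda>s. a + b * s) has_vector_derivative b) (at t)"
      by (auto intro!: derivative_eq_intros simp: has_real_derivative_iff_has_vector_derivative[symmetric])
    then have "((p \<circ> (\<lambda>s. a + b * s)) has_vector_derivative (b *\<^sub>R v)) (at t)"
      using v by (intro vector_diff_chain_at)
    then have "(r has_vector_derivative (b *\<^sub>R v)) (at t)"
      by (rule has_vector_derivative_transform_within_open[of _ _ _ S]) (use t r in auto)
    moreover have "sgn b *\<^sub>R sgn (b *\<^sub>R v) = sgn v"
      using assms by (simp add: sgn_scaleR sgn_real_def)
    moreover have "r t = p (a + b * t)" using r t by blast
    ultimately show "\<exists>v. (r has_vector_derivative v) (at t) \<and> (r t, sgn b *\<^sub>R sgn v) \<in> F"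
      using v by auto
  qed
qed

lemma follows_join:
  assumes "follows p F" "follows q F"
  shows "follows (p +++ q) F"
proof -
  obtain T1 where T1: "finite T1"
    "\<And>t r S. t \<notin> T1 \<Longrightarrow> 0 + 2 * t \<in> {0..1} \<Longrightarrow> open S \<Longrightarrow> t \<in> S \<Longrightarrow>
      (\<And>s. s \<in> S \<Longrightarrow> r s = p (0 + 2 * s)) \<Longrightarrow>
      \<exists>v. (r has_vector_derivative v) (at t) \<and> (r t, sgn 2 *\<^sub>R sgn v) \<in> F"
    using follows_affine_piece[OF assms(1), of 2 0] by (metis zero_neq_numeral)
  obtain T2 where T2: "finite T2"
    "\<And>t r S. t \<notin> T2 \<Longrightarrow> -1 + 2 * t \<in> {0..1} \<Longrightarrow> open S \<Longrightarrow> t \<in> S \<Longrightarrow>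
      (\<And>s. s \<in> S \<Longrightarrow> r s = q (-1 + 2 * s)) \<Longrightarrow>
      \<exists>v. (r has_vector_derivative v) (at t) \<and> (r t, sgn 2 *\<^sub>R sgn v) \<in> F"
    using follows_affine_piece[OF assms(2), of 2 "-1"] by (metis zero_neq_numeral)
  have "\<exists>v. ((p +++ q) has_vector_derivative v) (at t) \<and> ((p +++ q) t, sgn v) \<in> F"
    if t: "t \<in> {0..1} - (T1 \<union> T2 \<union> {1/2})" for t
  proof (cases "t < 1/2")
    case True
    then show ?thesis using T1(2)[of t "{..<1/2}" "p +++ q"] t
      by (auto simp: joinpaths_def)
  next
    case False
    then show ?thesis using T2(2)[of t "{1/2<..}" "p +++ q"] t
      by (auto simp: joinpaths_def)
  qed
  then show ?thesis unfolding follows_def using T1 T2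
    by (intro exI[of _ "T1 \<union> T2 \<union> {1/2}"]) simp
qed

lemma follows_subpath:
  assumes "follows p F" "0 \<le> u" "u < v" "v \<le> 1"
  shows "follows (subpath u v p) F"
proof -
  obtain T1 where T1: "finite T1"
    "\<And>t r S. t \<notin> T1 \<Longrightarrow> u + (v - u) * t \<in> {0..1} \<Longrightarrow> open S \<Longrightarrow> t \<in> S \<Longrightarrow>
      (\<And>s. s \<in> S \<Longrightarrow> r s = p (u + (v - u) * s)) \<Longrightarrow>
      \<exists>w. (r has_vector_derivative w) (at t) \<and> (r t, sgn (v - u) *\<^sub>R sgn w) \<in> F"
    using follows_affine_piece[OF assms(1), of "v - u" u] assms by (metis diff_gt_0_iff_gt less_irrefl)
  have "\<exists>w. (subpath u v p has_vector_derivative w) (at t) \<and> (subpath u v p t, sgn w) \<in> F"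
    if t: "t \<in> {0..1} - T1" for t
  proof -
    have "0 \<le> (v - u) * t"
      using t assms by (intro mult_nonneg_nonneg) auto
    moreover have "(v - u) * t \<le> v - u"
      using mult_left_mono[of t 1 "v - u"] t assms by simp
    ultimately have "u + (v - u) * t \<in> {0..1}"
      using assms unfolding atLeastAtMost_iff by linarith
    then show ?thesis using T1(2)[of t UNIV "subpath u v p"] t assms
      by (auto simp: subpath_def add.commute)
  qed
  then show ?thesis unfolding follows_def using T1 by blast
qed

lemma follows_shiftpath:
  assumes "follows p F" "0 \<le> a" "a \<le> 1"
  shows "follows (shiftpath a p) F"
proof -
  obtain T1 where T1: "finite T1"
    "\<And>t r S. t \<notin> T1 \<Longrightarrow> a + 1 * t \<in> {0..1} \<Longrightarrow> open S \<Longrightarrow> t \<in> S \<Longrightarrow>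
      (\<And>s. s \<in> S \<Longrightarrow> r s = p (a + 1 * s)) \<Longrightarrow>
      \<exists>v. (r has_vector_derivative v) (at t) \<and> (r t, sgn 1 *\<^sub>R sgn v) \<in> F"
    using follows_affine_piece[OF assms(1), of 1 a] by (metis zero_neq_one)
  obtain T2 where T2: "finite T2"
    "\<And>t r S. t \<notin> T2 \<Longrightarrow> (a - 1) + 1 * t \<in> {0..1} \<Longrightarrow> open S \<Longrightarrow> t \<in> S \<Longrightarrow>
      (\<And>s. s \<in> S \<Longrightarrow> r s = p ((a - 1) + 1 * s)) \<Longrightarrow>
      \<exists>v. (r has_vector_derivative v) (at t) \<and> (r t, sgn 1 *\<^sub>R sgn v) \<in> F"
    using follows_affine_piece[OF assms(1), of 1 "a - 1"] by (metis zero_neq_one)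
  have "\<exists>v. (shiftpath a p has_vector_derivative v) (at t) \<and> (shiftpath a p t, sgn v) \<in> F"
    if t: "t \<in> {0..1} - (T1 \<union> T2 \<union> {1 - a})" for t
  proof (cases "t < 1 - a")
    case True
    then show ?thesis using T1(2)[of t "{..<1-a}" "shiftpath a p"] t assms
      by (auto simp: shiftpath_def)
  next
    case False
    then show ?thesis using T2(2)[of t "{1-a<..}" "shiftpath a p"] t assms
      by (auto simp: shiftpath_def algebra_simps)
  qed
  then show ?thesis unfolding follows_def using T1 T2
    by (intro exI[of _ "T1 \<union> T2 \<union> {1-a}"]) simp
qed

lemma reverse_curve_iff: "(z, v) \<in> reverse_curve A \<longleftrightarrow> (z, - v) \<in> A"
  by (force simp: reverse_curve_def image_iff)

lemma follows_reversepath: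
  assumes "follows p F"
  shows "follows (reversepath p) (reverse_curve F)"
proof -
  obtain T1 where T1: "finite T1"
    "\<And>t r S. t \<notin> T1 \<Longrightarrow> 1 + (-1) * t \<in> {0..1} \<Longrightarrow> open S \<Longrightarrow> t \<in> S \<Longrightarrow>
      (\<And>s. s \<in> S \<Longrightarrow> r s = p (1 + (-1) * s)) \<Longrightarrow>
      \<exists>v. (r has_vector_derivative v) (at t) \<and> (r t, sgn (-1) *\<^sub>R sgn v) \<in> F"
    using follows_affine_piece[OF assms(1), of "-1" 1] by (metis neg_equal_0_iff_equal zero_neq_one)
  have "\<exists>v. (reversepath p has_vector_derivative v) (at t) \<and> (reversepath p t, sgn v) \<in> reverse_curve F"
    if t: "t \<in> {0..1} - T1" for t
    using T1(2)[of t UNIV "reversepath p"] t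
    by (auto simp: reversepath_def reverse_curve_iff)
  then show ?thesis unfolding follows_def using T1 by blast
qed

text \<open>Only the directions met by \<open>p\<close> matter, and finitely many parameters may be
  dropped. This carries outer arcs from one web to the other: the direction fields agree off the
  disc, and an outer arc meets the disc in finitely many points.\<close>

lemma follows_transfer:
  assumes "follows p F" "finite {t \<in> {0..1}. p t \<in> X}"
    and "\<And>z v. (z, v) \<in> F \<Longrightarrow> z \<in> path_image p \<Longrightarrow> z \<notin> X \<Longrightarrow> (z, v) \<in> F'"
  shows "follows p F'"
proof -
  obtain T where T: "finite T"
    "\<And>t. t \<in> {0..1} - T \<Longrightarrow> \<exists>v. (p has_vector_derivative v) (at t) \<and> (p t, sgn v) \<in> F"
    using assms unfolding follows_def by blast
  have "\<forall>t\<in>{0..1} - (T \<union> {t \<in> {0..1}. p t \<in> X}). \<exists>v. (p has_vector_derivative v) (at t) \<and> (p t, sgn v) \<in> F'"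
    using T assms(3) by (fastforce simp: path_image_def)
  then show ?thesis unfolding follows_def using T assms(2) by (metis (no_types, lifting) finite_UnI)
qed

lemma follows_mono: "follows p F \<Longrightarrow> F \<subseteq> F' \<Longrightarrow> follows p F'"
  using follows_transfer[of p F "{}" F'] by auto

section \<open>Winding numbers in simply connected sets, and the direction of travel along an
  arc\<close>

lemma winding_number_simply_connected_eq:
  assumes "simply_connected S" "path p" "path q" "path_image p \<subseteq> S" "path_image q \<subseteq> S"
    and "pathstart p = pathstart q" "pathfinish p = pathfinish q" "z \<notin> S"
  shows "winding_number p z = winding_number q z"
proof -
  have "homotopic_paths S p q"
    using assms(1)[unfolded simply_connected_eq_homotopic_paths] assms(2-7) by simp
  moreover have "S \<subseteq> - {z}" using assms(8) by blast
  ultimately show ?thesis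
    by (blast intro: winding_number_homotopic_paths homotopic_paths_subset)
qed

lemma simply_connected_arc_image:
  fixes p :: "real \<Rightarrow> complex"
  assumes "arc p"
  shows "simply_connected (path_image p)"
proof -
  have "{0..1::real} homeomorphic path_image p"
    unfolding homeomorphic_def by (rule homeomorphism_arc[OF assms]) blast
  then show ?thesis
    using homeomorphic_simply_connected_eq convex_imp_simply_connected
      convex_real_interval by blast
qed

text \<open>Pulled back along the homeomorphism \<open>q\<close>, the set \<open>C\<close> becomes a
  connected subset of the parameter interval, hence an order convex one.\<close>

lemma arc_connected_subset:
  fixes q :: "real \<Rightarrow> complex"
  assumes "arc q" "connected C" "C \<subseteq> path_image q" "q s \<in> C" "q t \<in> C" "s \<in> {0..1}" "t \<in> {0..1}"
  shows "q ` {s..t} \<subseteq> C"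
proof -
  obtain h where h: "homeomorphism {0..1} (path_image q) q h"
    using homeomorphism_arc[OF assms(1)] .
  have "connected (h ` C)"
    using h assms by (meson connected_continuous_image continuous_on_subset homeomorphism_cont2)
  moreover have "s \<in> h ` C" "t \<in> h ` C"
    using h assms by (metis homeomorphism_apply1 image_eqI)+
  ultimately have "{s..t} \<subseteq> h ` C" by (meson connected_contains_Icc)
  moreover have "q ` h ` C = C" using h assms
    by (force simp: homeomorphism_def image_image subset_iff)
  ultimately show ?thesis by blast
qed

text \<open>The smaller image is connected and contains both ends of \<open>q\<close>, so no point
  of \<open>q\<close> in between can be missing.\<close>

lemma arc_subset_eq:
  fixes p q :: "real \<Rightarrow> complex"
  assumes "arc p" "arc q" "path_image p \<subseteq> path_image q"
    and "{pathstart p, pathfinish p} = {pathstart q, pathfinish q}"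
  shows "path_image p = path_image q"
proof -
  have "q ` {0..1} \<subseteq> path_image p"
  proof (rule arc_connected_subset[OF assms(2)])
    have "pathstart q \<in> path_image p" "pathfinish q \<in> path_image p"
      using assms(4) by (metis insertCI insertE pathfinish_in_path_image pathstart_in_path_image singletonD)+
    then show "q 0 \<in> path_image p" "q 1 \<in> path_image p"
      by (auto simp: pathstart_def pathfinish_def)
  qed (use assms in \<open>auto simp: connected_path_image arc_imp_path\<close>)
  then show ?thesis using assms(3) by (auto simp: path_image_def)
qed

text \<open>The change of parameter \<open>\<phi>\<close> from \<open>p\<close> to \<open>q\<close>
  is monotone, and an increasing one preserves the start. For a decreasing one, consider a parameter
  where both paths have derivatives: single-valuedness of \<open>F\<close> makes these positive
  multiples of each other, so both paths advance in the direction \<open>v\<close>, although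
  \<open>p\<close> runs through \<open>q\<close> backwards. Comparing scalar products with
  \<open>v\<close> avoids the question whether \<open>\<phi>\<close> is differentiable.\<close>

lemma same_direction:
  assumes "arc p" "arc q" and im: "path_image p = path_image q"
    and F: "direction_field F" and fol: "follows p F" "follows q F"
  shows "pathstart p = pathstart q"
proof (rule ccontr)
  assume ne: "pathstart p \<noteq> pathstart q"
  obtain g where g: "homeomorphism {0..1} (path_image q) q g"
    using homeomorphism_arc[OF assms(2)] .
  define \<phi> where "\<phi> = g \<circ> p"
  have cont: "continuous_on {0..1} \<phi>"
    unfolding \<phi>_def using g im assms(1)
    by (metis arc_def continuous_on_compose homeomorphism_cont2 path_def path_image_def)
  have inj: "inj_on \<phi> {0..1}"
    unfolding \<phi>_def using g im assms(1)
    by (metis arc_def comp_inj_on homeomorphism_def inj_on_inverseI path_image_def)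
  have surj: "\<phi> ` {0..1} = {0..1}"
    unfolding \<phi>_def using g im by (metis homeomorphism_def image_comp path_image_def)
  have q\<phi>: "q (\<phi> t) = p t" if "t \<in> {0..1}" for t
  proof -
    have "p t \<in> path_image q" using im that by (auto simp: path_image_def)
    then show ?thesis unfolding \<phi>_def using g by (auto simp: homeomorphism_def)
  qed
  consider "strict_mono_on {0..1} \<phi>" | "strict_antimono_on {0..1} \<phi>"
    using injective_eq_monotone_map[of "{0..1}" \<phi>] cont inj is_interval_cc by blast
  then show False
  proof cases
    case 1
    obtain t where t: "t \<in> {0..1}" "\<phi> t = 0" using surj by (metis atLeastAtMost_iff imageE order_refl zero_le_one)
    have "\<phi> 0 \<in> {0..1}" using surj by force
    have "t = 0"
    proof (rule ccontr)
      assume "t \<noteq> 0"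
      then have "\<phi> 0 < \<phi> t" using strict_mono_onD[OF 1, of 0 t] t by auto
      then show False using t \<open>\<phi> 0 \<in> {0..1}\<close> by auto
    qed
    then show False using q\<phi>[of 0] t ne by (simp add: pathstart_def)
  next
    case 2
    obtain Tp where Tp: "finite Tp"
      "\<And>t. t \<in> {0..1} - Tp \<Longrightarrow> \<exists>v. (p has_vector_derivative v) (at t) \<and> (p t, sgn v) \<in> F"
      using fol(1) unfolding follows_def by blast
    obtain Tq where Tq: "finite Tq"
      "\<And>t. t \<in> {0..1} - Tq \<Longrightarrow> \<exists>v. (q has_vector_derivative v) (at t) \<and> (q t, sgn v) \<in> F"
      using fol(2) unfolding follows_def by blast
    \<comment> \<open>Since \<open>\<phi>\<close> is injective, only finitely many parameters are
      sent to exceptional parameters of \<open>q\<close>. The ends are excluded as well, to have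
      room on both sides.\<close>
    have "finite {t \<in> {0..1}. \<phi> t \<in> insert 0 (insert 1 Tq)}"
    proof -
      have "finite (\<phi> -` insert 0 (insert 1 Tq) \<inter> {0..1})"
        using Tq inj by (intro finite_vimage_IntI) auto
      then show ?thesis by (rule rev_finite_subset) auto
    qed
    then have "\<not> {0<..<1} \<subseteq> Tp \<union> {t \<in> {0..1}. \<phi> t \<in> insert 0 (insert 1 Tq)}"
      using Tp by (meson finite_UnI finite_subset infinite_Ioo zero_less_one)
    then obtain t where "t \<in> {0<..<1} - (Tp \<union> {t \<in> {0..1}. \<phi> t \<in> insert 0 (insert 1 Tq)})" by blast
    then have t: "t \<in> {0<..<1}" "t \<notin> Tp" "\<phi> t \<notin> insert 0 (insert 1 Tq)" by auto
    define s where "s = \<phi> t"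
    have s: "s \<in> {0<..<1}" "s \<notin> Tq"
    proof -
      have "\<phi> t \<in> \<phi> ` {0..1}" using t by (intro imageI) auto
      then have "s \<in> {0..1}" using surj unfolding s_def by simp
      then show "s \<in> {0<..<1}" "s \<notin> Tq" using t s_def by auto
    qed
    obtain v where v: "(p has_vector_derivative v) (at t)" "(p t, sgn v) \<in> F"
      using Tp(2)[of t] t by auto
    obtain w where w: "(q has_vector_derivative w) (at s)" "(q s, sgn w) \<in> F"
      using Tq(2)[of s] s by auto
    have "q s = p t" using q\<phi> t s_def by auto
    then have sg: "sgn v = sgn w" "sgn v \<noteq> 0"
      using F v(2) w(2) unfolding direction_field_def single_valued_def by (metis, force)
    then have nz: "v \<noteq> 0" "w \<noteq> 0" by auto
    have "w = (norm w / norm v) *\<^sub>R v"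
    proof -
      have "w = norm w *\<^sub>R sgn w" using nz by (simp add: sgn_div_norm)
      also have "\<dots> = norm w *\<^sub>R sgn v" using sg by simp
      also have "\<dots> = (norm w / norm v) *\<^sub>R v" by (simp add: sgn_div_norm divide_inverse)
      finally show ?thesis .
    qed
    then have "w \<bullet> v = (norm w / norm v) * (v \<bullet> v)" by (metis inner_scaleR_left)
    then have wv: "w \<bullet> v > 0" using nz by (simp add: zero_less_mult_iff)
    have "((\<lambda>x. p x \<bullet> v) has_real_derivative (v \<bullet> v)) (at t)"
      using bounded_linear.has_vector_derivative[OF bounded_linear_inner_left v(1), of v]
      by (simp add: has_real_derivative_iff_has_vector_derivative)
    then obtain d1 where d1: "d1 > 0" "\<And>h. 0 < h \<Longrightarrow> h < d1 \<Longrightarrow> p t \<bullet> v < p (t + h) \<bullet> v"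
      using DERIV_pos_inc_right[of "\<lambda>x. p x \<bullet> v" "v \<bullet> v" t] nz by auto
    have "((\<lambda>x. q x \<bullet> v) has_real_derivative (w \<bullet> v)) (at s)"
      using bounded_linear.has_vector_derivative[OF bounded_linear_inner_left w(1), of v]
      by (simp add: has_real_derivative_iff_has_vector_derivative)
    then obtain d2 where d2: "d2 > 0" "\<And>h. 0 < h \<Longrightarrow> h < d2 \<Longrightarrow> q (s - h) \<bullet> v < q s \<bullet> v"
      using DERIV_pos_inc_left[of "\<lambda>x. q x \<bullet> v" "w \<bullet> v" s] wv by auto
    obtain d3 where d3: "d3 > 0" "\<And>x. x \<in> {0..1} \<Longrightarrow> dist x t < d3 \<Longrightarrow> dist (\<phi> x) (\<phi> t) < d2"
      using cont[unfolded continuous_on_iff, rule_format, of t d2] t d2(1) by auto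
    define h where "h = min (min d1 d3) (1 - t) / 2"
    have h: "0 < h" "h < d1" "h < d3" "t + h \<in> {0..1}" using t d1(1) d3(1) by (auto simp: h_def min_def field_simps)
    have "\<phi> (t + h) < s" using monotone_onD[OF 2, of t "t + h"] t h by (auto simp: s_def)
    moreover have "dist (\<phi> (t + h)) s < d2" using d3(2)[OF h(4)] h by (simp add: s_def dist_real_def)
    ultimately have "q (s - (s - \<phi> (t + h))) \<bullet> v < q s \<bullet> v"
      using d2(2)[of "s - \<phi> (t + h)"] by (simp add: dist_real_def)
    then have "p (t + h) \<bullet> v < p t \<bullet> v" using q\<phi>[OF h(4)] \<open>q s = p t\<close> by simp
    then show False using d1(2)[OF h(1,2)] by simp
  qed
qed

section \<open>Simple loops\<close>

definition simple_loop :: "(real \<Rightarrow> complex) \<Rightarrow> bool" where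
  "simple_loop p \<longleftrightarrow> simple_path p \<and> pathfinish p = pathstart p"

text \<open>The condition is the one in \<open>counterclockwise\<close>. By the Jordan curve theorem
  the winding number is constant inside a simple loop and equal to 1 or -1, so the default -1 is its
  value in the remaining case.\<close>

definition loop_sign :: "(real \<Rightarrow> complex) \<Rightarrow> int" where
  "loop_sign p = (if \<forall>z\<in>inside (path_image p). winding_number p z = 1 then 1 else - 1)"

lemma simple_loop_imp_path: "simple_loop p \<Longrightarrow> path p"
  by (simp add: simple_loop_def simple_path_imp_path)

lemma loop_sign_inside:
  assumes "simple_loop p" "z \<in> inside (path_image p)"
  shows "winding_number p z = of_int (loop_sign p)"
proof -
  have "simple_path p" using assms by (simp add: simple_loop_def)
  then show ?thesis
    by (rule simple_closed_path_winding_number_inside) (use assms in \<open>auto simp: loop_sign_def\<close>)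
qed

lemma winding_number_simple_loop_cases:
  assumes "simple_loop p" "z \<notin> path_image p"
  shows "winding_number p z = 0 \<and> z \<in> outside (path_image p) \<or>
    winding_number p z = of_int (loop_sign p) \<and> z \<in> inside (path_image p)"
proof (cases "z \<in> inside (path_image p)")
  case True
  then show ?thesis using loop_sign_inside assms by blast
next
  case False
  then have "z \<in> outside (path_image p)" using assms by (metis ComplI UnE inside_Un_outside)
  then show ?thesis using assms
    by (simp add: winding_number_zero_in_outside simple_loop_imp_path simple_loop_def)
qed

lemma loop_sign_cases: "loop_sign p = 1 \<or> loop_sign p = - 1"
  by (simp add: loop_sign_def)

lemma simple_loop_inside_nonempty: "simple_loop p \<Longrightarrow> inside (path_image p) \<noteq> {}"
  by (simp add: Jordan_inside_outside simple_loop_def)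

text \<open>One common point with the same nonzero winding number decides: it is inside both loops,
  and there the winding number is the sign.\<close>

lemma loop_sign_eqI:
  assumes "simple_loop p" "simple_loop q" "z \<notin> path_image p" "z \<notin> path_image q"
    "winding_number p z = winding_number q z" "winding_number p z \<noteq> 0"
  shows "loop_sign p = loop_sign q"
  using winding_number_simple_loop_cases[OF assms(1,3)] winding_number_simple_loop_cases[OF assms(2,4)]
    assms(5,6) by auto

lemma simple_loop_reversepath: "simple_loop p \<Longrightarrow> simple_loop (reversepath p)"
  by (simp add: simple_loop_def simple_path_reversepath)

lemma loop_sign_reversepath:
  assumes "simple_loop p"
  shows "loop_sign (reversepath p) = - loop_sign p"
proof -
  obtain z where z: "z \<in> inside (path_image p)" using simple_loop_inside_nonempty assms by blast
  then have "z \<notin> path_image p" using inside_no_overlap by blast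
  then have "winding_number (reversepath p) z = - winding_number p z"
    using assms by (simp add: winding_number_reversepath simple_loop_imp_path)
  moreover have "winding_number p z = of_int (loop_sign p)" using loop_sign_inside assms z by blast
  moreover have "winding_number (reversepath p) z = of_int (loop_sign (reversepath p))"
    using loop_sign_inside simple_loop_reversepath assms z by (metis path_image_reversepath)
  ultimately have "(of_int (loop_sign (reversepath p)) :: complex) = of_int (- loop_sign p)" by simp
  then show ?thesis by (simp only: of_int_eq_iff)
qed

text \<open>A loop with a point \<open>x\<close> outside \<open>D\<close> also has inner points
  outside \<open>D\<close>, because \<open>x\<close> is on the frontier of the inside and the
  complement of \<open>D\<close> is open. At such a point the two winding numbers agree and are
  nonzero.\<close>

lemma loop_sign_transfer:
  assumes p: "simple_loop p" and q: "simple_loop q" and "closed D" "x \<in> path_image p" "x \<notin> D"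
    and sub: "path_image q \<subseteq> path_image p \<union> D"
    and eq: "\<And>z. z \<notin> D \<Longrightarrow> z \<notin> path_image p \<Longrightarrow> winding_number p z = winding_number q z"
  shows "loop_sign p = loop_sign q"
proof -
  have "x \<in> closure (inside (path_image p))"
    using assms(1,4) Jordan_inside_outside[of p] unfolding simple_loop_def frontier_def by blast
  moreover have "open (- D)" "x \<in> - D" using assms by auto
  ultimately have "- D \<inter> inside (path_image p) \<noteq> {}"
    using open_Int_closure_eq_empty[of "- D" "inside (path_image p)"] by blast
  then obtain z where z: "z \<in> inside (path_image p)" "z \<notin> D" by blast
  have "z \<notin> path_image p" using z inside_no_overlap by blast
  show ?thesis
  proof (rule loop_sign_eqI[OF p q])
    show "winding_number p z \<noteq> 0" using loop_sign_inside[OF p z(1)] loop_sign_cases[of p] by auto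
  qed (use z sub eq \<open>z \<notin> path_image p\<close> in auto)
qed

text \<open>Start the loop at the start of \<open>p\<close> and cut it where \<open>p\<close> ends.
  Without its ends \<open>p\<close> is connected and avoids the two cutting points, so it fills one
  of the two pieces. It is the one with the right direction, as the other piece runs from the end of
  \<open>p\<close> to its start.\<close>

lemma loop_minus_arc:
  assumes "simple_loop \<gamma>" "follows \<gamma> F" "arc p" "follows p F" "path_image p \<subseteq> path_image \<gamma>"
    and F: "direction_field F"
  obtains r where "arc r" "follows r F" "pathstart r = pathfinish p" "pathfinish r = pathstart p"
    "path_image p \<union> path_image r = path_image \<gamma>"
    "path_image p \<inter> path_image r = {pathstart p, pathfinish p}"
    "\<And>z. z \<notin> path_image \<gamma> \<Longrightarrow> winding_number \<gamma> z = winding_number p z + winding_number r z"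
proof -
  define a b where "a = pathstart p" and "b = pathfinish p"
  have ab: "a \<noteq> b" using arc_distinct_ends[OF assms(3)] by (simp add: a_def b_def)
  have "a \<in> path_image \<gamma>" "b \<in> path_image \<gamma>" using assms(5) a_def b_def by auto
  then obtain t0 where t0: "t0 \<in> {0..1}" "\<gamma> t0 = a" by (auto simp: path_image_def)
  define \<delta> where "\<delta> = shiftpath t0 \<gamma>"
  have \<gamma>: "simple_path \<gamma>" "pathfinish \<gamma> = pathstart \<gamma>" using assms(1) by (auto simp: simple_loop_def)
  have \<delta>: "simple_path \<delta>" "path_image \<delta> = path_image \<gamma>" "follows \<delta> F"
    using \<gamma> t0 assms(2) by (auto simp: \<delta>_def simple_path_shiftpath path_image_shiftpath follows_shiftpath)
  have \<delta>01: "\<delta> 0 = a" "\<delta> 1 = a"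
    using \<gamma> t0 by (auto simp: \<delta>_def shiftpath_def pathfinish_def pathstart_def)
  have wn: "winding_number \<delta> z = winding_number \<gamma> z" if "z \<notin> path_image \<gamma>" for z
    using \<gamma> t0 that by (auto simp: \<delta>_def winding_number_shiftpath simple_path_imp_path)
  obtain s where s: "s \<in> {0..1}" "\<delta> s = b"
    using \<open>b \<in> path_image \<gamma>\<close> \<delta>(2) by (metis imageE path_image_def)
  have s01: "0 < s" "s < 1" using s \<delta>01 ab by (auto simp: less_le)
  have free: "x = y \<or> x = 0 \<and> y = 1 \<or> x = 1 \<and> y = 0"
    if "x \<in> {0..1}" "y \<in> {0..1}" "\<delta> x = \<delta> y" for x y
    using \<delta>(1) that unfolding simple_path_def loop_free_def by blast
  define u d where "u = subpath 0 s \<delta>" and "d = subpath s 1 \<delta>"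
  have arcs: "arc u" "arc d"
    unfolding u_def d_def using \<delta> s s01 \<delta>01 ab by (intro arc_simple_path_subpath; simp)+
  have ends: "pathstart u = a" "pathfinish u = b" "pathstart d = b" "pathfinish d = a"
    using \<delta>01 s by (auto simp: u_def d_def)
  have fol: "follows u F" "follows d F"
    unfolding u_def d_def using \<delta> s01 by (intro follows_subpath; simp)+
  have imu: "path_image u = \<delta> ` {0..s}" and imd: "path_image d = \<delta> ` {s..1}"
    using s01 by (auto simp: u_def d_def path_image_subpath)
  have un: "path_image u \<union> path_image d = path_image \<gamma>"
  proof -
    have "{0..s} \<union> {s..1} = {0..1}" using s01 by auto
    then show ?thesis unfolding imu imd \<delta>(2)[symmetric] unfolding path_image_def image_Un[symmetric] by simp
  qed
  have int: "path_image u \<inter> path_image d = {a, b}"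
  proof
    show "path_image u \<inter> path_image d \<subseteq> {a, b}"
    proof
      fix x assume "x \<in> path_image u \<inter> path_image d"
      then obtain i j where ij: "i \<in> {0..s}" "j \<in> {s..1}" "\<delta> i = x" "\<delta> j = x"
        unfolding imu imd by auto
      then have "i = j \<or> i = 0 \<and> j = 1 \<or> i = 1 \<and> j = 0"
        using free[of i j] s01 by auto
      then show "x \<in> {a, b}" using ij s01 s \<delta>01 by auto
    qed
    show "{a, b} \<subseteq> path_image u \<inter> path_image d"
      using ends by (metis insert_subsetI Int_iff empty_subsetI pathfinish_in_path_image pathstart_in_path_image)
  qed
  have comb: "winding_number \<gamma> z = winding_number u z + winding_number d z" if "z \<notin> path_image \<gamma>" for z
    using winding_number_subpath_combine[of \<delta> z 0 s 1] wn[OF that] that \<delta> s01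
    by (simp add: u_def d_def simple_path_imp_path)
  define C where "C = path_image p - {a, b}"
  have C: "connected C" "C \<noteq> {}"
    unfolding C_def a_def b_def using arc_imp_simple_path[OF assms(3)]
    by (rule connected_simple_path_endless, rule nonempty_simple_path_endless)
  have "C \<subseteq> path_image u \<union> path_image d" using assms(5) un C_def by blast
  moreover have "path_image u \<inter> path_image d \<inter> C = {}" using int C_def by blast
  moreover have "closed (path_image u)" "closed (path_image d)"
    using arcs by (auto simp: closed_path_image arc_imp_path)
  ultimately have "path_image u \<inter> C = {} \<or> path_image d \<inter> C = {}"
    using connected_closedD[OF C(1), of "path_image u" "path_image d"] by blast
  then have "C \<subseteq> path_image u \<or> C \<subseteq> path_image d"
    using \<open>C \<subseteq> path_image u \<union> path_image d\<close> by blast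
  then have "path_image p \<subseteq> path_image u \<or> path_image p \<subseteq> path_image d"
    using int C_def by blast
  then have "path_image p = path_image u \<or> path_image p = path_image d"
  proof
    assume "path_image p \<subseteq> path_image u"
    then show ?thesis using arc_subset_eq[OF assms(3) arcs(1)] ends a_def b_def by simp
  next
    assume "path_image p \<subseteq> path_image d"
    then show ?thesis using arc_subset_eq[OF assms(3) arcs(2)] ends a_def b_def by auto
  qed
  moreover have "path_image p \<noteq> path_image d"
    using same_direction[OF assms(3) arcs(2) _ F assms(4) fol(2)] ends ab a_def by auto
  ultimately have pu: "path_image p = path_image u" by blast
  show ?thesis
  proof
    show "arc d" "follows d F" using arcs fol by auto
    show "pathstart d = pathfinish p" "pathfinish d = pathstart p" using ends a_def b_def by auto
    show "path_image p \<union> path_image d = path_image \<gamma>" using un pu by simp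
    show "path_image p \<inter> path_image d = {pathstart p, pathfinish p}" using int pu a_def b_def by simp
    fix z assume z: "z \<notin> path_image \<gamma>"
    have "winding_number p z = winding_number u z"
      using pu z un ends a_def b_def assms(3) arcs
      by (intro winding_number_simply_connected_eq[OF simply_connected_arc_image[OF arcs(1)]])
        (auto simp: arc_imp_path)
    then show "winding_number \<gamma> z = winding_number p z + winding_number d z" using comb z by simp
  qed
qed

text \<open>The parameters \<open>s\<close> and \<open>t\<close> of the ends of \<open>p\<close> on
  \<open>r\<close> satisfy \<open>s < t\<close> because both arcs follow the same field. As the ends
  of \<open>r\<close> do not lie on \<open>p\<close>, the two pieces left over are nondegenerate
  arcs.\<close>

lemma arc_minus_arc:
  assumes "arc r" "follows r F" "arc p" "follows p F" "path_image p \<subseteq> path_image r"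
    and ends: "pathstart r \<notin> path_image p" "pathfinish r \<notin> path_image p"
    and F: "direction_field F"
  obtains r1 r2 where "arc r1" "follows r1 F" "arc r2" "follows r2 F"
    "pathstart r1 = pathstart r" "pathfinish r1 = pathstart p"
    "pathstart r2 = pathfinish p" "pathfinish r2 = pathfinish r"
    "path_image r1 \<union> path_image p \<union> path_image r2 = path_image r"
    "path_image r1 \<inter> path_image p = {pathstart p}"
    "path_image r2 \<inter> path_image p = {pathfinish p}"
    "path_image r1 \<inter> path_image r2 = {}"
    "\<And>z. z \<notin> path_image r \<Longrightarrow>
      winding_number r z = winding_number r1 z + winding_number p z + winding_number r2 z"
proof -
  have "pathstart p \<in> path_image r" "pathfinish p \<in> path_image r" using assms(5) by auto
  then obtain s t where st: "s \<in> {0..1}" "t \<in> {0..1}" "r s = pathstart p" "r t = pathfinish p"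
    by (auto simp: path_image_def)
  have "s \<noteq> t" using st assms(3) arc_distinct_ends by force
  have inj: "inj_on r {0..1}" using assms(1) by (simp add: arc_def)
  have "path r" using assms(1) by (simp add: arc_imp_path)
  have nz: "s \<noteq> 0" "t \<noteq> 0" "s \<noteq> 1" "t \<noteq> 1"
    using st ends by (auto simp: pathstart_def pathfinish_def path_image_def)
  have mid: "path_image p = path_image (subpath i j r)" "arc (subpath i j r)" "follows (subpath i j r) F"
    if "i < j" "{i, j} = {s, t}" for i j
  proof -
    have ij: "i \<in> {0..1}" "j \<in> {0..1}" using that st by (auto simp: doubleton_eq_iff)
    show arc: "arc (subpath i j r)" using that ij assms(1) by (intro arc_subpath_arc) auto
    show "follows (subpath i j r) F" using follows_subpath assms(2) that ij by simp
    have "r ` {i..j} \<subseteq> path_image p"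
    proof (rule arc_connected_subset[OF assms(1)])
      show "connected (path_image p)" using assms(3) by (simp add: connected_path_image arc_imp_path)
      show "r i \<in> path_image p" "r j \<in> path_image p"
        using that(2) st by (auto simp: doubleton_eq_iff)
    qed (use assms ij in auto)
    then have "path_image (subpath i j r) \<subseteq> path_image p" using that by (simp add: path_image_subpath)
    moreover have "{pathstart (subpath i j r), pathfinish (subpath i j r)} = {pathstart p, pathfinish p}"
      using that st by (auto simp: doubleton_eq_iff)
    ultimately show "path_image p = path_image (subpath i j r)"
      using arc_subset_eq[OF arc assms(3)] by simp
  qed
  have "s < t"
  proof (rule ccontr)
    assume "\<not> s < t"
    then have "t < s" using \<open>s \<noteq> t\<close> by simp
    then have "pathstart p = pathstart (subpath t s r)"
      using mid[of t s] same_direction[OF assms(3) _ _ F assms(4)] by blast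
    then show False using st assms(3) arc_distinct_ends by force
  qed
  note mid = mid[OF this refl]
  have im: "path_image (subpath 0 s r) = r ` {0..s}" "path_image p = r ` {s..t}"
    "path_image (subpath t 1 r) = r ` {t..1}"
    using st \<open>s < t\<close> by (auto simp: mid path_image_subpath)
  show ?thesis
  proof
    show "arc (subpath 0 s r)" "arc (subpath t 1 r)"
      using assms(1) st nz by (auto intro!: arc_subpath_arc)
    show "follows (subpath 0 s r) F" "follows (subpath t 1 r) F"
      using assms(2) st nz by (auto intro!: follows_subpath simp: less_le)
    show "pathstart (subpath 0 s r) = pathstart r" "pathfinish (subpath 0 s r) = pathstart p"
      "pathstart (subpath t 1 r) = pathfinish p" "pathfinish (subpath t 1 r) = pathfinish r"
      using st by (auto simp: pathstart_def pathfinish_def subpath_def)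
    have "{0..s} \<union> {s..t} \<union> {t..1} = {0..1}" using st \<open>s < t\<close> by auto
    then show "path_image (subpath 0 s r) \<union> path_image p \<union> path_image (subpath t 1 r) = path_image r"
      unfolding im unfolding path_image_def image_Un[symmetric] by simp
    have *: "r ` A \<inter> r ` B = r ` (A \<inter> B)" if "A \<subseteq> {0..1}" "B \<subseteq> {0..1}" for A B
      using inj_on_image_Int[OF inj that] by simp
    have "{0..s} \<inter> {s..t} = {s}" "{t..1} \<inter> {s..t} = {t}" "{0..s} \<inter> {t..1} = {}"
      using st \<open>s < t\<close> by auto
    then show "path_image (subpath 0 s r) \<inter> path_image p = {pathstart p}"
      "path_image (subpath t 1 r) \<inter> path_image p = {pathfinish p}"
      "path_image (subpath 0 s r) \<inter> path_image (subpath t 1 r) = {}"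
      unfolding im using st \<open>s < t\<close> by (auto simp: *)
    fix z assume z: "z \<notin> path_image r"
    have "winding_number p z = winding_number (subpath s t r) z"
      using z assms(3,5) mid st
      by (intro winding_number_simply_connected_eq[OF simply_connected_arc_image[OF assms(3)]])
        (auto simp: arc_imp_path)
    moreover have "winding_number (subpath 0 s r) z + winding_number (subpath s 1 r) z = winding_number (subpath 0 1 r) z"
      by (rule winding_number_subpath_combine) (use \<open>path r\<close> z st in auto)
    moreover have "winding_number (subpath s t r) z + winding_number (subpath t 1 r) z = winding_number (subpath s 1 r) z"
      by (rule winding_number_subpath_combine) (use \<open>path r\<close> z st in auto)
    ultimately show "winding_number r z = winding_number (subpath 0 s r) z + winding_number p z
        + winding_number (subpath t 1 r) z" by (simp add: algebra_simps)
  qed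
qed

text \<open>Removing the first half of \<open>p\<close> from \<open>q\<close> leaves an arc with the
  image and the ends of the second half of \<open>p\<close>. An arc is simply connected, so the
  winding numbers coincide piece by piece. Hence the sign depends on neither the parametrization nor
  the starting point.\<close>

lemma loop_sign_unique:
  assumes "simple_loop p" "simple_loop q" "path_image p = path_image q"
    "follows p F" "follows q F" "direction_field F"
  shows "loop_sign p = loop_sign q"
proof -
  have p: "simple_path p" "pathfinish p = pathstart p" "path p"
    using assms(1) by (auto simp: simple_loop_def simple_path_imp_path)
  define u d where "u = subpath 0 (1/2) p" and "d = subpath (1/2) 1 p"
  have free: "x = y \<or> x = 0 \<and> y = 1 \<or> x = 1 \<and> y = 0"
    if "x \<in> {0..1}" "y \<in> {0..1}" "p x = p y" for x y
    using p(1) that unfolding simple_path_def loop_free_def by blast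
  have ne: "p 0 \<noteq> p (1/2)" "p (1/2) \<noteq> p 1"
    using free[of 0 "1/2"] free[of "1/2" 1] by auto
  have arcs: "arc u" "arc d"
    unfolding u_def d_def using p ne by (auto intro!: arc_simple_path_subpath)
  have fol: "follows u F" "follows d F"
    unfolding u_def d_def using assms(4) by (auto intro!: follows_subpath)
  have imu: "path_image u = p ` {0..1/2}" and imd: "path_image d = p ` {1/2..1}"
    by (auto simp: u_def d_def path_image_subpath)
  have "{0..1/2} \<union> {1/2..1} = {0..1::real}" by auto
  then have un: "path_image u \<union> path_image d = path_image q"
    unfolding imu imd assms(3)[symmetric] unfolding path_image_def image_Un[symmetric] by simp
  have ud: "path_image u \<inter> path_image d = {pathstart u, pathfinish u}"
  proof
    show "path_image u \<inter> path_image d \<subseteq> {pathstart u, pathfinish u}"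
    proof
      fix x assume "x \<in> path_image u \<inter> path_image d"
      then obtain i j where ij: "i \<in> {0..1/2}" "j \<in> {1/2..1}" "p i = x" "p j = x"
        unfolding imu imd by auto
      then have "i = j \<or> i = 0 \<and> j = 1 \<or> i = 1 \<and> j = 0"
        using free[of i j] by auto
      then have "i = 1/2 \<or> i = 0" using ij by auto
      then show "x \<in> {pathstart u, pathfinish u}" using ij(3)[symmetric]
        by (elim disjE) (simp_all add: u_def)
    qed
    have ends: "pathstart u = p 0" "pathfinish u = p (1/2)" by (simp_all add: u_def)
    have "p 1 = p 0" using p by (simp add: pathfinish_def pathstart_def)
    then show "{pathstart u, pathfinish u} \<subseteq> path_image u \<inter> path_image d"
      unfolding imu imd ends by (auto intro: image_eqI[of _ _ 1])
  qed
  obtain r where r: "arc r" "follows r F" "pathstart r = pathfinish u" "pathfinish r = pathstart u"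
    "path_image u \<union> path_image r = path_image q"
    "path_image u \<inter> path_image r = {pathstart u, pathfinish u}"
    "\<And>z. z \<notin> path_image q \<Longrightarrow> winding_number q z = winding_number u z + winding_number r z"
    using loop_minus_arc[OF assms(2,5) arcs(1) fol(1) _ assms(6)] un by blast
  have rd: "path_image r = path_image d" using r(5,6) un ud by blast
  have dends: "pathstart d = pathfinish u" "pathfinish d = pathstart u"
    using p by (auto simp: u_def d_def pathstart_def pathfinish_def subpath_def)
  have "winding_number p z = winding_number q z" if "z \<notin> path_image p" for z
  proof -
    have "winding_number r z = winding_number d z"
      using r rd dends arcs un that assms(3)
      by (intro winding_number_simply_connected_eq[OF simply_connected_arc_image[OF arcs(2)]])
        (auto simp: arc_imp_path)
    moreover have "winding_number u z + winding_number d z = winding_number p z"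
      using winding_number_subpath_combine[of p z 0 "1/2" 1] that p by (simp add: u_def d_def)
    ultimately show ?thesis using r(7)[of z] that assms(3) by simp
  qed
  then show ?thesis unfolding loop_sign_def
    using assms(3) inside_no_overlap by (metis (no_types, lifting) disjoint_iff)
qed

section \<open>Degrees of unions of loops\<close>

text \<open>This is \<open>counterclockwise\<close> for a set and a field instead of a graph;
  \<open>follows\<close> is the last clause of \<open>traverses\<close>. Support and field as
  separate arguments allow the comparison of webs that agree only outside a disc.\<close>

definition cycle_sign :: "curve \<Rightarrow> complex set \<Rightarrow> int" where
  "cycle_sign F K =
    (if \<exists>\<gamma>. simple_path \<gamma> \<and> pathfinish \<gamma> = pathstart \<gamma> \<and> path_image \<gamma> = K \<and> follows \<gamma> F \<and>
        (\<forall>z\<in>inside K. winding_number \<gamma> z = 1) then 1 else - 1)"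

definition cycle_degree :: "complex set \<Rightarrow> curve \<Rightarrow> int" where
  "cycle_degree M F = (\<Sum>K\<in>components M. cycle_sign F K)"

text \<open>Choosing parametrized loops turns a sum over components into a sum over paths that can
  be cut and rejoined.\<close>

definition loop_decomposition :: "(real \<Rightarrow> complex) set \<Rightarrow> complex set \<Rightarrow> curve \<Rightarrow> bool" where
  "loop_decomposition \<Gamma> M F \<longleftrightarrow>
    finite \<Gamma> \<and> (\<forall>\<gamma>\<in>\<Gamma>. simple_loop \<gamma> \<and> follows \<gamma> F) \<and>
    (\<forall>\<gamma>\<in>\<Gamma>. \<forall>\<delta>\<in>\<Gamma>. \<gamma> \<noteq> \<delta> \<longrightarrow> path_image \<gamma> \<inter> path_image \<delta> = {}) \<and>
    (\<Union>\<gamma>\<in>\<Gamma>. path_image \<gamma>) = M"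

lemma cycle_sign_path_image:
  assumes "simple_loop p" "follows p F" "direction_field F"
  shows "cycle_sign F (path_image p) = loop_sign p"
proof (cases "loop_sign p = 1")
  case True
  then show ?thesis
    unfolding cycle_sign_def using assms loop_sign_inside[OF assms(1)]
    by (auto simp: simple_loop_def)
next
  case False
  have "\<not> (\<forall>z\<in>inside (path_image p). winding_number \<gamma> z = 1)"
    if "simple_path \<gamma>" "pathfinish \<gamma> = pathstart \<gamma>" "path_image \<gamma> = path_image p" "follows \<gamma> F" for \<gamma>
  proof -
    have "loop_sign \<gamma> = loop_sign p"
      using loop_sign_unique[of \<gamma> p F] that assms by (simp add: simple_loop_def)
    then show ?thesis using False that(3) by (auto simp: loop_sign_def split: if_splits)
  qed
  then have "cycle_sign F (path_image p) = - 1" unfolding cycle_sign_def by auto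
  then show ?thesis using loop_sign_cases[of p] False by auto
qed

lemma clopen_component:
  assumes "connected K" "K \<noteq> {}" "closed K" "closed R" "K \<inter> R = {}" "M = K \<union> R"
  shows "K \<in> components M"
  unfolding in_components_maximal
proof (intro conjI allI impI)
  fix d assume d: "d \<noteq> {} \<and> K \<subseteq> d \<and> d \<subseteq> M \<and> connected d"
  then have "K \<inter> d = {} \<or> R \<inter> d = {}"
    by (intro connected_closedD) (use assms in auto)
  then show "d = K" using d assms by auto
qed (use assms in auto)

lemma components_Union_compact:
  assumes "finite \<K>" "\<And>K. K \<in> \<K> \<Longrightarrow> compact K \<and> connected K \<and> K \<noteq> {}"
    and "\<And>K L. K \<in> \<K> \<Longrightarrow> L \<in> \<K> \<Longrightarrow> K \<noteq> L \<Longrightarrow> K \<inter> L = {}"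
  shows "components (\<Union>\<K> :: complex set) = \<K>"
proof
  show *: "\<K> \<subseteq> components (\<Union>\<K>)"
  proof
    fix K assume K: "K \<in> \<K>"
    show "K \<in> components (\<Union>\<K>)"
    proof (rule clopen_component)
      show "closed (\<Union>(\<K> - {K}))" using assms by (intro closed_Union) (auto intro: compact_imp_closed)
    qed (use assms K in \<open>auto intro: compact_imp_closed\<close>)
  qed
  show "components (\<Union>\<K>) \<subseteq> \<K>"
  proof
    fix C assume C: "C \<in> components (\<Union>\<K>)"
    then obtain x where x: "x \<in> C" "x \<in> \<Union>\<K>"
      by (metis ex_in_conv in_components_nonempty in_components_subset subsetD)
    then obtain K where K: "K \<in> \<K>" "x \<in> K" by blast
    then have "K \<in> components (\<Union>\<K>)" using * by blast
    then have "C = K" using C x K components_nonoverlap by blast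
    then show "C \<in> \<K>" using K by simp
  qed
qed

text \<open>Finitely many disjoint compact connected sets are the components of their union. So the
  components of \<open>M\<close> are the images of the chosen loops, and distinct loops have
  distinct images.\<close>

lemma cycle_degree_loop_decomposition:
  assumes "loop_decomposition \<Gamma> M F" "direction_field F"
  shows "cycle_degree M F = (\<Sum>\<gamma>\<in>\<Gamma>. loop_sign \<gamma>)"
proof -
  note \<Gamma> = assms(1)[unfolded loop_decomposition_def]
  have "components (\<Union>(path_image ` \<Gamma>)) = path_image ` \<Gamma>"
  proof (rule components_Union_compact)
    show "compact K \<and> connected K \<and> K \<noteq> {}" if "K \<in> path_image ` \<Gamma>" for K
      using that \<Gamma> by (auto simp: compact_path_image connected_path_image simple_loop_imp_path)
    show "K \<inter> L = {}" if "K \<in> path_image ` \<Gamma>" "L \<in> path_image ` \<Gamma>" "K \<noteq> L" for K L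
      using that \<Gamma> by (metis imageE)
  qed (use \<Gamma> in simp)
  then have "components M = path_image ` \<Gamma>" using \<Gamma> by simp
  moreover have "inj_on path_image \<Gamma>"
    using \<Gamma> by (metis (no_types, lifting) Int_absorb inj_onI path_image_nonempty)
  ultimately have "cycle_degree M F = (\<Sum>\<gamma>\<in>\<Gamma>. cycle_sign F (path_image \<gamma>))"
    unfolding cycle_degree_def by (simp add: sum.reindex)
  also have "\<dots> = (\<Sum>\<gamma>\<in>\<Gamma>. loop_sign \<gamma>)"
    using \<Gamma> assms(2) by (intro sum.cong) (auto intro: cycle_sign_path_image)
  finally show ?thesis .
qed

lemma simple_loop_join:
  assumes "arc p" "arc q" "pathfinish p = pathstart q" "pathfinish q = pathstart p"
    "path_image p \<inter> path_image q \<subseteq> {pathstart p, pathstart q}"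
  shows "simple_loop (p +++ q)"
  unfolding simple_loop_def using assms simple_path_join_loop by auto

text \<open>Induction on the number of arcs. Each end point is the start of exactly one arc and the
  finish of exactly one. If \<open>e\<close> and its successor \<open>f\<close> close up, they form
  a loop disjoint from the other arcs. Otherwise their join replaces both: the middle point
  disappears from the set of ends, and the hypotheses hold with one arc less.\<close>

lemma arcs_loop_decomposition:
  fixes E :: "(real \<Rightarrow> complex) set"
  assumes "finite E" "\<And>p. p \<in> E \<Longrightarrow> arc p \<and> follows p F"
    and "\<And>p q. p \<in> E \<Longrightarrow> q \<in> E \<Longrightarrow> p \<noteq> q \<Longrightarrow> path_image p \<inter> path_image q
        \<subseteq> {pathstart p, pathfinish p} \<inter> {pathstart q, pathfinish q}"
    and "inj_on pathstart E" "inj_on pathfinish E" "pathstart ` E = pathfinish ` E"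
  shows "\<exists>\<Gamma>. loop_decomposition \<Gamma> (\<Union>p\<in>E. path_image p) F"
  using assms
proof (induction "card E" arbitrary: E rule: less_induct)
  case less
  show ?case
  proof (cases "E = {}")
    case True
    then show ?thesis by (intro exI[of _ "{}"]) (simp add: loop_decomposition_def)
  next
    case False
    then obtain e where e: "e \<in> E" by blast
    then obtain f where f: "f \<in> E" "pathstart f = pathfinish e"
      using less.prems(6) by (metis imageE image_eqI)
    have arcs: "arc e" "arc f" "follows e F" "follows f F" using e f less.prems(2) by auto
    have ef: "e \<noteq> f" using f arcs arc_distinct_ends by metis
    define x y z where "x = pathstart e" and "y = pathfinish e" and "z = pathfinish f"
    have xyz: "x \<noteq> y" "y \<noteq> z"
      using arc_distinct_ends[OF arcs(1)] arc_distinct_ends[OF arcs(2)] f(2)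
      unfolding x_def y_def z_def by metis+
    have int: "path_image e \<inter> path_image f \<subseteq> {x, y} \<inter> {y, z}"
      using less.prems(3)[OF e f(1) ef] f by (simp add: x_def y_def z_def)
    define E0 where "E0 = E - {e, f}"
    have E0: "finite E0" "E = insert e (insert f E0)" "e \<notin> E0" "f \<notin> E0"
      using less.prems(1) e f by (auto simp: E0_def)
    have cardE: "card E = Suc (Suc (card E0))" using E0 ef by simp
    have st: "pathstart q \<noteq> x" "pathstart q \<noteq> y" if "q \<in> E0" for q
      using that inj_onD[OF less.prems(4), of q e] inj_onD[OF less.prems(4), of q f] e f(1)
      unfolding x_def y_def f(2)[symmetric] E0_def by blast+
    have fi: "pathfinish q \<noteq> y" "pathfinish q \<noteq> z" if "q \<in> E0" for q
      using that inj_onD[OF less.prems(5), of q e] inj_onD[OF less.prems(5), of q f] e f(1)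
      unfolding y_def z_def E0_def by blast+
    have q_ef: "path_image q \<inter> (path_image e \<union> path_image f) \<subseteq> {pathstart q, pathfinish q} \<inter> {x, z}"
      if "q \<in> E0" for q
    proof -
      have "path_image q \<inter> path_image e \<subseteq> {pathstart q, pathfinish q} \<inter> {x, y}"
        using less.prems(3)[of q e] that e E0 by (auto simp: x_def y_def)
      moreover have "path_image q \<inter> path_image f \<subseteq> {pathstart q, pathfinish q} \<inter> {y, z}"
        using less.prems(3)[of q f] that f E0 by (auto simp: y_def z_def)
      ultimately show ?thesis using st[OF that] fi[OF that] by blast
    qed
    have im: "path_image (e +++ f) = path_image e \<union> path_image f"
      using f by (simp add: path_image_join)
    have starts: "insert x (insert y (pathstart ` E0)) = insert y (insert z (pathfinish ` E0))"
      using less.prems(6) f unfolding E0(2) by (simp add: x_def y_def z_def)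
    have folef: "follows (e +++ f) F" using arcs by (simp add: follows_join)
    show ?thesis
    proof (cases "z = x")
      case True
      have "pathstart ` E0 = pathfinish ` E0"
      proof -
        have "x \<notin> pathstart ` E0" "y \<notin> pathstart ` E0" "x \<notin> pathfinish ` E0" "y \<notin> pathfinish ` E0"
          using st fi True by auto
        then have "pathstart ` E0 = insert x (insert y (pathstart ` E0)) - {x, y}"
          "insert y (insert z (pathfinish ` E0)) - {x, y} = pathfinish ` E0"
          using True by auto
        then show ?thesis unfolding starts by (rule trans)
      qed
      moreover have "inj_on pathstart E0" "inj_on pathfinish E0"
        using less.prems(4,5) E0 by (meson inj_on_subset subset_insertI2 subset_refl)+
      ultimately have "\<exists>\<Gamma>. loop_decomposition \<Gamma> (\<Union>p\<in>E0. path_image p) F"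
        using less.hyps[of E0] less.prems(2,3) E0 cardE by simp
      then obtain \<Gamma> where \<Gamma>: "loop_decomposition \<Gamma> (\<Union>p\<in>E0. path_image p) F" by blast
      have "simple_loop (e +++ f)"
        by (rule simple_loop_join) (use arcs f int True in \<open>auto simp: x_def y_def z_def\<close>)
      moreover have disj: "path_image (e +++ f) \<inter> path_image \<gamma> = {}" if "\<gamma> \<in> \<Gamma>" for \<gamma>
      proof -
        have "path_image \<gamma> \<subseteq> (\<Union>p\<in>E0. path_image p)" using \<Gamma> that by (auto simp: loop_decomposition_def)
        moreover have "path_image q \<inter> path_image (e +++ f) = {}" if "q \<in> E0" for q
          using q_ef[OF that] st[OF that] fi[OF that] True unfolding im by auto
        ultimately show ?thesis by blast
      qed
      ultimately have "loop_decomposition (insert (e +++ f) \<Gamma>) (\<Union>p\<in>E. path_image p) F"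
        using \<Gamma> folef im unfolding loop_decomposition_def E0(2) by (auto simp: Int_commute)
      then show ?thesis by blast
    next
      case False
      define g where "g = e +++ f"
      have g: "pathstart g = x" "pathfinish g = z" "arc g" "follows g F"
        using arcs f int False folef by (auto simp: g_def x_def y_def z_def intro!: arc_join)
      have gE: "g \<notin> E0" using st g by auto
      have "\<exists>\<Gamma>. loop_decomposition \<Gamma> (\<Union>p\<in>insert g E0. path_image p) F"
      proof (rule less.hyps)
        show "card (insert g E0) < card E" using cardE gE E0 by simp
        show "arc p \<and> follows p F" if "p \<in> insert g E0" for p using that g E0 less.prems(2) by auto
        show "path_image p \<inter> path_image q \<subseteq> {pathstart p, pathfinish p} \<inter> {pathstart q, pathfinish q}"
          if pq: "p \<in> insert g E0" "q \<in> insert g E0" "p \<noteq> q" for p q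
        proof -
          consider "p \<in> E0" "q \<in> E0" | "p = g" "q \<in> E0" | "p \<in> E0" "q = g" using pq by blast
          then show ?thesis
          proof cases
            case 1
            then show ?thesis using less.prems(3) pq E0 by blast
          next
            case 2
            then show ?thesis using q_ef[of q] g im by (auto simp: g_def)
          next
            case 3
            then show ?thesis using q_ef[of p] g im by (auto simp: g_def)
          qed
        qed
        have "inj_on pathstart E0" "inj_on pathfinish E0"
          using less.prems(4,5) E0 by (meson inj_on_subset subset_insertI2 subset_refl)+
        moreover have "pathstart g \<notin> pathstart ` E0" "pathfinish g \<notin> pathfinish ` E0"
          using st(1) fi(2) unfolding g(1,2) by (metis imageE)+
        ultimately show "inj_on pathstart (insert g E0)" "inj_on pathfinish (insert g E0)"
          using gE by (simp_all add: inj_on_insert)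
        have "y \<notin> insert x (pathstart ` E0)" "y \<notin> insert z (pathfinish ` E0)"
          using st fi xyz by auto
        then show "pathstart ` insert g E0 = pathfinish ` insert g E0"
        proof -
          have "insert y (insert x (pathstart ` E0)) = insert y (insert z (pathfinish ` E0))"
            using starts by (simp add: insert_commute)
          then have "insert x (pathstart ` E0) = insert z (pathfinish ` E0)"
            using insert_ident[OF \<open>y \<notin> insert x (pathstart ` E0)\<close> \<open>y \<notin> insert z (pathfinish ` E0)\<close>]
            by blast
          then show ?thesis using g by simp
        qed
      qed (use E0 in simp)
      moreover have "(\<Union>p\<in>insert g E0. path_image p) = (\<Union>p\<in>E. path_image p)"
        unfolding E0(2) using im by (auto simp: g_def)
      ultimately show ?thesis by simp
    qed
  qed
qed

lemma loop_decomposition_Un: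
  assumes "loop_decomposition \<Gamma> M F" "loop_decomposition \<Gamma>' M' F" "M \<inter> M' = {}"
  shows "loop_decomposition (\<Gamma> \<union> \<Gamma>') (M \<union> M') F"
proof -
  note \<Gamma> = assms(1,2)[unfolded loop_decomposition_def]
  have "path_image \<gamma> \<inter> path_image \<delta> = {}" if "\<gamma> \<in> \<Gamma>" "\<delta> \<in> \<Gamma>'" for \<gamma> \<delta>
  proof -
    have "path_image \<gamma> \<subseteq> M" "path_image \<delta> \<subseteq> M'" using \<Gamma> that by auto
    then show ?thesis using assms(3) by blast
  qed
  then have "\<forall>\<gamma>\<in>\<Gamma> \<union> \<Gamma>'. \<forall>\<delta>\<in>\<Gamma> \<union> \<Gamma>'. \<gamma> \<noteq> \<delta> \<longrightarrow> path_image \<gamma> \<inter> path_image \<delta> = {}"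
    using \<Gamma> by (metis Int_commute Un_iff)
  then show ?thesis unfolding loop_decomposition_def using \<Gamma> by (intro conjI) auto
qed

section \<open>Loops through a disc\<close>

text \<open>The consequences of being homeomorphic to a closed disc that the winding number
  arguments use: loops in \<open>D\<close> contract, the interior is connected, and every frontier
  point is a limit of interior points.\<close>

definition topological_disc :: "complex set \<Rightarrow> bool" where
  "topological_disc D \<longleftrightarrow> compact D \<and> simply_connected D \<and> connected (interior D) \<and>
    interior D \<noteq> {} \<and> frontier D \<subseteq> closure (interior D)"

text \<open>Four boundary arcs joining \<open>A\<close>, \<open>B\<close>, \<open>C\<close>, \<open>E\<close> in this order; \<open>\<sigma>\<close> records whether this order is
  counterclockwise.\<close>

definition boundary_order ::
    "complex set \<Rightarrow> int \<Rightarrow> complex \<Rightarrow> complex \<Rightarrow> complex \<Rightarrow> complex \<Rightarrow> bool" where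
  "boundary_order D \<sigma> A B C E \<longleftrightarrow>
    (\<sigma> = 1 \<or> \<sigma> = - 1) \<and> (\<exists>k l m n. arc k \<and> arc l \<and> arc m \<and> arc n \<and>
      pathstart k = A \<and> pathfinish k = B \<and> pathstart l = B \<and> pathfinish l = C \<and>
      pathstart m = C \<and> pathfinish m = E \<and> pathstart n = E \<and> pathfinish n = A \<and>
      path_image k \<union> path_image l \<union> path_image m \<union> path_image n \<subseteq> frontier D \<and>
      path_image k \<inter> path_image l = {B} \<and> path_image l \<inter> path_image m = {C} \<and>
      path_image m \<inter> path_image n = {E} \<and> path_image n \<inter> path_image k = {A} \<and>
      path_image k \<inter> path_image m = {} \<and> path_image l \<inter> path_image n = {} \<and>
      (\<forall>z\<in>interior D. winding_number k z + winding_number l z + winding_number m z + winding_number n z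
        = of_int \<sigma>))"

lemma boundary_order_rotate:
  assumes "boundary_order D \<sigma> A B C E"
  shows "boundary_order D \<sigma> B C E A"
proof -
  obtain k l m n where *: "\<sigma> = 1 \<or> \<sigma> = - 1" "arc k" "arc l" "arc m" "arc n"
    "pathstart k = A" "pathfinish k = B" "pathstart l = B" "pathfinish l = C"
    "pathstart m = C" "pathfinish m = E" "pathstart n = E" "pathfinish n = A"
    "path_image k \<union> path_image l \<union> path_image m \<union> path_image n \<subseteq> frontier D"
    "path_image k \<inter> path_image l = {B}" "path_image l \<inter> path_image m = {C}"
    "path_image m \<inter> path_image n = {E}" "path_image n \<inter> path_image k = {A}"
    "path_image k \<inter> path_image m = {}" "path_image l \<inter> path_image n = {}"
    "\<And>z. z \<in> interior D \<Longrightarrow> winding_number k z + winding_number l z + winding_number m z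
      + winding_number n z = of_int \<sigma>"
    using assms unfolding boundary_order_def by (elim conjE exE) blast
  have "\<And>z. z \<in> interior D \<Longrightarrow> winding_number l z + winding_number m z + winding_number n z
      + winding_number k z = of_int \<sigma>"
    using *(21) by (simp add: ac_simps)
  moreover have "path_image l \<union> path_image m \<union> path_image n \<union> path_image k \<subseteq> frontier D"
    using *(14) by blast
  moreover have "path_image m \<inter> path_image k = {}" using *(19) by blast
  ultimately show ?thesis unfolding boundary_order_def
    using *(1-13,15-18,20) by blast
qed

lemma interior_frontier_disjoint: "interior D \<inter> frontier D = {}"
  by (auto simp: frontier_def)

lemma boundary_order_reverse:
  assumes "boundary_order D \<sigma> A B C E"
  shows "boundary_order D (- \<sigma>) A E C B"
proof -
  obtain k l m n where *: "\<sigma> = 1 \<or> \<sigma> = - 1" "arc k" "arc l" "arc m" "arc n"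
    "pathstart k = A" "pathfinish k = B" "pathstart l = B" "pathfinish l = C"
    "pathstart m = C" "pathfinish m = E" "pathstart n = E" "pathfinish n = A"
    "path_image k \<union> path_image l \<union> path_image m \<union> path_image n \<subseteq> frontier D"
    "path_image k \<inter> path_image l = {B}" "path_image l \<inter> path_image m = {C}"
    "path_image m \<inter> path_image n = {E}" "path_image n \<inter> path_image k = {A}"
    "path_image k \<inter> path_image m = {}" "path_image l \<inter> path_image n = {}"
    "\<And>z. z \<in> interior D \<Longrightarrow> winding_number k z + winding_number l z + winding_number m z
      + winding_number n z = of_int \<sigma>"
    using assms unfolding boundary_order_def by (elim conjE exE) blast
  have "winding_number (reversepath n) z + winding_number (reversepath m) z
      + winding_number (reversepath l) z + winding_number (reversepath k) z = of_int (- \<sigma>)"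
    if z: "z \<in> interior D" for z
  proof -
    have "z \<notin> frontier D" using z interior_frontier_disjoint by blast
    then have "z \<notin> path_image k" "z \<notin> path_image l" "z \<notin> path_image m" "z \<notin> path_image n"
      using *(14) by auto
    then show ?thesis using *(2-5) *(21)[OF z, symmetric]
      by (simp add: winding_number_reversepath arc_imp_path algebra_simps)
  qed
  moreover have "path_image n \<union> path_image m \<union> path_image l \<union> path_image k \<subseteq> frontier D"
    using *(14) by blast
  moreover have "- \<sigma> = 1 \<or> - \<sigma> = - 1" using *(1) by auto
  moreover have "path_image n \<inter> path_image m = {E}" "path_image m \<inter> path_image l = {C}"
    "path_image l \<inter> path_image k = {B}" "path_image k \<inter> path_image n = {A}"
    "path_image n \<inter> path_image l = {}" "path_image m \<inter> path_image k = {}"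
    using *(15-20) by (simp_all add: Int_commute)
  ultimately show ?thesis unfolding boundary_order_def
    by (intro conjI exI[of _ "reversepath n"] exI[of _ "reversepath m"] exI[of _ "reversepath l"]
        exI[of _ "reversepath k"]) (simp_all add: * arc_reversepath)
qed

section \<open>Winding numbers near the frontier of a disc and their jumps across a crosscut\<close>

lemma exterior_approximation:
  assumes "finite \<L>" "\<And>\<gamma>. \<gamma> \<in> \<L> \<Longrightarrow> path \<gamma> \<and> pathfinish \<gamma> = pathstart \<gamma> \<and> z \<notin> path_image \<gamma>"
    and "z \<in> frontier D"
  obtains z' where "z' \<notin> D" "\<And>\<gamma>. \<gamma> \<in> \<L> \<Longrightarrow> z' \<notin> path_image \<gamma>"
    "\<And>\<gamma>. \<gamma> \<in> \<L> \<Longrightarrow> winding_number \<gamma> z' = winding_number \<gamma> z"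
proof -
  have "closed (\<Union>\<gamma>\<in>\<L>. path_image \<gamma>)" using assms by (intro closed_UN) (auto simp: closed_path_image)
  moreover have "z \<in> - (\<Union>\<gamma>\<in>\<L>. path_image \<gamma>)" using assms by auto
  ultimately obtain e where e: "e > 0" "ball z e \<subseteq> - (\<Union>\<gamma>\<in>\<L>. path_image \<gamma>)"
    by (metis open_Compl open_contains_ball)
  \<comment> \<open>A frontier point is a limit of exterior points, and in a ball that meets none of
    the loops winding numbers are constant. Homotopies in \<open>D\<close> control winding numbers
    about points off \<open>D\<close>; this carries the result to the frontier.\<close>
  have "z \<in> closure (- D)" using assms(3) by (simp add: frontier_closures)
  then obtain z' where z': "z' \<in> - D" "dist z' z < e" using e(1) closure_approachable by blast
  then have z'b: "z' \<in> ball z e" "z \<in> ball z e" using e by (auto simp: dist_commute)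
  show ?thesis
  proof
    show "z' \<notin> D" using z' by simp
    fix \<gamma> assume \<gamma>: "\<gamma> \<in> \<L>"
    then have "ball z e \<inter> path_image \<gamma> = {}" using e by blast
    then show "z' \<notin> path_image \<gamma>" "winding_number \<gamma> z' = winding_number \<gamma> z"
      using z'b assms(2)[OF \<gamma>] winding_number_eq[of \<gamma> z' "ball z e" z] by auto
  qed
qed

lemma connected_insert_closure:
  assumes "connected S" "z \<in> closure S"
  shows "connected (insert z S)"
  using assms(1)
  by (rule connected_intermediate_closure) (use assms(2) closure_subset[of S] in auto)

text \<open>About points off \<open>D\<close> the paths \<open>p\<close> and \<open>q\<close> have
  equal winding numbers, being homotopic in \<open>D\<close>. The path \<open>r\<close> closes both
  of them, which makes the winding numbers locally constant, so that the equality extends to points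
  of the frontier.\<close>

lemma frontier_winding_number:
  assumes "topological_disc D" "path p" "path q" "path r" "path_image p \<subseteq> D" "path_image q \<subseteq> D"
    "pathstart p = pathstart q" "pathfinish p = pathfinish q"
    "pathstart r = pathfinish p" "pathfinish r = pathstart p"
    "z \<in> frontier D" "z \<notin> path_image p" "z \<notin> path_image q" "z \<notin> path_image r"
  shows "winding_number p z + winding_number r z = winding_number q z + winding_number r z"
proof -
  obtain z' where z': "z' \<notin> D" "\<And>\<gamma>. \<gamma> \<in> {p +++ r, q +++ r} \<Longrightarrow> z' \<notin> path_image \<gamma>"
    "\<And>\<gamma>. \<gamma> \<in> {p +++ r, q +++ r} \<Longrightarrow> winding_number \<gamma> z' = winding_number \<gamma> z"
    by (rule exterior_approximation[of "{p +++ r, q +++ r}" z D])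
      (use assms in \<open>auto simp: path_image_join\<close>)
  have "winding_number p z' = winding_number q z'"
    using assms z' by (intro winding_number_simply_connected_eq[of D]) (auto simp: topological_disc_def)
  moreover have "z' \<notin> path_image p" "z' \<notin> path_image q" "z' \<notin> path_image r"
    using z'(1) z'(2)[of "p +++ r"] assms by (auto simp: path_image_join)
  ultimately show ?thesis
    using z'(3)[of "p +++ r"] z'(3)[of "q +++ r"] assms by (simp add: winding_number_join)
qed

text \<open>The points \<open>x\<close> and \<open>y\<close> lie on the two boundary arcs between
  the ends of the crosscut \<open>p\<close>. About \<open>x\<close> the crosscut may be replaced by
  the reverse of the boundary arc \<open>l\<close>, which leaves the interior of the disc free, and
  \<open>x\<close> can then be moved to an interior point \<open>c\<close>; about \<open>y\<close>
  likewise with \<open>k\<close>. At \<open>c\<close> the two results differ by the winding number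
  of the whole boundary.\<close>

lemma crosscut_jump:
  assumes D: "topological_disc D" and paths: "path p" "path r" "path k" "path l"
    and p: "path_image p \<subseteq> D" "pathstart p = A" "pathfinish p = B"
    and r: "pathstart r = B" "pathfinish r = A" "path_image r \<inter> D \<subseteq> {A, B}"
    and k: "path_image k \<subseteq> frontier D" "pathstart k = A" "pathfinish k = B"
    and l: "path_image l \<subseteq> frontier D" "pathstart l = B" "pathfinish l = A"
    and wn: "\<And>z. z \<in> interior D \<Longrightarrow> winding_number k z + winding_number l z = of_int \<sigma>"
    and x: "x \<in> path_image k" "x \<notin> path_image l" "x \<notin> path_image p"
    and y: "y \<in> path_image l" "y \<notin> path_image k" "y \<notin> path_image p"
  shows "winding_number p y + winding_number r y = winding_number p x + winding_number r x + of_int \<sigma>"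
proof -
  have "closed D" using D by (simp add: topological_disc_def compact_imp_closed)
  then have fD: "frontier D \<subseteq> D" by (rule frontier_subset_closed)
  obtain c where c: "c \<in> interior D" using D by (auto simp: topological_disc_def)
  have AB: "A \<in> path_image p" "B \<in> path_image p" "A \<in> path_image k" "B \<in> path_image k"
      "A \<in> path_image l" "B \<in> path_image l"
    using p k l by (metis pathstart_in_path_image pathfinish_in_path_image)+
  have ints: "interior D \<inter> path_image j = {}" if "path_image j \<subseteq> frontier D" for j
    using that interior_frontier_disjoint by blast
  have intr: "interior D \<inter> path_image r = {}"
    using r(3) AB k(1) interior_subset interior_frontier_disjoint by blast
  \<comment> \<open>Neither \<open>j\<close> nor \<open>r\<close> meets the interior, so the
    interior together with the frontier point \<open>z\<close> is a connected set on which the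
    closed path has constant winding number.\<close>
  have *: "winding_number j z + winding_number r z = winding_number j c + winding_number r c"
    if j: "path j" "path_image j \<subseteq> frontier D" "pathstart j = A" "pathfinish j = B"
      and z: "z \<in> frontier D" "z \<notin> path_image j" "z \<notin> path_image p" for j z
  proof -
    have zr: "z \<notin> path_image r" using z r(3) AB fD by blast
    have "winding_number (j +++ r) z = winding_number (j +++ r) c"
    proof (rule winding_number_eq)
      show "connected (insert z (interior D))"
        using D z(1) unfolding topological_disc_def by (intro connected_insert_closure) blast+
      show "insert z (interior D) \<inter> path_image (j +++ r) = {}"
        using ints[OF j(2)] intr z zr r j by (auto simp: path_image_join)
    qed (use j r c paths in auto)
    then show ?thesis using j r paths z zr c ints[OF j(2)] intr
      by (simp add: winding_number_join disjoint_iff)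
  qed
  have xy: "x \<in> frontier D" "y \<in> frontier D" using x y k l by auto
  have xr: "x \<notin> path_image r" "y \<notin> path_image r" using r(3) xy x y AB fD by blast+
  have "winding_number p x + winding_number r x = winding_number (reversepath l) x + winding_number r x"
    by (rule frontier_winding_number[OF D]) (use paths p l r x xy xr fD in auto)
  also have "\<dots> = winding_number (reversepath l) c + winding_number r c"
    by (rule *) (use paths l xy x in auto)
  also have "\<dots> = - winding_number l c + winding_number r c"
    using paths c ints[OF l(1)] by (simp add: winding_number_reversepath disjoint_iff)
  finally have 1: "winding_number p x + winding_number r x = - winding_number l c + winding_number r c" .
  have "winding_number p y + winding_number r y = winding_number k y + winding_number r y"
    by (rule frontier_winding_number[OF D]) (use paths p k r y xy xr fD in auto)
  also have "\<dots> = winding_number k c + winding_number r c"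
    by (rule *) (use paths k xy y in auto)
  finally have 2: "winding_number p y + winding_number r y = winding_number k c + winding_number r c" .
  have "winding_number k c = of_int \<sigma> - winding_number l c" using wn[OF c] by (simp add: algebra_simps)
  then show ?thesis by (simp add: 1 2)
qed

lemma arc_interior_point:
  assumes "arc p"
  obtains z where "z \<in> path_image p" "z \<noteq> pathstart p" "z \<noteq> pathfinish p"
  using nonempty_simple_path_endless[OF arc_imp_simple_path[OF assms]] by blast

text \<open>The loops \<open>q1\<close> and \<open>q2\<close> contain the crosscuts from
  \<open>A\<close> to \<open>B\<close> and from \<open>C\<close> to \<open>E\<close>;
  \<open>q\<close> stands for the loop that joins the four ends the other way. Test points are taken
  on the boundary arcs \<open>k\<close>, \<open>l\<close> and \<open>m\<close>: \<open>q1\<close>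
  jumps by \<open>\<sigma>\<close> from \<open>x\<close> to \<open>y\<close>, \<open>q2\<close>
  jumps by \<open>\<sigma>\<close> from \<open>w\<close> to either of them, and about
  \<open>x\<close> and \<open>y\<close> the winding number of \<open>q\<close> is the sum of the
  other two. As the winding number of a simple loop is 0 or its sign, a jump determines the
  sign.\<close>

lemma saddle_loop_sign:
  assumes D: "topological_disc D" and ord: "boundary_order D \<sigma> A B C E"
    and p: "arc p" "pathstart p = A" "pathfinish p = B" "path_image p \<subseteq> D"
      "path_image p \<inter> frontier D = {A, B}"
    and p': "arc p'" "pathstart p' = C" "pathfinish p' = E" "path_image p' \<subseteq> D"
      "path_image p' \<inter> frontier D = {C, E}"
    and r: "arc r" "pathstart r = B" "pathfinish r = A" "path_image r \<inter> D = {A, B}"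
    and r': "arc r'" "pathstart r' = E" "pathfinish r' = C" "path_image r' \<inter> D = {C, E}"
    and q1: "simple_loop q1" "path_image q1 = path_image p \<union> path_image r"
      "\<And>z. z \<notin> path_image q1 \<Longrightarrow> winding_number q1 z = winding_number p z + winding_number r z"
    and q2: "simple_loop q2" "path_image q2 = path_image p' \<union> path_image r'"
      "\<And>z. z \<notin> path_image q2 \<Longrightarrow> winding_number q2 z = winding_number p' z + winding_number r' z"
    and q: "simple_loop q" "path_image q \<inter> frontier D \<subseteq> {A, B, C, E}"
      "\<And>z. z \<notin> D \<Longrightarrow> z \<notin> path_image q \<Longrightarrow> z \<notin> path_image q1 \<Longrightarrow> z \<notin> path_image q2 \<Longrightarrow>
        winding_number q z = winding_number q1 z + winding_number q2 z"
  shows "loop_sign q = loop_sign q1 + loop_sign q2 + \<sigma>"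
proof -
  obtain k l m n where bo: "\<sigma> = 1 \<or> \<sigma> = - 1" "arc k" "arc l" "arc m" "arc n"
    "pathstart k = A" "pathfinish k = B" "pathstart l = B" "pathfinish l = C"
    "pathstart m = C" "pathfinish m = E" "pathstart n = E" "pathfinish n = A"
    "path_image k \<union> path_image l \<union> path_image m \<union> path_image n \<subseteq> frontier D"
    "path_image k \<inter> path_image l = {B}" "path_image l \<inter> path_image m = {C}"
    "path_image m \<inter> path_image n = {E}" "path_image n \<inter> path_image k = {A}"
    "path_image k \<inter> path_image m = {}" "path_image l \<inter> path_image n = {}"
    "\<And>z. z \<in> interior D \<Longrightarrow> winding_number k z + winding_number l z + winding_number m z
      + winding_number n z = of_int \<sigma>"
    using ord unfolding boundary_order_def by (elim conjE exE) blast
  have fD: "frontier D \<subseteq> D"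
    using D by (simp add: topological_disc_def compact_imp_closed frontier_subset_closed)
  obtain x where x: "x \<in> path_image k" "x \<noteq> A" "x \<noteq> B" using arc_interior_point[OF bo(2)] bo by metis
  obtain y where y: "y \<in> path_image l" "y \<noteq> B" "y \<noteq> C" using arc_interior_point[OF bo(3)] bo by metis
  obtain w where w: "w \<in> path_image m" "w \<noteq> C" "w \<noteq> E" using arc_interior_point[OF bo(4)] bo by metis
  have ends: "A \<in> path_image k" "A \<in> path_image n" "B \<in> path_image k" "B \<in> path_image l"
    "C \<in> path_image l" "C \<in> path_image m" "E \<in> path_image m" "E \<in> path_image n"
    using bo(15-18) by auto
  have xk: "x \<notin> path_image l" "x \<notin> path_image m" "x \<notin> path_image n" "x \<in> frontier D" "x \<noteq> C" "x \<noteq> E"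
    using x bo(14-20) ends by auto
  have yl: "y \<notin> path_image k" "y \<notin> path_image m" "y \<notin> path_image n" "y \<in> frontier D" "y \<noteq> A" "y \<noteq> E"
    using y bo(14-20) ends by auto
  have wm: "w \<notin> path_image k" "w \<notin> path_image l" "w \<notin> path_image n" "w \<in> frontier D" "w \<noteq> A" "w \<noteq> B"
    using w bo(14-20) ends by auto
  have np: "x \<notin> path_image p" "y \<notin> path_image p" "x \<notin> path_image p'" "y \<notin> path_image p'" "w \<notin> path_image p'"
    using p(5) p'(5) x xk y yl w wm by auto
  have nr: "x \<notin> path_image r" "y \<notin> path_image r" "x \<notin> path_image r'" "y \<notin> path_image r'" "w \<notin> path_image r'"
    using r(4) r'(4) x xk y yl w wm fD by blast+
  have nq: "x \<notin> path_image q" "y \<notin> path_image q" using q(2) x xk y yl by auto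
  have nq1: "x \<notin> path_image q1" "y \<notin> path_image q1" "x \<notin> path_image q2" "y \<notin> path_image q2" "w \<notin> path_image q2"
    using q1(2) q2(2) np nr by auto
  note P = bo(2-5)[THEN arc_imp_path]
  have nf: "z \<notin> path_image k" "z \<notin> path_image l" "z \<notin> path_image m" "z \<notin> path_image n" if "z \<in> interior D" for z
    using that bo(14) interior_frontier_disjoint by blast+
  have im1: "path_image (l +++ m +++ n) = path_image l \<union> path_image m \<union> path_image n"
    using bo by (simp add: path_image_join Un_assoc)
  have im2: "path_image (n +++ k +++ l) = path_image n \<union> path_image k \<union> path_image l"
    using bo by (simp add: path_image_join Un_assoc)
  have jump1: "winding_number p y + winding_number r y = winding_number p x + winding_number r x + of_int \<sigma>"
  proof (rule crosscut_jump[where k = k and l = "l +++ m +++ n" and A = A and B = B, OF D])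
    show "winding_number k z + winding_number (l +++ m +++ n) z = of_int \<sigma>" if "z \<in> interior D" for z
      using bo(21)[OF that] nf[OF that] P bo
      by (simp add: winding_number_join path_image_join add.assoc)
  qed (use p r bo P x xk y yl np in \<open>auto simp: im1 arc_imp_path\<close>)
  have jump2: "winding_number p' z + winding_number r' z = winding_number p' w + winding_number r' w + of_int \<sigma>"
    if "z = x \<or> z = y" for z
  proof (rule crosscut_jump[where k = m and l = "n +++ k +++ l" and A = C and B = E, OF D])
    show "winding_number m z + winding_number (n +++ k +++ l) z = of_int \<sigma>" if "z \<in> interior D" for z
      using bo(21)[OF that] nf[OF that] P bo
      by (simp add: winding_number_join path_image_join add.assoc)
        (metis (no_types, opaque_lifting) add.assoc add.commute)
  qed (use p' r' bo P x xk y yl w wm np that in \<open>auto simp: im2 arc_imp_path\<close>)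
  \<comment> \<open>The hypothesis on \<open>q\<close> speaks of points off \<open>D\<close>;
    exterior points close to \<open>x\<close> and \<open>y\<close> carry it to the frontier.\<close>
  have sum: "winding_number q z = winding_number q1 z + winding_number q2 z" if z: "z = x \<or> z = y" for z
  proof -
    have "z \<in> frontier D" using z xk yl by auto
    then obtain z' where z': "z' \<notin> D" "\<And>\<gamma>. \<gamma> \<in> {q, q1, q2} \<Longrightarrow> z' \<notin> path_image \<gamma>"
      "\<And>\<gamma>. \<gamma> \<in> {q, q1, q2} \<Longrightarrow> winding_number \<gamma> z' = winding_number \<gamma> z"
      by (rule_tac exterior_approximation[of "{q, q1, q2}" z D])
        (use q(1) q1(1) q2(1) z nq nq1 in \<open>auto simp: simple_loop_def simple_path_imp_path\<close>)
    then show ?thesis using q(3)[of z'] by simp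
  qed
  have rel: "winding_number q1 y = winding_number q1 x + of_int \<sigma>"
    "winding_number q2 x = winding_number q2 w + of_int \<sigma>" "winding_number q2 y = winding_number q2 w + of_int \<sigma>"
    using jump1 jump2[of x] jump2[of y] q1(3) q2(3) nq1 by auto
  have int: "\<exists>i. winding_number g z = of_int i \<and> (i = 0 \<or> i = loop_sign g)"
    if "simple_loop g" "z \<notin> path_image g" for g z
    using winding_number_simple_loop_cases[OF that] by (metis of_int_0)
  obtain a where a: "winding_number q1 x = of_int a" "a = 0 \<or> a = loop_sign q1" using int q1(1) nq1 by metis
  obtain a' where a': "winding_number q1 y = of_int a'" "a' = 0 \<or> a' = loop_sign q1" using int q1(1) nq1 by metis
  obtain b where b: "winding_number q2 w = of_int b" "b = 0 \<or> b = loop_sign q2" using int q2(1) nq1 by metis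
  obtain b' where b': "winding_number q2 x = of_int b'" "b' = 0 \<or> b' = loop_sign q2" using int q2(1) nq1 by metis
  obtain b'' where b'': "winding_number q2 y = of_int b''" "b'' = 0 \<or> b'' = loop_sign q2" using int q2(1) nq1 by metis
  obtain c where c: "winding_number q x = of_int c" "c = 0 \<or> c = loop_sign q" using int q(1) nq by metis
  obtain c' where c': "winding_number q y = of_int c'" "c' = 0 \<or> c' = loop_sign q" using int q(1) nq by metis
  have eqs: "(of_int a' :: complex) = of_int (a + \<sigma>)" "(of_int b' :: complex) = of_int (b + \<sigma>)"
    "(of_int b'' :: complex) = of_int (b + \<sigma>)" "(of_int c :: complex) = of_int (a + b')"
    "(of_int c' :: complex) = of_int (a' + b'')"
    using rel sum[of x] sum[of y] a a' b b' b'' c c' by simp_all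
  then have "a' = a + \<sigma>" "b' = b + \<sigma>" "b'' = b + \<sigma>" "c = a + b'" "c' = a' + b''"
    unfolding of_int_eq_iff by simp_all
  \<comment> \<open>\<open>i\<close> and \<open>i + \<sigma>\<close> are the two different elements
    of \<open>{0, t}\<close>, so their sum \<open>2 * i + \<sigma>\<close> is \<open>t\<close>. This
    is applied with \<open>a\<close> for \<open>q1\<close>, \<open>b\<close> for \<open>q2\<close>
    and \<open>a + b + \<sigma>\<close> for \<open>q\<close>.\<close>
  moreover have step: "t = 2 * i + \<sigma>" if "t = 1 \<or> t = - 1" "i = 0 \<or> i = t" "i + \<sigma> = 0 \<or> i + \<sigma> = t"
    for t i :: int
    using that bo(1) by auto
  ultimately show ?thesis
    using step[OF loop_sign_cases[of q1] a(2)] step[OF loop_sign_cases[of q2] b(2)]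
      step[OF loop_sign_cases[of q] c(2)] a'(2) b'(2) c'(2) by simp
qed

section \<open>The sign of a loop joined to the boundary by four spokes\<close>

lemma arc_minus_start_connected:
  fixes s :: "real \<Rightarrow> complex"
  assumes "arc s"
  shows "connected (path_image s - {pathstart s})"
proof -
  have "path_image s - {pathstart s} = s ` {0<..1}"
  proof -
    have "{0..1} = insert 0 {0<..1::real}" by auto
    moreover have "s 0 \<notin> s ` {0<..1}"
    proof
      assume "s 0 \<in> s ` {0<..1}"
      then obtain x where "x \<in> {0<..1}" "s 0 = s x" by auto
      then show False using inj_onD[of s "{0..1}" 0 x] assms by (simp add: arc_def)
    qed
    ultimately show ?thesis by (simp add: path_image_def pathstart_def)
  qed
  moreover have "connected (s ` {0<..1})"
    using assms by (intro connected_continuous_image)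
      (auto simp: arc_def path_def intro: continuous_on_subset)
  ultimately show ?thesis by simp
qed

text \<open>A loop in a simply connected set does not wind around points off this set, so the inside
  is contained in \<open>D\<close>; being open, it is contained in the interior.\<close>

lemma inside_subset_interior_disc:
  assumes "topological_disc D" "simple_loop q" "path_image q \<subseteq> D"
  shows "inside (path_image q) \<subseteq> interior D"
proof -
  have "inside (path_image q) \<subseteq> D"
  proof
    fix z assume z: "z \<in> inside (path_image q)"
    show "z \<in> D"
    proof (rule ccontr)
      assume "z \<notin> D"
      then have "winding_number q z = 0"
        using assms by (intro simply_connected_imp_winding_number_zero[of D])
          (auto simp: topological_disc_def simple_loop_def simple_path_imp_path)
      then show False using loop_sign_inside[OF assms(2) z] loop_sign_cases[of q] by auto
    qed
  qed
  moreover have "open (inside (path_image q))"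
    using assms by (simp add: Jordan_inside_outside simple_loop_def)
  ultimately show ?thesis by (simp add: interior_maximal)
qed

text \<open>Without its start the spoke is connected and disjoint from the loop, which is the
  frontier of the inside. Since its last point is not inside, no other point is.\<close>

lemma spoke_outside:
  assumes D: "topological_disc D" and q: "simple_loop q" "path_image q \<subseteq> D"
    and s: "arc s" "pathfinish s \<in> frontier D" "path_image s \<inter> path_image q = {pathstart s}"
  shows "path_image s \<inter> inside (path_image q) = {}"
proof (rule ccontr)
  assume ne: "path_image s \<inter> inside (path_image q) \<noteq> {}"
  have "pathfinish s \<notin> inside (path_image q)"
    using inside_subset_interior_disc[OF D q] s(2) interior_frontier_disjoint by blast
  moreover have "pathfinish s \<in> path_image s - {pathstart s}" using s(1) arc_distinct_ends by auto
  ultimately have "(path_image s - {pathstart s}) - inside (path_image q) \<noteq> {}" by blast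
  moreover have "(path_image s - {pathstart s}) \<inter> inside (path_image q) \<noteq> {}"
    using ne s(3) inside_no_overlap[of "path_image q"] by blast
  ultimately have "(path_image s - {pathstart s}) \<inter> frontier (inside (path_image q)) \<noteq> {}"
    by (intro connected_Int_frontier arc_minus_start_connected s(1))
  moreover have "frontier (inside (path_image q)) = path_image q"
    using q(1) by (simp add: Jordan_inside_outside simple_loop_def)
  ultimately show False using s(3) by blast
qed

text \<open>The point \<open>c\<close> can be moved out of the disc without crossing
  \<open>g\<close>: through the inside of \<open>q\<close> to the start of the spoke
  \<open>s\<close>, along \<open>s\<close> to the frontier, and from there off \<open>D\<close>,
  where the winding number of a loop in \<open>D\<close> vanishes.\<close>

lemma sector_winding_number:
  assumes D: "topological_disc D" and q: "simple_loop q" "path_image q \<subseteq> D"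
    and g: "path g" "pathfinish g = pathstart g" "path_image g \<subseteq> D" "path_image g \<inter> inside (path_image q) = {}"
    and s: "path s" "pathstart s \<in> path_image q" "pathfinish s \<in> frontier D" "path_image s \<inter> path_image g = {}"
    and c: "c \<in> inside (path_image q)"
  shows "winding_number g c = 0"
proof -
  let ?I = "inside (path_image q)"
  have J: "connected ?I" "frontier ?I = path_image q"
    using q(1) by (simp_all add: Jordan_inside_outside simple_loop_def)
  have "connected (insert (pathstart s) ?I)"
    using J s(2) unfolding frontier_def by (intro connected_insert_closure) blast+
  moreover have "pathstart s \<notin> path_image g" using s(4) by auto
  ultimately have "winding_number g c = winding_number g (pathstart s)"
    using g c by (intro winding_number_eq[of g _ "insert (pathstart s) ?I"]) auto
  also have "\<dots> = winding_number g (pathfinish s)"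
    using g s by (intro winding_number_eq[of g _ "path_image s"]) (auto simp: connected_path_image)
  also have "\<dots> = 0"
  proof -
    have "pathfinish s \<notin> path_image g" using s(4) by auto
    then obtain z' where z': "z' \<notin> D" "winding_number g z' = winding_number g (pathfinish s)"
      by (rule_tac exterior_approximation[of "{g}" "pathfinish s" D]) (use g s in auto)
    then have "winding_number g z' = 0"
      using D g by (intro simply_connected_imp_winding_number_zero[of D]) (auto simp: topological_disc_def)
    then show ?thesis using z' by simp
  qed
  finally show ?thesis .
qed

text \<open>Two neighboring spokes, a side of the loop and a boundary arc form the boundary of a
  sector, which does not wind around points inside the loop. In the sum over the four sectors the
  spokes cancel, so the sides together wind as often as the boundary arcs, which is
  \<open>\<sigma>\<close>. In this way the spokes transfer the cyclic order from the boundary to the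
  loop.\<close>

lemma spoked_loop_sign:
  assumes D: "topological_disc D" and ord: "boundary_order D \<sigma> A B C E"
    and e: "arc e1" "arc e2" "arc e3" "arc e4"
      "pathstart e1 = a" "pathfinish e1 = b" "pathstart e2 = b" "pathfinish e2 = c"
      "pathstart e3 = c" "pathfinish e3 = d" "pathstart e4 = d" "pathfinish e4 = a"
      "c \<notin> path_image e1" "d \<notin> path_image e2" "a \<notin> path_image e3" "b \<notin> path_image e4"
    and q: "simple_loop q" "path_image q = path_image e1 \<union> path_image e2 \<union> path_image e3 \<union> path_image e4"
      "\<And>z. z \<notin> path_image q \<Longrightarrow> winding_number q z =
        winding_number e1 z + winding_number e2 z + winding_number e3 z + winding_number e4 z"
      "path_image q \<subseteq> interior D"
    and s: "arc s1" "arc s2" "arc s3" "arc s4"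
      "pathstart s1 = a" "pathfinish s1 = A" "pathstart s2 = b" "pathfinish s2 = B"
      "pathstart s3 = c" "pathfinish s3 = C" "pathstart s4 = d" "pathfinish s4 = E"
      "path_image s1 \<union> path_image s2 \<union> path_image s3 \<union> path_image s4 \<subseteq> D"
      "path_image s1 \<inter> frontier D = {A}" "path_image s2 \<inter> frontier D = {B}"
      "path_image s3 \<inter> frontier D = {C}" "path_image s4 \<inter> frontier D = {E}"
      "path_image s1 \<inter> path_image q = {a}" "path_image s2 \<inter> path_image q = {b}"
      "path_image s3 \<inter> path_image q = {c}" "path_image s4 \<inter> path_image q = {d}"
      "path_image s1 \<inter> path_image s2 = {}" "path_image s1 \<inter> path_image s3 = {}"
      "path_image s1 \<inter> path_image s4 = {}" "path_image s2 \<inter> path_image s3 = {}"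
      "path_image s2 \<inter> path_image s4 = {}" "path_image s3 \<inter> path_image s4 = {}"
  shows "loop_sign q = \<sigma>"
proof -
  obtain k l m n where bo: "\<sigma> = 1 \<or> \<sigma> = - 1" "arc k" "arc l" "arc m" "arc n"
    "pathstart k = A" "pathfinish k = B" "pathstart l = B" "pathfinish l = C"
    "pathstart m = C" "pathfinish m = E" "pathstart n = E" "pathfinish n = A"
    "path_image k \<union> path_image l \<union> path_image m \<union> path_image n \<subseteq> frontier D"
    "path_image k \<inter> path_image l = {B}" "path_image l \<inter> path_image m = {C}"
    "path_image m \<inter> path_image n = {E}" "path_image n \<inter> path_image k = {A}"
    "path_image k \<inter> path_image m = {}" "path_image l \<inter> path_image n = {}"
    "\<And>z. z \<in> interior D \<Longrightarrow> winding_number k z + winding_number l z + winding_number m z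
      + winding_number n z = of_int \<sigma>"
    using ord unfolding boundary_order_def by (elim conjE exE) blast
  have fD: "frontier D \<subseteq> D"
    using D by (simp add: topological_disc_def compact_imp_closed frontier_subset_closed)
  have qD: "path_image q \<subseteq> D" using q(4) interior_subset by blast
  have IF: "inside (path_image q) \<subseteq> interior D" by (rule inside_subset_interior_disc[OF D q(1) qD])
  obtain z where z: "z \<in> inside (path_image q)" using simple_loop_inside_nonempty q(1) by blast
  have zD: "z \<in> interior D" and zq: "z \<notin> path_image q" using IF z inside_no_overlap by blast+
  \<comment> \<open>The path \<open>t\<close> is a spoke not belonging to the sector; it is the way
    out for \<open>z\<close>.\<close>
  have sector: "winding_number s z + winding_number j z - winding_number s' z - winding_number f z = 0"
    if "arc s" "arc j" "arc s'" "arc f" "pathfinish s = pathstart j" "pathfinish j = pathfinish s'"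
      "pathstart s = pathstart f" "pathstart s' = pathfinish f" "path_image j \<subseteq> frontier D"
      "path_image s \<subseteq> D" "path_image s' \<subseteq> D" "path_image f \<subseteq> path_image q"
      "path_image s \<inter> path_image q = {pathstart s}" "path_image s' \<inter> path_image q = {pathstart s'}"
      "path t" "pathstart t \<in> path_image q" "pathfinish t \<in> frontier D"
      "path_image t \<inter> path_image s = {}" "path_image t \<inter> path_image s' = {}"
      "path_image t \<inter> path_image j = {}" "path_image t \<inter> path_image f = {}" for s j s' f t
  proof -
    define g where "g = (s +++ j) +++ (reversepath s' +++ reversepath f)"
    have paths: "path s" "path j" "path s'" "path f" using that by (auto simp: arc_imp_path)
    have fj: "pathfinish s \<in> frontier D" "pathfinish s' \<in> frontier D"
      using that(5,6,9) by (metis pathstart_in_path_image pathfinish_in_path_image subsetD)+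
    have im: "path_image g = path_image s \<union> path_image j \<union> path_image s' \<union> path_image f"
      using that by (simp add: g_def path_image_join Un_assoc)
    have out: "path_image s \<inter> inside (path_image q) = {}" "path_image s' \<inter> inside (path_image q) = {}"
      using spoke_outside[OF D q(1) qD that(1) fj(1) that(13)] spoke_outside[OF D q(1) qD that(3) fj(2) that(14)] by blast+
    have "path_image j \<inter> inside (path_image q) = {}" using that(9) IF interior_frontier_disjoint[of D] by blast
    moreover have "path_image f \<inter> inside (path_image q) = {}" using that(12) inside_no_overlap[of "path_image q"] by blast
    ultimately have gI: "path_image g \<inter> inside (path_image q) = {}" using out im by blast
    have "winding_number g z = 0"
    proof (rule sector_winding_number[OF D q(1) qD, of g t])
      show "path g" "pathfinish g = pathstart g" using paths that by (auto simp: g_def)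
      show "path_image g \<subseteq> D" unfolding im using that(9-12) fD qD by blast
      show "path_image t \<inter> path_image g = {}" unfolding im using that(18-21) by blast
    qed (use that gI z in auto)
    moreover have "z \<notin> path_image s" "z \<notin> path_image j" "z \<notin> path_image s'" "z \<notin> path_image f"
      using gI z im by auto
    ultimately show ?thesis using paths that
      by (simp add: g_def winding_number_join path_image_join winding_number_reversepath algebra_simps)
  qed
  have ends: "A \<in> path_image k" "A \<in> path_image n" "B \<in> path_image k" "B \<in> path_image l"
    "C \<in> path_image l" "C \<in> path_image m" "E \<in> path_image m" "E \<in> path_image n"
    using bo(15-18) by auto
  have ve: "a \<in> path_image e1" "b \<in> path_image e2" "c \<in> path_image e3" "d \<in> path_image e4"
    using e by (metis pathstart_in_path_image)+
  have fr: "A \<in> frontier D" "B \<in> frontier D" "C \<in> frontier D" "E \<in> frontier D" using s(14-17) by auto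
  have sp: "path_image s3 \<inter> path_image k = {}" "path_image s4 \<inter> path_image l = {}"
    "path_image s1 \<inter> path_image m = {}" "path_image s2 \<inter> path_image n = {}"
    using s(14-17) bo(14-20) ends by auto
  have se: "path_image s3 \<inter> path_image e1 = {}" "path_image s4 \<inter> path_image e2 = {}"
    "path_image s1 \<inter> path_image e3 = {}" "path_image s2 \<inter> path_image e4 = {}"
    using s(18-21) e(13-16) q(2) by auto
  have vq: "a \<in> path_image q" "b \<in> path_image q" "c \<in> path_image q" "d \<in> path_image q"
    using ve q(2) by auto
  have sub: "path_image k \<subseteq> frontier D" "path_image l \<subseteq> frontier D" "path_image m \<subseteq> frontier D"
    "path_image n \<subseteq> frontier D" "path_image s1 \<subseteq> D" "path_image s2 \<subseteq> D" "path_image s3 \<subseteq> D"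
    "path_image s4 \<subseteq> D" "path_image e1 \<subseteq> path_image q" "path_image e2 \<subseteq> path_image q"
    "path_image e3 \<subseteq> path_image q" "path_image e4 \<subseteq> path_image q"
    using bo(14) s(13) q(2) by blast+
  have 1: "winding_number s1 z + winding_number k z - winding_number s2 z - winding_number e1 z = 0"
    by (rule sector[where t = s3]) (simp_all add: bo(2-13) e(1-12) s(1-12,18-27) s(22-27)[THEN trans[OF Int_commute]] sp se fr vq sub arc_imp_path)
  have 2: "winding_number s2 z + winding_number l z - winding_number s3 z - winding_number e2 z = 0"
    by (rule sector[where t = s4]) (simp_all add: bo(2-13) e(1-12) s(1-12,18-27) s(22-27)[THEN trans[OF Int_commute]] sp se fr vq sub arc_imp_path)
  have 3: "winding_number s3 z + winding_number m z - winding_number s4 z - winding_number e3 z = 0"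
    by (rule sector[where t = s1]) (simp_all add: bo(2-13) e(1-12) s(1-12,18-27) s(22-27)[THEN trans[OF Int_commute]] sp se fr vq sub arc_imp_path)
  have 4: "winding_number s4 z + winding_number n z - winding_number s1 z - winding_number e4 z = 0"
    by (rule sector[where t = s2]) (simp_all add: bo(2-13) e(1-12) s(1-12,18-27) s(22-27)[THEN trans[OF Int_commute]] sp se fr vq sub arc_imp_path)
  have "of_int (loop_sign q) = winding_number e1 z + winding_number e2 z + winding_number e3 z + winding_number e4 z"
    using q(3)[OF zq] loop_sign_inside[OF q(1) z] by simp
  also have "\<dots> = winding_number k z + winding_number l z + winding_number m z + winding_number n z"
    unfolding 1[unfolded right_minus_eq, symmetric] 2[unfolded right_minus_eq, symmetric]
      3[unfolded right_minus_eq, symmetric] 4[unfolded right_minus_eq, symmetric] by simp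
  also have "\<dots> = of_int \<sigma>" using bo(21)[OF zD] .
  finally show ?thesis by (simp only: of_int_eq_iff)
qed

section \<open>Exchanging arcs inside a disc\<close>

definition agree_outside ::
    "complex set \<Rightarrow> complex set \<Rightarrow> curve \<Rightarrow> complex set \<Rightarrow> curve \<Rightarrow> bool" where
  "agree_outside D M F M' F' \<longleftrightarrow>
    M - D = M' - D \<and> (\<forall>z v. z \<notin> D \<longrightarrow> ((z, v) \<in> F \<longleftrightarrow> (z, v) \<in> F'))"

lemma disjoint_if_disjoint_outside:
  "Y \<inter> D = {} \<Longrightarrow> Y \<inter> Z = {} \<Longrightarrow> X - D = Z - D \<Longrightarrow> X \<inter> Y = {}"
  by blast

lemma Un_eq_if_agree_outside:
  "Y \<inter> D = {} \<Longrightarrow> M' - D = M - D \<Longrightarrow> M = Z \<union> Y \<Longrightarrow> X - D = Z - D \<Longrightarrow> M' \<inter> D = X \<inter> D \<Longrightarrow> X \<union> Y = M'"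
  by blast

text \<open>Loops not in \<open>\<Delta>\<close> are disjoint from those in \<open>\<Delta>\<close>
  and hence avoid \<open>D\<close>, where alone the supports and fields may differ. They remain
  loops for \<open>M'\<close> and \<open>F'\<close>, so only the signs of \<open>\<Delta>\<close>
  and \<open>\<Delta>'\<close> enter the difference.\<close>

lemma cycle_degree_exchange:
  assumes dec: "loop_decomposition \<Gamma> M F" and df: "direction_field F" "direction_field F'"
    and agree: "agree_outside D M F M' F'"
    and \<Delta>: "\<Delta> \<subseteq> \<Gamma>" "M \<inter> D \<subseteq> (\<Union>\<gamma>\<in>\<Delta>. path_image \<gamma>)"
    and \<Delta>': "finite \<Delta>'" "\<And>\<gamma>. \<gamma> \<in> \<Delta>' \<Longrightarrow> simple_loop \<gamma> \<and> follows \<gamma> F'"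
      "\<And>\<gamma> \<delta>. \<gamma> \<in> \<Delta>' \<Longrightarrow> \<delta> \<in> \<Delta>' \<Longrightarrow> \<gamma> \<noteq> \<delta> \<Longrightarrow> path_image \<gamma> \<inter> path_image \<delta> = {}"
      "(\<Union>\<gamma>\<in>\<Delta>'. path_image \<gamma>) - D = (\<Union>\<gamma>\<in>\<Delta>. path_image \<gamma>) - D"
      "M' \<inter> D = (\<Union>\<gamma>\<in>\<Delta>'. path_image \<gamma>) \<inter> D"
  shows "cycle_degree M' F' = cycle_degree M F - sum loop_sign \<Delta> + sum loop_sign \<Delta>'"
proof -
  note \<Gamma> = dec[unfolded loop_decomposition_def]
  have \<Gamma>f: "finite \<Gamma>" "\<And>\<gamma>. \<gamma> \<in> \<Gamma> \<Longrightarrow> simple_loop \<gamma>" "\<And>\<gamma>. \<gamma> \<in> \<Gamma> \<Longrightarrow> follows \<gamma> F"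
    "\<And>\<gamma> \<delta>. \<gamma> \<in> \<Gamma> \<Longrightarrow> \<delta> \<in> \<Gamma> \<Longrightarrow> \<gamma> \<noteq> \<delta> \<Longrightarrow> path_image \<gamma> \<inter> path_image \<delta> = {}"
    "M = (\<Union>\<gamma>\<in>\<Gamma>. path_image \<gamma>)"
    using \<Gamma> by simp_all
  define R where "R = \<Gamma> - \<Delta>"
  have fin: "finite \<Gamma>" using \<Gamma> by blast
  have RD: "path_image \<delta> \<inter> path_image \<gamma> = {}" if "\<delta> \<in> R" "\<gamma> \<in> \<Delta>" for \<delta> \<gamma>
    using \<Gamma>f(4)[of \<delta> \<gamma>] that \<Delta>(1) unfolding R_def by blast
  have out: "path_image \<delta> \<inter> D = {}" if "\<delta> \<in> R" for \<delta>
  proof -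
    have "path_image \<delta> \<subseteq> M" using \<Gamma>f(5) that unfolding R_def by blast
    then show ?thesis using RD[OF that] \<Delta>(2) by blast
  qed
  have M: "M = (\<Union>\<gamma>\<in>\<Delta>. path_image \<gamma>) \<union> (\<Union>\<gamma>\<in>R. path_image \<gamma>)"
    using \<Gamma>f(5) \<Delta>(1) unfolding R_def by blast
  have "loop_decomposition \<Delta>' (\<Union>\<gamma>\<in>\<Delta>'. path_image \<gamma>) F'"
    unfolding loop_decomposition_def using \<Delta>'(1-3) by simp
  moreover have "loop_decomposition R (\<Union>\<gamma>\<in>R. path_image \<gamma>) F'"
  proof -
    have "follows \<gamma> F'" if "\<gamma> \<in> R" for \<gamma>
    proof (rule follows_transfer[where X = "{}" and F = F])
      show "follows \<gamma> F" using \<Gamma>f(3) that unfolding R_def by blast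
      show "(z, v) \<in> F'" if "(z, v) \<in> F" "z \<in> path_image \<gamma>" for z v
        using agree out[OF \<open>\<gamma> \<in> R\<close>] that unfolding agree_outside_def by blast
    qed auto
    then show ?thesis unfolding loop_decomposition_def using \<Gamma>f(1,2,4) unfolding R_def by simp
  qed
  moreover have disj: "(\<Union>\<gamma>\<in>\<Delta>'. path_image \<gamma>) \<inter> (\<Union>\<gamma>\<in>R. path_image \<gamma>) = {}"
  proof -
    have "(\<Union>\<gamma>\<in>R. path_image \<gamma>) \<inter> D = {}" using out by blast
    moreover have "(\<Union>\<gamma>\<in>R. path_image \<gamma>) \<inter> (\<Union>\<gamma>\<in>\<Delta>. path_image \<gamma>) = {}" using RD by blast
    ultimately show ?thesis using \<Delta>'(4) by (rule disjoint_if_disjoint_outside)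
  qed
  ultimately have "loop_decomposition (\<Delta>' \<union> R) ((\<Union>\<gamma>\<in>\<Delta>'. path_image \<gamma>) \<union> (\<Union>\<gamma>\<in>R. path_image \<gamma>)) F'"
    by (rule loop_decomposition_Un)
  moreover have "(\<Union>\<gamma>\<in>\<Delta>'. path_image \<gamma>) \<union> (\<Union>\<gamma>\<in>R. path_image \<gamma>) = M'"
  proof -
    have "(\<Union>\<gamma>\<in>R. path_image \<gamma>) \<inter> D = {}" using out by blast
    moreover have "M' - D = M - D" using agree by (simp add: agree_outside_def)
    ultimately show ?thesis using M \<Delta>'(4,5) by (rule Un_eq_if_agree_outside)
  qed
  ultimately have "cycle_degree M' F' = sum loop_sign (\<Delta>' \<union> R)"
    using cycle_degree_loop_decomposition df(2) by simp
  also have "\<dots> = sum loop_sign \<Delta>' + sum loop_sign R"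
  proof (rule sum.union_disjoint)
    show "\<Delta>' \<inter> R = {}"
    proof (rule equals0I)
      fix \<gamma> assume "\<gamma> \<in> \<Delta>' \<inter> R"
      then have "path_image \<gamma> = {}" using disj by blast
      then show False by simp
    qed
  qed (use \<Delta>'(1) fin R_def in auto)
  also have "sum loop_sign R = sum loop_sign \<Gamma> - sum loop_sign \<Delta>"
    unfolding R_def by (rule sum_diff) (use fin \<Delta>(1) in auto)
  also have "sum loop_sign \<Gamma> = cycle_degree M F"
    using cycle_degree_loop_decomposition[OF dec df(1)] by simp
  finally show ?thesis by simp
qed

text \<open>By injectivity a finite intersection with \<open>D\<close> takes up only finitely many
  parameters, and these may be dropped.\<close>

lemma outer_arc_follows:
  assumes "arc r" "follows r F" "agree_outside D M F M' F'" "finite (path_image r \<inter> D)"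
  shows "follows r F'"
proof (rule follows_transfer[OF assms(2), where X = D])
  have "r ` {t \<in> {0..1}. r t \<in> D} \<subseteq> path_image r \<inter> D" by (auto simp: path_image_def)
  then have "finite (r ` {t \<in> {0..1}. r t \<in> D})" using assms(4) finite_subset by blast
  moreover have "inj_on r {0..1}" using assms(1) by (simp add: arc_def)
  then have "inj_on r {t \<in> {0..1}. r t \<in> D}" by (rule inj_on_subset) blast
  ultimately show "finite {t \<in> {0..1}. r t \<in> D}" using finite_imageD by blast
  show "(z, v) \<in> F'" if "(z, v) \<in> F" "z \<in> path_image r" "z \<notin> D" for z v
    using assms(3) that unfolding agree_outside_def by blast
qed

definition splits_loop where
  "splits_loop F \<gamma> p r \<longleftrightarrow> arc r \<and> follows r F \<and> pathstart r = pathfinish p \<and> pathfinish r = pathstart p \<and>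
    path_image p \<union> path_image r = path_image \<gamma> \<and>
    path_image p \<inter> path_image r = {pathstart p, pathfinish p} \<and>
    (\<forall>z. z \<notin> path_image \<gamma> \<longrightarrow> winding_number \<gamma> z = winding_number p z + winding_number r z)"

text \<open>The loop runs through \<open>p\<close>, \<open>r\<close>, \<open>p'\<close>,
  \<open>r'\<close> in this cyclic order: both given arcs lie on it, and \<open>r\<close> and
  \<open>r'\<close> are what remains.\<close>

definition splits_loop2 where
  "splits_loop2 F \<gamma> p r p' r' \<longleftrightarrow> arc r \<and> follows r F \<and> arc r' \<and> follows r' F \<and>
    pathstart r = pathfinish p \<and> pathfinish r = pathstart p' \<and>
    pathstart r' = pathfinish p' \<and> pathfinish r' = pathstart p \<and>
    path_image \<gamma> = path_image p \<union> path_image r \<union> path_image p' \<union> path_image r' \<and>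
    path_image r \<inter> path_image p = {pathfinish p} \<and> path_image r \<inter> path_image p' = {pathstart p'} \<and>
    path_image r' \<inter> path_image p' = {pathfinish p'} \<and> path_image r' \<inter> path_image p = {pathstart p} \<and>
    path_image r \<inter> path_image r' = {} \<and>
    (\<forall>z. z \<notin> path_image \<gamma> \<longrightarrow> winding_number \<gamma> z =
      winding_number p z + winding_number r z + winding_number p' z + winding_number r' z)"

lemma loop_decomposition_containing:
  assumes "loop_decomposition \<Gamma> M F" "connected C" "C \<subseteq> M" "C \<noteq> {}"
  obtains \<gamma> where "\<gamma> \<in> \<Gamma>" "C \<subseteq> path_image \<gamma>"
proof -
  note \<Gamma> = assms(1)[unfolded loop_decomposition_def]
  obtain x where x: "x \<in> C" using assms(4) by blast
  then obtain \<gamma> where \<gamma>: "\<gamma> \<in> \<Gamma>" "x \<in> path_image \<gamma>" using \<Gamma> assms(3) by blast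
  have cl: "closed (path_image \<delta>)" if "\<delta> \<in> \<Gamma>" for \<delta>
    using \<Gamma> that by (auto simp: closed_path_image simple_loop_imp_path)
  have "path_image \<gamma> \<inter> C = {} \<or> (\<Union>\<delta>\<in>\<Gamma> - {\<gamma>}. path_image \<delta>) \<inter> C = {}"
  proof (rule connected_closedD[OF assms(2)])
    show "closed (\<Union>\<delta>\<in>\<Gamma> - {\<gamma>}. path_image \<delta>)" using \<Gamma> cl by (intro closed_UN) auto
    show "C \<subseteq> path_image \<gamma> \<union> (\<Union>\<delta>\<in>\<Gamma> - {\<gamma>}. path_image \<delta>)" using \<Gamma> assms(3) by blast
    show "path_image \<gamma> \<inter> (\<Union>\<delta>\<in>\<Gamma> - {\<gamma>}. path_image \<delta>) \<inter> C = {}" using \<Gamma> \<gamma> by blast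
  qed (use cl \<gamma> in auto)
  then have "(\<Union>\<delta>\<in>\<Gamma> - {\<gamma>}. path_image \<delta>) \<inter> C = {}" using x \<gamma> by blast
  moreover have "C \<subseteq> (\<Union>\<delta>\<in>\<Gamma>. path_image \<delta>)" using \<Gamma> assms(3) by blast
  ultimately have "C \<subseteq> path_image \<gamma>" by blast
  then show ?thesis using that \<gamma> by blast
qed

lemma loop_decomposition_cut:
  assumes "loop_decomposition \<Gamma> M F" "direction_field F" "arc p" "follows p F" "path_image p \<subseteq> M"
  obtains \<gamma> r where "\<gamma> \<in> \<Gamma>" "splits_loop F \<gamma> p r"
proof -
  obtain \<gamma> where \<gamma>: "\<gamma> \<in> \<Gamma>" "path_image p \<subseteq> path_image \<gamma>"
    using loop_decomposition_containing[OF assms(1) _ assms(5)] assms(3)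
    by (metis arc_imp_path connected_path_image path_image_nonempty)
  have g: "simple_loop \<gamma>" "follows \<gamma> F" using assms(1) \<gamma> by (auto simp: loop_decomposition_def)
  show ?thesis
  proof (rule loop_minus_arc[OF g assms(3,4) \<gamma>(2) assms(2)])
    fix r assume "arc r" "follows r F" "pathstart r = pathfinish p" "pathfinish r = pathstart p"
      "path_image p \<union> path_image r = path_image \<gamma>"
      "path_image p \<inter> path_image r = {pathstart p, pathfinish p}"
      "\<And>z. z \<notin> path_image \<gamma> \<Longrightarrow> winding_number \<gamma> z = winding_number p z + winding_number r z"
    then have "splits_loop F \<gamma> p r" unfolding splits_loop_def by blast
    then show thesis using that \<gamma>(1) by blast
  qed
qed

text \<open>Whether the two arcs lie on one loop or on two is decided by how the outside connects
  them, so both cases are offered. If they lie on one loop, \<open>p'\<close> is contained in the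
  arc that \<open>p\<close> leaves over and is removed from it in turn.\<close>

lemma loop_decomposition_cut2:
  assumes dec: "loop_decomposition \<Gamma> M F" and df: "direction_field F"
    and p: "arc p" "follows p F" "path_image p \<subseteq> M"
    and p': "arc p'" "follows p' F" "path_image p' \<subseteq> M"
    and disj: "path_image p \<inter> path_image p' = {}"
  obtains (two) \<gamma> \<gamma>' r r' where "\<gamma> \<in> \<Gamma>" "\<gamma>' \<in> \<Gamma>" "\<gamma> \<noteq> \<gamma>'" "path_image \<gamma> \<inter> path_image \<gamma>' = {}"
      "splits_loop F \<gamma> p r" "splits_loop F \<gamma>' p' r'"
  | (one) \<gamma> r r' where "\<gamma> \<in> \<Gamma>" "splits_loop2 F \<gamma> p r p' r'"
proof -
  obtain \<gamma> r where \<gamma>: "\<gamma> \<in> \<Gamma>" "splits_loop F \<gamma> p r" using loop_decomposition_cut[OF dec df p] .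
  obtain \<gamma>' r' where \<gamma>': "\<gamma>' \<in> \<Gamma>" "splits_loop F \<gamma>' p' r'" using loop_decomposition_cut[OF dec df p'] .
  show ?thesis
  proof (cases "\<gamma> = \<gamma>'")
    case False
    then have "path_image \<gamma> \<inter> path_image \<gamma>' = {}" using dec \<gamma> \<gamma>' by (auto simp: loop_decomposition_def)
    then show ?thesis using two False \<gamma> \<gamma>' by blast
  next
    case True
    have r: "arc r" "follows r F" "pathstart r = pathfinish p" "pathfinish r = pathstart p"
      "path_image p \<union> path_image r = path_image \<gamma>"
      "path_image p \<inter> path_image r = {pathstart p, pathfinish p}"
      "\<And>z. z \<notin> path_image \<gamma> \<Longrightarrow> winding_number \<gamma> z = winding_number p z + winding_number r z"
      using \<gamma>(2) by (auto simp: splits_loop_def)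
    have "path_image p' \<subseteq> path_image \<gamma>" using \<gamma>' True by (auto simp: splits_loop_def)
    then have "path_image p' \<subseteq> path_image r" using disj r(5) by blast
    moreover have "pathstart r \<notin> path_image p'" "pathfinish r \<notin> path_image p'"
      using disj r(3,4) by (metis disjoint_iff pathfinish_in_path_image pathstart_in_path_image)+
    ultimately obtain r1 r2 where s: "arc r1" "follows r1 F" "arc r2" "follows r2 F"
      "pathstart r1 = pathstart r" "pathfinish r1 = pathstart p'"
      "pathstart r2 = pathfinish p'" "pathfinish r2 = pathfinish r"
      "path_image r1 \<union> path_image p' \<union> path_image r2 = path_image r"
      "path_image r1 \<inter> path_image p' = {pathstart p'}"
      "path_image r2 \<inter> path_image p' = {pathfinish p'}"
      "path_image r1 \<inter> path_image r2 = {}"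
      "\<And>z. z \<notin> path_image r \<Longrightarrow>
        winding_number r z = winding_number r1 z + winding_number p' z + winding_number r2 z"
      using arc_minus_arc[OF r(1,2) p'(1,2) _ _ _ df] by blast
    have in1: "pathfinish p \<in> path_image r1" "pathstart p \<in> path_image r2"
      using s(5,8) r(3,4) by (metis pathstart_in_path_image pathfinish_in_path_image)+
    have "path_image r1 \<inter> path_image p \<subseteq> {pathstart p, pathfinish p}"
      "path_image r2 \<inter> path_image p \<subseteq> {pathstart p, pathfinish p}"
      using r(6) s(9) by blast+
    then have "path_image r1 \<inter> path_image p = {pathfinish p}" "path_image r2 \<inter> path_image p = {pathstart p}"
      using in1 s(12) by auto
    moreover have "path_image \<gamma> = path_image p \<union> path_image r1 \<union> path_image p' \<union> path_image r2"
      using r(5) s(9) by blast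
    moreover have "winding_number \<gamma> z = winding_number p z + winding_number r1 z + winding_number p' z
        + winding_number r2 z" if "z \<notin> path_image \<gamma>" for z
      using that r(5,7) s(13) by auto
    ultimately have "splits_loop2 F \<gamma> p r1 p' r2"
      unfolding splits_loop2_def using s r by simp
    then show ?thesis using one \<gamma>(1) by blast
  qed
qed

text \<open>About points outside \<open>D\<close> the arcs \<open>p\<close> and \<open>p'\<close>
  have the same winding numbers, and the loop has points outside \<open>D\<close>, namely those of
  \<open>r\<close> other than its ends. Hence the sign survives the replacement.\<close>

lemma splits_loop_replace:
  assumes \<gamma>: "simple_loop \<gamma>" "splits_loop F \<gamma> p r" and D: "closed D" "simply_connected D"
    and agree: "agree_outside D M F M' F'"
    and p: "arc p" "path_image p \<subseteq> D"
    and p': "arc p'" "follows p' F'" "path_image p' \<subseteq> D" "pathstart p' = pathstart p" "pathfinish p' = pathfinish p"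
    and rD: "path_image r \<inter> D \<subseteq> {pathstart p, pathfinish p}"
  obtains \<delta> where "simple_loop \<delta>" "follows \<delta> F'" "path_image \<delta> = path_image p' \<union> path_image r"
    "loop_sign \<delta> = loop_sign \<gamma>"
proof -
  have r: "arc r" "follows r F" "pathstart r = pathfinish p" "pathfinish r = pathstart p"
    "path_image p \<union> path_image r = path_image \<gamma>"
    "\<And>z. z \<notin> path_image \<gamma> \<Longrightarrow> winding_number \<gamma> z = winding_number p z + winding_number r z"
    using \<gamma>(2) by (auto simp: splits_loop_def)
  define \<delta> where "\<delta> = p' +++ r"
  have im: "path_image \<delta> = path_image p' \<union> path_image r" using p' r by (simp add: \<delta>_def path_image_join)
  have loop: "simple_loop \<delta>"
    unfolding \<delta>_def by (rule simple_loop_join) (use p' r rD in auto)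
  have "finite (path_image r \<inter> D)" using rD by (rule finite_subset) simp
  then have "follows r F'" by (rule outer_arc_follows[OF r(1,2) agree])
  then have fol: "follows \<delta> F'" unfolding \<delta>_def using p'(2) by (rule follows_join[rotated])
  obtain x where x: "x \<in> path_image r" "x \<noteq> pathstart r" "x \<noteq> pathfinish r"
    using arc_interior_point[OF r(1)] by metis
  have "loop_sign \<gamma> = loop_sign \<delta>"
  proof (rule loop_sign_transfer[OF \<gamma>(1) loop D(1)])
    show "x \<in> path_image \<gamma>" "x \<notin> D" using x r rD by auto
    show "path_image \<delta> \<subseteq> path_image \<gamma> \<union> D" using im r p' by blast
    fix z assume z: "z \<notin> D" "z \<notin> path_image \<gamma>"
    then have "z \<notin> path_image p" "z \<notin> path_image p'" "z \<notin> path_image r" using p p' r by auto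
    moreover have "winding_number p z = winding_number p' z"
      using p p' z D by (intro winding_number_simply_connected_eq[of D]) (auto simp: arc_imp_path)
    ultimately show "winding_number \<gamma> z = winding_number \<delta> z"
      using r(6)[OF z(2)] p' r by (simp add: \<delta>_def winding_number_join arc_imp_path)
  qed
  then show ?thesis using that[OF loop fol im] by simp
qed

lemma simple_loop_join4:
  assumes arcs: "arc a" "arc b" "arc c" "arc d"
    and ends: "pathfinish a = pathstart b" "pathfinish b = pathstart c" "pathfinish c = pathstart d"
      "pathfinish d = pathstart a"
    and int: "path_image a \<inter> path_image b \<subseteq> {pathstart b}" "path_image b \<inter> path_image c \<subseteq> {pathstart c}"
      "path_image c \<inter> path_image d \<subseteq> {pathstart d}" "path_image d \<inter> path_image a \<subseteq> {pathstart a}"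
      "path_image a \<inter> path_image c = {}" "path_image b \<inter> path_image d = {}"
  defines "q \<equiv> (a +++ b) +++ (c +++ d)"
  shows "simple_loop q"
    and "path_image q = path_image a \<union> path_image b \<union> path_image c \<union> path_image d"
    and "z \<notin> path_image q \<Longrightarrow> winding_number q z =
      winding_number a z + winding_number b z + winding_number c z + winding_number d z"
proof -
  have "arc (a +++ b)" "arc (c +++ d)" using arcs ends int by (auto intro!: arc_join)
  moreover have "path_image (a +++ b) \<inter> path_image (c +++ d) \<subseteq> {pathstart (a +++ b), pathstart (c +++ d)}"
    using ends int by (auto simp: path_image_join)
  ultimately show "simple_loop q" unfolding q_def using ends by (intro simple_loop_join) auto
  show im: "path_image q = path_image a \<union> path_image b \<union> path_image c \<union> path_image d"
    using ends by (simp add: q_def path_image_join Un_assoc)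
  show "winding_number q z =
      winding_number a z + winding_number b z + winding_number c z + winding_number d z"
    if "z \<notin> path_image q"
    using that arcs ends unfolding im q_def by (simp add: winding_number_join path_image_join arc_imp_path)
qed

text \<open>The crosscut is all of the support inside the disc, so exactly one loop is
  affected.\<close>

lemma cycle_degree_crosscut:
  assumes dec: "loop_decomposition \<Gamma> M F" and df: "direction_field F" "direction_field F'"
    and D: "closed D" "simply_connected D" and agree: "agree_outside D M F M' F'"
    and p: "arc p" "follows p F" "M \<inter> D = path_image p"
    and p': "arc p'" "follows p' F'" "M' \<inter> D = path_image p'"
      "pathstart p' = pathstart p" "pathfinish p' = pathfinish p"
  shows "cycle_degree M' F' = cycle_degree M F"
proof -
  obtain \<gamma> r where \<gamma>: "\<gamma> \<in> \<Gamma>" "splits_loop F \<gamma> p r"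
    using loop_decomposition_cut[OF dec df(1) p(1,2)] p(3) by blast
  have loop: "simple_loop \<gamma>" "path_image \<gamma> \<subseteq> M" using dec \<gamma> by (auto simp: loop_decomposition_def)
  have r: "path_image p \<union> path_image r = path_image \<gamma>"
    "path_image p \<inter> path_image r = {pathstart p, pathfinish p}"
    using \<gamma>(2) by (auto simp: splits_loop_def)
  have rD: "path_image r \<inter> D \<subseteq> {pathstart p, pathfinish p}" using r loop p(3) by blast
  obtain \<delta> where \<delta>: "simple_loop \<delta>" "follows \<delta> F'" "path_image \<delta> = path_image p' \<union> path_image r"
    "loop_sign \<delta> = loop_sign \<gamma>"
    using splits_loop_replace[OF loop(1) \<gamma>(2) D agree p(1) _ p'(1,2) _ p'(4,5) rD] p(3) p'(3) by blast
  have "cycle_degree M' F' = cycle_degree M F - sum loop_sign {\<gamma>} + sum loop_sign {\<delta>}"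
  proof (rule cycle_degree_exchange[OF dec df agree])
    show "(\<Union>\<gamma>\<in>{\<delta>}. path_image \<gamma>) - D = (\<Union>\<gamma>\<in>{\<gamma>}. path_image \<gamma>) - D"
      using \<delta>(3) r(1) p(3) p'(3) by auto
    have "path_image r \<inter> D \<subseteq> path_image p'" using rD p'(4,5)
      by (metis insert_subset pathfinish_in_path_image pathstart_in_path_image subset_trans empty_subsetI)
    then show "M' \<inter> D = (\<Union>\<gamma>\<in>{\<delta>}. path_image \<gamma>) \<inter> D" using \<delta>(3) p'(3) by auto
  qed (use \<gamma> \<delta> p(3) r(1) in auto)
  then show ?thesis using \<delta>(4) by simp
qed

text \<open>The closed path along \<open>q\<close>, back along \<open>p'\<close>, along
  \<open>q'\<close> and back along \<open>p\<close> lies in \<open>D\<close> and therefore does not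
  wind around \<open>z\<close>.\<close>

lemma winding_number_exchange:
  assumes "simply_connected D" "path p" "path p'" "path q" "path q'" "z \<notin> D"
    "path_image p \<subseteq> D" "path_image p' \<subseteq> D" "path_image q \<subseteq> D" "path_image q' \<subseteq> D"
    "pathstart q = pathstart p" "pathfinish q = pathfinish p'" "pathstart q' = pathstart p'"
    "pathfinish q' = pathfinish p"
  shows "winding_number q z + winding_number q' z = winding_number p z + winding_number p' z"
proof -
  have "winding_number ((q +++ reversepath p') +++ (q' +++ reversepath p)) z = 0"
    using assms by (intro simply_connected_imp_winding_number_zero[of D]) (auto simp: path_image_join)
  moreover have "z \<notin> path_image p" "z \<notin> path_image p'" "z \<notin> path_image q" "z \<notin> path_image q'"
    using assms by auto
  ultimately have "winding_number q z - winding_number p' z + (winding_number q' z - winding_number p z) = 0"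
    using assms by (simp add: winding_number_join winding_number_reversepath path_image_join)
  then show ?thesis by (simp add: algebra_simps)
qed

text \<open>Both crosscuts are replaced at the same time, as they may belong to one loop. In either
  case of \<open>loop_decomposition_cut2\<close> the outer arcs stay and the new crosscuts have the
  old ends, so each affected loop is replaced by one of the same sign.\<close>

lemma cycle_degree_two_crosscuts:
  assumes dec: "loop_decomposition \<Gamma> M F" and df: "direction_field F" "direction_field F'"
    and D: "closed D" "simply_connected D" and agree: "agree_outside D M F M' F'"
    and p: "arc p1" "follows p1 F" "arc p2" "follows p2 F" "M \<inter> D = path_image p1 \<union> path_image p2"
      "path_image p1 \<inter> path_image p2 = {}"
    and p': "arc p1'" "follows p1' F'" "arc p2'" "follows p2' F'"
      "M' \<inter> D = path_image p1' \<union> path_image p2'" "path_image p1' \<inter> path_image p2' = {}"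
    and ends: "pathstart p1' = pathstart p1" "pathfinish p1' = pathfinish p1"
      "pathstart p2' = pathstart p2" "pathfinish p2' = pathfinish p2"
  shows "cycle_degree M' F' = cycle_degree M F"
proof -
  have pM: "path_image p1 \<subseteq> M" "path_image p2 \<subseteq> M" and pD: "path_image p1 \<subseteq> D" "path_image p2 \<subseteq> D"
    and pD': "path_image p1' \<subseteq> D" "path_image p2' \<subseteq> D"
    using p(5) p'(5) by blast+
  have e': "pathstart p1 \<in> path_image p1'" "pathfinish p1 \<in> path_image p1'"
    "pathstart p2 \<in> path_image p2'" "pathfinish p2 \<in> path_image p2'"
    using ends by (metis pathfinish_in_path_image pathstart_in_path_image)+
  have nm: "pathfinish p1 \<notin> path_image p2'" "pathstart p2 \<notin> path_image p1'"
    "pathfinish p2 \<notin> path_image p1'" "pathstart p1 \<notin> path_image p2'"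
    using e' p'(6) by blast+
  show ?thesis
  proof (rule loop_decomposition_cut2[OF dec df(1) p(1,2) pM(1) p(3,4) pM(2) p(6)])
    fix \<gamma> \<gamma>' r r'
    assume g: "\<gamma> \<in> \<Gamma>" "\<gamma>' \<in> \<Gamma>" "\<gamma> \<noteq> \<gamma>'" "path_image \<gamma> \<inter> path_image \<gamma>' = {}"
      and s: "splits_loop F \<gamma> p1 r" "splits_loop F \<gamma>' p2 r'"
    have loop: "simple_loop \<gamma>" "simple_loop \<gamma>'" "path_image \<gamma> \<subseteq> M" "path_image \<gamma>' \<subseteq> M"
      using dec g by (auto simp: loop_decomposition_def)
    have r: "path_image p1 \<union> path_image r = path_image \<gamma>"
      "path_image p1 \<inter> path_image r = {pathstart p1, pathfinish p1}"
      "path_image p2 \<union> path_image r' = path_image \<gamma>'"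
      "path_image p2 \<inter> path_image r' = {pathstart p2, pathfinish p2}"
      using s by (auto simp: splits_loop_def)
    have rD: "path_image r \<inter> D \<subseteq> {pathstart p1, pathfinish p1}"
      "path_image r' \<inter> D \<subseteq> {pathstart p2, pathfinish p2}"
      using r loop p(5) g(4) by blast+
    obtain \<delta> where \<delta>: "simple_loop \<delta>" "follows \<delta> F'" "path_image \<delta> = path_image p1' \<union> path_image r"
      "loop_sign \<delta> = loop_sign \<gamma>"
      using splits_loop_replace[OF loop(1) s(1) D agree p(1) pD(1) p'(1,2) pD'(1) ends(1,2) rD(1)] .
    obtain \<delta>' where \<delta>': "simple_loop \<delta>'" "follows \<delta>' F'" "path_image \<delta>' = path_image p2' \<union> path_image r'"
      "loop_sign \<delta>' = loop_sign \<gamma>'"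
      using splits_loop_replace[OF loop(2) s(2) D agree p(3) pD(2) p'(3,4) pD'(2) ends(3,4) rD(2)] .
    have disj: "path_image \<delta> \<inter> path_image \<delta>' = {}"
    proof -
      have "path_image p1' \<inter> path_image r' = {}" using rD(2) pD' e' p'(6) by blast
      moreover have "path_image p2' \<inter> path_image r = {}" using rD(1) pD' e' p'(6) by blast
      moreover have "path_image r \<inter> path_image r' = {}" using r g(4) by blast
      ultimately show ?thesis using \<delta>(3) \<delta>'(3) p'(6) by blast
    qed
    then have ne: "\<delta> \<noteq> \<delta>'" by auto
    have "cycle_degree M' F' = cycle_degree M F - sum loop_sign {\<gamma>, \<gamma>'} + sum loop_sign {\<delta>, \<delta>'}"
    proof (rule cycle_degree_exchange[OF dec df agree])
      show "(\<Union>\<gamma>\<in>{\<delta>, \<delta>'}. path_image \<gamma>) - D = (\<Union>\<gamma>\<in>{\<gamma>, \<gamma>'}. path_image \<gamma>) - D"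
        using \<delta>(3) \<delta>'(3) r pD pD' by auto
      show "M' \<inter> D = (\<Union>\<gamma>\<in>{\<delta>, \<delta>'}. path_image \<gamma>) \<inter> D"
        using \<delta>(3) \<delta>'(3) p'(5) rD e' by auto
      show "M \<inter> D \<subseteq> (\<Union>\<gamma>\<in>{\<gamma>, \<gamma>'}. path_image \<gamma>)" using p(5) r by auto
    qed (use g \<delta> \<delta>' disj in auto)
    then show ?thesis using \<delta>(4) \<delta>'(4) g(3) ne by simp
  next
    fix \<gamma> r r'
    assume g: "\<gamma> \<in> \<Gamma>" and s: "splits_loop2 F \<gamma> p1 r p2 r'"
    have loop: "simple_loop \<gamma>" "path_image \<gamma> \<subseteq> M"
      using dec g by (auto simp: loop_decomposition_def)
    have r: "arc r" "follows r F" "arc r'" "follows r' F"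
      "pathstart r = pathfinish p1" "pathfinish r = pathstart p2"
      "pathstart r' = pathfinish p2" "pathfinish r' = pathstart p1"
      "path_image \<gamma> = path_image p1 \<union> path_image r \<union> path_image p2 \<union> path_image r'"
      "path_image r \<inter> path_image p1 = {pathfinish p1}" "path_image r \<inter> path_image p2 = {pathstart p2}"
      "path_image r' \<inter> path_image p2 = {pathfinish p2}" "path_image r' \<inter> path_image p1 = {pathstart p1}"
      "path_image r \<inter> path_image r' = {}"
      "\<And>z. z \<notin> path_image \<gamma> \<Longrightarrow> winding_number \<gamma> z =
        winding_number p1 z + winding_number r z + winding_number p2 z + winding_number r' z"
      using s unfolding splits_loop2_def by simp_all
    have rD: "path_image r \<inter> D \<subseteq> {pathfinish p1, pathstart p2}"
      "path_image r' \<inter> D \<subseteq> {pathfinish p2, pathstart p1}"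
      using r(9-13) loop(2) p(5) by blast+
    have fol: "follows r F'" "follows r' F'"
      using outer_arc_follows[OF _ _ agree] r(1-4) rD by (meson finite.emptyI finite.insertI finite_subset)+
    have i: "path_image p1' \<inter> path_image r \<subseteq> {pathstart r}" "path_image r \<inter> path_image p2' \<subseteq> {pathstart p2'}"
      "path_image p2' \<inter> path_image r' \<subseteq> {pathstart r'}" "path_image r' \<inter> path_image p1' \<subseteq> {pathstart p1'}"
      unfolding r(5,7) ends using rD(1) pD'(1) nm(2) apply blast
      using rD(1) pD'(2) nm(1) apply blast using rD(2) pD'(2) nm(4) apply blast
      using rD(2) pD'(1) nm(3) by blast
    obtain q where q: "simple_loop q" "follows q F'"
      "path_image q = path_image p1' \<union> path_image r \<union> path_image p2' \<union> path_image r'"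
      "\<And>z. z \<notin> path_image q \<Longrightarrow> winding_number q z =
        winding_number p1' z + winding_number r z + winding_number p2' z + winding_number r' z"
    proof
      have e: "pathfinish p1' = pathstart r" "pathfinish r = pathstart p2'" "pathfinish p2' = pathstart r'"
        "pathfinish r' = pathstart p1'" using r(5-8) ends by auto
      note join = simple_loop_join4[OF p'(1) r(1) p'(3) r(3) e i p'(6) r(14)]
      show "simple_loop ((p1' +++ r) +++ (p2' +++ r'))" by (rule join)
      show "follows ((p1' +++ r) +++ (p2' +++ r')) F'" using p' fol by (intro follows_join)
      show "path_image ((p1' +++ r) +++ (p2' +++ r'))
        = path_image p1' \<union> path_image r \<union> path_image p2' \<union> path_image r'" by (rule join)
    qed (rule simple_loop_join4[OF p'(1) r(1) p'(3) r(3) _ _ _ _ i p'(6) r(14)], use r(5-8) ends in auto)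
    obtain x where x: "x \<in> path_image r" "x \<noteq> pathstart r" "x \<noteq> pathfinish r"
      using arc_interior_point[OF r(1)] by metis
    have sign: "loop_sign \<gamma> = loop_sign q"
    proof (rule loop_sign_transfer[OF loop(1) q(1) D(1)])
      show "x \<in> path_image \<gamma>" "x \<notin> D" using x r(5,6,9) rD by auto
      show "path_image q \<subseteq> path_image \<gamma> \<union> D" using q(3) r(9) pD' by blast
      fix z assume z: "z \<notin> D" "z \<notin> path_image \<gamma>"
      then have "z \<notin> path_image q" using q(3) r(9) pD' by blast
      moreover have "winding_number p1 z = winding_number p1' z" "winding_number p2 z = winding_number p2' z"
        using p p' ends pD pD' z D
        by (auto intro!: winding_number_simply_connected_eq[of D] simp: arc_imp_path)
      ultimately show "winding_number \<gamma> z = winding_number q z" using r(15)[OF z(2)] q(4) by simp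
    qed
    have "cycle_degree M' F' = cycle_degree M F - sum loop_sign {\<gamma>} + sum loop_sign {q}"
    proof (rule cycle_degree_exchange[OF dec df agree])
      show "(\<Union>\<gamma>\<in>{q}. path_image \<gamma>) - D = (\<Union>\<gamma>\<in>{\<gamma>}. path_image \<gamma>) - D"
        using q(3) r(9) pD pD' by auto
      show "M' \<inter> D = (\<Union>\<gamma>\<in>{q}. path_image \<gamma>) \<inter> D"
        using q(3) p'(5) rD e' by auto
      show "M \<inter> D \<subseteq> (\<Union>\<gamma>\<in>{\<gamma>}. path_image \<gamma>)" using p(5) r(9) by auto
    qed (use g q in auto)
    then show ?thesis using sign by simp
  qed
qed

text \<open>Two loops merge or one loop splits, and the contribution is the same: a split is a
  merger read backwards, which exchanges old and new loops and also reverses the cyclic order of the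
  four ends, so that two changes of sign cancel.\<close>

lemma cycle_degree_saddle:
  assumes dec: "loop_decomposition \<Gamma> M F" and df: "direction_field F" "direction_field F'"
    and D: "topological_disc D" and agree: "agree_outside D M F M' F'"
    and ord: "boundary_order D \<sigma> A B C E"
    and p: "arc p1" "follows p1 F" "arc p2" "follows p2 F" "M \<inter> D = path_image p1 \<union> path_image p2"
      "path_image p1 \<inter> path_image p2 = {}"
      "pathstart p1 = A" "pathfinish p1 = B" "pathstart p2 = C" "pathfinish p2 = E"
      "path_image p1 \<inter> frontier D = {A, B}" "path_image p2 \<inter> frontier D = {C, E}"
    and p': "arc p1'" "follows p1' F'" "arc p2'" "follows p2' F'"
      "M' \<inter> D = path_image p1' \<union> path_image p2'" "path_image p1' \<inter> path_image p2' = {}"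
      "pathstart p1' = A" "pathfinish p1' = E" "pathstart p2' = C" "pathfinish p2' = B"
      "path_image p1' \<inter> frontier D = {A, E}" "path_image p2' \<inter> frontier D = {C, B}"
  shows "cycle_degree M' F' = cycle_degree M F + \<sigma>"
proof -
  have cD: "closed D" and sD: "simply_connected D"
    using D by (auto simp: topological_disc_def compact_imp_closed)
  have fD: "frontier D \<subseteq> D" using cD by (rule frontier_subset_closed)
  have pM: "path_image p1 \<subseteq> M" "path_image p2 \<subseteq> M" and pD: "path_image p1 \<subseteq> D" "path_image p2 \<subseteq> D"
    and pD': "path_image p1' \<subseteq> D" "path_image p2' \<subseteq> D"
    using p(5) p'(5) by blast+
  have e: "A \<in> path_image p1" "B \<in> path_image p1" "C \<in> path_image p2" "E \<in> path_image p2"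
    using p(11,12) by auto
  have e': "A \<in> path_image p1'" "E \<in> path_image p1'" "C \<in> path_image p2'" "B \<in> path_image p2'"
    using p'(11,12) by auto
  have nm: "B \<notin> path_image p1'" "C \<notin> path_image p1'" "A \<notin> path_image p2'" "E \<notin> path_image p2'"
    using e' p'(6) by blast+
  have ABCE: "A \<in> D" "B \<in> D" "C \<in> D" "E \<in> D" using e pD by auto
  note paths = p(1,3)[THEN arc_imp_path] p'(1,3)[THEN arc_imp_path]
  have ex: "winding_number p1' z + winding_number p2' z = winding_number p1 z + winding_number p2 z"
    if "z \<notin> D" for z
    by (rule winding_number_exchange[OF sD paths(1,2,3,4) that pD pD']) (use p p' in auto)
  show ?thesis
  proof (rule loop_decomposition_cut2[OF dec df(1) p(1,2) pM(1) p(3,4) pM(2) p(6)])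
    fix \<gamma> \<gamma>' r r'
    assume g: "\<gamma> \<in> \<Gamma>" "\<gamma>' \<in> \<Gamma>" "\<gamma> \<noteq> \<gamma>'" "path_image \<gamma> \<inter> path_image \<gamma>' = {}"
      and s: "splits_loop F \<gamma> p1 r" "splits_loop F \<gamma>' p2 r'"
    have loop: "simple_loop \<gamma>" "simple_loop \<gamma>'" "path_image \<gamma> \<subseteq> M" "path_image \<gamma>' \<subseteq> M"
      using dec g by (auto simp: loop_decomposition_def)
    have r: "arc r" "follows r F" "arc r'" "follows r' F"
      "pathstart r = B" "pathfinish r = A" "pathstart r' = E" "pathfinish r' = C"
      "path_image p1 \<union> path_image r = path_image \<gamma>" "path_image p1 \<inter> path_image r = {A, B}"
      "path_image p2 \<union> path_image r' = path_image \<gamma>'" "path_image p2 \<inter> path_image r' = {C, E}"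
      "\<And>z. z \<notin> path_image \<gamma> \<Longrightarrow> winding_number \<gamma> z = winding_number p1 z + winding_number r z"
      "\<And>z. z \<notin> path_image \<gamma>' \<Longrightarrow> winding_number \<gamma>' z = winding_number p2 z + winding_number r' z"
      using s p unfolding splits_loop_def by simp_all
    have rD: "path_image r \<inter> D = {A, B}" "path_image r' \<inter> D = {C, E}"
      using r(9-12) loop p(5) g(4) ABCE by blast+
    have rr: "path_image r \<inter> path_image r' = {}" using r(9,11) g(4) by blast
    have fol: "follows r F'" "follows r' F'"
      using outer_arc_follows[OF _ _ agree] r(1-4) rD by simp_all
    have i: "path_image p1' \<inter> path_image r' \<subseteq> {pathstart r'}" "path_image r' \<inter> path_image p2' \<subseteq> {pathstart p2'}"
      "path_image p2' \<inter> path_image r \<subseteq> {pathstart r}" "path_image r \<inter> path_image p1' \<subseteq> {pathstart p1'}"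
      unfolding r(5,7) p'(7,9) using equalityD1[OF rD(2)] pD'(1) nm(2) apply blast
      using equalityD1[OF rD(2)] pD'(2) nm(4) apply blast
      using equalityD1[OF rD(1)] pD'(2) nm(3) apply blast
      using equalityD1[OF rD(1)] pD'(1) nm(1) by blast
    obtain q where q: "simple_loop q" "follows q F'"
      "path_image q = path_image p1' \<union> path_image r' \<union> path_image p2' \<union> path_image r"
      "\<And>z. z \<notin> path_image q \<Longrightarrow> winding_number q z =
        winding_number p1' z + winding_number r' z + winding_number p2' z + winding_number r z"
    proof
      have e: "pathfinish p1' = pathstart r'" "pathfinish r' = pathstart p2'" "pathfinish p2' = pathstart r"
        "pathfinish r = pathstart p1'" using r(5-8) p' by auto
      have rr': "path_image r' \<inter> path_image r = {}" using rr by blast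
      note join = simple_loop_join4[OF p'(1) r(3) p'(3) r(1) e i p'(6) rr']
      show "simple_loop ((p1' +++ r') +++ (p2' +++ r))" by (rule join)
      show "follows ((p1' +++ r') +++ (p2' +++ r)) F'" using p' fol by (intro follows_join)
      show "path_image ((p1' +++ r') +++ (p2' +++ r))
        = path_image p1' \<union> path_image r' \<union> path_image p2' \<union> path_image r" by (rule join)
    qed (rule simple_loop_join4[OF p'(1) r(3) p'(3) r(1) _ _ _ _ i p'(6)], use r(5-8) p' rr in auto)
    have sign: "loop_sign q = loop_sign \<gamma> + loop_sign \<gamma>' + \<sigma>"
    proof (rule saddle_loop_sign[OF D ord p(1,7,8) pD(1) p(11) p(3,9,10) pD(2) p(12)
          r(1,5,6) rD(1) r(3,7,8) rD(2) loop(1) r(9)[symmetric] r(13) loop(2) r(11)[symmetric] r(14) q(1)])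
      have "path_image r \<inter> frontier D \<subseteq> {A, B}" "path_image r' \<inter> frontier D \<subseteq> {C, E}"
        using rD fD by blast+
      then show "path_image q \<inter> frontier D \<subseteq> {A, B, C, E}" using q(3) p'(11,12) by auto
      fix z assume z: "z \<notin> D" "z \<notin> path_image q" "z \<notin> path_image \<gamma>" "z \<notin> path_image \<gamma>'"
      show "winding_number q z = winding_number \<gamma> z + winding_number \<gamma>' z"
        using ex[OF z(1)] q(4)[OF z(2)] r(13)[OF z(3)] r(14)[OF z(4)]
        by (simp add: algebra_simps)
    qed
    have "cycle_degree M' F' = cycle_degree M F - sum loop_sign {\<gamma>, \<gamma>'} + sum loop_sign {q}"
    proof (rule cycle_degree_exchange[OF dec df agree])
      show "(\<Union>\<gamma>\<in>{q}. path_image \<gamma>) - D = (\<Union>\<gamma>\<in>{\<gamma>, \<gamma>'}. path_image \<gamma>) - D"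
        using q(3) r(9,11) pD pD' by auto
      show "M' \<inter> D = (\<Union>\<gamma>\<in>{q}. path_image \<gamma>) \<inter> D"
        using q(3) p'(5) rD e' by auto
      show "M \<inter> D \<subseteq> (\<Union>\<gamma>\<in>{\<gamma>, \<gamma>'}. path_image \<gamma>)" using p(5) r(9,11) by auto
    qed (use g q in auto)
    then show ?thesis using sign g(3) by simp
  next
    fix \<gamma> r r'
    assume g: "\<gamma> \<in> \<Gamma>" and s: "splits_loop2 F \<gamma> p1 r p2 r'"
    have loop: "simple_loop \<gamma>" "path_image \<gamma> \<subseteq> M"
      using dec g by (auto simp: loop_decomposition_def)
    have r: "arc r" "follows r F" "arc r'" "follows r' F"
      "pathstart r = B" "pathfinish r = C" "pathstart r' = E" "pathfinish r' = A"
      "path_image \<gamma> = path_image p1 \<union> path_image r \<union> path_image p2 \<union> path_image r'"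
      "path_image r \<inter> path_image p1 = {B}" "path_image r \<inter> path_image p2 = {C}"
      "path_image r' \<inter> path_image p2 = {E}" "path_image r' \<inter> path_image p1 = {A}"
      "path_image r \<inter> path_image r' = {}"
      "\<And>z. z \<notin> path_image \<gamma> \<Longrightarrow> winding_number \<gamma> z =
        winding_number p1 z + winding_number r z + winding_number p2 z + winding_number r' z"
      using s p(7-10) unfolding splits_loop2_def by simp_all
    have rD: "path_image r \<inter> D = {B, C}" "path_image r' \<inter> D = {A, E}"
      using r(9-13) loop(2) p(5) ABCE by blast+
    have fol: "follows r F'" "follows r' F'"
      using outer_arc_follows[OF _ _ agree] r(1-4) rD by simp_all
    define q1 q2 where "q1 = p1' +++ r'" and "q2 = p2' +++ r"
    have im: "path_image q1 = path_image p1' \<union> path_image r'" "path_image q2 = path_image p2' \<union> path_image r"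
      using p' r(5-8) by (simp_all add: q1_def q2_def path_image_join)
    have loops: "simple_loop q1" "simple_loop q2"
      unfolding q1_def q2_def
      by (rule simple_loop_join; use p' r(1,3,5-8) rD pD' in auto)+
    have folq: "follows q1 F'" "follows q2 F'" unfolding q1_def q2_def using p' fol by (auto intro: follows_join)
    have wn: "winding_number q1 z = winding_number p1' z + winding_number r' z" if "z \<notin> path_image q1" for z
      using that im(1) paths r(3,7) p' by (simp add: q1_def winding_number_join arc_imp_path)
    have wn': "winding_number q2 z = winding_number p2' z + winding_number r z" if "z \<notin> path_image q2" for z
      using that im(2) paths r(1,5) p' by (simp add: q2_def winding_number_join arc_imp_path)
    have disj: "path_image q1 \<inter> path_image q2 = {}"
    proof -
      have "path_image p1' \<inter> path_image r = {}"
        using equalityD1[OF rD(1)] pD'(1) nm(1,2) by blast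
      moreover have "path_image p2' \<inter> path_image r' = {}"
        using equalityD1[OF rD(2)] pD'(2) nm(3,4) by blast
      ultimately show ?thesis using im p'(6) r(14) by blast
    qed
    then have ne: "q1 \<noteq> q2" by auto
    have rD': "path_image r' \<inter> D = {A, E}" "path_image r \<inter> D = {C, B}" using rD by auto
    \<comment> \<open>The merger read backwards: the crosscuts from \<open>A\<close> to
      \<open>E\<close> and from \<open>C\<close> to \<open>B\<close> take the roles of
      \<open>p1\<close> and \<open>p2\<close>, with the four ends in the order \<open>A\<close>,
      \<open>E\<close>, \<open>C\<close>, \<open>B\<close>.\<close>
    have sign: "loop_sign \<gamma> = loop_sign q1 + loop_sign q2 + (- \<sigma>)"
    proof (rule saddle_loop_sign[OF D boundary_order_reverse[OF ord] p'(1,7,8) pD'(1) p'(11)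
          p'(3,9,10) pD'(2) p'(12) r(3,7,8) rD'(1) r(1,5,6) rD'(2) loops(1) im(1) wn loops(2) im(2) wn' loop(1)])
      have "path_image r \<inter> frontier D \<subseteq> {B, C}" "path_image r' \<inter> frontier D \<subseteq> {A, E}"
        using rD fD by blast+
      then show "path_image \<gamma> \<inter> frontier D \<subseteq> {A, E, C, B}" using r(9) p(11,12) by auto
      fix z assume z: "z \<notin> D" "z \<notin> path_image \<gamma>" "z \<notin> path_image q1" "z \<notin> path_image q2"
      show "winding_number \<gamma> z = winding_number q1 z + winding_number q2 z"
        using ex[OF z(1), symmetric] r(15)[OF z(2)] wn[OF z(3)] wn'[OF z(4)]
        by (simp add: algebra_simps)
    qed
    have "cycle_degree M' F' = cycle_degree M F - sum loop_sign {\<gamma>} + sum loop_sign {q1, q2}"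
    proof (rule cycle_degree_exchange[OF dec df agree])
      show "(\<Union>\<gamma>\<in>{q1, q2}. path_image \<gamma>) - D = (\<Union>\<gamma>\<in>{\<gamma>}. path_image \<gamma>) - D"
        using im r(9) pD pD' by auto
      show "M' \<inter> D = (\<Union>\<gamma>\<in>{q1, q2}. path_image \<gamma>) \<inter> D"
        using im p'(5) rD e' by auto
      show "M \<inter> D \<subseteq> (\<Union>\<gamma>\<in>{\<gamma>}. path_image \<gamma>)" using p(5) r(9) by auto
    qed (use g loops folq disj in auto)
    then show ?thesis using sign ne by simp
  qed
qed

section \<open>Additivity of the degree over disjoint closed sets\<close>

lemma components_Un_closed:
  assumes "closed A" "closed B" "A \<inter> B = {}"
  shows "components (A \<union> B :: complex set) = components A \<union> components B"
proof -
  have side: "d \<subseteq> A \<or> d \<subseteq> B" if "connected d" "d \<subseteq> A \<union> B" for d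
    using connected_closedD[of d A B] assms that by blast
  have *: "c \<in> components (A \<union> B)" if c: "c \<in> components A" and AB: "A \<inter> B = {}"
    and side: "\<And>d. connected d \<Longrightarrow> d \<subseteq> A \<union> B \<Longrightarrow> d \<subseteq> A \<or> d \<subseteq> B" for c A B :: "complex set"
    unfolding in_components_maximal
  proof (intro conjI allI impI)
    note c' = c[unfolded in_components_maximal]
    show "c \<noteq> {}" "c \<subseteq> A \<union> B" "connected c" using c' by auto
    fix d assume d: "d \<noteq> {} \<and> c \<subseteq> d \<and> d \<subseteq> A \<union> B \<and> connected d"
    then have "d \<subseteq> A \<or> d \<subseteq> B" using side[of d] by blast
    moreover have "\<not> d \<subseteq> B"
    proof
      assume "d \<subseteq> B"
      moreover have "c \<subseteq> d" using d by simp
      ultimately have "c \<subseteq> A \<inter> B" using in_components_subset[OF c] by blast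
      then show False using AB \<open>c \<noteq> {}\<close> by simp
    qed
    ultimately have "d \<subseteq> A" by blast
    then show "d = c" using d c'[THEN conjunct2, THEN conjunct2, THEN conjunct2, THEN spec, of d] by simp
  qed
  have **: "c \<in> components A" if "c \<in> components (A \<union> B)" "c \<subseteq> A" for c A B :: "complex set"
    using that unfolding in_components_maximal by blast
  show ?thesis
  proof
    show "components A \<union> components B \<subseteq> components (A \<union> B)"
    proof -
      have "d \<subseteq> B \<or> d \<subseteq> A" if "connected d" "d \<subseteq> B \<union> A" for d
        using side[of d] that by (auto simp: Un_commute)
      moreover have "B \<inter> A = {}" using assms(3) by blast
      ultimately have "components B \<subseteq> components (B \<union> A)" using *[of _ B A] by blast
      moreover have "components A \<subseteq> components (A \<union> B)" using *[of _ A B] assms(3) side by blast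
      ultimately show ?thesis by (simp add: Un_commute)
    qed
    show "components (A \<union> B) \<subseteq> components A \<union> components B"
    proof
      fix c assume c: "c \<in> components (A \<union> B)"
      then have "c \<subseteq> A \<or> c \<subseteq> B" using side in_components_connected in_components_subset by metis
      then show "c \<in> components A \<union> components B" using **[of c A B] **[of c B A] c by (auto simp: Un_commute)
    qed
  qed
qed

lemma cycle_degree_Un:
  assumes "closed A" "closed B" "A \<inter> B = {}" "finite (components (A \<union> B))"
  shows "cycle_degree (A \<union> B) F = cycle_degree A F + cycle_degree B F"
proof -
  have "components A \<inter> components B = {}"
  proof (rule equals0I)
    fix c assume "c \<in> components A \<inter> components B"
    then have "c \<noteq> {}" "c \<subseteq> A" "c \<subseteq> B" by (auto dest: in_components_nonempty in_components_subset)
    then show False using assms(3) by blast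
  qed
  then show ?thesis using assms(4) unfolding cycle_degree_def components_Un_closed[OF assms(1-3)]
    by (simp add: sum.union_disjoint)
qed

lemma cycle_sign_cong:
  assumes "\<And>z v. z \<in> K \<Longrightarrow> (z, v) \<in> F \<longleftrightarrow> (z, v) \<in> F'"
  shows "cycle_sign F K = cycle_sign F' K"
proof -
  have "path_image \<gamma> = K \<and> follows \<gamma> F \<and> P \<longleftrightarrow> path_image \<gamma> = K \<and> follows \<gamma> F' \<and> P" for \<gamma> P
    using follows_transfer[of \<gamma> F "{}" F'] follows_transfer[of \<gamma> F' "{}" F] assms by auto
  then show ?thesis unfolding cycle_sign_def by presburger
qed

lemma cycle_degree_cong:
  assumes "\<And>z v. z \<in> M \<Longrightarrow> (z, v) \<in> F \<longleftrightarrow> (z, v) \<in> F'"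
  shows "cycle_degree M F = cycle_degree M F'"
  unfolding cycle_degree_def
  by (intro sum.cong cycle_sign_cong refl) (use assms in_components_subset in blast)

lemma finite_components_loop_decomposition:
  assumes "loop_decomposition \<Gamma> M F" shows "finite (components M)"
proof -
  note \<Gamma> = assms[unfolded loop_decomposition_def]
  have "components (\<Union>(path_image ` \<Gamma>)) = path_image ` \<Gamma>"
  proof (rule components_Union_compact)
    show "compact K \<and> connected K \<and> K \<noteq> {}" if "K \<in> path_image ` \<Gamma>" for K
      using that \<Gamma> by (auto simp: compact_path_image connected_path_image simple_loop_imp_path)
    show "K \<inter> L = {}" if "K \<in> path_image ` \<Gamma>" "L \<in> path_image ` \<Gamma>" "K \<noteq> L" for K L
      using that \<Gamma> by (metis imageE)
  qed (use \<Gamma> in simp)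
  then show ?thesis using \<Gamma> by simp
qed

text \<open>Inside the disc the support is the whole loop \<open>q\<close>. Since
  \<open>M - D\<close> is closed, \<open>q\<close> is a component of its own, and the rest is the
  support \<open>M'\<close>.\<close>

lemma cycle_degree_remove_loop:
  assumes dec: "loop_decomposition \<Gamma> M F" and df: "direction_field F"
    and agree: "agree_outside D M F M' F'"
    and q: "simple_loop q" "follows q F" "M \<inter> D = path_image q" and "M' \<inter> D = {}"
    and cl: "closed (M - D)"
  shows "cycle_degree M F = cycle_degree M' F' + loop_sign q"
proof -
  have M: "M = (M - D) \<union> path_image q" using q(3) by blast
  have M': "M' = M - D" using agree assms(7) unfolding agree_outside_def by blast
  have "cycle_degree ((M - D) \<union> path_image q) F = cycle_degree (M - D) F + cycle_degree (path_image q) F"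
  proof (rule cycle_degree_Un[OF cl])
    show "finite (components ((M - D) \<union> path_image q))"
      using finite_components_loop_decomposition[OF dec] M by simp
  qed (use q in \<open>auto simp: closed_path_image simple_loop_imp_path\<close>)
  moreover have "cycle_degree (M - D) F = cycle_degree (M - D) F'"
    using agree by (intro cycle_degree_cong) (auto simp: agree_outside_def)
  moreover have "cycle_degree (path_image q) F = loop_sign q"
  proof -
    have "components (path_image q) = {path_image q}"
      using connected_path_image[OF simple_loop_imp_path[OF q(1)]] by (simp add: components_eq_sing_iff)
    then show ?thesis using cycle_sign_path_image[OF q(1,2) df] by (simp add: cycle_degree_def)
  qed
  ultimately show ?thesis using M M' by simp
qed

section \<open>Closed discs\<close>

text \<open>Invariance of domain, for \<open>h\<close> on the open ball and for \<open>g\<close> on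
  the interior of \<open>D\<close>, shows that \<open>h\<close> maps the open ball onto the
  interior; hence it maps the unit circle onto the frontier.\<close>

lemma disc_homeomorphism:
  fixes h g :: "complex \<Rightarrow> complex"
  assumes "homeomorphism (cball 0 1) D h g"
  shows "topological_disc D" and "frontier D = h ` sphere 0 1"
proof -
  have h: "continuous_on (cball 0 1) h" "h ` cball 0 1 = D" "continuous_on D g" "g ` D = cball 0 1"
    "\<And>x. x \<in> cball 0 1 \<Longrightarrow> g (h x) = x" "\<And>y. y \<in> D \<Longrightarrow> h (g y) = y"
    using assms unfolding homeomorphism_def by auto
  have inj: "inj_on h (cball 0 1)" "inj_on g D" using h by (metis inj_on_inverseI)+
  have "compact D" using h(1,2) compact_continuous_image compact_cball by metis
  then have cl: "closed D" by (rule compact_imp_closed)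
  have "open (h ` ball 0 1)"
    by (intro invariance_of_domain continuous_on_subset[OF h(1)] inj_on_subset[OF inj(1)])
      (rule ball_subset_cball open_ball)+
  then have 1: "h ` ball 0 1 \<subseteq> interior D"
    using h(2) ball_subset_cball by (intro interior_maximal) blast+
  have "open (g ` interior D)"
    by (intro invariance_of_domain continuous_on_subset[OF h(3)] inj_on_subset[OF inj(2)])
      (rule interior_subset open_interior)+
  moreover have "g ` interior D \<subseteq> cball 0 1" using h(4) interior_subset by blast
  ultimately have "g ` interior D \<subseteq> ball 0 1" using interior_maximal by (metis interior_cball)
  then have 2: "interior D \<subseteq> h ` ball 0 1"
  proof (intro subsetI)
    fix x assume "x \<in> interior D"
    moreover have "x \<in> D" using \<open>x \<in> interior D\<close> interior_subset by blast
    ultimately show "x \<in> h ` ball 0 1"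
      using h(6)[of x] \<open>g ` interior D \<subseteq> ball 0 1\<close> by (intro image_eqI[of x h "g x"]) auto
  qed
  have int: "interior D = h ` ball 0 1" using 1 2 by blast
  have "sphere (0::complex) 1 = cball 0 1 - ball 0 1" by auto
  then have "h ` sphere 0 1 = h ` cball 0 1 - h ` ball 0 1"
    using inj_on_image_set_diff[OF inj(1), of "cball 0 1" "ball 0 1"] ball_subset_cball by auto
  then show fr: "frontier D = h ` sphere 0 1"
    using h(2) int cl by (simp add: frontier_def)
  have "simply_connected D"
    using assms homeomorphic_simply_connected_eq[of "cball (0::complex) 1" D]
      convex_imp_simply_connected[of "cball (0::complex) 1"]
    unfolding homeomorphic_def by blast
  moreover have "connected (interior D)"
    unfolding int using h(1) by (intro connected_continuous_image) (auto intro: continuous_on_subset)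
  moreover have "interior D \<noteq> {}" unfolding int by simp
  moreover have "frontier D \<subseteq> closure (interior D)"
  proof -
    have "h ` closure (ball 0 1) \<subseteq> closure (interior D)"
      by (rule image_closure_subset) (use h(1) int closure_subset in \<open>auto simp: image_subset_iff\<close>)
    then show ?thesis unfolding fr by force
  qed
  ultimately show "topological_disc D" using \<open>compact D\<close> unfolding topological_disc_def by blast
qed

lemma closed_disc_imp_topological_disc: "closed_disc D \<Longrightarrow> topological_disc D"
  unfolding closed_disc_def homeomorphic_def using disc_homeomorphism(1) by blast

lemma cis_eq_imp:
  assumes "cis s = cis t" "t \<le> s" "s - t \<le> 2 * pi"
  shows "s = t \<or> s = t + 2 * pi"
proof -
  have "sin s = sin t \<and> cos s = cos t" using assms(1) by (simp add: complex_eq_iff)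
  then obtain n :: int where n: "s = t + 2 * pi * n" by (metis sin_cos_eq_iff)
  then have "0 \<le> 2 * pi * n" "2 * pi * n \<le> 2 * pi * 1" using assms by auto
  then have "0 \<le> n" "n \<le> 1" using pi_gt_zero by (simp_all add: zero_le_mult_iff mult_le_cancel_left)
  then have "n = 0 \<or> n = 1" by auto
  then show ?thesis using n by auto
qed

text \<open>The boundary arcs are the images under \<open>h\<close> of four successive arcs of the
  unit circle. They form a simple loop that avoids the connected interior of \<open>D\<close>, so
  its winding number is constant there, and \<open>\<sigma>\<close> is this constant. Its existence
  is all that can be claimed, since \<open>h\<close> may preserve or reverse the
  orientation.\<close>

lemma boundary_order_if_cyclic:
  assumes "cyclic_on_boundary D A B C E"
  shows "topological_disc D" and "\<exists>\<sigma>. boundary_order D \<sigma> A B C E"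
proof -
  obtain h g \<theta>1 \<theta>2 \<theta>3 \<theta>4 where h: "homeomorphism (cball 0 1) D h g"
    and \<theta>: "\<theta>1 < \<theta>2" "\<theta>2 < \<theta>3" "\<theta>3 < \<theta>4" "\<theta>4 < \<theta>1 + 2 * pi"
    and pts: "A = h (cis \<theta>1)" "B = h (cis \<theta>2)" "C = h (cis \<theta>3)" "E = h (cis \<theta>4)"
    using assms unfolding cyclic_on_boundary_def by blast
  show D: "topological_disc D" using disc_homeomorphism(1) h by blast
  have fr: "frontier D = h ` sphere 0 1" using disc_homeomorphism(2) h by blast
  define w where "w = (\<lambda>\<alpha> \<beta>. h \<circ> (cis \<circ> linepath \<alpha> \<beta>))"
  have im: "path_image (w \<alpha> \<beta>) = (h \<circ> cis) ` {\<alpha>..\<beta>}" if "\<alpha> < \<beta>" for \<alpha> \<beta>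
  proof -
    have "linepath \<alpha> \<beta> ` {0..1} = {\<alpha>..\<beta>}"
      using that path_image_linepath[of \<alpha> \<beta>] by (simp add: path_image_def closed_segment_eq_real_ivl)
    moreover have "path_image (w \<alpha> \<beta>) = (h \<circ> cis) ` (linepath \<alpha> \<beta> ` {0..1})"
      unfolding path_image_def w_def by (simp only: image_comp comp_assoc)
    ultimately show ?thesis by simp
  qed
  have hinj: "s = t \<or> s = t + 2 * pi" if "h (cis s) = h (cis t)" "t \<le> s" "s - t \<le> 2 * pi" for s t
  proof -
    have "cis s = cis t" using h that(1) unfolding homeomorphism_def
      by (metis mem_cball_0 norm_cis order_refl)
    then show ?thesis using cis_eq_imp that by blast
  qed
  have arc: "arc (w \<alpha> \<beta>)" if "\<alpha> < \<beta>" "\<beta> < \<alpha> + 2 * pi" for \<alpha> \<beta>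
    unfolding arc_def path_def
  proof
    have "continuous_on {0..1} (cis \<circ> linepath \<alpha> \<beta>)"
      by (intro continuous_on_compose continuous_intros)
    then show "continuous_on {0..1} (w \<alpha> \<beta>)"
      unfolding w_def
      by (rule continuous_on_compose)
        (rule continuous_on_subset[OF homeomorphism_cont1[OF h]], auto)
    show "inj_on (w \<alpha> \<beta>) {0..1}"
    proof -
      have *: "s = t" if st: "w \<alpha> \<beta> s = w \<alpha> \<beta> t" "s \<in> {0..1}" "t \<in> {0..1}" "t \<le> s" for s t
      proof -
        have l: "linepath \<alpha> \<beta> x = \<alpha> + x * (\<beta> - \<alpha>)" for x by (simp add: linepath_def algebra_simps)
        have "(s - t) * (\<beta> - \<alpha>) \<le> 1 * (\<beta> - \<alpha>)"
          using st \<open>\<alpha> < \<beta>\<close> by (intro mult_right_mono) auto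
        then have d: "linepath \<alpha> \<beta> s - linepath \<alpha> \<beta> t \<le> \<beta> - \<alpha>" by (simp add: l algebra_simps)
        have "t * (\<beta> - \<alpha>) \<le> s * (\<beta> - \<alpha>)" using st \<open>\<alpha> < \<beta>\<close> by (intro mult_right_mono) auto
        then have "linepath \<alpha> \<beta> s = linepath \<alpha> \<beta> t"
          using hinj[of "linepath \<alpha> \<beta> s" "linepath \<alpha> \<beta> t"] st d that(2) \<open>\<beta> < \<alpha> + 2 * pi\<close>
          by (auto simp: w_def l)
        then show "s = t" using \<open>\<alpha> < \<beta>\<close> by (simp add: l)
      qed
      show ?thesis using * by (intro inj_onI) (metis linear)
    qed
  qed
  \<comment> \<open>The last angular interval ends a full turn after the first one begins, so that
    the four arcs close up.\<close>
  define k l m n where "k = w \<theta>1 \<theta>2" and "l = w \<theta>2 \<theta>3" and "m = w \<theta>3 \<theta>4" and "n = w \<theta>4 (\<theta>1 + 2 * pi)"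
  have arcs: "arc k" "arc l" "arc m" "arc n"
    unfolding k_def l_def m_def n_def using \<theta> by (intro arc; simp)+
  have "cis (\<theta>1 + 2 * pi) = cis \<theta>1" by (simp add: cis.ctr)
  then have ends: "pathstart k = A" "pathfinish k = B" "pathstart l = B" "pathfinish l = C"
    "pathstart m = C" "pathfinish m = E" "pathstart n = E" "pathfinish n = A"
    by (auto simp: k_def l_def m_def n_def w_def pts pathstart_def pathfinish_def linepath_def)
  have ims: "path_image k = (h \<circ> cis) ` {\<theta>1..\<theta>2}" "path_image l = (h \<circ> cis) ` {\<theta>2..\<theta>3}"
    "path_image m = (h \<circ> cis) ` {\<theta>3..\<theta>4}" "path_image n = (h \<circ> cis) ` {\<theta>4..\<theta>1 + 2 * pi}"
    unfolding k_def l_def m_def n_def using \<theta> by (intro im; simp)+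
  have ends_in: "A \<in> path_image k" "A \<in> path_image n" "B \<in> path_image k" "B \<in> path_image l"
    "C \<in> path_image l" "C \<in> path_image m" "E \<in> path_image m" "E \<in> path_image n"
    using ends by (metis pathstart_in_path_image pathfinish_in_path_image)+
  have int: "path_image k \<inter> path_image l = {B}" "path_image l \<inter> path_image m = {C}"
    "path_image m \<inter> path_image n = {E}" "path_image n \<inter> path_image k = {A}"
    "path_image k \<inter> path_image m = {}" "path_image l \<inter> path_image n = {}"
  proof -
    have 1: "x = h (cis \<beta>)" if i: "x \<in> (h \<circ> cis) ` {\<alpha>..\<beta>}" "x \<in> (h \<circ> cis) ` {\<beta>..\<gamma>}" "\<gamma> < \<alpha> + 2 * pi" for x \<alpha> \<beta> \<gamma>
    proof -
      obtain t where "t \<in> {\<alpha>..\<beta>}" "x = h (cis t)" using i(1) by auto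
      moreover obtain s where "s \<in> {\<beta>..\<gamma>}" "x = h (cis s)" using i(2) by auto
      ultimately show ?thesis using hinj[of s t] that(3) by auto
    qed
    have 2: "False" if i: "x \<in> (h \<circ> cis) ` {\<alpha>..\<beta>}" "x \<in> (h \<circ> cis) ` {\<gamma>..\<delta>}" "\<beta> < \<gamma>" "\<delta> < \<alpha> + 2 * pi" for x \<alpha> \<beta> \<gamma> \<delta>
    proof -
      obtain t where "t \<in> {\<alpha>..\<beta>}" "x = h (cis t)" using i(1) by auto
      moreover obtain s where "s \<in> {\<gamma>..\<delta>}" "x = h (cis s)" using i(2) by auto
      ultimately show ?thesis using hinj[of s t] that(3,4) by auto
    qed
    show "path_image k \<inter> path_image l = {B}"
      using 1[of _ \<theta>1 \<theta>2 \<theta>3] \<theta> ends_in unfolding ims pts by auto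
    show "path_image l \<inter> path_image m = {C}"
      using 1[of _ \<theta>2 \<theta>3 \<theta>4] \<theta> ends_in unfolding ims pts by auto
    show "path_image m \<inter> path_image n = {E}"
      using 1[of _ \<theta>3 \<theta>4 "\<theta>1 + 2 * pi"] \<theta> ends_in unfolding ims pts by auto
    show "path_image k \<inter> path_image m = {}"
      using 2[of _ \<theta>1 \<theta>2 \<theta>3 \<theta>4] \<theta> unfolding ims by blast
    show "path_image l \<inter> path_image n = {}"
      using 2[of _ \<theta>2 \<theta>3 \<theta>4 "\<theta>1 + 2 * pi"] \<theta> unfolding ims by auto
    have "x = A" if x: "x \<in> path_image n" "x \<in> path_image k" for x
    proof -
      obtain t where t: "t \<in> {\<theta>1..\<theta>2}" "x = h (cis t)" using x(2) unfolding ims by auto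
      moreover obtain s where s: "s \<in> {\<theta>4..\<theta>1 + 2 * pi}" "x = h (cis s)" using x(1) unfolding ims by auto
      ultimately have st: "s \<in> {\<theta>4..\<theta>1 + 2 * pi}" "t \<in> {\<theta>1..\<theta>2}" "x = h (cis t)" "h (cis s) = h (cis t)"
        by auto
      then have "s = t + 2 * pi" using hinj[of s t] \<theta> by auto
      then have "t = \<theta>1" using st by auto
      then show ?thesis using st pts by simp
    qed
    then show "path_image n \<inter> path_image k = {A}" using ends_in by blast
  qed
  have sub: "path_image k \<union> path_image l \<union> path_image m \<union> path_image n \<subseteq> frontier D"
    unfolding ims fr by auto
  define q where "q = (k +++ l) +++ (m +++ n)"
  have q: "simple_loop q" "path_image q = path_image k \<union> path_image l \<union> path_image m \<union> path_image n"
    "\<And>z. z \<notin> path_image q \<Longrightarrow> winding_number q z =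
      winding_number k z + winding_number l z + winding_number m z + winding_number n z"
    unfolding q_def
    by (rule simple_loop_join4[OF arcs]; use ends int in auto)+
  have cD: "frontier D \<subseteq> D"
    using D by (simp add: topological_disc_def compact_imp_closed frontier_subset_closed)
  \<comment> \<open>A point inside the loop lies in the interior of \<open>D\<close>; it identifies
    the constant winding number there as the sign of the loop.\<close>
  obtain c where c: "c \<in> inside (path_image q)" using simple_loop_inside_nonempty[OF q(1)] by blast
  have "path_image q \<subseteq> D" using q(2) sub cD by blast
  then have cI: "c \<in> interior D" using inside_subset_interior_disc[OF D q(1)] c by blast
  have qI: "interior D \<inter> path_image q = {}" using q(2) sub interior_frontier_disjoint[of D] by blast
  have "winding_number k z + winding_number l z + winding_number m z + winding_number n z = of_int (loop_sign q)"
    if z: "z \<in> interior D" for z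
  proof -
    have "winding_number q z = winding_number q c"
      by (rule winding_number_eq[of q z "interior D" c])
        (use q(1) z cI qI D in \<open>auto simp: simple_loop_def simple_path_imp_path topological_disc_def\<close>)
    moreover have "z \<notin> path_image q" using z qI by blast
    ultimately show ?thesis using loop_sign_inside[OF q(1) c] q(3)[of z] by simp
  qed
  then have "boundary_order D (loop_sign q) A B C E"
    unfolding boundary_order_def using loop_sign_cases[of q] arcs ends sub int by blast
  then show "\<exists>\<sigma>. boundary_order D \<sigma> A B C E" by blast
qed

section \<open>Webs and their configurations\<close>

lemma unit_tangent_direction:
  assumes "smooth_immersion I \<gamma>" "t \<in> interior I"
  obtains v where "(\<gamma> has_vector_derivative v) (at t)" "v \<noteq> 0" "unit_tangent \<gamma> t = sgn v"
proof -
  obtain F where F: "F 0 = \<gamma>" "\<And>n t. t \<in> I \<Longrightarrow> (F n has_vector_derivative F (Suc n) t) (at t within I)"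
    "\<And>t. t \<in> I \<Longrightarrow> F 1 t \<noteq> 0"
    using assms(1) unfolding smooth_immersion_def by blast
  have t: "t \<in> I" using assms(2) interior_subset by blast
  have "(\<gamma> has_vector_derivative F 1 t) (at t)"
    using F(2)[OF t, of 0] F(1) at_within_interior[OF assms(2)] by simp
  then show ?thesis using that F(3)[OF t] by (metis unit_tangent_def vector_derivative_at)
qed

lemma smooth_immersion_continuous: "smooth_immersion I \<gamma> \<Longrightarrow> continuous_on I \<gamma>"
  unfolding smooth_immersion_def by (metis continuous_on_vector_derivative)

lemma direction_field_param:
  assumes "\<And>t. t \<in> J \<Longrightarrow> \<exists>v. v \<noteq> 0 \<and> unit_tangent \<gamma> t = sgn v" "inj_on \<gamma> J"
  shows "direction_field ((\<lambda>t. (\<gamma> t, unit_tangent \<gamma> t)) ` J)"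
proof -
  have "unit_tangent \<gamma> t \<noteq> 0" if "t \<in> J" for t using assms(1)[OF that] by (metis sgn_zero_iff)
  then show ?thesis
    unfolding direction_field_def single_valued_def using assms(2) by (auto dest: inj_onD)
qed

text \<open>The curve \<open>A\<close> records only the open arc. Its end points come back as the
  points added by the closure, which is the image of the full path.\<close>

lemma oriented_arc_path:
  assumes "oriented_arc A x y"
  obtains \<gamma> where "arc \<gamma>" "pathstart \<gamma> = x" "pathfinish \<gamma> = y" "follows \<gamma> A"
    "path_image \<gamma> = insert x (insert y (locus A))" "x \<notin> locus A" "y \<notin> locus A" "direction_field A"
    "path_image \<gamma> = closure (locus A)" "connected (locus A)" "locus A \<noteq> {}"
proof -
  obtain \<gamma> where \<gamma>: "smooth_immersion {0..1} \<gamma>" "inj_on \<gamma> {0..1}" "\<gamma> 0 = x" "\<gamma> 1 = y"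
    "A = (\<lambda>t. (\<gamma> t, unit_tangent \<gamma> t)) ` {0<..<1}"
    using assms unfolding oriented_arc_def by blast
  have cont: "continuous_on {0..1} \<gamma>" using \<gamma>(1) by (rule smooth_immersion_continuous)
  have loc: "locus A = \<gamma> ` {0<..<1}" unfolding locus_def \<gamma>(5) by (auto simp: image_image)
  have 01: "{0..1} = insert 0 (insert 1 {0<..<1::real})" by auto
  show ?thesis
  proof
    show "arc \<gamma>" using cont \<gamma>(2) by (simp add: arc_def path_def)
    show "pathstart \<gamma> = x" "pathfinish \<gamma> = y" using \<gamma> by (simp_all add: pathstart_def pathfinish_def)
    have "\<exists>v. (\<gamma> has_vector_derivative v) (at t) \<and> (\<gamma> t, sgn v) \<in> A" if "t \<in> {0..1} - {0, 1}" for t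
    proof -
      have "t \<in> {0<..<1}" using that by auto
      moreover obtain v where "(\<gamma> has_vector_derivative v) (at t)" "unit_tangent \<gamma> t = sgn v"
        using unit_tangent_direction[OF \<gamma>(1), of t] \<open>t \<in> {0<..<1}\<close> by auto
      ultimately show ?thesis unfolding \<gamma>(5) by (metis (mono_tags, lifting) image_eqI)
    qed
    then show "follows \<gamma> A" unfolding follows_def by (intro exI[of _ "{0, 1}"]) auto
    show im: "path_image \<gamma> = insert x (insert y (locus A))"
      unfolding path_image_def 01 loc using \<gamma>(3,4) by simp
    show "x \<notin> locus A"
    proof
      assume "x \<in> locus A"
      then obtain t where t: "t \<in> {0<..<1}" "\<gamma> 0 = \<gamma> t" using loc \<gamma>(3) by auto
      then show False using inj_onD[OF \<gamma>(2), of 0 t] by auto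
    qed
    show "y \<notin> locus A"
    proof
      assume "y \<in> locus A"
      then obtain t where t: "t \<in> {0<..<1}" "\<gamma> 1 = \<gamma> t" using loc \<gamma>(4) by auto
      then show False using inj_onD[OF \<gamma>(2), of 1 t] by auto
    qed
    show "direction_field A"
      unfolding \<gamma>(5)
    proof (rule direction_field_param)
      show "inj_on \<gamma> {0<..<1}" using \<gamma>(2) by (rule inj_on_subset) auto
      show "\<exists>v. v \<noteq> 0 \<and> unit_tangent \<gamma> t = sgn v" if "t \<in> {0<..<1}" for t
        using unit_tangent_direction[OF \<gamma>(1), of t] that by auto
    qed
    have "path_image \<gamma> \<subseteq> closure (locus A)"
    proof -
      have "\<gamma> ` closure {0<..<1} \<subseteq> closure (\<gamma> ` {0<..<1})"
        by (rule image_closure_subset) (use cont closure_subset[of "\<gamma> ` {0<..<1}"] in auto)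
      then show ?thesis by (simp add: path_image_def loc)
    qed
    moreover have "closure (locus A) \<subseteq> path_image \<gamma>"
    proof (rule closure_minimal)
      show "closed (path_image \<gamma>)" using cont by (intro closed_path_image) (simp add: path_def)
    qed (use im in blast)
    ultimately show "path_image \<gamma> = closure (locus A)" by blast
    show "connected (locus A)" unfolding loc
      using cont by (intro connected_continuous_image) (auto intro: continuous_on_subset)
    show "locus A \<noteq> {}" unfolding loc by simp
  qed
qed

text \<open>The closure of the locus determines the pair of ends, and the recorded tangent
  directions determine which of them is the start. This makes \<open>tail\<close> and
  \<open>head\<close> well defined.\<close>

lemma oriented_arc_unique:
  assumes "oriented_arc A x y" "oriented_arc A x' y'"
  shows "x = x' \<and> y = y'"
proof -
  obtain \<gamma> where \<gamma>: "arc \<gamma>" "pathstart \<gamma> = x" "pathfinish \<gamma> = y" "follows \<gamma> A"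
    "path_image \<gamma> = insert x (insert y (locus A))" "x \<notin> locus A" "y \<notin> locus A" "direction_field A"
    "path_image \<gamma> = closure (locus A)" using oriented_arc_path[OF assms(1)] .
  obtain \<delta> where \<delta>: "arc \<delta>" "pathstart \<delta> = x'" "pathfinish \<delta> = y'" "follows \<delta> A"
    "path_image \<delta> = insert x' (insert y' (locus A))" "x' \<notin> locus A" "y' \<notin> locus A" "direction_field A"
    "path_image \<delta> = closure (locus A)" using oriented_arc_path[OF assms(2)] .
  have "x = x'" using same_direction[OF \<gamma>(1) \<delta>(1) _ \<gamma>(8,4) \<delta>(4)] \<gamma> \<delta> by simp
  moreover have "x \<noteq> y" "x' \<noteq> y'" using arc_distinct_ends \<gamma>(1-3) \<delta>(1-3) by metis+
  moreover have "{x, y} = {x', y'}" using \<gamma>(5-7,9) \<delta>(5-7,9) by auto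
  ultimately show ?thesis by (auto simp: doubleton_eq_iff)
qed

lemma oriented_circle_loop:
  assumes "oriented_circle A"
  obtains \<gamma> where "simple_loop \<gamma>" "follows \<gamma> A" "path_image \<gamma> = locus A" "direction_field A"
proof -
  obtain \<gamma> where \<gamma>: "smooth_immersion UNIV \<gamma>" "\<And>t. \<gamma> (t + 1) = \<gamma> t" "inj_on \<gamma> {0..<1}"
    "A = (\<lambda>t. (\<gamma> t, unit_tangent \<gamma> t)) ` {0..<1}"
    using assms unfolding oriented_circle_def by blast
  have "\<gamma> 1 = \<gamma> 0" using \<gamma>(2)[of 0] by simp
  have cont: "path \<gamma>" unfolding path_def
    using smooth_immersion_continuous[OF \<gamma>(1)] continuous_on_subset by blast
  have loc: "locus A = \<gamma> ` {0..<1}" unfolding locus_def \<gamma>(4) by (auto simp: image_image)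
  show ?thesis
  proof
    have "loop_free \<gamma>" unfolding loop_free_def
    proof (intro ballI impI)
      fix x y :: real assume xy: "x \<in> {0..1}" "y \<in> {0..1}" "\<gamma> x = \<gamma> y"
      define r where "r z = (if z = 1 then 0 else z)" for z :: real
      have "\<gamma> (r x) = \<gamma> (r y)" using xy \<open>\<gamma> 1 = \<gamma> 0\<close> by (auto simp: r_def)
      then have "r x = r y" using \<gamma>(3) xy by (auto simp: r_def inj_on_def)
      then show "x = y \<or> x = 0 \<and> y = 1 \<or> x = 1 \<and> y = 0" by (auto simp: r_def split: if_splits)
    qed
    then show "simple_loop \<gamma>" using cont \<open>\<gamma> 1 = \<gamma> 0\<close>
      by (simp add: simple_loop_def simple_path_def pathstart_def pathfinish_def)
    have "\<exists>v. (\<gamma> has_vector_derivative v) (at t) \<and> (\<gamma> t, sgn v) \<in> A" if "t \<in> {0..1} - {1}" for t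
    proof -
      have "t \<in> {0..<1}" using that by auto
      moreover obtain v where "(\<gamma> has_vector_derivative v) (at t)" "unit_tangent \<gamma> t = sgn v"
        using unit_tangent_direction[OF \<gamma>(1), of t] by auto
      ultimately show ?thesis unfolding \<gamma>(4) by (metis (mono_tags, lifting) image_eqI)
    qed
    then show "follows \<gamma> A" unfolding follows_def by (intro exI[of _ "{1}"]) auto
    have "{0..1} = insert 1 {0..<1::real}" by auto
    then show "path_image \<gamma> = locus A" unfolding loc path_image_def using \<open>\<gamma> 1 = \<gamma> 0\<close> by force
    show "direction_field A" unfolding \<gamma>(4)
      using unit_tangent_direction[OF \<gamma>(1)] \<gamma>(3) by (intro direction_field_param) auto
  qed
qed

lemma locus_reverse_curve [simp]: "locus (reverse_curve A) = locus A"
  by (force simp: locus_def reverse_curve_def image_iff)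

lemma direction_field_reverse_curve: "direction_field A \<Longrightarrow> direction_field (reverse_curve A)"
  unfolding direction_field_def single_valued_def
  by (intro conjI allI impI ballI)
    (simp add: reverse_curve_iff, metis neg_equal_iff_equal, clarsimp simp: reverse_curve_iff, force)

definition tail :: "curve \<Rightarrow> complex" where "tail e = (THE x. leaves e x)"
definition head :: "curve \<Rightarrow> complex" where "head e = (THE y. enters e y)"

lemma oriented_arc_tail_head:
  assumes "oriented_arc e x y"
  shows "tail e = x" "head e = y" "leaves e v \<longleftrightarrow> v = x" "enters e v \<longleftrightarrow> v = y"
proof -
  show l: "leaves e v \<longleftrightarrow> v = x" for v unfolding leaves_def using assms oriented_arc_unique by blast
  show r: "enters e v \<longleftrightarrow> v = y" for v unfolding enters_def using assms oriented_arc_unique by blast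
  show "tail e = x" "head e = y" unfolding tail_def head_def using l r by auto
qed

definition touches :: "curve \<Rightarrow> complex \<Rightarrow> bool" where
  "touches e v \<longleftrightarrow> tail e = v \<or> head e = v"

section \<open>Edges, vertices and proper colorings of a closed web\<close>

locale web =
  fixes w :: plane_graph
  assumes closed_web: "closed_web w"
begin

lemma finite_parts: "finite (verts w)" "finite (edges w)" "finite (circles w)" "finite (curves w)"
  using closed_web by (auto simp: closed_web_def embedded_graph_def curves_def)

lemma edge_arc: "e \<in> edges w \<Longrightarrow> oriented_arc e (tail e) (head e) \<and> tail e \<in> verts w \<and> head e \<in> verts w"
  using closed_web unfolding closed_web_def embedded_graph_def by (metis oriented_arc_tail_head(1,2))

lemma leaves_iff: "e \<in> edges w \<Longrightarrow> leaves e v \<longleftrightarrow> v = tail e"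
  using edge_arc oriented_arc_tail_head(3) by blast

lemma enters_iff: "e \<in> edges w \<Longrightarrow> enters e v \<longleftrightarrow> v = head e"
  using edge_arc oriented_arc_tail_head(4) by blast

lemma tail_neq_head: "e \<in> edges w \<Longrightarrow> tail e \<noteq> head e"
  using edge_arc oriented_arc_path[of e "tail e" "head e"] arc_distinct_ends by metis

lemma circle: "C \<in> circles w \<Longrightarrow> oriented_circle C"
  using closed_web by (auto simp: closed_web_def embedded_graph_def)

lemma locus_disjoint: "A \<in> curves w \<Longrightarrow> B \<in> curves w \<Longrightarrow> A \<noteq> B \<Longrightarrow> locus A \<inter> locus B = {}"
  using closed_web by (auto simp: closed_web_def embedded_graph_def disjoint_family_on_def)

lemma locus_verts: "A \<in> curves w \<Longrightarrow> locus A \<inter> verts w = {}"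
  using closed_web by (auto simp: closed_web_def embedded_graph_def)

lemma closure_edge: "e \<in> edges w \<Longrightarrow> closure (locus e) = insert (tail e) (insert (head e) (locus e))"
proof -
  assume e: "e \<in> edges w"
  show ?thesis by (rule oriented_arc_path[OF conjunct1[OF edge_arc[OF e]]]) simp
qed

lemma closure_circle: "C \<in> circles w \<Longrightarrow> closure (locus C) = locus C"
proof -
  assume C: "C \<in> circles w"
  obtain \<gamma> where g: "simple_loop \<gamma>" "path_image \<gamma> = locus C"
    by (rule oriented_circle_loop[OF circle[OF C]]) blast
  then show ?thesis using closed_path_image[OF simple_loop_imp_path[OF g(1)]] closure_closed by simp
qed

lemma curve_facts:
  assumes "A \<in> curves w"
  shows "connected (locus A)" "locus A \<noteq> {}" "direction_field A" "compact (closure (locus A))"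
proof -
  consider "A \<in> edges w" | "A \<in> circles w" using assms by (auto simp: curves_def)
  then have "connected (locus A) \<and> locus A \<noteq> {} \<and> direction_field A \<and> compact (closure (locus A))"
  proof cases
    case 1
    obtain p where p: "arc p" "path_image p = closure (locus A)" "direction_field A"
      "connected (locus A)" "locus A \<noteq> {}"
      by (rule oriented_arc_path[OF conjunct1[OF edge_arc[OF 1]]]) blast
    then show ?thesis using compact_path_image[OF arc_imp_path[OF p(1)]] by simp
  next
    case 2
    obtain \<gamma> where g: "simple_loop \<gamma>" "path_image \<gamma> = locus A" "direction_field A"
      by (rule oriented_circle_loop[OF circle[OF 2]]) blast
    note p = simple_loop_imp_path[OF g(1)]
    show ?thesis using closure_circle[OF 2] g compact_path_image[OF p] connected_path_image[OF p]
        path_image_nonempty[of \<gamma>] by simp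
  qed
  then show "connected (locus A)" "locus A \<noteq> {}" "direction_field A" "compact (closure (locus A))" by auto
qed

lemma edge_not_circle: "e \<in> edges w \<Longrightarrow> e \<notin> circles w"
proof
  assume e: "e \<in> edges w" "e \<in> circles w"
  have "tail e \<in> locus e" using closure_edge[OF e(1)] closure_circle[OF e(2)] by blast
  then show False using edge_arc[OF e(1)] locus_verts[of e] e by (auto simp: curves_def)
qed

lemma closure_locus_disjoint:
  assumes "A \<in> curves w" "B \<in> curves w" "A \<noteq> B"
  shows "closure (locus A) \<inter> locus B = {}"
proof -
  have "closure (locus A) \<subseteq> locus A \<union> verts w"
    using assms(1) closure_edge closure_circle edge_arc by (auto simp: curves_def)
  then show ?thesis using locus_disjoint[OF assms] locus_verts[OF assms(2)] by blast
qed

lemma vertex_in_closure_iff: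
  assumes "A \<in> curves w" "v \<in> verts w"
  shows "v \<in> closure (locus A) \<longleftrightarrow> A \<in> edges w \<and> touches A v"
  using assms closure_edge[of A] closure_circle[of A] edge_not_circle locus_verts[OF assms(1)]
  by (auto simp: curves_def touches_def)

lemma sink_or_source: "v \<in> verts w \<Longrightarrow> (\<forall>e\<in>edges w. tail e \<noteq> v) \<or> (\<forall>e\<in>edges w. head e \<noteq> v)"
  using closed_web leaves_iff enters_iff
  unfolding closed_web_def sinks_and_sources_def is_sink_def is_source_def by metis

text \<open>The two ends of an edge are different, so it cannot both leave and enter
  \<open>v\<close>. The set \<open>E\<close> is a parameter because the count is also made for the
  cycles of a configuration.\<close>

lemma vertex_degree_touches:
  assumes "E \<subseteq> edges w"
  shows "card {e \<in> E. leaves e v} + card {e \<in> E. enters e v} = card {e \<in> E. touches e v}"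
proof -
  have "{e \<in> E. touches e v} = {e \<in> E. leaves e v} \<union> {e \<in> E. enters e v}"
    using assms leaves_iff enters_iff by (auto simp: touches_def)
  moreover have "{e \<in> E. leaves e v} \<inter> {e \<in> E. enters e v} = {}"
    using assms leaves_iff enters_iff tail_neq_head by auto
  moreover have "finite E" using assms finite_parts finite_subset by blast
  ultimately show ?thesis by (simp add: card_Un_disjoint)
qed

lemma card_touching: "v \<in> verts w \<Longrightarrow> card {e \<in> edges w. touches e v} = 3"
  using closed_web vertex_degree_touches[of "edges w" v]
  by (simp add: closed_web_def regular_graph_def vertex_degree_def)

lemma card_UNIV_color: "card (UNIV :: color set) = 3"
  by (simp add: UNIV_color)

lemma proper_iff:
  "proper_on w c \<longleftrightarrow> (\<forall>v\<in>verts w. inj_on c {e \<in> edges w. touches e v})"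
proof -
  have adj_iff: "adjacent_edges e f \<longleftrightarrow> e \<noteq> f \<and> (\<exists>v\<in>verts w. touches e v \<and> touches f v)"
    if "e \<in> edges w" "f \<in> edges w" for e f
    unfolding adjacent_edges_def touches_def
    using leaves_iff[OF that(1)] leaves_iff[OF that(2)] enters_iff[OF that(1)] enters_iff[OF that(2)]
      edge_arc[OF that(1)] by metis
  then have adj: "adjacent_edges e f" if "e \<in> edges w" "f \<in> edges w" "e \<noteq> f" "v \<in> verts w" "touches e v" "touches f v" for e f v
    using that by blast
  show ?thesis
  proof
    assume "proper_on w c"
    then show "\<forall>v\<in>verts w. inj_on c {e \<in> edges w. touches e v}"
      using adj unfolding proper_on_def by (intro ballI inj_onI) blast
  next
    assume R: "\<forall>v\<in>verts w. inj_on c {e \<in> edges w. touches e v}"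
    show "proper_on w c" unfolding proper_on_def
    proof (intro ballI impI)
      fix e f assume ef: "e \<in> edges w" "f \<in> edges w" "adjacent_edges e f"
      then obtain v where v: "e \<noteq> f" "v \<in> verts w" "touches e v" "touches f v" using adj_iff by blast
      show "c e \<noteq> c f"
      proof
        assume "c e = c f"
        then have "e = f" by (rule inj_onD[OF bspec[OF R v(2)]]) (use v ef in auto)
        then show False using v(1) by simp
      qed
    qed
  qed
qed

text \<open>With three edges at a vertex and three colors, injectivity and surjectivity are
  equivalent. The surjective form is the one that can be expressed by closures of color
  classes.\<close>

lemma proper_iff_all_colors:
  "proper_on w c \<longleftrightarrow> (\<forall>v\<in>verts w. c ` {e \<in> edges w. touches e v} = UNIV)"
proof -
  have "inj_on c {e \<in> edges w. touches e v} \<longleftrightarrow> c ` {e \<in> edges w. touches e v} = UNIV" if "v \<in> verts w" for v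
  proof -
    have fin: "finite {e \<in> edges w. touches e v}" using finite_parts by simp
    show ?thesis
    proof
      assume "inj_on c {e \<in> edges w. touches e v}"
      then have "card (c ` {e \<in> edges w. touches e v}) = card (UNIV :: color set)"
        using card_touching[OF that] card_UNIV_color by (simp add: card_image)
      then show "c ` {e \<in> edges w. touches e v} = UNIV" by (intro card_subset_eq) auto
    next
      assume "c ` {e \<in> edges w. touches e v} = UNIV"
      then show "inj_on c {e \<in> edges w. touches e v}"
        using card_touching[OF that] card_UNIV_color by (intro eq_card_imp_inj_on[OF fin]) simp
    qed
  qed
  then show ?thesis using proper_iff by blast
qed

end

section \<open>A colored configuration as a disjoint union of directed loops\<close>

locale colored_web = web +
  fixes c :: "curve \<Rightarrow> color" and u :: color
  assumes proper: "proper_on w c"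
begin

definition "u_graph = delete_color u w c"

definition directed :: "curve \<Rightarrow> curve" where
  "directed A = (if c A = Max (colors_without u) then reverse_curve A else A)"

lemma edge_of_color:
  assumes "v \<in> verts w"
  obtains e where "e \<in> edges w" "touches e v" "c e = k"
    "\<And>f. f \<in> edges w \<Longrightarrow> touches f v \<Longrightarrow> c f = k \<Longrightarrow> f = e"
proof -
  have "c ` {e \<in> edges w. touches e v} = UNIV" "inj_on c {e \<in> edges w. touches e v}"
    using proper assms proper_iff[of c] proper_iff_all_colors[of c] by blast+
  then have "k \<in> c ` {e \<in> edges w. touches e v}" by simp
  then obtain e where "e \<in> edges w" "touches e v" "c e = k" by blast
  moreover have "f = e" if "f \<in> edges w" "touches f v" "c f = k" for f
    using \<open>inj_on c _\<close> that \<open>e \<in> edges w\<close> \<open>touches e v\<close> \<open>c e = k\<close> by (auto dest: inj_onD)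
  ultimately show ?thesis using that by blast
qed

lemma u_graph_simps:
  "verts u_graph = verts w" "edges u_graph = {e \<in> edges w. c e \<noteq> u}"
  "circles u_graph = {C \<in> circles w. c C \<noteq> u}" "curves u_graph = {A \<in> curves w. c A \<noteq> u}"
  by (auto simp: u_graph_def delete_color_def curves_def)

lemma graph_locus_u_graph: "graph_locus u_graph = verts w \<union> (\<Union>A\<in>curves u_graph. locus A)"
  by (auto simp: graph_locus_def flow_def u_graph_simps locus_def)

lemma card_u_graph_touching:
  assumes "v \<in> verts w"
  shows "card {e \<in> edges u_graph. touches e v} = 2"
proof -
  obtain e where e: "e \<in> edges w" "touches e v" "c e = u"
    "\<And>f. f \<in> edges w \<Longrightarrow> touches f v \<Longrightarrow> c f = u \<Longrightarrow> f = e"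
    by (rule edge_of_color[OF assms, of u]) blast
  have "{e \<in> edges u_graph. touches e v} = {e \<in> edges w. touches e v} - {e}"
    unfolding u_graph_simps using e by blast
  then show ?thesis using card_touching[OF assms] e(1,2) by (simp add: card_Diff_singleton)
qed

lemma Max_colors_without: "Max (colors_without u) \<noteq> u"
proof -
  have "Max (colors_without u) \<in> colors_without u"
    by (rule Max_in) (cases u, auto simp: colors_without_def UNIV_color)
  then show ?thesis by (simp add: colors_without_def)
qed

definition "other = (THE k. k \<noteq> u \<and> k \<noteq> Max (colors_without u))"

lemma other: "other \<noteq> u" "other \<noteq> Max (colors_without u)"
  "k \<noteq> u \<Longrightarrow> k \<noteq> Max (colors_without u) \<Longrightarrow> k = other"
proof -
  have *: "\<exists>!k. k \<noteq> u \<and> k \<noteq> m" if "m \<noteq> u" for m :: color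
  proof -
    have "k = Red \<or> k = Green \<or> k = Blue" for k by (cases k) auto
    then show ?thesis using that by (cases u; cases m) (auto, (metis color.distinct)+)
  qed
  note ex = *[OF Max_colors_without]
  have "other \<noteq> u \<and> other \<noteq> Max (colors_without u)" unfolding other_def by (rule theI'[OF ex])
  then show "other \<noteq> u" "other \<noteq> Max (colors_without u)"
    "k \<noteq> u \<Longrightarrow> k \<noteq> Max (colors_without u) \<Longrightarrow> k = other" using ex by blast+
qed

lemma flow_reverse_greatest: "flow (reverse_greatest u Z c) = (\<Union>A\<in>curves Z. directed A)"
  by (auto simp: flow_def curves_def reverse_greatest_def Let_def directed_def)

lemma locus_directed [simp]: "locus (directed A) = locus A"
  by (simp add: directed_def)

lemma graph_locus_reverse_greatest: "graph_locus (reverse_greatest u Z c) = graph_locus Z"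
proof -
  have "locus (flow (reverse_greatest u Z c)) = (\<Union>A\<in>curves Z. locus (directed A))"
    unfolding flow_reverse_greatest locus_def by (rule image_UN)
  also have "\<dots> = locus (flow Z)" by (simp add: flow_def) (simp add: locus_def image_Union)
  finally show ?thesis by (simp add: graph_locus_def reverse_greatest_def Let_def)
qed

definition "u_field = flow (reverse_greatest u u_graph c)"

lemma u_field_eq: "u_field = (\<Union>A\<in>curves u_graph. directed A)"
  by (simp add: u_field_def flow_reverse_greatest)

lemma direction_field_u_field: "direction_field u_field"
proof -
  have *: "direction_field (directed A)" if "A \<in> curves u_graph" for A
    using that curve_facts(3) direction_field_reverse_curve by (simp add: directed_def u_graph_simps)
  have "v = v'" if v: "(z, v) \<in> u_field" "(z, v') \<in> u_field" for z v v'
  proof -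
    obtain A B where AB: "A \<in> curves u_graph" "B \<in> curves u_graph" "(z, v) \<in> directed A" "(z, v') \<in> directed B"
      using v by (auto simp: u_field_eq)
    then have "z \<in> locus A" "z \<in> locus B" by (metis fst_conv image_eqI locus_def locus_directed)+
    then have "A = B" using locus_disjoint[of A B] AB by (auto simp: u_graph_simps)
    then show ?thesis using *[OF AB(1)] AB by (auto simp: direction_field_def single_valued_def)
  qed
  moreover have "v \<noteq> 0" if "(z, v) \<in> u_field" for z v
    using that * by (auto simp: u_field_eq direction_field_def)
  ultimately show ?thesis unfolding direction_field_def single_valued_def by blast
qed

text \<open>A parametrization of the edge together with its ends, run in the direction that the edge
  has after the reversal of the greatest color.\<close>

definition dpath :: "curve \<Rightarrow> real \<Rightarrow> complex" where
  "dpath e = (SOME p. arc p \<and> follows p (directed e) \<and> path_image p = closure (locus e) \<and>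
    pathstart p = (if c e = Max (colors_without u) then head e else tail e) \<and>
    pathfinish p = (if c e = Max (colors_without u) then tail e else head e))"

lemma dpath:
  assumes "e \<in> edges w"
  shows "arc (dpath e)" "follows (dpath e) (directed e)" "path_image (dpath e) = closure (locus e)"
    "pathstart (dpath e) = (if c e = Max (colors_without u) then head e else tail e)"
    "pathfinish (dpath e) = (if c e = Max (colors_without u) then tail e else head e)"
proof -
  obtain p where p: "arc p" "pathstart p = tail e" "pathfinish p = head e" "follows p e"
    "path_image p = closure (locus e)"
    using oriented_arc_path[of e "tail e" "head e"] edge_arc[OF assms] by metis
  have "\<exists>p. arc p \<and> follows p (directed e) \<and> path_image p = closure (locus e) \<and>
    pathstart p = (if c e = Max (colors_without u) then head e else tail e) \<and>
    pathfinish p = (if c e = Max (colors_without u) then tail e else head e)"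
  proof (cases "c e = Max (colors_without u)")
    case True
    then show ?thesis using p
      by (intro exI[of _ "reversepath p"]) (simp add: directed_def follows_reversepath arc_reversepath)
  next
    case False
    then show ?thesis using p by (intro exI[of _ p]) (simp add: directed_def)
  qed
  from someI_ex[OF this, folded dpath_def]
  show "arc (dpath e)" "follows (dpath e) (directed e)" "path_image (dpath e) = closure (locus e)"
    "pathstart (dpath e) = (if c e = Max (colors_without u) then head e else tail e)"
    "pathfinish (dpath e) = (if c e = Max (colors_without u) then tail e else head e)" by blast+
qed

lemma dpath_touches:
  assumes "e \<in> edges w"
  shows "touches e (pathstart (dpath e))" "touches e (pathfinish (dpath e))"
    "pathstart (dpath e) \<in> verts w" "pathfinish (dpath e) \<in> verts w"
  using dpath(4,5)[OF assms] edge_arc[OF assms] by (simp_all add: touches_def)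

text \<open>In the web the edges at a vertex all enter it or all leave it. After the reversal of one
  of the two remaining colors, edges that start at the same vertex therefore have the same color,
  and properness leaves only one of them.\<close>

lemma dpath_start_unique:
  assumes "e \<in> edges u_graph" "f \<in> edges u_graph" "pathstart (dpath e) = pathstart (dpath f)"
  shows "e = f"
proof -
  define v where "v = pathstart (dpath e)"
  have ef: "e \<in> edges w" "f \<in> edges w" "c e \<noteq> u" "c f \<noteq> u" using assms by (auto simp: u_graph_simps)
  have te: "touches e v" "touches f v" "v \<in> verts w"
    using dpath_touches(1,3)[OF ef(1)] dpath_touches(1)[OF ef(2)] assms(3) by (simp_all add: v_def)
  have "c e = c f"
    using sink_or_source[OF te(3)] ef v_def assms(3) dpath(4)[OF ef(1)] dpath(4)[OF ef(2)] other(3)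
    by (metis (full_types))
  then show ?thesis using edge_of_color[OF te(3), of "c e"] te ef by metis
qed

lemma dpath_finish_unique:
  assumes "e \<in> edges u_graph" "f \<in> edges u_graph" "pathfinish (dpath e) = pathfinish (dpath f)"
  shows "e = f"
proof -
  define v where "v = pathfinish (dpath e)"
  have ef: "e \<in> edges w" "f \<in> edges w" "c e \<noteq> u" "c f \<noteq> u" using assms by (auto simp: u_graph_simps)
  have te: "touches e v" "touches f v" "v \<in> verts w"
    using dpath_touches(2,4)[OF ef(1)] dpath_touches(2)[OF ef(2)] assms(3) by (simp_all add: v_def)
  have "c e = c f"
    using sink_or_source[OF te(3)] ef v_def assms(3) dpath(5)[OF ef(1)] dpath(5)[OF ef(2)] other(3)
    by (metis (full_types))
  then show ?thesis using edge_of_color[OF te(3), of "c e"] te ef by metis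
qed

text \<open>The edges at \<open>v\<close> of the two colors other than \<open>u\<close> are directed
  oppositely: in the web both enter or both leave, and exactly one of them is reversed.\<close>

lemma dpath_ends_exist:
  assumes "v \<in> verts w"
  shows "\<exists>e\<in>edges u_graph. pathstart (dpath e) = v" "\<exists>e\<in>edges u_graph. pathfinish (dpath e) = v"
proof -
  obtain e where e: "e \<in> edges w" "touches e v" "c e = Max (colors_without u)"
    using edge_of_color[OF assms] by metis
  obtain f where f: "f \<in> edges w" "touches f v" "c f = other"
    using edge_of_color[OF assms] by metis
  have "e \<in> edges u_graph" "f \<in> edges u_graph"
    using e f other(1) Max_colors_without by (simp_all add: u_graph_simps)
  then show "\<exists>e\<in>edges u_graph. pathstart (dpath e) = v" "\<exists>e\<in>edges u_graph. pathfinish (dpath e) = v"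
    using e f dpath(4,5)[OF e(1)] dpath(4,5)[OF f(1)] sink_or_source[OF assms] other(2)
    unfolding touches_def by (metis (no_types))+
qed

text \<open>The directed edges satisfy the hypotheses of \<open>arcs_loop_decomposition\<close>: at
  each vertex exactly one starts and exactly one finishes. Vertex-less circles are loops already,
  reversed if they have the greatest color.\<close>

lemma loops_exist: "\<exists>\<Gamma>. loop_decomposition \<Gamma> (graph_locus u_graph) u_field"
proof -
  define E where "E = dpath ` edges u_graph"
  have Ew: "e \<in> edges w" "c e \<noteq> u" "e \<in> curves u_graph" "e \<in> curves w" if "e \<in> edges u_graph" for e
    using that by (auto simp: u_graph_simps curves_def)
  have "\<exists>\<Gamma>. loop_decomposition \<Gamma> (\<Union>p\<in>E. path_image p) u_field"
  proof (rule arcs_loop_decomposition)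
    show "finite E" using finite_parts by (simp add: E_def u_graph_simps)
    show "arc p \<and> follows p u_field" if p: "p \<in> E" for p
    proof -
      obtain e where e: "e \<in> edges u_graph" "p = dpath e" using p E_def by blast
      have "directed e \<subseteq> u_field" using Ew(3)[OF e(1)] unfolding u_field_eq by blast
      then show ?thesis using dpath(1,2)[OF Ew(1)[OF e(1)]] follows_mono e(2) by blast
    qed
    show "path_image p \<inter> path_image q \<subseteq> {pathstart p, pathfinish p} \<inter> {pathstart q, pathfinish q}"
      if pq: "p \<in> E" "q \<in> E" "p \<noteq> q" for p q
    proof -
      obtain e f where ef: "e \<in> edges u_graph" "f \<in> edges u_graph" "p = dpath e" "q = dpath f" "e \<noteq> f"
        using pq by (auto simp: E_def)
      have ends: "{pathstart p, pathfinish p} = {tail e, head e}" "{pathstart q, pathfinish q} = {tail f, head f}"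
        using dpath(4,5) Ew ef by auto
      have im: "path_image p = insert (tail e) (insert (head e) (locus e))"
        "path_image q = insert (tail f) (insert (head f) (locus f))"
        using dpath(3) Ew ef closure_edge by auto
      have "locus e \<inter> locus f = {}" using locus_disjoint Ew ef by blast
      moreover have "tail e \<notin> locus f" "head e \<notin> locus f" "tail f \<notin> locus e" "head f \<notin> locus e"
        using edge_arc[OF Ew(1)[OF ef(1)]] edge_arc[OF Ew(1)[OF ef(2)]]
          locus_verts[OF Ew(4)[OF ef(1)]] locus_verts[OF Ew(4)[OF ef(2)]] by blast+
      ultimately show ?thesis unfolding ends unfolding im by auto
    qed
    show "inj_on pathstart E" "inj_on pathfinish E"
      using dpath_start_unique dpath_finish_unique by (auto simp: E_def inj_on_def)
    have "pathstart p \<in> verts w" "pathfinish p \<in> verts w" if "p \<in> E" for p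
      using that dpath_touches(3,4) Ew(1) unfolding E_def by blast+
    moreover have "v \<in> pathstart ` E" "v \<in> pathfinish ` E" if "v \<in> verts w" for v
      using dpath_ends_exist[OF that] unfolding E_def by (metis imageI)+
    ultimately have "pathstart ` E = verts w" "pathfinish ` E = verts w" by blast+
    then show "pathstart ` E = pathfinish ` E" by simp
  qed
  then obtain \<Gamma> where \<Gamma>: "loop_decomposition \<Gamma> (\<Union>p\<in>E. path_image p) u_field" by blast
  \<comment> \<open>Every vertex is an end of an edge that is kept, so no vertex is missing from the
    union of the closed edges.\<close>
  have E_im: "(\<Union>p\<in>E. path_image p) = verts w \<union> (\<Union>e\<in>edges u_graph. locus e)"
  proof -
    have E_eq: "(\<Union>p\<in>E. path_image p) = (\<Union>e\<in>edges u_graph. insert (tail e) (insert (head e) (locus e)))"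
      using dpath(3) Ew closure_edge by (simp add: E_def)
    have "\<exists>e\<in>edges u_graph. v = tail e \<or> v = head e" if v: "v \<in> verts w" for v
    proof -
      obtain e where "e \<in> edges u_graph" "pathstart (dpath e) = v" using dpath_ends_exist(1)[OF v] by blast
      then show ?thesis using dpath_touches(1)[OF Ew(1)] unfolding touches_def by metis
    qed
    moreover have "tail e \<in> verts w \<and> head e \<in> verts w" if "e \<in> edges u_graph" for e
      using edge_arc[OF Ew(1)[OF that]] by simp
    ultimately have "(\<Union>e\<in>edges u_graph. {tail e, head e}) = verts w" by blast
    moreover have "(\<Union>e\<in>edges u_graph. insert (tail e) (insert (head e) (locus e)))
        = (\<Union>e\<in>edges u_graph. {tail e, head e}) \<union> (\<Union>e\<in>edges u_graph. locus e)" by auto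
    ultimately show ?thesis using E_eq by simp
  qed
  have "\<exists>g. simple_loop g \<and> follows g (directed C) \<and> path_image g = locus C" if "C \<in> circles u_graph" for C
  proof -
    have C: "C \<in> circles w" using that by (simp add: u_graph_simps)
    obtain g where g: "simple_loop g" "follows g C" "path_image g = locus C"
      by (rule oriented_circle_loop[OF circle[OF C]])
    then show ?thesis
      using simple_loop_reversepath[OF g(1)] follows_reversepath[OF g(2)]
      by (cases "c C = Max (colors_without u)") (auto simp: directed_def intro: exI[of _ "reversepath g"])
  qed
  then obtain g where g: "\<And>C. C \<in> circles u_graph \<Longrightarrow> simple_loop (g C) \<and> follows (g C) (directed C) \<and> path_image (g C) = locus C"
    by metis
  have Cw: "C \<in> circles w" "C \<in> curves u_graph" "C \<in> curves w" if "C \<in> circles u_graph" for C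
    using that by (auto simp: u_graph_simps curves_def)
  have "loop_decomposition (g ` circles u_graph) (\<Union>C\<in>circles u_graph. locus C) u_field"
    unfolding loop_decomposition_def
  proof (intro conjI ballI impI)
    show "finite (g ` circles u_graph)" using finite_parts by (simp add: u_graph_simps)
    show "simple_loop \<gamma>" "follows \<gamma> u_field" if \<gamma>: "\<gamma> \<in> g ` circles u_graph" for \<gamma>
    proof -
      obtain C where C: "C \<in> circles u_graph" "\<gamma> = g C" using \<gamma> by blast
      have "directed C \<subseteq> u_field" using Cw(2)[OF C(1)] unfolding u_field_eq by blast
      then show "simple_loop \<gamma>" "follows \<gamma> u_field" using g[OF C(1)] follows_mono C(2) by blast+
    qed
    show "path_image \<gamma> \<inter> path_image \<delta> = {}"
      if "\<gamma> \<in> g ` circles u_graph" "\<delta> \<in> g ` circles u_graph" "\<gamma> \<noteq> \<delta>" for \<gamma> \<delta>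
      using that g Cw locus_disjoint by (metis imageE)
    show "(\<Union>\<gamma>\<in>g ` circles u_graph. path_image \<gamma>) = (\<Union>C\<in>circles u_graph. locus C)" using g by simp
  qed
  moreover have "(\<Union>p\<in>E. path_image p) \<inter> (\<Union>C\<in>circles u_graph. locus C) = {}"
  proof -
    have "locus e \<inter> locus C = {}" if "e \<in> edges u_graph" "C \<in> circles u_graph" for e C
      using that Ew Cw edge_not_circle locus_disjoint by metis
    moreover have "verts w \<inter> locus C = {}" if "C \<in> circles u_graph" for C
      using that Cw locus_verts by blast
    ultimately show ?thesis unfolding E_im by blast
  qed
  ultimately have "loop_decomposition (\<Gamma> \<union> g ` circles u_graph)
      ((\<Union>p\<in>E. path_image p) \<union> (\<Union>C\<in>circles u_graph. locus C)) u_field"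
    using \<Gamma> by (intro loop_decomposition_Un)
  moreover have "(\<Union>p\<in>E. path_image p) \<union> (\<Union>C\<in>circles u_graph. locus C) = graph_locus u_graph"
    unfolding E_im graph_locus_u_graph by (auto simp: curves_def)
  ultimately show ?thesis by metis
qed

end

section \<open>The cycles of a configuration and the components of its locus\<close>

context colored_web
begin

text \<open>The part of the configuration that lies on \<open>K\<close>. On components this is the
  inverse of \<open>graph_locus\<close>.\<close>

definition sub_of :: "complex set \<Rightarrow> plane_graph" where
  "sub_of K = \<lparr>verts = {v \<in> verts w. v \<in> K}, edges = {e \<in> edges u_graph. locus e \<subseteq> K},
    circles = {C \<in> circles u_graph. locus C \<subseteq> K}\<rparr>"

lemma u_curve: "A \<in> curves u_graph \<Longrightarrow> A \<in> curves w"
  by (simp add: u_graph_simps)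

lemma u_edge: "e \<in> edges u_graph \<Longrightarrow> e \<in> edges w \<and> e \<in> curves u_graph"
  by (simp add: u_graph_simps curves_def)

lemma u_circle: "C \<in> circles u_graph \<Longrightarrow> C \<in> circles w \<and> C \<in> curves u_graph"
  by (simp add: u_graph_simps curves_def)

lemma finite_u_curves: "finite (curves u_graph)"
  using finite_parts by (simp add: u_graph_simps)

lemma vertex_on_u_edge:
  assumes "v \<in> verts w"
  obtains e where "e \<in> edges u_graph" "v \<in> closure (locus e)"
proof -
  obtain e where "e \<in> edges u_graph" "pathstart (dpath e) = v" using dpath_ends_exist(1)[OF assms] by blast
  then show ?thesis using that dpath(3) u_edge pathstart_in_path_image by metis
qed

text \<open>Presents the locus as a finite union of closed connected sets, so that a component is a
  union of closures of curves. Vertices are covered because at each of them some edge has a color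
  other than \<open>u\<close>.\<close>

lemma locus_u_graph_closures: "graph_locus u_graph = (\<Union>A\<in>curves u_graph. closure (locus A))"
proof
  show "graph_locus u_graph \<subseteq> (\<Union>A\<in>curves u_graph. closure (locus A))"
  proof
    fix x assume "x \<in> graph_locus u_graph"
    then consider "x \<in> verts w" | A where "A \<in> curves u_graph" "x \<in> locus A"
      unfolding graph_locus_u_graph by blast
    then show "x \<in> (\<Union>A\<in>curves u_graph. closure (locus A))"
    proof cases
      case 1
      then show ?thesis using vertex_on_u_edge[OF 1] u_edge by blast
    next
      case 2
      then show ?thesis using closure_subset by blast
    qed
  qed
  have "closure (locus A) \<subseteq> graph_locus u_graph" if A: "A \<in> curves u_graph" for A
  proof (cases "A \<in> edges w")
    case True
    then have "closure (locus A) \<subseteq> locus A \<union> verts w" using closure_edge edge_arc by simp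
    then show ?thesis using A unfolding graph_locus_u_graph by blast
  next
    case False
    then have "A \<in> circles w" using A by (auto simp: u_graph_simps curves_def)
    then show ?thesis using A closure_circle unfolding graph_locus_u_graph by blast
  qed
  then show "(\<Union>A\<in>curves u_graph. closure (locus A)) \<subseteq> graph_locus u_graph" by blast
qed

lemma component_closure:
  assumes "K \<in> components (graph_locus u_graph)" "A \<in> curves u_graph" "closure (locus A) \<inter> K \<noteq> {}"
  shows "closure (locus A) \<subseteq> K"
proof (rule components_maximal[OF assms(1)])
  show "connected (closure (locus A))"
    using curve_facts(1)[OF u_curve[OF assms(2)]] by (rule connected_imp_connected_closure)
  show "closure (locus A) \<subseteq> graph_locus u_graph" using assms(2) unfolding locus_u_graph_closures by blast
  show "K \<inter> closure (locus A) \<noteq> {}" using assms(3) by blast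
qed

lemma locus_subset_component:
  assumes "K \<in> components (graph_locus u_graph)" "A \<in> curves u_graph" "locus A \<subseteq> K"
  shows "closure (locus A) \<subseteq> K"
  using assms curve_facts(2)[OF u_curve[OF assms(2)]] closure_subset[of "locus A"]
  by (intro component_closure) blast+

lemma graph_locus_sub_of:
  assumes K: "K \<in> components (graph_locus u_graph)"
  shows "graph_locus (sub_of K) = K"
proof -
  have gl: "graph_locus (sub_of K) = {v \<in> verts w. v \<in> K} \<union> (\<Union>A\<in>{A \<in> curves u_graph. locus A \<subseteq> K}. locus A)"
    by (auto simp: graph_locus_def sub_of_def flow_def curves_def locus_def)
  have "x \<in> graph_locus (sub_of K)" if x: "x \<in> K" for x
  proof -
    have "x \<in> graph_locus u_graph" using in_components_subset[OF K] x by blast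
    then consider "x \<in> verts w" | A where "A \<in> curves u_graph" "x \<in> locus A"
      unfolding graph_locus_u_graph by blast
    then show ?thesis
    proof cases
      case 1
      then show ?thesis using x unfolding gl by blast
    next
      case 2
      then have "closure (locus A) \<subseteq> K" using component_closure[OF K 2(1)] x closure_subset by blast
      then have "locus A \<subseteq> K" using closure_subset by blast
      then show ?thesis using 2 unfolding gl by blast
    qed
  qed
  then show ?thesis unfolding gl by blast
qed

text \<open>The other curves have a closed union of closures, by finiteness, so avoiding each of
  them makes \<open>K\<close> open and closed in the locus.\<close>

lemma clopen_curves_component:
  assumes "\<A> \<subseteq> curves u_graph" "K = (\<Union>A\<in>\<A>. closure (locus A))" "connected K" "K \<noteq> {}"
    and "\<And>B. B \<in> curves u_graph - \<A> \<Longrightarrow> closure (locus B) \<inter> K = {}"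
  shows "K \<in> components (graph_locus u_graph)"
proof (rule clopen_component[where R = "\<Union>B\<in>curves u_graph - \<A>. closure (locus B)"])
  have "finite \<A>" using assms(1) finite_u_curves finite_subset by blast
  then show "closed K" unfolding assms(2) by (intro closed_UN) auto
  show "closed (\<Union>B\<in>curves u_graph - \<A>. closure (locus B))"
    using finite_u_curves by (intro closed_UN) auto
  show "K \<inter> (\<Union>B\<in>curves u_graph - \<A>. closure (locus B)) = {}" using assms(5) by blast
  show "graph_locus u_graph = K \<union> (\<Union>B\<in>curves u_graph - \<A>. closure (locus B))"
    unfolding locus_u_graph_closures assms(2) using assms(1) by blast
qed (use assms in auto)

lemma circle_component:
  assumes "C \<in> circles u_graph"
  shows "locus C \<in> components (graph_locus u_graph)"
proof (rule clopen_curves_component[where \<A> = "{C}"])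
  note C = u_circle[OF assms]
  show "{C} \<subseteq> curves u_graph" using C by simp
  show "locus C = (\<Union>A\<in>{C}. closure (locus A))" using closure_circle C by simp
  show "connected (locus C)" "locus C \<noteq> {}" using curve_facts u_curve C by blast+
  show "closure (locus B) \<inter> locus C = {}" if "B \<in> curves u_graph - {C}" for B
    using closure_locus_disjoint[of B C] that u_curve C by blast
qed

lemma sub_of_circle:
  assumes "C \<in> circles u_graph"
  shows "sub_of (locus C) = \<lparr>verts = {}, edges = {}, circles = {C}\<rparr>"
proof -
  note C = u_circle[OF assms]
  have *: "A = C" if A: "A \<in> curves u_graph" "locus A \<subseteq> locus C" for A
  proof (rule ccontr)
    assume "A \<noteq> C"
    then have "locus A \<inter> locus C = {}" using locus_disjoint u_curve A C by blast
    then show False using A curve_facts(2)[OF u_curve[OF A(1)]] by blast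
  qed
  have "{v \<in> verts w. v \<in> locus C} = {}" using locus_verts u_curve C by blast
  moreover have "{e \<in> edges u_graph. locus e \<subseteq> locus C} = {}"
    using * u_edge C edge_not_circle by blast
  moreover have "{D \<in> circles u_graph. locus D \<subseteq> locus C} = {C}"
    using * u_circle assms by blast
  ultimately show ?thesis unfolding sub_of_def by simp
qed

lemma embedded_sub_of:
  assumes K: "K \<in> components (graph_locus u_graph)"
  shows "embedded_graph (sub_of K)"
proof -
  have "tail e \<in> K" "head e \<in> K" if "e \<in> edges u_graph" "locus e \<subseteq> K" for e
    using locus_subset_component[OF K, of e] that u_edge closure_edge by blast+
  then have "\<exists>x\<in>verts (sub_of K). \<exists>y\<in>verts (sub_of K). oriented_arc e x y" if "e \<in> edges (sub_of K)" for e
    using that edge_arc u_edge unfolding sub_of_def by simp blast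
  moreover have "curves (sub_of K) \<subseteq> curves w" by (auto simp: sub_of_def curves_def u_graph_simps)
  then have "disjoint_family_on locus (curves (sub_of K))"
    using locus_disjoint unfolding disjoint_family_on_def by blast
  moreover have "\<forall>A\<in>curves (sub_of K). locus A \<inter> verts (sub_of K) = {}"
    using locus_verts \<open>curves (sub_of K) \<subseteq> curves w\<close> unfolding sub_of_def by auto
  moreover have "finite (verts (sub_of K))" "finite (edges (sub_of K))" "finite (circles (sub_of K))"
    using finite_parts by (simp_all add: sub_of_def u_graph_simps)
  moreover have "\<forall>C\<in>circles (sub_of K). oriented_circle C"
    using circle by (simp add: sub_of_def u_graph_simps)
  ultimately show ?thesis unfolding embedded_graph_def by blast
qed

lemma proper_on_subset: "E \<subseteq> edges w \<Longrightarrow> edges Z = E \<Longrightarrow> proper_on Z c"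
  using proper unfolding proper_on_def by blast

text \<open>A component that contains a circle equals this circle. Otherwise every edge of the
  configuration at a vertex in \<open>K\<close> lies in \<open>K\<close>, as its closure is
  connected; no edge at the vertex is lost, and its degree remains 2.\<close>

lemma sub_of_in_config_cycles:
  assumes K: "K \<in> components (graph_locus u_graph)"
  shows "sub_of K \<in> config_cycles u u_graph c"
proof -
  have "subgraph (sub_of K) u_graph"
    by (auto simp: subgraph_def sub_of_def u_graph_simps)
  moreover have "c ` curves (sub_of K) \<subseteq> colors_without u"
    by (auto simp: sub_of_def curves_def u_graph_simps colors_without_def)
  moreover have "(\<exists>C. sub_of K = \<lparr>verts = {}, edges = {}, circles = {C}\<rparr>) \<or>
     (circles (sub_of K) = {} \<and> graph_locus (sub_of K) \<noteq> {} \<and> connected (graph_locus (sub_of K)) \<and>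
      regular_graph 2 (sub_of K) \<and> sinks_and_sources (sub_of K) \<and> proper_on (sub_of K) c)"
  proof (cases "\<exists>C\<in>circles u_graph. locus C \<subseteq> K")
    case True
    then obtain C where C: "C \<in> circles u_graph" "locus C \<subseteq> K" by blast
    moreover have "locus C \<noteq> {}" using curve_facts(2) u_circle[OF C(1)] u_curve by blast
    ultimately have "K = locus C" using components_nonoverlap[OF K circle_component[OF C(1)]] by blast
    then show ?thesis using sub_of_circle[OF C(1)] by blast
  next
    case False
    have ed: "edges (sub_of K) \<subseteq> edges w" by (auto simp: sub_of_def u_graph_simps)
    have "vertex_degree (sub_of K) v = 2" if v: "v \<in> verts (sub_of K)" for v
    proof -
      have vw: "v \<in> verts w" "v \<in> K" using v by (auto simp: sub_of_def)
      have "e \<in> edges (sub_of K)" if e: "e \<in> edges u_graph" "touches e v" for e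
      proof -
        have "v \<in> closure (locus e)" using vertex_in_closure_iff[of e v] vw(1) e u_edge u_curve by blast
        then have "closure (locus e) \<subseteq> K" using component_closure[OF K] u_edge e vw(2) by blast
        then show ?thesis using e closure_subset[of "locus e"] by (auto simp: sub_of_def)
      qed
      then have "{e \<in> edges (sub_of K). touches e v} = {e \<in> edges u_graph. touches e v}"
        by (auto simp: sub_of_def)
      then show ?thesis unfolding vertex_degree_def vertex_degree_touches[OF ed]
        using card_u_graph_touching[OF vw(1)] by simp
    qed
    moreover have "sinks_and_sources (sub_of K)"
      using closed_web ed unfolding closed_web_def sinks_and_sources_def is_sink_def is_source_def
      by (auto simp: sub_of_def) blast
    moreover have "proper_on (sub_of K) c" using ed proper_on_subset by blast
    moreover have "circles (sub_of K) = {}" using False by (auto simp: sub_of_def)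
    ultimately show ?thesis
      using graph_locus_sub_of[OF K] in_components_nonempty[OF K] in_components_connected[OF K]
      by (simp add: regular_graph_def)
  qed
  ultimately show ?thesis unfolding config_cycles_def colored_cycle_def using embedded_sub_of[OF K] by blast
qed

text \<open>A 2-regular subgraph already has both edges that the configuration has at each of its
  vertices. Its locus therefore avoids the closures of all other curves and, being connected, is a
  component.\<close>

lemma config_cycle_component:
  assumes Z: "Z \<in> config_cycles u u_graph c"
  shows "graph_locus Z \<in> components (graph_locus u_graph)" "Z = sub_of (graph_locus Z)"
proof -
  have sub: "verts Z \<subseteq> verts w" "edges Z \<subseteq> edges u_graph" "circles Z \<subseteq> circles u_graph"
    and cyc: "colored_cycle u Z c"
    using Z by (auto simp: config_cycles_def subgraph_def u_graph_simps)
  have gl: "graph_locus Z = verts Z \<union> (\<Union>A\<in>curves Z. locus A)"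
    by (auto simp: graph_locus_def flow_def locus_def)
  consider C where "Z = \<lparr>verts = {}, edges = {}, circles = {C}\<rparr>"
    | "circles Z = {}" "graph_locus Z \<noteq> {}" "connected (graph_locus Z)" "regular_graph 2 Z"
    using cyc unfolding colored_cycle_def by blast
  then have "graph_locus Z \<in> components (graph_locus u_graph) \<and> Z = sub_of (graph_locus Z)"
  proof cases
    case 1
    then have C: "C \<in> circles u_graph" using sub by simp
    have "graph_locus Z = locus C" unfolding gl using 1 by (simp add: curves_def)
    then show ?thesis using circle_component[OF C] sub_of_circle[OF C] 1 by simp
  next
    case 2
    have cZ: "curves Z = edges Z" using 2 by (simp add: curves_def)
    have ends: "tail e \<in> verts Z" "head e \<in> verts Z" if "e \<in> edges Z" for e
      using cyc that oriented_arc_tail_head(1,2) unfolding colored_cycle_def embedded_graph_def by metis+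
    have ed: "edges Z \<subseteq> edges w" using sub u_edge by blast
    have touch: "{e \<in> edges Z. touches e v} = {e \<in> edges u_graph. touches e v}" if v: "v \<in> verts Z" for v
    proof (rule card_subset_eq)
      show "finite {e \<in> edges u_graph. touches e v}" using finite_parts by (simp add: u_graph_simps)
      show "{e \<in> edges Z. touches e v} \<subseteq> {e \<in> edges u_graph. touches e v}" using sub by blast
      have "card {e \<in> edges Z. touches e v} = 2"
        using 2(4) v unfolding regular_graph_def vertex_degree_def vertex_degree_touches[OF ed] by blast
      then show "card {e \<in> edges Z. touches e v} = card {e \<in> edges u_graph. touches e v}"
        using card_u_graph_touching sub(1) v by auto
    qed
    have on_edge: "\<exists>e\<in>edges Z. v \<in> closure (locus e)" if v: "v \<in> verts Z" for v
    proof -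
      obtain e where e: "e \<in> edges u_graph" "v \<in> closure (locus e)" using vertex_on_u_edge sub(1) v by blast
      then have "touches e v" using vertex_in_closure_iff[of e v] sub(1) v u_edge u_curve by blast
      then show ?thesis using touch[OF v] e by blast
    qed
    have hull: "closure (locus e) \<subseteq> graph_locus Z" if "e \<in> edges Z" for e
    proof -
      have "closure (locus e) = insert (tail e) (insert (head e) (locus e))" using closure_edge ed that by blast
      then show ?thesis using ends[OF that] that unfolding gl cZ by auto
    qed
    have K: "graph_locus Z = (\<Union>A\<in>edges Z. closure (locus A))"
    proof
      show "graph_locus Z \<subseteq> (\<Union>A\<in>edges Z. closure (locus A))"
        using on_edge closure_subset unfolding gl cZ by fastforce
      show "(\<Union>A\<in>edges Z. closure (locus A)) \<subseteq> graph_locus Z" using hull by blast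
    qed
    have comp: "graph_locus Z \<in> components (graph_locus u_graph)"
    proof (rule clopen_curves_component[OF _ K 2(3,2)])
      show "edges Z \<subseteq> curves u_graph" using sub u_edge by blast
      fix B assume B: "B \<in> curves u_graph - edges Z"
      have "closure (locus B) \<inter> locus e = {}" if "e \<in> edges Z" for e
        using closure_locus_disjoint[of B e] B that u_curve sub u_edge by blast
      moreover have "v \<notin> closure (locus B)" if v: "v \<in> verts Z" for v
      proof
        assume "v \<in> closure (locus B)"
        then have "B \<in> edges w" "touches B v"
          using vertex_in_closure_iff[of B v] B v sub(1) u_curve by blast+
        then have "B \<in> {e \<in> edges u_graph. touches e v}" using B by (simp add: u_graph_simps)
        then show False using touch[OF v] B by blast
      qed
      ultimately show "closure (locus B) \<inter> graph_locus Z = {}" unfolding gl cZ by blast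
    qed
    have in_Z: "A \<in> edges Z" if A: "A \<in> curves u_graph" "locus A \<subseteq> graph_locus Z" for A
    proof (rule ccontr)
      assume "A \<notin> edges Z"
      then have "locus A \<inter> locus e = {}" if "e \<in> edges Z" for e
        using locus_disjoint[of A e] A that u_curve sub u_edge by blast
      moreover have "locus A \<inter> verts Z = {}" using locus_verts[OF u_curve[OF A(1)]] sub(1) by blast
      ultimately have "locus A = {}" using A(2) unfolding gl cZ by blast
      then show False using curve_facts(2)[OF u_curve[OF A(1)]] by blast
    qed
    have "verts (sub_of (graph_locus Z)) = verts Z"
    proof
      show "verts Z \<subseteq> verts (sub_of (graph_locus Z))" using sub(1) gl by (auto simp: sub_of_def)
      have "v \<in> verts Z" if "v \<in> verts w" "v \<in> graph_locus Z" for v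
        using that locus_verts u_curve sub u_edge unfolding gl cZ by blast
      then show "verts (sub_of (graph_locus Z)) \<subseteq> verts Z" by (auto simp: sub_of_def)
    qed
    moreover have "edges (sub_of (graph_locus Z)) = edges Z"
    proof
      show "edges Z \<subseteq> edges (sub_of (graph_locus Z))" using sub(2) unfolding gl cZ by (auto simp: sub_of_def)
      show "edges (sub_of (graph_locus Z)) \<subseteq> edges Z" using in_Z u_edge by (auto simp: sub_of_def)
    qed
    moreover have "circles (sub_of (graph_locus Z)) = circles Z"
      using in_Z u_circle ed edge_not_circle 2(1) by (auto simp: sub_of_def)
    ultimately show ?thesis using comp by (metis plane_graph.equality unit.exhaust)
  qed
  then show "graph_locus Z \<in> components (graph_locus u_graph)" "Z = sub_of (graph_locus Z)" by auto
qed

text \<open>For paths with image \<open>K\<close> the flow of the reversed subgraph and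
  \<open>u_field\<close> are interchangeable, since every curve of the configuration that meets
  \<open>K\<close> belongs to the subgraph.\<close>

lemma positively_oriented_iff:
  assumes K: "K \<in> components (graph_locus u_graph)"
  shows "positively_oriented u (sub_of K) c \<longleftrightarrow> cycle_sign u_field K = 1"
proof -
  let ?R = "reverse_greatest u (sub_of K) c"
  have gl: "graph_locus ?R = K" using graph_locus_reverse_greatest graph_locus_sub_of[OF K] by simp
  have R: "flow ?R = (\<Union>A\<in>curves (sub_of K). directed A)" by (rule flow_reverse_greatest)
  have sub: "curves (sub_of K) \<subseteq> curves u_graph" by (auto simp: sub_of_def curves_def)
  have "follows \<gamma> (flow ?R) \<longleftrightarrow> follows \<gamma> u_field" if im: "path_image \<gamma> = K" for \<gamma>
  proof
    assume "follows \<gamma> (flow ?R)"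
    then show "follows \<gamma> u_field" by (rule follows_mono) (use R sub u_field_eq in auto)
  next
    assume "follows \<gamma> u_field"
    then show "follows \<gamma> (flow ?R)"
    proof (rule follows_transfer[where X = "{}"])
      fix z v assume zv: "(z, v) \<in> u_field" "z \<in> path_image \<gamma>"
      then obtain A where A: "A \<in> curves u_graph" "(z, v) \<in> directed A" by (auto simp: u_field_eq)
      have "z \<in> locus A" using A(2) by (metis fst_conv image_eqI locus_def locus_directed)
      then have "closure (locus A) \<subseteq> K" using component_closure[OF K A(1)] zv(2) im closure_subset by blast
      then have "locus A \<subseteq> K" using closure_subset by blast
      then have "A \<in> curves (sub_of K)" using A by (auto simp: sub_of_def curves_def)
      then show "(z, v) \<in> flow ?R" using A R by blast
    qed auto
  qed
  then have "counterclockwise ?R \<longleftrightarrow> (\<exists>\<gamma>. simple_path \<gamma> \<and> pathfinish \<gamma> = pathstart \<gamma> \<and> path_image \<gamma> = K \<and>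
      follows \<gamma> u_field \<and> (\<forall>z\<in>inside K. winding_number \<gamma> z = 1))"
    unfolding counterclockwise_def traverses_def gl follows_def[symmetric] by metis
  then show ?thesis unfolding positively_oriented_def cycle_sign_def by simp
qed

text \<open>Removes graphs from the degree of a configuration: only a set and a direction field
  remain.\<close>

lemma config_degree_eq: "config_degree u u_graph c = cycle_degree (graph_locus u_graph) u_field"
proof -
  let ?CC = "config_cycles u u_graph c" and ?K = "components (graph_locus u_graph)"
  have bij: "bij_betw sub_of ?K ?CC"
    by (rule bij_betwI[where g = graph_locus])
      (use sub_of_in_config_cycles config_cycle_component graph_locus_sub_of in auto)
  have finK: "finite ?K" using loops_exist finite_components_loop_decomposition by blast
  then have fin: "finite ?CC" using bij bij_betw_finite by blast
  have "(\<Sum>Z\<in>?CC. if positively_oriented u Z c then 1 else - 1 :: int) = config_degree u u_graph c"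
    using fin by (simp add: config_degree_def sum.If_cases Int_def)
  moreover have "(\<Sum>Z\<in>?CC. if positively_oriented u Z c then 1 else - 1 :: int)
      = (\<Sum>K\<in>?K. if positively_oriented u (sub_of K) c then 1 else - 1)"
    by (rule sum.reindex_bij_betw[OF bij, symmetric])
  moreover have "\<dots> = (\<Sum>K\<in>?K. cycle_sign u_field K)"
  proof (rule sum.cong[OF refl])
    fix K assume "K \<in> ?K"
    then show "(if positively_oriented u (sub_of K) c then 1 else - 1) = cycle_sign u_field K"
      using positively_oriented_iff by (auto simp: cycle_sign_def)
  qed
  ultimately show ?thesis by (simp add: cycle_degree_def)
qed

end

section \<open>Colorings of points\<close>

definition locally_const :: "(complex \<Rightarrow> 'a) \<Rightarrow> complex set \<Rightarrow> bool" where
  "locally_const f S \<longleftrightarrow> (\<forall>a\<in>S. \<exists>T. open T \<and> a \<in> T \<and> (\<forall>x\<in>S \<inter> T. f x = f a))"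

lemma locally_const_connected:
  assumes "locally_const f S" "connected C" "C \<subseteq> S" "x \<in> C" "y \<in> C"
  shows "f x = f y"
proof -
  have "f constant_on C"
  proof (rule locally_constant_imp_constant[OF assms(2)])
    fix a assume a: "a \<in> C"
    then have "a \<in> S" using assms(3) by blast
    obtain T where T: "open T \<and> a \<in> T \<and> (\<forall>x\<in>S \<inter> T. f x = f a)"
      using bspec[OF assms(1)[unfolded locally_const_def] \<open>a \<in> S\<close>] ..
    show "\<exists>T. openin (top_of_set C) T \<and> a \<in> T \<and> (\<forall>x\<in>T. f x = f a)"
    proof (intro exI conjI ballI)
      show "openin (top_of_set C) (C \<inter> T)" using T by (intro openin_open_Int) simp
      show "a \<in> C \<inter> T" using T a by simp
      show "f x = f a" if "x \<in> C \<inter> T" for x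
        using conjunct2[OF conjunct2[OF T]] that assms(3) by (meson IntD1 IntD2 IntI bspec subsetD)
    qed
  qed
  then show ?thesis using assms(4,5) by (metis constant_on_def)
qed

lemma locally_const_subset:
  assumes "locally_const f S" "S' \<subseteq> S"
  shows "locally_const f S'"
  unfolding locally_const_def
proof
  fix a assume "a \<in> S'"
  then have "a \<in> S" using assms(2) by blast
  obtain T where T: "open T \<and> a \<in> T \<and> (\<forall>x\<in>S \<inter> T. f x = f a)"
    using bspec[OF assms(1)[unfolded locally_const_def] \<open>a \<in> S\<close>] ..
  then show "\<exists>T. open T \<and> a \<in> T \<and> (\<forall>x\<in>S' \<inter> T. f x = f a)"
    using assms(2) by (intro exI[of _ T]) auto
qed

lemma locally_const_cong: "locally_const f S \<Longrightarrow> (\<And>x. x \<in> S \<Longrightarrow> f x = g x) \<Longrightarrow> locally_const g S"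
  unfolding locally_const_def by (metis IntD1)

text \<open>At a vertex of degree three, adjacent edges have different colors if and only if the vertex is
  in the closure of every color class.\<close>

definition point_colorings :: "curve \<Rightarrow> complex set \<Rightarrow> (complex \<Rightarrow> color) set" where
  "point_colorings \<Phi> V = {f \<in> locus \<Phi> \<rightarrow>\<^sub>E UNIV. locally_const f (locus \<Phi>) \<and>
    (\<forall>v\<in>V. \<forall>k. v \<in> closure {z \<in> locus \<Phi>. f z = k})}"

text \<open>All vertices belong to the support, since at each of them two of the three edges have
  colors other than \<open>u\<close>.\<close>

definition point_support :: "color \<Rightarrow> (complex \<Rightarrow> color) \<Rightarrow> curve \<Rightarrow> complex set \<Rightarrow> complex set" where
  "point_support u f \<Phi> V = V \<union> {z \<in> locus \<Phi>. f z \<noteq> u}"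

text \<open>The minus sign undoes the reversal: at a point of the greatest color a direction belongs
  to the field if its opposite belongs to the flow.\<close>

definition point_field :: "color \<Rightarrow> (complex \<Rightarrow> color) \<Rightarrow> curve \<Rightarrow> curve" where
  "point_field u f \<Phi> =
    {(z, v). f z \<noteq> u \<and> (z, if f z = Max (colors_without u) then - v else v) \<in> \<Phi>}"

definition point_degree :: "(complex \<Rightarrow> color) \<Rightarrow> curve \<Rightarrow> complex set \<Rightarrow> int" where
  "point_degree f \<Phi> V = (\<Sum>u\<in>UNIV. cycle_degree (point_support u f \<Phi> V) (point_field u f \<Phi>))"

lemma locus_Union: "locus (\<Union>\<A>) = (\<Union>A\<in>\<A>. locus A)"
  by (simp add: locus_def image_Union)

context web
begin

definition point_coloring :: "(curve \<Rightarrow> color) \<Rightarrow> complex \<Rightarrow> color" where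
  "point_coloring c = restrict (\<lambda>z. c (THE A. A \<in> curves w \<and> z \<in> locus A)) (locus (flow w))"

lemma locus_flow: "locus (flow w) = (\<Union>A\<in>curves w. locus A)"
  by (simp add: flow_def locus_Union)

lemma point_coloring_eq:
  assumes "A \<in> curves w" "z \<in> locus A"
  shows "point_coloring c z = c A"
proof -
  have "(THE A. A \<in> curves w \<and> z \<in> locus A) = A"
    using assms locus_disjoint by (intro the_equality) blast+
  then show ?thesis using assms locus_flow by (auto simp: point_coloring_def)
qed

lemma colored_web_if_coloring: "c \<in> colorings w \<Longrightarrow> colored_web w c"
  using web_axioms by (simp add: colored_web_def colored_web_axioms_def colorings_def)

lemma point_coloring_in:
  assumes c: "c \<in> colorings w"
  shows "point_coloring c \<in> point_colorings (flow w) (verts w)"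
proof -
  have "locally_const (point_coloring c) (locus (flow w))"
    unfolding locally_const_def
  proof
    fix a assume "a \<in> locus (flow w)"
    then obtain A where A: "A \<in> curves w" "a \<in> locus A" unfolding locus_flow by blast
    \<comment> \<open>Without the closures of the finitely many other curves, a neighborhood of
      \<open>a\<close> remains in which only the curve \<open>A\<close> is seen.\<close>
    let ?T = "- (\<Union>B\<in>curves w - {A}. closure (locus B))"
    have "closed (\<Union>B\<in>curves w - {A}. closure (locus B))" using finite_parts by (intro closed_UN) auto
    then have "open ?T" by (rule open_Compl)
    moreover have "a \<in> ?T" using A closure_locus_disjoint by blast
    moreover have "point_coloring c x = point_coloring c a" if x: "x \<in> locus (flow w) \<inter> ?T" for x
    proof -
      obtain B where B: "B \<in> curves w" "x \<in> locus B" using x unfolding locus_flow by blast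
      then have "B = A" using x closure_subset by blast
      then show ?thesis using A B point_coloring_eq by metis
    qed
    ultimately show "\<exists>T. open T \<and> a \<in> T \<and> (\<forall>x\<in>locus (flow w) \<inter> T. point_coloring c x = point_coloring c a)"
      by blast
  qed
  moreover have "v \<in> closure {z \<in> locus (flow w). point_coloring c z = k}" if v: "v \<in> verts w" for v k
  proof -
    have "k \<in> c ` {e \<in> edges w. touches e v}"
      using c v proper_iff_all_colors[of c] by (simp add: colorings_def)
    then obtain e where e: "e \<in> edges w" "touches e v" "c e = k" by blast
    then have ec: "e \<in> curves w" by (simp add: curves_def)
    then have "v \<in> closure (locus e)" using vertex_in_closure_iff e v by blast
    moreover have "locus e \<subseteq> {z \<in> locus (flow w). point_coloring c z = k}"
      using point_coloring_eq[OF ec] ec e locus_flow by auto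
    ultimately show ?thesis using closure_mono by blast
  qed
  moreover have "point_coloring c \<in> locus (flow w) \<rightarrow>\<^sub>E UNIV" by (simp add: point_coloring_def)
  ultimately show ?thesis by (simp add: point_colorings_def)
qed

text \<open>A locally constant coloring is constant on each curve, because the locus of a curve is
  connected. As to properness, the class of color \<open>k\<close> lies in the closed union of the
  closures of the curves of color \<open>k\<close>, so a vertex in its closure is an end of an edge
  of that color.\<close>

lemma point_coloring_bij: "bij_betw point_coloring (colorings w) (point_colorings (flow w) (verts w))"
  unfolding bij_betw_def
proof
  show "inj_on point_coloring (colorings w)"
  proof (rule inj_onI)
    fix c c' assume c: "c \<in> colorings w" "c' \<in> colorings w" "point_coloring c = point_coloring c'"
    show "c = c'"
    proof (rule extensionalityI[of _ "curves w"])
      show "c \<in> extensional (curves w)" "c' \<in> extensional (curves w)"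
        using c by (auto simp: colorings_def PiE_def)
      fix A assume A: "A \<in> curves w"
      then obtain z where "z \<in> locus A" using curve_facts(2) by blast
      then show "c A = c' A" using point_coloring_eq[OF A] c(3) by metis
    qed
  qed
  show "point_coloring ` colorings w = point_colorings (flow w) (verts w)"
  proof
    show "point_coloring ` colorings w \<subseteq> point_colorings (flow w) (verts w)" using point_coloring_in by blast
    show "point_colorings (flow w) (verts w) \<subseteq> point_coloring ` colorings w"
    proof
      fix f assume f: "f \<in> point_colorings (flow w) (verts w)"
      define c where "c = restrict (\<lambda>A. f (SOME z. z \<in> locus A)) (curves w)"
      have fc: "f z = c A" if A: "A \<in> curves w" "z \<in> locus A" for A z
      proof -
        have some: "(SOME z. z \<in> locus A) \<in> locus A" using A by (metis someI)
        have lc: "locally_const f (locus (flow w))" using f by (simp add: point_colorings_def)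
        have "locus A \<subseteq> locus (flow w)" using A locus_flow by blast
        then have "f z = f (SOME z. z \<in> locus A)"
          using locally_const_connected[OF lc curve_facts(1)[OF A(1)] _ A(2) some] by blast
        then show ?thesis using A(1) by (simp add: c_def)
      qed
      have "point_coloring c = f"
      proof (rule extensionalityI[of _ "locus (flow w)"])
        show "point_coloring c \<in> extensional (locus (flow w))" by (simp add: point_coloring_def)
        show "f \<in> extensional (locus (flow w))" using f by (simp add: point_colorings_def PiE_def)
        fix z assume "z \<in> locus (flow w)"
        then obtain A where "A \<in> curves w" "z \<in> locus A" unfolding locus_flow by blast
        then show "point_coloring c z = f z" using point_coloring_eq fc by metis
      qed
      moreover have "c \<in> colorings w"
      proof -
        have "c ` {e \<in> edges w. touches e v} = UNIV" if v: "v \<in> verts w" for v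
        proof -
          have "k \<in> c ` {e \<in> edges w. touches e v}" for k
          proof -
            have "{z \<in> locus (flow w). f z = k} \<subseteq> (\<Union>A\<in>{A \<in> curves w. c A = k}. closure (locus A))"
            proof
              fix z assume z: "z \<in> {z \<in> locus (flow w). f z = k}"
              then obtain A where A: "A \<in> curves w" "z \<in> locus A" unfolding locus_flow by blast
              then have "c A = k" using fc z by auto
              then show "z \<in> (\<Union>A\<in>{A \<in> curves w. c A = k}. closure (locus A))" using A closure_subset by blast
            qed
            moreover have "closed (\<Union>A\<in>{A \<in> curves w. c A = k}. closure (locus A))"
              using finite_parts by (intro closed_UN) auto
            ultimately have "closure {z \<in> locus (flow w). f z = k} \<subseteq> (\<Union>A\<in>{A \<in> curves w. c A = k}. closure (locus A))"
              by (rule closure_minimal)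
            moreover have "v \<in> closure {z \<in> locus (flow w). f z = k}" using f v by (simp add: point_colorings_def)
            ultimately obtain A where "A \<in> curves w" "c A = k" "v \<in> closure (locus A)" by blast
            then show ?thesis using vertex_in_closure_iff v by blast
          qed
          then show ?thesis by blast
        qed
        then have "proper_on w c" using proper_iff_all_colors by blast
        then show ?thesis by (simp add: colorings_def c_def)
      qed
      ultimately show "f \<in> point_coloring ` colorings w" by blast
    qed
  qed
qed

lemma finite_colorings: "finite (colorings w)"
proof -
  have "finite (curves w \<rightarrow>\<^sub>E (UNIV :: color set))" using finite_parts by (intro finite_PiE) auto
  then show ?thesis by (rule rev_finite_subset) (auto simp: colorings_def)
qed

lemma finite_point_colorings: "finite (point_colorings (flow w) (verts w))"
  using finite_colorings point_coloring_bij bij_betw_finite by blast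

lemma point_support_eq:
  assumes "c \<in> colorings w"
  shows "point_support u (point_coloring c) (flow w) (verts w) = graph_locus (delete_color u w c)"
proof -
  interpret colored_web w c u using colored_web_if_coloring[OF assms] .
  have "{z \<in> locus (flow w). point_coloring c z \<noteq> u} = (\<Union>A\<in>curves u_graph. locus A)"
    unfolding locus_flow u_graph_simps using point_coloring_eq by fastforce
  then show ?thesis using graph_locus_u_graph by (simp add: point_support_def u_graph_def)
qed

lemma point_field_eq:
  assumes "c \<in> colorings w"
  shows "point_field u (point_coloring c) (flow w) = colored_web.u_field w c u"
proof -
  interpret colored_web w c u using colored_web_if_coloring[OF assms] .
  have in_locus: "z \<in> locus A" if "(z, v) \<in> A" for z v A using that by (force simp: locus_def)
  have "(z, v) \<in> point_field u (point_coloring c) (flow w) \<longleftrightarrow> (z, v) \<in> u_field" for z v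
  proof
    assume zv: "(z, v) \<in> point_field u (point_coloring c) (flow w)"
    let ?v = "if point_coloring c z = Max (colors_without u) then - v else v"
    have p: "point_coloring c z \<noteq> u" "(z, ?v) \<in> flow w" using zv by (simp_all add: point_field_def)
    then obtain A where A: "A \<in> curves w" "(z, ?v) \<in> A" by (auto simp: flow_def)
    have "point_coloring c z = c A" using point_coloring_eq[OF A(1) in_locus[OF A(2)]] .
    then have "A \<in> curves u_graph" "(z, v) \<in> directed A"
      using p A by (auto simp: u_graph_simps directed_def reverse_curve_iff split: if_splits)
    then show "(z, v) \<in> u_field" unfolding u_field_eq by blast
  next
    assume "(z, v) \<in> u_field"
    then obtain A where A: "A \<in> curves u_graph" "(z, v) \<in> directed A" unfolding u_field_eq by blast
    have "z \<in> locus A" using in_locus[OF A(2)] by simp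
    then have "point_coloring c z = c A" using point_coloring_eq A(1) by (simp add: u_graph_simps)
    then show "(z, v) \<in> point_field u (point_coloring c) (flow w)"
      using A by (auto simp: point_field_def u_graph_simps directed_def reverse_curve_iff flow_def split: if_splits)
  qed
  then show ?thesis by auto
qed

lemma total_degree_eq:
  assumes "c \<in> colorings w"
  shows "total_degree w c = point_degree (point_coloring c) (flow w) (verts w)"
  unfolding total_degree_def point_degree_def
proof (rule sum.cong[OF refl])
  fix u
  interpret colored_web w c u using colored_web_if_coloring[OF assms] .
  show "config_degree u (delete_color u w c) c = cycle_degree (point_support u (point_coloring c) (flow w) (verts w))
      (point_field u (point_coloring c) (flow w))"
    using config_degree_eq point_support_eq[OF assms] point_field_eq[OF assms] by (simp add: u_graph_def)
qed

text \<open>From here on the webs that differ in a disc can be compared without their edges: only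
  flow and vertices enter.\<close>

lemma bracket_eq: "bracket w = (\<Sum>f\<in>point_colorings (flow w) (verts w). qpow (point_degree f (flow w) (verts w)))"
  unfolding bracket_def sum.reindex_bij_betw[OF point_coloring_bij, symmetric]
  using total_degree_eq by (intro sum.cong) auto

lemma point_coloring_loops:
  assumes "f \<in> point_colorings (flow w) (verts w)"
  shows "\<exists>\<Gamma>. loop_decomposition \<Gamma> (point_support u f (flow w) (verts w)) (point_field u f (flow w))"
    "direction_field (point_field u f (flow w))"
proof -
  obtain c where c: "c \<in> colorings w" "f = point_coloring c"
    using assms point_coloring_bij unfolding bij_betw_def by blast
  interpret colored_web w c u using colored_web_if_coloring[OF c(1)] .
  show "\<exists>\<Gamma>. loop_decomposition \<Gamma> (point_support u f (flow w) (verts w)) (point_field u f (flow w))"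
    "direction_field (point_field u f (flow w))"
    using loops_exist direction_field_u_field point_support_eq[OF c(1)] point_field_eq[OF c(1)] c(2)
    by (simp_all add: u_graph_def)
qed

end

section \<open>The circle relation and multiplicativity\<close>

lemma quantum_int_2: "quantum_int 2 = qpow 1 + qpow (- 1)"
  by (rule quantum_int_unique) (simp add: algebra_simps flip: qpow_add)

lemma quantum_int_3: "quantum_int 3 = qpow 2 + 1 + qpow (- 2)"
  by (rule quantum_int_unique) (simp add: algebra_simps flip: qpow_add qpow_0)

lemma sum_color: "(\<Sum>k\<in>(UNIV :: color set). f k) = f Red + (f Green + f Blue)"
  by (simp add: UNIV_color)

lemma Max_color: "Max (colors_without Red) = Blue" "Max (colors_without Green) = Blue"
  "Max (colors_without Blue) = Green"
proof -
  have s: "colors_without Red = {Green, Blue}" "colors_without Green = {Red, Blue}"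
    "colors_without Blue = {Red, Green}"
    by (auto simp: colors_without_def UNIV_color)
  have o: "Green \<le> Blue" "Red \<le> Blue" "Red \<le> Green" by (auto simp: less_eq_color_def)
  show "Max (colors_without Red) = Blue" "Max (colors_without Green) = Blue" "Max (colors_without Blue) = Green"
    unfolding s using o by (simp_all add: max_absorb2)
qed

text \<open>Red is never the greatest of two colors, blue always is, and green is so only when blue
  is excluded. For a circle of sign \<open>s\<close> the total degrees are therefore
  \<open>2 * s\<close>, 0 and \<open>- 2 * s\<close>, and the sum of the three powers is the same
  for both signs.\<close>

lemma bracket_circle:
  assumes "closed_web w" "w = \<lparr>verts = {}, edges = {}, circles = {C}\<rparr>"
  shows "bracket w = quantum_int 3"
proof -
  interpret web w using assms(1) by unfold_locales
  have cur: "curves w = {C}" using assms(2) by (simp add: curves_def)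
  obtain \<gamma> where \<gamma>: "simple_loop \<gamma>" "follows \<gamma> C" "path_image \<gamma> = locus C"
    by (rule oriented_circle_loop[OF circle, of C]) (use assms(2) in auto)
  define s where "s = loop_sign \<gamma>"
  have deg: "config_degree u (delete_color u w c) c =
      (if c C = u then 0 else if c C = Max (colors_without u) then - s else s)"
    if c: "c \<in> colorings w" for c u
  proof -
    interpret colored_web w c u using colored_web_if_coloring[OF c] .
    have M: "graph_locus u_graph = (if c C = u then {} else locus C)"
      unfolding graph_locus_u_graph u_graph_simps cur using assms(2) by auto
    have F: "u_field = directed C" if "c C \<noteq> u"
    proof -
      have "curves u_graph = {C}" using that cur by (auto simp: u_graph_simps)
      then show ?thesis by (simp add: u_field_eq)
    qed
    have "config_degree u u_graph c = (if c C = u then 0 else if c C = Max (colors_without u) then - s else s)"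
    proof (cases "c C = u")
      case True
      then show ?thesis unfolding config_degree_eq M by (simp add: cycle_degree_def)
    next
      case False
      define \<delta> where "\<delta> = (if c C = Max (colors_without u) then reversepath \<gamma> else \<gamma>)"
      have \<delta>: "simple_loop \<delta>" "follows \<delta> u_field" "path_image \<delta> = locus C"
        "loop_sign \<delta> = (if c C = Max (colors_without u) then - s else s)"
        using \<gamma> F[OF False] by (auto simp: \<delta>_def directed_def simple_loop_reversepath follows_reversepath
            loop_sign_reversepath s_def)
      have "components (locus C) = {locus C}"
        using connected_path_image[OF simple_loop_imp_path[OF \<delta>(1)]] \<delta>(3) path_image_nonempty[of \<delta>]
        by (simp add: components_eq_sing_iff)
      then have "cycle_degree (locus C) u_field = loop_sign \<delta>"
        using cycle_sign_path_image[OF \<delta>(1,2) direction_field_u_field] \<delta>(3) by (simp add: cycle_degree_def)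
      then show ?thesis unfolding config_degree_eq M using False \<delta>(4) by simp
    qed
    then show ?thesis by (simp add: u_graph_def)
  qed
  have col: "colorings w = (\<lambda>k. \<lambda>A\<in>{C}. k) ` UNIV"
  proof
    show "colorings w \<subseteq> (\<lambda>k. \<lambda>A\<in>{C}. k) ` UNIV"
    proof
      fix c assume "c \<in> colorings w"
      then have "c \<in> extensional {C}" by (simp add: colorings_def cur PiE_def)
      then have "c = (\<lambda>A\<in>{C}. c C)" by (intro extensionalityI[of _ "{C}"]) auto
      then show "c \<in> (\<lambda>k. \<lambda>A\<in>{C}. k) ` UNIV" by blast
    qed
    have "proper_on w c" for c using assms(2) by (simp add: proper_on_def)
    then show "(\<lambda>k. \<lambda>A\<in>{C}. k) ` UNIV \<subseteq> colorings w"
      unfolding colorings_def cur by (simp add: image_subset_iff)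
  qed
  have inj: "inj (\<lambda>k::color. \<lambda>A\<in>{C}. k)"
    by (rule injI) (metis restrict_apply singletonI)
  have td: "total_degree w (\<lambda>A\<in>{C}. k) = (case k of Red \<Rightarrow> 2 * s | Green \<Rightarrow> 0 | Blue \<Rightarrow> - 2 * s)" for k
  proof -
    have "(\<lambda>A\<in>{C}. k) \<in> colorings w" using col by blast
    then show ?thesis unfolding total_degree_def sum_color
      by (simp add: deg Max_color) (cases k, auto)
  qed
  have "bracket w = (\<Sum>k\<in>UNIV. qpow (total_degree w (\<lambda>A\<in>{C}. k)))"
    unfolding bracket_def col by (simp add: sum.reindex[OF inj])
  also have "\<dots> = qpow (2 * s) + (qpow 0 + qpow (- 2 * s))" unfolding td sum_color by simp
  also have "\<dots> = quantum_int 3"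
    using loop_sign_cases[of \<gamma>] unfolding quantum_int_3 qpow_0 s_def by auto
  finally show ?thesis .
qed

text \<open>For each color the two configurations have disjoint closed loci, so no component meets
  both, and the degrees add. No edge of one web touches a vertex of the other, so the colorings of
  the union correspond to pairs of colorings.\<close>

lemma bracket_disjoint_union:
  assumes "closed_web w" "closed_web w1" "closed_web w2" "disjoint_union w w1 w2"
  shows "bracket w = bracket w1 * bracket w2"
proof -
  interpret w: web w using assms(1) by unfold_locales
  interpret w1: web w1 using assms(2) by unfold_locales
  interpret w2: web w2 using assms(3) by unfold_locales
  have gl: "graph_locus w1 \<inter> graph_locus w2 = {}" and V: "verts w = verts w1 \<union> verts w2"
    and E: "edges w = edges w1 \<union> edges w2" and C: "circles w = circles w1 \<union> circles w2"
    using assms(4) by (auto simp: disjoint_union_def)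
  have cur: "curves w = curves w1 \<union> curves w2" using E C by (auto simp: curves_def)
  have sub: "locus A \<subseteq> graph_locus w1" if "A \<in> curves w1" for A
    using that w1.locus_flow by (auto simp: graph_locus_def)
  have sub2: "locus A \<subseteq> graph_locus w2" if "A \<in> curves w2" for A
    using that w2.locus_flow by (auto simp: graph_locus_def)
  have disj: "curves w1 \<inter> curves w2 = {}"
    using sub sub2 gl w1.curve_facts(2) by fastforce
  have Vd: "verts w1 \<inter> verts w2 = {}" using gl by (auto simp: graph_locus_def)
  have t1: "{e \<in> edges w. touches e v} = {e \<in> edges w1. touches e v}" if "v \<in> verts w1" for v
    using that Vd w2.edge_arc unfolding E touches_def by blast
  have t2: "{e \<in> edges w. touches e v} = {e \<in> edges w2. touches e v}" if "v \<in> verts w2" for v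
    using that Vd w1.edge_arc unfolding E touches_def by blast
  have pr: "proper_on w c \<longleftrightarrow> proper_on w1 c \<and> proper_on w2 c" for c
    unfolding w.proper_iff w1.proper_iff w2.proper_iff V by (simp add: ball_Un t1 t2)
  have prop1: "proper_on w1 c \<longleftrightarrow> proper_on w1 c'" if "\<And>A. A \<in> curves w1 \<Longrightarrow> c A = c' A" for c c'
    using that unfolding proper_on_def curves_def by auto
  have prop2: "proper_on w2 c \<longleftrightarrow> proper_on w2 c'" if "\<And>A. A \<in> curves w2 \<Longrightarrow> c A = c' A" for c c'
    using that unfolding proper_on_def curves_def by auto
  have deg: "total_degree w c = total_degree w1 c1 + total_degree w2 c2"
    if c: "c \<in> colorings w" "c1 \<in> colorings w1" "c2 \<in> colorings w2"
      and e1: "\<And>A. A \<in> curves w1 \<Longrightarrow> c1 A = c A" and e2: "\<And>A. A \<in> curves w2 \<Longrightarrow> c2 A = c A" for c c1 c2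
    unfolding total_degree_def sum.distrib[symmetric]
  proof (rule sum.cong[OF refl])
    fix u
    interpret a: colored_web w c u using w.colored_web_if_coloring[OF c(1)] .
    interpret a1: colored_web w1 c1 u using w1.colored_web_if_coloring[OF c(2)] .
    interpret a2: colored_web w2 c2 u using w2.colored_web_if_coloring[OF c(3)] .
    have uc: "curves a.u_graph = curves a1.u_graph \<union> curves a2.u_graph"
      unfolding a.u_graph_simps a1.u_graph_simps a2.u_graph_simps cur using e1 e2 by auto
    have M: "graph_locus a.u_graph = graph_locus a1.u_graph \<union> graph_locus a2.u_graph"
      unfolding a.graph_locus_u_graph a1.graph_locus_u_graph a2.graph_locus_u_graph V uc by blast
    have s1: "graph_locus a1.u_graph \<subseteq> graph_locus w1"
      using sub unfolding a1.graph_locus_u_graph a1.u_graph_simps by (auto simp: graph_locus_def)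
    have s2: "graph_locus a2.u_graph \<subseteq> graph_locus w2"
      using sub2 unfolding a2.graph_locus_u_graph a2.u_graph_simps by (auto simp: graph_locus_def)
    have cl1: "closed (graph_locus a1.u_graph)"
      unfolding a1.locus_u_graph_closures using a1.finite_u_curves by (intro closed_UN) auto
    have cl2: "closed (graph_locus a2.u_graph)"
      unfolding a2.locus_u_graph_closures using a2.finite_u_curves by (intro closed_UN) auto
    have dir1: "a.directed A = a1.directed A" if "A \<in> curves a1.u_graph" for A
      using that e1 by (simp add: a.directed_def a1.directed_def a1.u_graph_simps)
    have dir2: "a.directed A = a2.directed A" if "A \<in> curves a2.u_graph" for A
      using that e2 by (simp add: a.directed_def a2.directed_def a2.u_graph_simps)
    have F: "a.u_field = a1.u_field \<union> a2.u_field"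
      unfolding a.u_field_eq a1.u_field_eq a2.u_field_eq uc using dir1 dir2 by auto
    have f1: "z \<in> graph_locus w1" if zv: "(z, v) \<in> a1.u_field" for z v
    proof -
      obtain A where A: "A \<in> curves a1.u_graph" "(z, v) \<in> a1.directed A" using zv by (auto simp: a1.u_field_eq)
      have "z \<in> locus A" using A(2) by (metis a1.locus_directed fst_conv image_eqI locus_def)
      then show ?thesis using sub A(1) by (auto simp: a1.u_graph_simps)
    qed
    have f2: "z \<in> graph_locus w2" if zv: "(z, v) \<in> a2.u_field" for z v
    proof -
      obtain A where A: "A \<in> curves a2.u_graph" "(z, v) \<in> a2.directed A" using zv by (auto simp: a2.u_field_eq)
      have "z \<in> locus A" using A(2) by (metis a2.locus_directed fst_conv image_eqI locus_def)
      then show ?thesis using sub2 A(1) by (auto simp: a2.u_graph_simps)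
    qed
    have "finite (components (graph_locus a.u_graph))"
      using a.loops_exist finite_components_loop_decomposition by blast
    then have "cycle_degree (graph_locus a.u_graph) a.u_field
        = cycle_degree (graph_locus a1.u_graph) a.u_field + cycle_degree (graph_locus a2.u_graph) a.u_field"
      unfolding M using s1 s2 gl by (intro cycle_degree_Un cl1 cl2) auto
    moreover have "cycle_degree (graph_locus a1.u_graph) a.u_field = cycle_degree (graph_locus a1.u_graph) a1.u_field"
      by (intro cycle_degree_cong) (use F f2 s1 gl in blast)
    moreover have "cycle_degree (graph_locus a2.u_graph) a.u_field = cycle_degree (graph_locus a2.u_graph) a2.u_field"
      by (intro cycle_degree_cong) (use F f1 s2 gl in blast)
    ultimately show "config_degree u (delete_color u w c) c =
        config_degree u (delete_color u w1 c1) c1 + config_degree u (delete_color u w2 c2) c2"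
      using a.config_degree_eq a1.config_degree_eq a2.config_degree_eq
      by (simp add: a.u_graph_def a1.u_graph_def a2.u_graph_def)
  qed
  define glue where "glue = (\<lambda>(c1, c2) A. if A \<in> curves w1 then c1 A else c2 A :: color)"
  define split where "split = (\<lambda>c :: curve \<Rightarrow> color. (restrict c (curves w1), restrict c (curves w2)))"
  have glue_in: "glue (c1, c2) \<in> colorings w" if c: "c1 \<in> colorings w1" "c2 \<in> colorings w2" for c1 c2
  proof -
    have "proper_on w1 (glue (c1, c2))" using prop1[of "glue (c1, c2)" c1] c by (simp add: colorings_def glue_def)
    moreover have "proper_on w2 (glue (c1, c2))"
    proof -
      have "glue (c1, c2) A = c2 A" if "A \<in> curves w2" for A using that disj by (auto simp: glue_def)
      then show ?thesis using prop2[of "glue (c1, c2)" c2] c by (simp add: colorings_def)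
    qed
    moreover have "glue (c1, c2) \<in> curves w \<rightarrow>\<^sub>E UNIV"
      using c unfolding cur by (auto simp: colorings_def glue_def PiE_def extensional_def)
    ultimately show ?thesis using pr by (simp add: colorings_def)
  qed
  have split_in: "split c \<in> colorings w1 \<times> colorings w2" if c: "c \<in> colorings w" for c
  proof -
    have "proper_on w1 (restrict c (curves w1))" "proper_on w2 (restrict c (curves w2))"
      using prop1[of "restrict c (curves w1)" c] prop2[of "restrict c (curves w2)" c] c pr[of c]
      by (auto simp: colorings_def)
    then show ?thesis by (simp add: split_def colorings_def)
  qed
  have "(\<Sum>c\<in>colorings w. qpow (total_degree w c)) =
      (\<Sum>p\<in>colorings w1 \<times> colorings w2. qpow (total_degree w1 (fst p)) * qpow (total_degree w2 (snd p)))"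
  proof (rule sum.reindex_bij_witness[where i = glue and j = split])
    fix c assume c: "c \<in> colorings w"
    show "split c \<in> colorings w1 \<times> colorings w2" using split_in c .
    have "c \<in> extensional (curves w)" using c by (simp add: colorings_def PiE_def)
    then show "glue (split c) = c"
      unfolding cur by (auto simp: glue_def split_def extensional_def fun_eq_iff)
    have "total_degree w c = total_degree w1 (fst (split c)) + total_degree w2 (snd (split c))"
      using split_in[OF c] by (intro deg[OF c]) (auto simp: split_def)
    then show "qpow (total_degree w1 (fst (split c))) * qpow (total_degree w2 (snd (split c))) = qpow (total_degree w c)"
      by (simp add: qpow_add)
  next
    fix p assume p: "p \<in> colorings w1 \<times> colorings w2"
    then show "glue p \<in> colorings w" using glue_in by auto
    obtain c1 c2 where p12: "p = (c1, c2)" "c1 \<in> extensional (curves w1)" "c2 \<in> extensional (curves w2)"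
      using p by (auto simp: colorings_def PiE_def)
    show "split (glue p) = p"
      unfolding p12(1) split_def glue_def
    proof (simp, intro conjI)
      show "restrict (\<lambda>A. if A \<in> curves w1 then c1 A else c2 A) (curves w1) = c1"
        using p12(2) by (auto simp: extensional_def fun_eq_iff)
      show "restrict (\<lambda>A. if A \<in> curves w1 then c1 A else c2 A) (curves w2) = c2"
        using p12(3) disj by (auto simp: extensional_def fun_eq_iff)
    qed
  qed
  also have "\<dots> = bracket w1 * bracket w2"
    unfolding bracket_def sum_product sum.cartesian_product by (simp add: case_prod_unfold)
  finally show ?thesis by (simp add: bracket_def)
qed

section \<open>Webs cut along a disc\<close>

text \<open>The conditions of \<open>point_colorings\<close> for an arbitrary set of points: what
  lies outside a disc is not the locus of a web, as curves are cut at the boundary. Webs that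
  coincide outside the disc have literally the same outer colorings.\<close>

definition outer_colorings :: "complex set \<Rightarrow> complex set \<Rightarrow> (complex \<Rightarrow> color) set" where
  "outer_colorings X V = {g \<in> X \<rightarrow>\<^sub>E UNIV. locally_const g X \<and> (\<forall>v\<in>V. \<forall>c. v \<in> closure {z \<in> X. g z = c})}"

text \<open>Strands are numbered by their position in \<open>ends\<close>, so that a coloring of the
  inside is a function on an initial segment of the natural numbers.\<close>

locale web_disc = web +
  fixes D P V :: "complex set" and ends :: "(complex \<times> complex) list" and As :: "curve list"
  assumes disc: "topological_disc D"
    and P: "graph_locus w \<inter> frontier D = P" and V: "verts w \<inter> D = V" "V \<subseteq> interior D"
    and arcs: "list_all2 (\<lambda>A (x, y). oriented_arc A x y) As ends"
    and disjoint_arcs: "disjoint_family_on (\<lambda>i. locus (As ! i)) {..<length As}"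
    and inner: "{x \<in> flow w. fst x \<in> interior D} = \<Union> (set As)"
    and ends: "(\<Union>(x, y)\<in>set ends. {x, y}) = V \<union> P"
begin

definition "src i = fst (ends ! i)"
definition "tgt i = snd (ends ! i)"
text \<open>Only the interior is removed, so the cut points \<open>P\<close> belong to
  \<open>outer\<close> and carry the colors that the strands have to match.\<close>

definition "outer = locus (flow w) - interior D"

definition strand :: "nat \<Rightarrow> real \<Rightarrow> complex" where
  "strand i = (SOME p. arc p \<and> pathstart p = src i \<and> pathfinish p = tgt i \<and> follows p (As ! i) \<and>
     path_image p = closure (locus (As ! i)))"

definition strand_colorings :: "(complex \<Rightarrow> color) \<Rightarrow> (nat \<Rightarrow> color) set" where
  "strand_colorings g = {k \<in> {..<length ends} \<rightarrow>\<^sub>E UNIV.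
    (\<forall>i<length ends. \<forall>e\<in>{src i, tgt i} \<inter> P. g e = k i) \<and>
    (\<forall>v\<in>V. k ` {i. i < length ends \<and> v \<in> {src i, tgt i}} = UNIV)}"

definition glue :: "(complex \<Rightarrow> color) \<Rightarrow> (nat \<Rightarrow> color) \<Rightarrow> complex \<Rightarrow> color" where
  "glue g k = restrict (\<lambda>z. if z \<in> outer then g z else k (THE i. i < length ends \<and> z \<in> locus (As ! i)))
     (locus (flow w))"

lemma oriented: "i < length ends \<Longrightarrow> oriented_arc (As ! i) (src i) (tgt i)"
  using arcs list_all2_nthD2 by (fastforce simp: src_def tgt_def split: prod.splits)

lemma length_As [simp]: "length As = length ends"
  using arcs list_all2_lengthD by blast

lemma strand_facts:
  assumes "i < length ends"
  shows "arc (strand i)" "pathstart (strand i) = src i" "pathfinish (strand i) = tgt i"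
    "follows (strand i) (As ! i)" "path_image (strand i) = closure (locus (As ! i))"
proof -
  obtain p where "arc p" "pathstart p = src i" "pathfinish p = tgt i" "follows p (As ! i)"
    "path_image p = closure (locus (As ! i))"
    by (rule oriented_arc_path[OF oriented[OF assms]])
  then have "\<exists>p. arc p \<and> pathstart p = src i \<and> pathfinish p = tgt i \<and> follows p (As ! i) \<and>
     path_image p = closure (locus (As ! i))" by blast
  from someI_ex[OF this, folded strand_def]
  show "arc (strand i)" "pathstart (strand i) = src i" "pathfinish (strand i) = tgt i"
    "follows (strand i) (As ! i)" "path_image (strand i) = closure (locus (As ! i))" by blast+
qed

lemma arc_locus_facts:
  assumes "i < length ends"
  shows "closure (locus (As ! i)) = insert (src i) (insert (tgt i) (locus (As ! i)))"
    "connected (locus (As ! i))" "locus (As ! i) \<noteq> {}"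
  by (rule oriented_arc_path[OF oriented[OF assms]], simp)+

lemma ends_in:
  assumes "i < length ends" shows "src i \<in> V \<union> P" "tgt i \<in> V \<union> P"
proof -
  have "ends ! i \<in> set ends" using assms by simp
  then have "{fst (ends ! i), snd (ends ! i)} \<subseteq> (\<Union>(x, y)\<in>set ends. {x, y})"
    by (intro UN_upper[of "ends ! i" "set ends" "\<lambda>(x, y). {x, y}", THEN subset_trans[rotated]])
      (auto split: prod.splits)
  then show "src i \<in> V \<union> P" "tgt i \<in> V \<union> P" unfolding ends src_def tgt_def by auto
qed

lemma end_exists:
  assumes "p \<in> V \<union> P" obtains i where "i < length ends" "p \<in> {src i, tgt i}"
proof -
  obtain x y where "(x, y) \<in> set ends" "p \<in> {x, y}" using assms unfolding ends[symmetric] by auto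
  then obtain i where "i < length ends" "ends ! i = (x, y)" by (metis in_set_conv_nth)
  then show ?thesis using that \<open>p \<in> {x, y}\<close> by (simp add: src_def tgt_def)
qed

lemma closed_disc: "closed D"
  using disc by (simp add: topological_disc_def compact_imp_closed)

lemma frontier_subset: "frontier D \<subseteq> D"
  using closed_disc by (rule frontier_subset_closed)

lemma D_eq: "D = interior D \<union> frontier D"
  using closed_disc interior_subset[of D] by (auto simp: frontier_def)

lemma P_frontier: "P \<subseteq> frontier D"
  using P by blast

lemma verts_flow: "verts w \<inter> locus (flow w) = {}"
  using locus_verts unfolding locus_flow by blast

lemma P_flow: "P \<subseteq> locus (flow w)"
proof
  fix p assume p: "p \<in> P"
  then have "p \<in> frontier D" "p \<in> graph_locus w" using P by auto
  moreover have "p \<notin> verts w"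
    using V p P_frontier frontier_subset interior_frontier_disjoint[of D] by blast
  ultimately show "p \<in> locus (flow w)" by (simp add: graph_locus_def)
qed

lemma outer_disc: "outer \<inter> D = P"
proof -
  have "outer \<inter> D = locus (flow w) \<inter> frontier D"
    using D_eq interior_frontier_disjoint[of D] unfolding outer_def by blast
  also have "\<dots> = P" using P P_flow unfolding graph_locus_def by blast
  finally show ?thesis .
qed

lemma outer_eq: "outer = (locus (flow w) - D) \<union> P"
  using outer_disc P_flow interior_subset unfolding outer_def by blast

lemma inner_locus: "locus (flow w) \<inter> interior D = (\<Union>i<length ends. locus (As ! i))"
proof -
  have "locus (flow w) \<inter> interior D = locus {x \<in> flow w. fst x \<in> interior D}"
    by (auto simp: locus_def)
  also have "\<dots> = (\<Union>A\<in>set As. locus A)" unfolding inner locus_Union ..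
  also have "\<dots> = (\<Union>i<length ends. locus (As ! i))"
  proof -
    have "set As = (\<lambda>i. As ! i) ` {..<length ends}" by (auto simp: set_conv_nth)
    then show ?thesis by simp
  qed
  finally show ?thesis .
qed

lemma arc_interior: "i < length ends \<Longrightarrow> locus (As ! i) \<subseteq> interior D \<inter> locus (flow w)"
  using inner_locus by blast

lemma arc_unique: "i < length ends \<Longrightarrow> j < length ends \<Longrightarrow> z \<in> locus (As ! i) \<Longrightarrow> z \<in> locus (As ! j) \<Longrightarrow> i = j"
  using disjoint_arcs unfolding disjoint_family_on_def by auto

lemma ends_not_in_arc:
  assumes "i < length ends" "p \<in> V \<union> P" shows "p \<notin> locus (As ! i)"
  using arc_interior[OF assms(1)] assms(2) P_frontier interior_frontier_disjoint[of D] verts_flow V by blast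

lemma flow_cases:
  assumes "z \<in> locus (flow w)"
  obtains "z \<in> outer" | i where "i < length ends" "z \<in> locus (As ! i)" "z \<notin> outer"
  using assms inner_locus unfolding outer_def by blast

lemma glue_outer: "z \<in> outer \<Longrightarrow> glue g k z = g z"
  by (simp add: glue_def outer_def)

lemma glue_arc:
  assumes "i < length ends" "z \<in> locus (As ! i)"
  shows "glue g k z = k i"
proof -
  have "z \<in> locus (flow w)" "z \<notin> outer" using arc_interior assms unfolding outer_def by blast+
  moreover have "(THE i. i < length ends \<and> z \<in> locus (As ! i)) = i"
    using assms arc_unique by (intro the_equality) blast+
  ultimately show ?thesis by (simp add: glue_def)
qed

lemma closed_arcs: "closed (\<Union>j\<in>J \<inter> {..<length ends}. closure (locus (As ! j)))"
  by (intro closed_UN) auto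

text \<open>The point is local constancy where the two parts meet. Near a cut point only the strands
  ending there come close, and these have its color. A point off \<open>D\<close> has a neighborhood
  that avoids the disc, and a point of a strand has one that avoids the closures of the other
  strands.\<close>

lemma glue_in:
  assumes g: "g \<in> outer_colorings outer (verts w - D)" and k: "k \<in> strand_colorings g"
  shows "glue g k \<in> point_colorings (flow w) (verts w)"
proof -
  let ?n = "length ends"
  have lcg: "locally_const g outer" using g by (simp add: outer_colorings_def)
  have kP: "g e = k i" if "i < ?n" "e \<in> {src i, tgt i}" "e \<in> P" for i e
    using k that unfolding strand_colorings_def by blast
  have "locally_const (glue g k) (locus (flow w))"
    unfolding locally_const_def
  proof
    fix a assume a: "a \<in> locus (flow w)"
    show "\<exists>T. open T \<and> a \<in> T \<and> (\<forall>x\<in>locus (flow w) \<inter> T. glue g k x = glue g k a)"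
      using a
    proof (cases rule: flow_cases)
      case (2 i)
      let ?T = "interior D \<inter> - (\<Union>j\<in>(- {i}) \<inter> {..<?n}. closure (locus (As ! j)))"
      have "open ?T" using closed_arcs by (intro open_Int open_Compl) auto
      moreover have "a \<notin> closure (locus (As ! j))" if j: "j < ?n" "j \<noteq> i" for j
      proof -
        have "a \<noteq> src j" "a \<noteq> tgt j" using ends_in[OF j(1)] ends_not_in_arc[OF 2(1)] 2(2) by blast+
        then show ?thesis using arc_locus_facts(1)[OF j(1)] arc_unique[OF 2(1) j(1) 2(2)] j(2) by auto
      qed
      then have "a \<in> ?T" using arc_interior[OF 2(1)] 2(2) by auto
      moreover have "glue g k x = glue g k a" if x: "x \<in> locus (flow w) \<inter> ?T" for x
      proof -
        have "x \<in> locus (flow w) \<inter> interior D" using x by simp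
        then obtain j where j: "j < ?n" "x \<in> locus (As ! j)" unfolding inner_locus by blast
        then have "j = i" using x closure_subset by blast
        then show ?thesis using glue_arc j 2 by simp
      qed
      ultimately show ?thesis by blast
    next
      case 1
      obtain T where T: "open T \<and> a \<in> T \<and> (\<forall>x\<in>outer \<inter> T. g x = g a)"
        using bspec[OF lcg[unfolded locally_const_def] 1] ..
      let ?J = "{j. a \<notin> {src j, tgt j}}"
      let ?T = "T \<inter> (if a \<in> D then UNIV else - D) \<inter> - (\<Union>j\<in>?J \<inter> {..<?n}. closure (locus (As ! j)))"
      have "open ?T" using closed_arcs closed_disc T by (intro open_Int open_Compl) auto
      moreover have "a \<notin> closure (locus (As ! j))" if j: "j < ?n" "j \<in> ?J" for j
      proof -
        have "a \<notin> locus (As ! j)" using arc_interior[OF j(1)] 1 unfolding outer_def by blast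
        then show ?thesis using arc_locus_facts(1)[OF j(1)] j(2) by auto
      qed
      then have "a \<in> ?T" using T by auto
      moreover have "glue g k x = glue g k a" if x: "x \<in> locus (flow w) \<inter> ?T" for x
      proof -
        have "x \<in> locus (flow w)" using x by blast
        then show ?thesis
        proof (cases rule: flow_cases)
          case 1
          then have "x \<in> outer \<inter> T" using x by simp
          then have "g x = g a" using T by blast
          then show ?thesis using 1 \<open>a \<in> outer\<close> by (simp add: glue_outer)
        next
          case (2 j)
          then have "x \<in> D" using arc_interior[OF 2(1)] interior_subset by blast
          then have "a \<in> D" using x by (auto split: if_splits)
          then have "a \<in> P" using 1 outer_disc by blast
          have "j \<notin> ?J" using x 2 closure_subset by blast
          then have "a \<in> {src j, tgt j}" by simp
          then have "g a = k j" using kP[OF 2(1) _ \<open>a \<in> P\<close>] by blast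
          then show ?thesis using glue_arc[OF 2(1,2)] glue_outer 1 by simp
        qed
      qed
      ultimately show ?thesis by blast
    qed
  qed
  moreover have "v \<in> closure {z \<in> locus (flow w). glue g k z = c}" if v: "v \<in> verts w" for v c
  proof (cases "v \<in> D")
    case False
    then have "v \<in> closure {z \<in> outer. g z = c}" using g v unfolding outer_colorings_def by blast
    moreover have "{z \<in> outer. g z = c} \<subseteq> {z \<in> locus (flow w). glue g k z = c}"
      using glue_outer unfolding outer_def by auto
    ultimately show ?thesis using closure_mono by blast
  next
    case True
    then have "c \<in> k ` {i. i < ?n \<and> v \<in> {src i, tgt i}}"
      using k V v unfolding strand_colorings_def by blast
    then obtain i where i: "i < ?n" "v \<in> {src i, tgt i}" "k i = c" by blast
    then have "v \<in> closure (locus (As ! i))" using arc_locus_facts(1) by blast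
    moreover have "locus (As ! i) \<subseteq> {z \<in> locus (flow w). glue g k z = c}"
      using glue_arc[OF i(1)] i(3) arc_interior[OF i(1)] by auto
    ultimately show ?thesis using closure_mono by blast
  qed
  moreover have "glue g k \<in> locus (flow w) \<rightarrow>\<^sub>E UNIV" by (simp add: glue_def)
  ultimately show ?thesis by (simp add: point_colorings_def)
qed

definition inner_coloring :: "(complex \<Rightarrow> color) \<Rightarrow> nat \<Rightarrow> color" where
  "inner_coloring f = (\<lambda>i\<in>{..<length ends}. f (SOME z. z \<in> locus (As ! i)))"

text \<open>A strand remains connected when an end point is added, and cut points belong to the
  flow. So a locally constant coloring has the color of the strand at the cut point as well.\<close>

lemma inner_coloring_eq:
  assumes f: "f \<in> point_colorings (flow w) (verts w)" and i: "i < length ends"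
    and z: "z \<in> locus (As ! i) \<or> z \<in> {src i, tgt i} \<inter> P"
  shows "f z = inner_coloring f i"
proof -
  have some: "(SOME z. z \<in> locus (As ! i)) \<in> locus (As ! i)" using arc_locus_facts(3)[OF i] by (metis ex_in_conv someI_ex)
  have lc: "locally_const f (locus (flow w))" using f by (simp add: point_colorings_def)
  have "connected (insert z (locus (As ! i)))"
    using arc_locus_facts(1)[OF i] z closure_subset
    by (intro connected_insert_closure arc_locus_facts(2)[OF i]) blast
  moreover have "insert z (locus (As ! i)) \<subseteq> locus (flow w)" using arc_interior[OF i] z P_flow by blast
  ultimately have "f z = f (SOME z. z \<in> locus (As ! i))"
    by (rule locally_const_connected[OF lc]) (use some in auto)
  then show ?thesis using i by (simp add: inner_coloring_def)
qed

text \<open>The condition at vertices can be localized: a vertex off \<open>D\<close> has the open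
  neighborhood \<open>- D\<close>, an inner vertex has the interior of \<open>D\<close>. In the
  interior a color class is covered by the closures of the strands of its color, so one of these
  ends at the vertex.\<close>

lemma unglue:
  assumes f: "f \<in> point_colorings (flow w) (verts w)"
  shows "restrict f outer \<in> outer_colorings outer (verts w - D)"
    "inner_coloring f \<in> strand_colorings (restrict f outer)"
    "glue (restrict f outer) (inner_coloring f) = f"
proof -
  let ?n = "length ends"
  have lc: "locally_const f (locus (flow w))" using f by (simp add: point_colorings_def)
  have fv: "v \<in> closure {z \<in> locus (flow w). f z = c}" if "v \<in> verts w" for v c
    using f that by (simp add: point_colorings_def)
  have "locally_const f outer" using lc by (rule locally_const_subset) (simp add: outer_def)
  then have "locally_const (restrict f outer) outer" by (rule locally_const_cong) simp
  moreover have "v \<in> closure {z \<in> outer. restrict f outer z = c}" if v: "v \<in> verts w - D" for v c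
  proof -
    have "v \<in> - D \<inter> closure {z \<in> locus (flow w). f z = c}" using v fv by blast
    then have "v \<in> closure (- D \<inter> {z \<in> locus (flow w). f z = c})"
      using open_Int_closure_subset[of "- D"] closed_disc by blast
    moreover have "- D \<inter> {z \<in> locus (flow w). f z = c} \<subseteq> {z \<in> outer. restrict f outer z = c}"
      using interior_subset by (auto simp: outer_def)
    ultimately show ?thesis using closure_mono by blast
  qed
  ultimately show "restrict f outer \<in> outer_colorings outer (verts w - D)"
    by (simp add: outer_colorings_def)
  have "P \<subseteq> outer" using outer_eq by blast
  then have "restrict f outer e = inner_coloring f i" if "i < ?n" "e \<in> {src i, tgt i} \<inter> P" for i e
    using inner_coloring_eq[OF f that(1), of e] that(2) by auto
  moreover have "inner_coloring f ` {i. i < ?n \<and> v \<in> {src i, tgt i}} = UNIV" if v: "v \<in> V" for v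
  proof -
    have "c \<in> inner_coloring f ` {i. i < ?n \<and> v \<in> {src i, tgt i}}" for c
    proof -
      have vw: "v \<in> verts w" "v \<in> interior D" using v V by auto
      have "v \<in> closure (interior D \<inter> {z \<in> locus (flow w). f z = c})"
        using open_Int_closure_subset[of "interior D"] fv[OF vw(1), of c] vw(2) by blast
      moreover have "interior D \<inter> {z \<in> locus (flow w). f z = c}
          \<subseteq> (\<Union>i\<in>{i. inner_coloring f i = c} \<inter> {..<?n}. closure (locus (As ! i)))"
      proof
        fix z assume z: "z \<in> interior D \<inter> {z \<in> locus (flow w). f z = c}"
        then have "z \<in> locus (flow w) \<inter> interior D" by blast
        then obtain i where i: "i < ?n" "z \<in> locus (As ! i)" unfolding inner_locus by blast
        then have "inner_coloring f i = c" using inner_coloring_eq[OF f i(1), of z] z by simp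
        then show "z \<in> (\<Union>i\<in>{i. inner_coloring f i = c} \<inter> {..<?n}. closure (locus (As ! i)))"
          using i closure_subset[of "locus (As ! i)"] by blast
      qed
      then have "closure (interior D \<inter> {z \<in> locus (flow w). f z = c})
          \<subseteq> (\<Union>i\<in>{i. inner_coloring f i = c} \<inter> {..<?n}. closure (locus (As ! i)))"
        using closed_arcs by (rule closure_minimal)
      ultimately obtain i where i: "inner_coloring f i = c" "i < ?n" "v \<in> closure (locus (As ! i))" by blast
      then have "v \<in> {src i, tgt i}"
        using arc_locus_facts(1)[OF i(2)] ends_not_in_arc[OF i(2), of v] v by auto
      then show ?thesis using i by blast
    qed
    then show ?thesis by blast
  qed
  moreover have "inner_coloring f \<in> {..<?n} \<rightarrow>\<^sub>E UNIV" by (simp add: inner_coloring_def)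
  ultimately show "inner_coloring f \<in> strand_colorings (restrict f outer)"
    by (simp add: strand_colorings_def)
  show "glue (restrict f outer) (inner_coloring f) = f"
  proof (rule extensionalityI[of _ "locus (flow w)"])
    show "glue (restrict f outer) (inner_coloring f) \<in> extensional (locus (flow w))" by (simp add: glue_def)
    show "f \<in> extensional (locus (flow w))" using f by (simp add: point_colorings_def PiE_def)
    fix z assume "z \<in> locus (flow w)"
    then show "glue (restrict f outer) (inner_coloring f) z = f z"
      by (cases rule: flow_cases) (simp_all add: glue_outer glue_arc inner_coloring_eq[OF f])
  qed
qed

text \<open>Separates a sum over colorings into an outer sum over \<open>g\<close> and inner sums
  over strand colorings, whose range depends on \<open>g\<close> only through its values on
  \<open>P\<close>.\<close>

lemma glue_bij:
  "bij_betw (\<lambda>(g, k). glue g k) (Sigma (outer_colorings outer (verts w - D)) strand_colorings)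
    (point_colorings (flow w) (verts w))"
proof (rule bij_betwI[where g = "\<lambda>f. (restrict f outer, inner_coloring f)"])
  show "(\<lambda>(g, k). glue g k) \<in> Sigma (outer_colorings outer (verts w - D)) strand_colorings
    \<rightarrow> point_colorings (flow w) (verts w)" using glue_in by auto
  show "(\<lambda>f. (restrict f outer, inner_coloring f)) \<in> point_colorings (flow w) (verts w)
    \<rightarrow> Sigma (outer_colorings outer (verts w - D)) strand_colorings" using unglue(1,2) by auto
  show "(\<lambda>(g, k). glue g k) (restrict f outer, inner_coloring f) = f"
    if "f \<in> point_colorings (flow w) (verts w)" for f using unglue(3)[OF that] by simp
  fix x assume "x \<in> Sigma (outer_colorings outer (verts w - D)) strand_colorings"
  then obtain g k where x: "x = (g, k)" "g \<in> outer_colorings outer (verts w - D)" "k \<in> strand_colorings g" by blast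
  have "restrict (glue g k) outer = g"
  proof (rule extensionalityI[of _ outer])
    show "g \<in> extensional outer" using x(2) by (simp add: outer_colorings_def PiE_def)
  qed (simp_all add: glue_outer)
  moreover have "inner_coloring (glue g k) = k"
  proof (rule extensionalityI[of _ "{..<length ends}"])
    show "k \<in> extensional {..<length ends}" using x(3) by (simp add: strand_colorings_def PiE_def)
    show "inner_coloring (glue g k) i = k i" if i: "i \<in> {..<length ends}" for i
    proof -
      obtain z where z: "z \<in> locus (As ! i)" using arc_locus_facts(3)[of i] i by auto
      then show ?thesis using inner_coloring_eq[OF glue_in[OF x(2,3)], of i z] glue_arc[of i z g k] i by simp
    qed
  qed (simp add: inner_coloring_def)
  ultimately show "(restrict ((\<lambda>(g, k). glue g k) x) outer, inner_coloring ((\<lambda>(g, k). glue g k) x)) = x"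
    using x(1) by simp
qed

definition "local_degree g k u =
  cycle_degree (point_support u (glue g k) (flow w) (verts w)) (point_field u (glue g k) (flow w))"

text \<open>Finiteness comes from the finitely many colorings of the web and thus concerns the outer
  colorings that extend over the disc. Which ones extend depends on the filling; the freedom in
  \<open>H\<close> lets webs with the same outside be summed over a common index set.\<close>

lemma bracket_local:
  shows "finite {g \<in> outer_colorings outer (verts w - D). strand_colorings g \<noteq> {}}"
    and "finite H \<Longrightarrow> H \<subseteq> outer_colorings outer (verts w - D) \<Longrightarrow>
      {g \<in> outer_colorings outer (verts w - D). strand_colorings g \<noteq> {}} \<subseteq> H \<Longrightarrow>
      bracket w = (\<Sum>g\<in>H. \<Sum>k\<in>strand_colorings g. qpow (\<Sum>u\<in>UNIV. local_degree g k u))"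
proof -
  let ?G = "outer_colorings outer (verts w - D)"
  have fin: "finite (Sigma ?G strand_colorings)"
    using glue_bij finite_point_colorings bij_betw_finite by blast
  have "{g \<in> ?G. strand_colorings g \<noteq> {}} \<subseteq> fst ` Sigma ?G strand_colorings" by force
  then show "finite {g \<in> ?G. strand_colorings g \<noteq> {}}" using fin finite_subset by blast
  have finK: "finite (strand_colorings g)" for g
  proof -
    have "finite ({..<length ends} \<rightarrow>\<^sub>E (UNIV :: color set))" by (intro finite_PiE) auto
    then show ?thesis by (rule rev_finite_subset) (auto simp: strand_colorings_def)
  qed
  assume H: "finite H" "H \<subseteq> ?G" "{g \<in> ?G. strand_colorings g \<noteq> {}} \<subseteq> H"
  have eq: "Sigma ?G strand_colorings = Sigma H strand_colorings" using H by blast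
  have "bracket w = (\<Sum>x\<in>Sigma ?G strand_colorings.
      qpow (point_degree ((\<lambda>(g, k). glue g k) x) (flow w) (verts w)))"
    unfolding bracket_eq by (rule sum.reindex_bij_betw[OF glue_bij, symmetric])
  also have "\<dots> = (\<Sum>g\<in>H. \<Sum>k\<in>strand_colorings g. qpow (point_degree (glue g k) (flow w) (verts w)))"
    unfolding eq using H(1) finK by (subst sum.Sigma) (auto intro: sum.cong)
  finally show "bracket w = (\<Sum>g\<in>H. \<Sum>k\<in>strand_colorings g. qpow (\<Sum>u\<in>UNIV. local_degree g k u))"
    by (simp add: local_degree_def point_degree_def)
qed

lemma strand_intersection:
  assumes "i < length ends" "j < length ends" "i \<noteq> j"
  shows "path_image (strand i) \<inter> path_image (strand j) \<subseteq> {src i, tgt i} \<inter> {src j, tgt j}"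
proof -
  have "locus (As ! i) \<inter> locus (As ! j) = {}" using arc_unique assms by blast
  moreover have "src i \<notin> locus (As ! j)" "tgt i \<notin> locus (As ! j)" "src j \<notin> locus (As ! i)" "tgt j \<notin> locus (As ! i)"
    using ends_in ends_not_in_arc assms by blast+
  ultimately show ?thesis
    unfolding strand_facts(5)[OF assms(1)] strand_facts(5)[OF assms(2)]
      arc_locus_facts(1)[OF assms(1)] arc_locus_facts(1)[OF assms(2)] by auto
qed

lemma strand_disc:
  assumes "i < length ends"
  shows "path_image (strand i) \<subseteq> D" "path_image (strand i) \<inter> frontier D = {src i, tgt i} \<inter> P"
proof -
  have im: "path_image (strand i) = insert (src i) (insert (tgt i) (locus (As ! i)))"
    using strand_facts(5)[OF assms] arc_locus_facts(1)[OF assms] by simp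
  have VP: "V \<union> P \<subseteq> D" using V(1) P_frontier frontier_subset by blast
  show "path_image (strand i) \<subseteq> D"
    unfolding im using ends_in[OF assms] VP arc_interior[OF assms] interior_subset by blast
  have "locus (As ! i) \<inter> frontier D = {}" using arc_interior[OF assms] interior_frontier_disjoint[of D] by blast
  moreover have "V \<inter> frontier D = {}" using V(2) interior_frontier_disjoint[of D] by blast
  ultimately show "path_image (strand i) \<inter> frontier D = {src i, tgt i} \<inter> P"
    unfolding im using ends_in[OF assms] P_frontier by auto
qed

text \<open>All that the comparison of two fillings uses. Outside the disc support and field are
  determined by \<open>g\<close>; inside, the support consists of the strands whose colors differ
  from \<open>u\<close>, each run forwards or backwards according to its color.\<close>

lemma local_structure:
  assumes g: "g \<in> outer_colorings outer (verts w - D)" and k: "k \<in> strand_colorings g"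
  defines "M u \<equiv> point_support u (glue g k) (flow w) (verts w)"
    and "F u \<equiv> point_field u (glue g k) (flow w)"
  shows "M u \<inter> D = (\<Union>i\<in>{i. i < length ends \<and> k i \<noteq> u}. path_image (strand i))"
    and "M u - D = (verts w - D) \<union> {z \<in> outer - D. g z \<noteq> u}"
    and "z \<notin> D \<Longrightarrow> (z, v) \<in> F u \<longleftrightarrow> z \<in> outer \<and> g z \<noteq> u \<and>
      (z, if g z = Max (colors_without u) then - v else v) \<in> flow w"
    and "i < length ends \<Longrightarrow> k i \<noteq> u \<Longrightarrow> k i \<noteq> Max (colors_without u) \<Longrightarrow> follows (strand i) (F u)"
    and "i < length ends \<Longrightarrow> k i \<noteq> u \<Longrightarrow> k i = Max (colors_without u) \<Longrightarrow>
      follows (reversepath (strand i)) (F u)"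
    and "\<exists>\<Gamma>. loop_decomposition \<Gamma> (M u) (F u)" and "direction_field (F u)"
proof -
  let ?n = "length ends"
  have kP: "g e = k i" if "i < ?n" "e \<in> {src i, tgt i}" "e \<in> P" for i e
    using k that unfolding strand_colorings_def by blast
  have kV: "k ` {i. i < ?n \<and> v \<in> {src i, tgt i}} = UNIV" if "v \<in> V" for v
    using k that unfolding strand_colorings_def by blast
  have locus_outer: "{z \<in> locus (flow w). glue g k z \<noteq> u} - D = {z \<in> outer - D. g z \<noteq> u}"
  proof -
    have "z \<in> locus (flow w) \<and> z \<notin> D \<longleftrightarrow> z \<in> outer \<and> z \<notin> D" for z
      using interior_subset[of D] unfolding outer_def by blast
    moreover have "glue g k z = g z" if "z \<in> outer" for z using that by (rule glue_outer)
    ultimately show ?thesis by (intro set_eqI) (metis (mono_tags, lifting) Diff_iff mem_Collect_eq)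
  qed
  then show "M u - D = (verts w - D) \<union> {z \<in> outer - D. g z \<noteq> u}"
    unfolding M_def point_support_def by blast
  show "M u \<inter> D = (\<Union>i\<in>{i. i < ?n \<and> k i \<noteq> u}. path_image (strand i))"
  proof
    show "M u \<inter> D \<subseteq> (\<Union>i\<in>{i. i < ?n \<and> k i \<noteq> u}. path_image (strand i))"
    proof
      fix z assume z: "z \<in> M u \<inter> D"
      have "\<exists>i. i < ?n \<and> k i \<noteq> u \<and> z \<in> path_image (strand i)"
      proof (cases "z \<in> verts w")
        case True
        then have zV: "z \<in> V" using z V by blast
        obtain c :: color where "c \<noteq> u" by (metis color.distinct(1))
        moreover have "c \<in> k ` {i. i < ?n \<and> z \<in> {src i, tgt i}}" using kV[OF zV] by simp
        ultimately obtain i where i: "i < ?n" "z \<in> {src i, tgt i}" "k i \<noteq> u" by blast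
        then have "z \<in> path_image (strand i)"
          using strand_facts(5)[OF i(1)] arc_locus_facts(1)[OF i(1)] by auto
        then show ?thesis using i by blast
      next
        case False
        then have zL: "z \<in> locus (flow w)" "glue g k z \<noteq> u" using z by (auto simp: M_def point_support_def)
        show ?thesis using zL(1)
        proof (cases rule: flow_cases)
          case 1
          then have zP: "z \<in> P" using z outer_disc by blast
          then obtain i where i: "i < ?n" "z \<in> {src i, tgt i}" using end_exists by blast
          have "k i \<noteq> u" using kP[OF i zP] zL(2) glue_outer[OF 1] by simp
          moreover have "z \<in> path_image (strand i)"
            using i strand_facts(5)[OF i(1)] arc_locus_facts(1)[OF i(1)] by auto
          ultimately show ?thesis using i by blast
        next
          case (2 i)
          then show ?thesis using strand_facts(5)[OF 2(1)] closure_subset zL(2) glue_arc by blast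
        qed
      qed
      then show "z \<in> (\<Union>i\<in>{i. i < ?n \<and> k i \<noteq> u}. path_image (strand i))" by blast
    qed
    show "(\<Union>i\<in>{i. i < ?n \<and> k i \<noteq> u}. path_image (strand i)) \<subseteq> M u \<inter> D"
    proof
      fix z assume "z \<in> (\<Union>i\<in>{i. i < ?n \<and> k i \<noteq> u}. path_image (strand i))"
      then obtain i where i: "i < ?n" "k i \<noteq> u" "z \<in> path_image (strand i)" by blast
      then have "z \<in> D" using strand_disc(1) by blast
      have "z \<in> {src i, tgt i} \<or> z \<in> locus (As ! i)"
        using i(3) strand_facts(5)[OF i(1)] arc_locus_facts(1)[OF i(1)] by auto
      then consider "z \<in> V" | "z \<in> {src i, tgt i}" "z \<in> P" | "z \<in> locus (As ! i)"
        using ends_in[OF i(1)] by blast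
      then have "z \<in> M u"
      proof cases
        case 1
        then show ?thesis using V unfolding M_def point_support_def by blast
      next
        case 2
        then have "glue g k z = k i" using kP[OF i(1)] glue_outer[of z g k] outer_eq by simp
        then show ?thesis using 2 i(2) P_flow unfolding M_def point_support_def by auto
      next
        case 3
        then have "z \<in> locus (flow w)" using arc_interior[OF i(1)] by blast
        then show ?thesis using 3 i(2) glue_arc[OF i(1) 3] unfolding M_def point_support_def by simp
      qed
      then show "z \<in> M u \<inter> D" using \<open>z \<in> D\<close> by blast
    qed
  qed
  have in_locus: "z \<in> locus (flow w)" if "(z, v) \<in> flow w" for z v using that by (force simp: locus_def)
  show "(z, v) \<in> F u \<longleftrightarrow> z \<in> outer \<and> g z \<noteq> u \<and> (z, if g z = Max (colors_without u) then - v else v) \<in> flow w"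
    if z: "z \<notin> D"
  proof (cases "z \<in> locus (flow w)")
    case True
    then have "z \<in> outer" using z interior_subset unfolding outer_def by blast
    then show ?thesis by (simp add: F_def point_field_def glue_outer)
  next
    case False
    then show ?thesis using in_locus by (auto simp: F_def point_field_def outer_def)
  qed
  have As_F: "(z, if k i = Max (colors_without u) then - v else v) \<in> F u"
    if i: "i < ?n" "k i \<noteq> u" and zv: "(z, v) \<in> As ! i" for i z v
  proof -
    have "z \<in> locus (As ! i)" using zv by (force simp: locus_def)
    then have "glue g k z = k i" using glue_arc i by blast
    moreover have "(z, v) \<in> flow w" using inner zv i(1) by (metis (no_types, lifting) UnionI length_As mem_Collect_eq nth_mem)
    ultimately show ?thesis using i by (simp add: F_def point_field_def)
  qed
  show "follows (strand i) (F u)" if "i < ?n" "k i \<noteq> u" "k i \<noteq> Max (colors_without u)"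
    using As_F[OF that(1,2)] that(3) by (intro follows_mono[OF strand_facts(4)[OF that(1)]]) auto
  show "follows (reversepath (strand i)) (F u)" if "i < ?n" "k i \<noteq> u" "k i = Max (colors_without u)"
  proof (rule follows_mono[OF follows_reversepath[OF strand_facts(4)[OF that(1)]]])
    show "reverse_curve (As ! i) \<subseteq> F u"
    proof
      fix x assume x: "x \<in> reverse_curve (As ! i)"
      obtain z v where "x = (z, v)" by fastforce
      then show "x \<in> F u" using As_F[OF that(1,2), of z "- v"] that(3) x by (simp add: reverse_curve_iff)
    qed
  qed
  show "\<exists>\<Gamma>. loop_decomposition \<Gamma> (M u) (F u)" "direction_field (F u)"
    unfolding M_def F_def using point_coloring_loops[OF glue_in[OF g k]] by auto
qed

end

text \<open>Outside the disc support and field are computed from \<open>g\<close> and the common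
  part of the two webs, whatever the colors of the strands are.\<close>

lemma agree_outside_local:
  assumes a: "web_disc w D P V ends As" and b: "web_disc w' D P V' ends' As'"
    and co: "coincide_outside D w w'"
  shows "web_disc.outer w D = web_disc.outer w' D" and "verts w - D = verts w' - D"
    and "g \<in> outer_colorings (web_disc.outer w D) (verts w - D) \<Longrightarrow> k \<in> web_disc.strand_colorings P V ends g \<Longrightarrow>
      k' \<in> web_disc.strand_colorings P V' ends' g \<Longrightarrow>
      agree_outside D (point_support u (web_disc.glue w D ends As g k) (flow w) (verts w))
        (point_field u (web_disc.glue w D ends As g k) (flow w))
        (point_support u (web_disc.glue w' D ends' As' g k') (flow w') (verts w'))
        (point_field u (web_disc.glue w' D ends' As' g k') (flow w'))"
proof -
  interpret a: web_disc w D P V ends As by (rule a)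
  interpret b: web_disc w' D P V' ends' As' by (rule b)
  show verts: "verts w - D = verts w' - D" using co by (simp add: coincide_outside_def)
  have flow_eq: "{x \<in> flow w. fst x \<notin> D} = {x \<in> flow w'. fst x \<notin> D}"
    using co by (simp add: coincide_outside_def)
  have flow: "(z, v) \<in> flow w \<longleftrightarrow> (z, v) \<in> flow w'" if "z \<notin> D" for z v
    using that flow_eq[THEN eqset_imp_iff, of "(z, v)"] by simp
  have "locus (flow w) - D = locus {x \<in> flow w. fst x \<notin> D}" "locus (flow w') - D = locus {x \<in> flow w'. fst x \<notin> D}"
    by (auto simp: locus_def)
  then show outer: "a.outer = b.outer" unfolding a.outer_eq b.outer_eq flow_eq by simp
  assume g: "g \<in> outer_colorings a.outer (verts w - D)" and k: "k \<in> a.strand_colorings g" "k' \<in> b.strand_colorings g"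
  have g': "g \<in> outer_colorings b.outer (verts w' - D)" using g outer verts by simp
  show "agree_outside D (point_support u (a.glue g k) (flow w) (verts w)) (point_field u (a.glue g k) (flow w))
        (point_support u (b.glue g k') (flow w') (verts w')) (point_field u (b.glue g k') (flow w'))"
    unfolding agree_outside_def a.local_structure(2)[OF g k(1)] b.local_structure(2)[OF g' k(2)] outer verts
    using a.local_structure(3)[OF g k(1)] b.local_structure(3)[OF g' k(2)] flow outer by simp
qed

section \<open>Two webs that differ in a disc\<close>

lemma UNIV_color_iff: "{p, q, r} = (UNIV :: color set) \<longleftrightarrow> p \<noteq> q \<and> p \<noteq> r \<and> q \<noteq> r"
proof
  assume "{p, q, r} = (UNIV :: color set)"
  then have "card {p, q, r} = 3" by (simp add: UNIV_color)
  then show "p \<noteq> q \<and> p \<noteq> r \<and> q \<noteq> r" by (auto simp: card_insert_if split: if_splits)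
next
  assume "p \<noteq> q \<and> p \<noteq> r \<and> q \<noteq> r"
  then have "card {p, q, r} = card (UNIV :: color set)" by (simp add: UNIV_color)
  then show "{p, q, r} = UNIV" by (intro card_subset_eq) auto
qed

lemma Max_without_third:
  assumes "p \<noteq> q" "p \<noteq> r" "q \<noteq> (r :: color)"
  shows "Max (colors_without r) = p \<and> Max (colors_without r) \<noteq> q \<or>
    Max (colors_without r) = q \<and> Max (colors_without r) \<noteq> p"
proof -
  have "colors_without r = {p, q}"
    using assms UNIV_color_iff[of p q r] by (auto simp: colors_without_def)
  then have "Max (colors_without r) = max p q" by simp
  then show ?thesis using assms(1) by (auto simp: max_def)
qed

lemma sum_color_triple:
  assumes "p \<noteq> q" "p \<noteq> r" "q \<noteq> (r :: color)"
  shows "(\<Sum>k\<in>UNIV. f k) = f p + (f q + f r)"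
proof -
  have "UNIV = {p, q, r}" using assms UNIV_color_iff by metis
  then have "(\<Sum>k\<in>UNIV. f k) = (\<Sum>k\<in>{p, q, r}. f k)" by simp
  then show ?thesis using assms by simp
qed

section \<open>Strands of alternating colors joined into one crosscut\<close>

context web_disc
begin

text \<open>Here \<open>p\<close> runs along the orientation of the web, and the greatest color is
  run backwards in the configuration. The definition serves also for joined strands, which are then
  treated like a single strand of color \<open>c\<close>.\<close>

definition directed_along :: "color \<Rightarrow> color \<Rightarrow> (real \<Rightarrow> complex) \<Rightarrow> curve \<Rightarrow> bool" where
  "directed_along u c p F \<longleftrightarrow>
    (if c = Max (colors_without u) then follows (reversepath p) F else follows p F)"

lemma strand_directed:
  assumes "g \<in> outer_colorings outer (verts w - D)" "k \<in> strand_colorings g" "i < length ends" "k i \<noteq> u"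
  shows "directed_along u (k i) (strand i) (point_field u (glue g k) (flow w))"
  using local_structure(4,5)[OF assms(1-3), of u] assms(4) by (simp add: directed_along_def)

text \<open>The paths end at the same point, as strands do at a sink, and their colors are the two
  colors other than \<open>u\<close>. Exactly one of the two is reversed, so going along
  \<open>p\<close> and back along \<open>q\<close> is consistent with the field up to an overall
  reversal, which is that of color \<open>c\<close>.\<close>

lemma directed_along_join_reverse:
  assumes "directed_along u c p F" "directed_along u c' q F" "c \<noteq> c'" "c \<noteq> u" "c' \<noteq> u"
    "pathfinish p = pathfinish q"
  shows "directed_along u c (p +++ reversepath q) F"
  using assms Max_without_third[of c c' u]
  by (auto simp: directed_along_def follows_join reversepath_joinpaths)

lemma directed_along_join:
  assumes "directed_along u c p F" "directed_along u c q F" "pathfinish p = pathstart q"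
  shows "directed_along u c (p +++ q) F"
  using assms by (auto simp: directed_along_def follows_join reversepath_joinpaths)

text \<open>Strand \<open>i\<close> forwards, \<open>j\<close> backwards, \<open>l\<close> forwards:
  the path turns at a common final point and then at a common initial point, and the colors
  alternate. The result can be exchanged for a single strand of color \<open>c\<close> with the same
  ends.\<close>

lemma zigzag3:
  assumes g: "g \<in> outer_colorings outer (verts w - D)" "k \<in> strand_colorings g"
    and i: "i < length ends" "j < length ends" "l < length ends" "distinct [i, j, l]"
    and ends: "tgt i = tgt j" "src j = src l" "distinct [src i, tgt j, src j, tgt l]"
    and col: "k i = c" "k j = c'" "k l = c" "c \<noteq> c'" "c \<noteq> u" "c' \<noteq> u"
  obtains p where "arc p" "pathstart p = src i" "pathfinish p = tgt l"
    "path_image p = path_image (strand i) \<union> path_image (strand j) \<union> path_image (strand l)"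
    "directed_along u c p (point_field u (glue g k) (flow w))"
proof
  let ?p = "(strand i +++ reversepath (strand j)) +++ strand l"
  note s = strand_facts[OF i(1)] strand_facts[OF i(2)] strand_facts[OF i(3)]
  have int: "path_image (strand i) \<inter> path_image (strand j) \<subseteq> {tgt j}"
    "path_image (strand i) \<inter> path_image (strand l) \<subseteq> {}"
    "path_image (strand j) \<inter> path_image (strand l) \<subseteq> {src j}"
    using strand_intersection[OF i(1,2)] strand_intersection[OF i(1,3)] strand_intersection[OF i(2,3)] i(4) ends
    by auto
  have a1: "arc (strand i +++ reversepath (strand j))"
    by (rule arc_join) (use s(1-3,6-8) int ends in \<open>auto simp: arc_reversepath\<close>)
  show "arc ?p"
    by (rule arc_join[OF a1]) (use s(1-3,6-8,11-13) int ends in \<open>auto simp: path_image_join\<close>)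
  show "pathstart ?p = src i" "pathfinish ?p = tgt l" using s by auto
  show "path_image ?p = path_image (strand i) \<union> path_image (strand j) \<union> path_image (strand l)"
    using s(1-3,6-8,11-13) ends by (simp add: path_image_join)
  show "directed_along u c ?p (point_field u (glue g k) (flow w))"
  proof (rule directed_along_join[OF directed_along_join_reverse[where c' = c']])
    show "directed_along u c (strand i) (point_field u (glue g k) (flow w))"
      using strand_directed[OF g i(1), of u] col by simp
    show "directed_along u c' (strand j) (point_field u (glue g k) (flow w))"
      using strand_directed[OF g i(2), of u] col by simp
    show "directed_along u c (strand l) (point_field u (glue g k) (flow w))"
      using strand_directed[OF g i(3), of u] col by simp
  qed (use s(1-3,6-8,11-13) ends col in auto)
qed

lemma zigzag5:
  assumes g: "g \<in> outer_colorings outer (verts w - D)" "k \<in> strand_colorings g"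
    and i: "i < length ends" "j < length ends" "l < length ends" "m < length ends" "n < length ends"
      "distinct [i, j, l, m, n]"
    and ends: "tgt i = tgt j" "src j = src l" "tgt l = tgt m" "src m = src n"
      "distinct [src i, tgt j, src j, tgt l, src m, tgt n]"
    and col: "k i = c" "k j = c'" "k l = c" "k m = c'" "k n = c" "c \<noteq> c'" "c \<noteq> u" "c' \<noteq> u"
  obtains p where "arc p" "pathstart p = src i" "pathfinish p = tgt n"
    "path_image p = path_image (strand i) \<union> path_image (strand j) \<union> path_image (strand l) \<union>
      path_image (strand m) \<union> path_image (strand n)"
    "directed_along u c p (point_field u (glue g k) (flow w))"
proof -
  let ?F = "point_field u (glue g k) (flow w)"
  have d3: "distinct [i, j, l]" "distinct [src i, tgt j, src j, tgt l]" using i(6) ends(5) by auto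
  obtain q where q: "arc q" "pathstart q = src i" "pathfinish q = tgt l"
    "path_image q = path_image (strand i) \<union> path_image (strand j) \<union> path_image (strand l)"
    "directed_along u c q ?F"
    by (rule zigzag3[OF g i(1-3) d3(1) ends(1,2) d3(2) col(1-3) col(6-8)])
  let ?p = "(q +++ reversepath (strand m)) +++ strand n"
  note s = strand_facts[OF i(4)] strand_facts[OF i(5)]
  have int: "path_image (strand i) \<inter> path_image (strand m) \<subseteq> {}"
    "path_image (strand j) \<inter> path_image (strand m) \<subseteq> {}"
    "path_image (strand l) \<inter> path_image (strand m) \<subseteq> {tgt l}"
    "path_image (strand i) \<inter> path_image (strand n) \<subseteq> {}"
    "path_image (strand j) \<inter> path_image (strand n) \<subseteq> {}"
    "path_image (strand l) \<inter> path_image (strand n) \<subseteq> {}"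
    "path_image (strand m) \<inter> path_image (strand n) \<subseteq> {src m}"
  proof -
    have d: "i \<noteq> m" "j \<noteq> m" "l \<noteq> m" "i \<noteq> n" "j \<noteq> n" "l \<noteq> n" "m \<noteq> n" using i(6) by auto
    show "path_image (strand i) \<inter> path_image (strand m) \<subseteq> {}"
      using strand_intersection[OF i(1,4) d(1)] ends by auto
    show "path_image (strand j) \<inter> path_image (strand m) \<subseteq> {}"
      using strand_intersection[OF i(2,4) d(2)] ends by auto
    show "path_image (strand l) \<inter> path_image (strand m) \<subseteq> {tgt l}"
      using strand_intersection[OF i(3,4) d(3)] ends by auto
    show "path_image (strand i) \<inter> path_image (strand n) \<subseteq> {}"
      using strand_intersection[OF i(1,5) d(4)] ends by auto
    show "path_image (strand j) \<inter> path_image (strand n) \<subseteq> {}"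
      using strand_intersection[OF i(2,5) d(5)] ends by auto
    show "path_image (strand l) \<inter> path_image (strand n) \<subseteq> {}"
      using strand_intersection[OF i(3,5) d(6)] ends by auto
    show "path_image (strand m) \<inter> path_image (strand n) \<subseteq> {src m}"
      using strand_intersection[OF i(4,5) d(7)] ends by auto
  qed
  have a1: "arc (q +++ reversepath (strand m))"
    by (rule arc_join) (use q(1-4) s(1-3) int(1-3) ends(3) in \<open>auto simp: arc_reversepath\<close>)
  show ?thesis
  proof
    show "arc ?p"
      by (rule arc_join[OF a1]) (use q(1-4) s(1-3,6-8) int ends(3,4) in \<open>auto simp: path_image_join\<close>)
    show "pathstart ?p = src i" "pathfinish ?p = tgt n" using q s by auto
    show "path_image ?p = path_image (strand i) \<union> path_image (strand j) \<union> path_image (strand l) \<union>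
      path_image (strand m) \<union> path_image (strand n)"
      using q(1-4) s(1-3,6-8) ends(3,4) by (simp add: path_image_join)
    show "directed_along u c ?p ?F"
    proof (rule directed_along_join[OF directed_along_join_reverse[where c' = c', OF q(5)]])
      show "directed_along u c' (strand m) ?F" using strand_directed[OF g i(4), of u] col by simp
      show "directed_along u c (strand n) ?F" using strand_directed[OF g i(5), of u] col by simp
    qed (use q s(1-3,6-8) ends(3,4) col in auto)
  qed
qed

end

section \<open>Degrees of two fillings of one disc with the same outer coloring\<close>

locale two_discs =
  a: web_disc w D P V ends As + b: web_disc w' D P V' ends' As'
  for w w' D P V V' ends ends' As As' +
  fixes g :: "complex \<Rightarrow> color" and k k' :: "nat \<Rightarrow> color"
  assumes co: "coincide_outside D w w'"
    and g: "g \<in> outer_colorings a.outer (verts w - D)"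
    and k: "k \<in> a.strand_colorings g" and k': "k' \<in> b.strand_colorings g"
begin

lemma g': "g \<in> outer_colorings b.outer (verts w' - D)"
  using agree_outside_local(1,2)[OF a.web_disc_axioms b.web_disc_axioms co] g by simp

lemma agree:
  "agree_outside D (point_support u (a.glue g k) (flow w) (verts w)) (point_field u (a.glue g k) (flow w))
     (point_support u (b.glue g k') (flow w') (verts w')) (point_field u (b.glue g k') (flow w'))"
  by (rule agree_outside_local(3)[OF a.web_disc_axioms b.web_disc_axioms co g k k'])

lemma simply_connected_D: "simply_connected D"
  using a.disc by (simp add: topological_disc_def)

lemma local_degree_no_strands:
  assumes "\<And>i. i < length ends \<Longrightarrow> k i = u" "\<And>i. i < length ends' \<Longrightarrow> k' i = u"
  shows "a.local_degree g k u = b.local_degree g k' u"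
proof -
  let ?M = "point_support u (a.glue g k) (flow w) (verts w)"
  let ?M' = "point_support u (b.glue g k') (flow w') (verts w')"
  have "?M \<inter> D = {}" "?M' \<inter> D = {}"
    using a.local_structure(1)[OF g k, of u] b.local_structure(1)[OF g' k', of u] assms by auto
  moreover from this have M: "?M = ?M'" using agree[of u] unfolding agree_outside_def by blast
  ultimately have "z \<notin> D" if "z \<in> ?M" for z using that by blast
  then have "cycle_degree ?M (point_field u (a.glue g k) (flow w))
      = cycle_degree ?M (point_field u (b.glue g k') (flow w'))"
    using agree[of u] unfolding agree_outside_def by (intro cycle_degree_cong) blast
  then show ?thesis unfolding a.local_degree_def b.local_degree_def M .
qed

lemma local_degree_crosscut:
  assumes p: "arc p" "a.directed_along u c p (point_field u (a.glue g k) (flow w))"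
    "(\<Union>i\<in>{i. i < length ends \<and> k i \<noteq> u}. path_image (a.strand i)) = path_image p"
    and p': "arc p'" "b.directed_along u c p' (point_field u (b.glue g k') (flow w'))"
    "(\<Union>i\<in>{i. i < length ends' \<and> k' i \<noteq> u}. path_image (b.strand i)) = path_image p'"
    and ends: "pathstart p' = pathstart p" "pathfinish p' = pathfinish p"
  shows "a.local_degree g k u = b.local_degree g k' u"
proof -
  obtain \<Gamma> where \<Gamma>: "loop_decomposition \<Gamma> (point_support u (a.glue g k) (flow w) (verts w))
      (point_field u (a.glue g k) (flow w))"
    using a.local_structure(6)[OF g k] by blast
  note crosscut = cycle_degree_crosscut[OF \<Gamma> a.local_structure(7)[OF g k] b.local_structure(7)[OF g' k']
      a.closed_disc simply_connected_D agree]
  note M = a.local_structure(1)[OF g k, of u] b.local_structure(1)[OF g' k', of u]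
  show ?thesis
  proof (cases "c = Max (colors_without u)")
    case True
    then show ?thesis
      using crosscut[of "reversepath p" "reversepath p'"] p p' ends M
      by (simp add: a.directed_along_def b.directed_along_def a.local_degree_def b.local_degree_def arc_reversepath)
  next
    case False
    then show ?thesis
      using crosscut[of p p'] p p' ends M
      by (simp add: a.directed_along_def b.directed_along_def a.local_degree_def b.local_degree_def)
  qed
qed

lemma local_degree_two_crosscuts:
  assumes p: "arc p" "a.directed_along u c p (point_field u (a.glue g k) (flow w))"
    and q: "arc q" "a.directed_along u e q (point_field u (a.glue g k) (flow w))"
    and pq: "(\<Union>i\<in>{i. i < length ends \<and> k i \<noteq> u}. path_image (a.strand i)) = path_image p \<union> path_image q"
      "path_image p \<inter> path_image q = {}"
    and p': "arc p'" "b.directed_along u c p' (point_field u (b.glue g k') (flow w'))"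
    and q': "arc q'" "b.directed_along u e q' (point_field u (b.glue g k') (flow w'))"
    and pq': "(\<Union>i\<in>{i. i < length ends' \<and> k' i \<noteq> u}. path_image (b.strand i)) = path_image p' \<union> path_image q'"
      "path_image p' \<inter> path_image q' = {}"
    and ends: "pathstart p' = pathstart p" "pathfinish p' = pathfinish p"
      "pathstart q' = pathstart q" "pathfinish q' = pathfinish q"
  shows "a.local_degree g k u = b.local_degree g k' u"
proof -
  obtain \<Gamma> where \<Gamma>: "loop_decomposition \<Gamma> (point_support u (a.glue g k) (flow w) (verts w))
      (point_field u (a.glue g k) (flow w))"
    using a.local_structure(6)[OF g k] by blast
  \<comment> \<open>Brings a crosscut into the direction of the configuration. This depends on its
    color, and the two crosscuts may have different colors.\<close>
  define rev where "rev = (\<lambda>c p :: real \<Rightarrow> complex. if c = Max (colors_without u) then reversepath p else p)"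
  have arc: "arc (rev x s) \<longleftrightarrow> arc s" and im: "path_image (rev x s) = path_image s"
    and fol: "a.directed_along u x s F \<longleftrightarrow> follows (rev x s) F" "b.directed_along u x s F \<longleftrightarrow> follows (rev x s) F"
    for x s F
    by (auto simp: rev_def a.directed_along_def b.directed_along_def arc_reversepath dest: arc_reversepath)
  have "cycle_degree (point_support u (b.glue g k') (flow w') (verts w')) (point_field u (b.glue g k') (flow w'))
      = cycle_degree (point_support u (a.glue g k) (flow w) (verts w)) (point_field u (a.glue g k) (flow w))"
  proof (rule cycle_degree_two_crosscuts[OF \<Gamma> a.local_structure(7)[OF g k] b.local_structure(7)[OF g' k']
        a.closed_disc simply_connected_D agree, of "rev c p" "rev e q" "rev c p'" "rev e q'"])
    show "pathstart (rev c p') = pathstart (rev c p)" "pathfinish (rev c p') = pathfinish (rev c p)"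
      "pathstart (rev e q') = pathstart (rev e q)" "pathfinish (rev e q') = pathfinish (rev e q)"
      using ends by (simp_all add: rev_def)
  qed (use p q pq p' q' pq' a.local_structure(1)[OF g k, of u] b.local_structure(1)[OF g' k', of u]
      in \<open>simp_all add: arc im fol\<close>)
  then show ?thesis by (simp add: a.local_degree_def b.local_degree_def)
qed

text \<open>The loop \<open>q\<close> is directed like a strand of color \<open>c\<close>; if this
  is the greatest color, the field runs through it backwards, which negates its sign.\<close>

lemma local_degree_loop:
  assumes q: "simple_loop q" "a.directed_along u c q (point_field u (a.glue g k) (flow w))"
    "(\<Union>i\<in>{i. i < length ends \<and> k i \<noteq> u}. path_image (a.strand i)) = path_image q"
    and k'u: "\<And>i. i < length ends' \<Longrightarrow> k' i = u"
  shows "a.local_degree g k u = b.local_degree g k' u +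
    (if c = Max (colors_without u) then - loop_sign q else loop_sign q)"
proof -
  let ?M = "point_support u (a.glue g k) (flow w) (verts w)"
  let ?M' = "point_support u (b.glue g k') (flow w') (verts w')"
  obtain \<Gamma> where \<Gamma>: "loop_decomposition \<Gamma> ?M (point_field u (a.glue g k) (flow w))"
    using a.local_structure(6)[OF g k] by blast
  define r where "r = (if c = Max (colors_without u) then reversepath q else q)"
  have r: "simple_loop r" "follows r (point_field u (a.glue g k) (flow w))" "path_image r = path_image q"
    "loop_sign r = (if c = Max (colors_without u) then - loop_sign q else loop_sign q)"
    using q(1,2) by (auto simp: r_def a.directed_along_def simple_loop_reversepath loop_sign_reversepath)
  have M: "?M \<inter> D = path_image r" using a.local_structure(1)[OF g k, of u] q(3) r(3) by simp
  have M': "?M' \<inter> D = {}" using b.local_structure(1)[OF g' k', of u] k'u by auto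
  \<comment> \<open>Closedness comes from the other web: without strands in the disc its support is
    \<open>?M - D\<close>, and this is a finite union of loops.\<close>
  have "closed (?M - D)"
  proof -
    obtain \<Gamma>' where "loop_decomposition \<Gamma>' ?M' (point_field u (b.glue g k') (flow w'))"
      using b.local_structure(6)[OF g' k'] by blast
    then have "?M' = (\<Union>\<gamma>\<in>\<Gamma>'. path_image \<gamma>)" "finite \<Gamma>'" "\<forall>\<gamma>\<in>\<Gamma>'. simple_loop \<gamma>"
      unfolding loop_decomposition_def by auto
    then have "closed ?M'" by (auto intro!: closed_UN closed_path_image simple_loop_imp_path)
    moreover have "?M' = ?M - D" using agree[of u] M' unfolding agree_outside_def by blast
    ultimately show ?thesis by simp
  qed
  then show ?thesis
    using cycle_degree_remove_loop[OF \<Gamma> a.local_structure(7)[OF g k] agree r(1,2) M M'] r(4)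
    by (simp add: a.local_degree_def b.local_degree_def)
qed

end

lemma inside_disc_web_disc:
  assumes "closed_web w" "closed_disc D" "inside_disc D w P V ends" "(\<Union>(x, y)\<in>set ends. {x, y}) = V \<union> P"
  obtains As where "web_disc w D P V ends As"
proof -
  obtain As where As: "list_all2 (\<lambda>A (x, y). oriented_arc A x y) As ends"
    "disjoint_family_on (\<lambda>i. locus (As ! i)) {..<length As}"
    "{x \<in> flow w. fst x \<in> interior D} = \<Union> (set As)"
    using assms(3) unfolding inside_disc_def by blast
  have "web_disc w D P V ends As"
  proof
    show "closed_web w" by (rule assms(1))
    show "topological_disc D" by (rule closed_disc_imp_topological_disc[OF assms(2)])
  qed (use assms(3,4) As in \<open>simp_all add: inside_disc_def\<close>)
  then show ?thesis using that by blast
qed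

text \<open>Lists make strand colorings explicit. The restriction to positions in the list produces
  the extensional functions of which \<open>strand_colorings\<close> consists.\<close>

definition listed :: "'a list \<Rightarrow> nat \<Rightarrow> 'a" where
  "listed xs = (\<lambda>i\<in>{..<length xs}. xs ! i)"

lemma listed_nth [simp]: "i < length xs \<Longrightarrow> listed xs i = xs ! i"
  by (simp add: listed_def)

lemma PiE_listed: "(k \<in> {..<n} \<rightarrow>\<^sub>E UNIV) \<longleftrightarrow> (\<exists>xs. length xs = n \<and> k = listed xs)"
proof
  assume k: "k \<in> {..<n} \<rightarrow>\<^sub>E UNIV"
  have "k = listed (map k [0..<n])"
  proof (rule extensionalityI[of _ "{..<n}"])
    show "k \<in> extensional {..<n}" using k by (simp add: PiE_def)
    show "listed (map k [0..<n]) \<in> extensional {..<n}" by (simp add: listed_def)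
  qed simp
  then show "\<exists>xs. length xs = n \<and> k = listed xs" by (intro exI[of _ "map k [0..<n]"]) simp
qed (auto simp: listed_def PiE_def)

lemma listed_inject: "length xs = length ys \<Longrightarrow> listed xs = listed ys \<longleftrightarrow> xs = ys"
  by (metis listed_nth nth_equalityI)

section \<open>The digon relation\<close>

lemma Collect_less_Suc_conj:
  "{i. i < Suc n \<and> Q i} = (if Q n then insert n {i. i < n \<and> Q i} else {i. i < n \<and> Q i})"
  by (auto simp: less_Suc_eq)

lemma Collect_eq_0_conj: "{i :: nat. i = 0 \<and> Q i} = (if Q 0 then {0} else {})"
  by auto

lemmas strand_simps = All_less_Suc Collect_less_Suc_conj Collect_eq_0_conj listed_def

lemma third_color:
  assumes "(x :: color) \<noteq> y" "x \<noteq> z" "y \<noteq> z" "p \<noteq> x" "p \<noteq> y"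
  shows "p = z"
  using assms UNIV_color_iff[of x y z] by blast

lemma other_colors: obtains y z :: color where "x \<noteq> y" "x \<noteq> z" "y \<noteq> z"
  by (cases x) auto

locale digon =
  a: web_disc w D "{S, N}" "{a, b}" "[(b, a), (b, a), (S, a), (b, N)]" As +
  b: web_disc w' D "{S, N}" "{}" "[(S, N)]" As'
  for w w' D S N a b As As' +
  assumes co: "coincide_outside D w w'" and ab: "a \<noteq> b" and SN: "S \<noteq> N"
begin

lemma distinct_points: "S \<noteq> a" "S \<noteq> b" "N \<noteq> a" "N \<noteq> b"
  using a.V(2) a.P_frontier interior_frontier_disjoint[of D] by auto

lemma ends_simps:
  "a.src 0 = b" "a.tgt 0 = a" "a.src (Suc 0) = b" "a.tgt (Suc 0) = a" "a.src 2 = S" "a.tgt 2 = a"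
  "a.src 3 = b" "a.tgt 3 = N" "b.src 0 = S" "b.tgt 0 = N"
  by (simp_all add: a.src_def a.tgt_def b.src_def b.tgt_def)

lemma a_colorings: "listed [p, q, r, s] \<in> a.strand_colorings g \<longleftrightarrow>
    g S = r \<and> g N = s \<and> {p, q, r} = UNIV \<and> {p, q, s} = UNIV"
  unfolding a.strand_colorings_def using ab SN distinct_points
  by (auto simp: a.src_def a.tgt_def strand_simps insert_commute)

lemma b_colorings: "listed [r] \<in> b.strand_colorings g \<longleftrightarrow> g S = r \<and> g N = r"
  using SN by (auto simp: b.strand_colorings_def b.src_def b.tgt_def strand_simps)

text \<open>The sides of the digon must carry the two colors different from that of the leg at
  \<open>a\<close>, and the leg at \<open>b\<close> then receives the third color again. So the two
  ends have equal colors, and the two colorings differ by exchanging the sides.\<close>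

lemma a_colorings_eq:
  assumes "x \<noteq> y" "x \<noteq> z" "y \<noteq> z" "g S = x"
  shows "a.strand_colorings g = (if g N = x then {listed [y, z, x, x], listed [z, y, x, x]} else {})"
proof -
  have "k = listed [y, z, x, x] \<or> k = listed [z, y, x, x]" "g N = x" if k: "k \<in> a.strand_colorings g" for k
  proof -
    have "k \<in> {..<length [(b, a), (b, a), (S, a), (b, N)]} \<rightarrow>\<^sub>E UNIV"
      using k unfolding a.strand_colorings_def by blast
    then obtain xs where "length xs = Suc (Suc (Suc (Suc 0)))" "k = listed xs" unfolding PiE_listed by auto
    then obtain p q r s where kk: "k = listed [p, q, r, s]" by (auto simp: length_Suc_conv)
    have *: "g S = r" "g N = s" "p \<noteq> q" "p \<noteq> r" "q \<noteq> r" "p \<noteq> s" "q \<noteq> s"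
      using k unfolding kk a_colorings UNIV_color_iff by simp_all
    have "s = r" by (rule third_color[OF *(3,4,5)]) (use *(6,7) in blast)+
    moreover have "r = x" using *(1) assms(4) by simp
    ultimately have "r = x" "s = x" by simp_all
    moreover have "p = y \<or> p = z" using third_color[OF assms(1-3), of p] * \<open>r = x\<close> by blast
    moreover have "q = y \<or> q = z" using third_color[OF assms(1-3), of q] * \<open>r = x\<close> by blast
    ultimately show "k = listed [y, z, x, x] \<or> k = listed [z, y, x, x]" "g N = x"
      using kk *(2,3) by blast+
  qed
  moreover have "listed [y, z, x, x] \<in> a.strand_colorings g" "listed [z, y, x, x] \<in> a.strand_colorings g"
    if "g N = x" using that assms by (auto simp: a_colorings UNIV_color_iff)
  ultimately show ?thesis by (auto split: if_splits)
qed

lemma b_colorings_eq: "b.strand_colorings g = (if g N = g S then {listed [g S]} else {})"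
proof -
  have "k = listed [g S] \<and> g N = g S" if k: "k \<in> b.strand_colorings g" for k
  proof -
    have "k \<in> {..<length [(S, N)]} \<rightarrow>\<^sub>E UNIV" using k unfolding b.strand_colorings_def by blast
    then obtain xs where "length xs = Suc 0" "k = listed xs" unfolding PiE_listed by auto
    then obtain r where "k = listed [r]" by (auto simp: length_Suc_conv)
    then show ?thesis using k b_colorings by auto
  qed
  moreover have "listed [g S] \<in> b.strand_colorings g" if "g N = g S" using that by (simp add: b_colorings)
  ultimately show ?thesis by (auto split: if_splits)
qed

definition "bigon = a.strand 0 +++ reversepath (a.strand (Suc 0))"

lemma bigon:
  "simple_loop bigon" "path_image bigon = path_image (a.strand 0) \<union> path_image (a.strand (Suc 0))"
proof -
  have s: "arc (a.strand 0)" "pathstart (a.strand 0) = b" "pathfinish (a.strand 0) = a"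
    "arc (a.strand (Suc 0))" "pathstart (a.strand (Suc 0)) = b" "pathfinish (a.strand (Suc 0)) = a"
    using a.strand_facts(1-3)[of 0] a.strand_facts(1-3)[of "Suc 0"] ends_simps by simp_all
  have "path_image (a.strand 0) \<inter> path_image (a.strand (Suc 0)) \<subseteq> {a, b}"
    using a.strand_intersection[of 0 "Suc 0"] ends_simps by auto
  then show "simple_loop bigon"
    unfolding bigon_def by (intro simple_loop_join) (use s in \<open>auto simp: arc_reversepath\<close>)
  show "path_image bigon = path_image (a.strand 0) \<union> path_image (a.strand (Suc 0))"
    unfolding bigon_def using s by (simp add: path_image_join)
qed

text \<open>If \<open>x\<close> is deleted, the digon remains as a separate loop and the strand of
  \<open>w'\<close> disappears. If \<open>y\<close> or \<open>z\<close> is deleted, the two legs and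
  the side of the other color form a zigzag from \<open>S\<close> to \<open>N\<close>, which is
  exchanged for the strand.\<close>

lemma degree:
  assumes g: "g \<in> outer_colorings a.outer (verts w - D)" and gSN: "g S = x" "g N = x"
    and xyz: "x \<noteq> y" "x \<noteq> z" "y \<noteq> z"
  shows "(\<Sum>u\<in>UNIV. a.local_degree g (listed [y, z, x, x]) u) = (\<Sum>u\<in>UNIV. b.local_degree g (listed [x]) u) +
    (if y = Max (colors_without x) then - loop_sign bigon else loop_sign bigon)"
proof -
  let ?k = "listed [y, z, x, x]" and ?k' = "listed [x]"
  have k: "?k \<in> a.strand_colorings g" using gSN xyz by (auto simp: a_colorings UNIV_color_iff)
  have k': "?k' \<in> b.strand_colorings g" using gSN by (simp add: b_colorings)
  interpret t: two_discs w w' D "{S, N}" "{a, b}" "{}" "[(b, a), (b, a), (S, a), (b, N)]" "[(S, N)]" As As' g ?k ?k'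
    by unfold_locales (use co g k k' in auto)
  have kv: "?k 0 = y" "?k (Suc 0) = z" "?k 2 = x" "?k 3 = x" "?k' 0 = x" by (simp_all add: listed_def)
  have deg_x: "a.local_degree g ?k x = b.local_degree g ?k' x +
      (if y = Max (colors_without x) then - loop_sign bigon else loop_sign bigon)"
  proof (rule t.local_degree_loop[OF bigon(1)])
    show "a.directed_along x y bigon (point_field x (a.glue g ?k) (flow w))"
      unfolding bigon_def
    proof (rule a.directed_along_join_reverse[where c' = z])
      show "a.directed_along x y (a.strand 0) (point_field x (a.glue g ?k) (flow w))"
        using a.strand_directed[OF g k, of 0 x] kv xyz by simp
      show "a.directed_along x z (a.strand (Suc 0)) (point_field x (a.glue g ?k) (flow w))"
        using a.strand_directed[OF g k, of "Suc 0" x] kv xyz by simp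
      show "pathfinish (a.strand 0) = pathfinish (a.strand (Suc 0))"
        using a.strand_facts(3)[of 0] a.strand_facts(3)[of "Suc 0"] ends_simps by simp
    qed (use xyz in auto)
    show "(\<Union>i\<in>{i. i < length [(b, a), (b, a), (S, a), (b, N)] \<and> ?k i \<noteq> x}. path_image (a.strand i)) = path_image bigon"
      unfolding bigon(2) using xyz by (auto simp: strand_simps)
    show "?k' i = x" if "i < length [(S, N)]" for i using that kv by simp
  qed
  \<comment> \<open>Deleting one side color leaves the other side \<open>j\<close> between the legs
    2 and 3; its color is \<open>c'\<close>.\<close>
  have crosscut: "a.local_degree g ?k u = b.local_degree g ?k' u"
    if u: "u \<noteq> x" "u \<noteq> c'" "x \<noteq> c'" and j: "j < 2" "?k j = c'"
      and J: "{i. i < length [(b, a), (b, a), (S, a), (b, N)] \<and> ?k i \<noteq> u} = {2, j, 3}" for u c' j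
  proof -
    have je: "a.src j = b" "a.tgt j = a" using j(1) ends_simps by (auto simp: less_Suc_eq numeral_2_eq_2)
    obtain p where p: "arc p" "pathstart p = a.src 2" "pathfinish p = a.tgt 3"
      "path_image p = path_image (a.strand 2) \<union> path_image (a.strand j) \<union> path_image (a.strand 3)"
      "a.directed_along u x p (point_field u (a.glue g ?k) (flow w))"
    proof (rule a.zigzag3[OF g k, of 2 j 3 x c' u])
      show "distinct [a.src 2, a.tgt j, a.src j, a.tgt 3]"
        using je ends_simps distinct_points ab SN by auto
    qed (use j u je ends_simps kv in auto)
    have s: "arc (b.strand 0)" "pathstart (b.strand 0) = S" "pathfinish (b.strand 0) = N"
      using b.strand_facts(1-3)[of 0] ends_simps by simp_all
    show ?thesis
    proof (rule t.local_degree_crosscut[OF p(1,5) _ s(1)])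
      show "(\<Union>i\<in>{i. i < length [(b, a), (b, a), (S, a), (b, N)] \<and> ?k i \<noteq> u}. path_image (a.strand i)) = path_image p"
        unfolding J p(4) by auto
      show "b.directed_along u x (b.strand 0) (point_field u (b.glue g ?k') (flow w'))"
        using b.strand_directed[OF t.g' k', of 0 u] kv u by simp
      show "(\<Union>i\<in>{i. i < length [(S, N)] \<and> ?k' i \<noteq> u}. path_image (b.strand i)) = path_image (b.strand 0)"
        using u by (auto simp: strand_simps)
    qed (use p(2,3) s ends_simps in simp_all)
  qed
  have deg_y: "a.local_degree g ?k y = b.local_degree g ?k' y"
    by (rule crosscut[of y z "Suc 0"]) (use xyz kv in \<open>auto simp: strand_simps\<close>)
  have deg_z: "a.local_degree g ?k z = b.local_degree g ?k' z"
    by (rule crosscut[of z y 0]) (use xyz kv in \<open>auto simp: strand_simps\<close>)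
  show ?thesis unfolding sum_color_triple[OF xyz] deg_x deg_y deg_z by simp
qed

lemma bracket: "bracket w = quantum_int 2 * bracket w'"
proof -
  let ?G = "outer_colorings a.outer (verts w - D)"
  note same = agree_outside_local(1,2)[OF a.web_disc_axioms b.web_disc_axioms co]
  \<comment> \<open>The outer colorings that extend to at least one of the two webs, as a common
    finite index set.\<close>
  define H where "H = {g \<in> ?G. a.strand_colorings g \<noteq> {}} \<union> {g \<in> ?G. b.strand_colorings g \<noteq> {}}"
  have H: "finite H" "H \<subseteq> ?G"
    using a.bracket_local(1) b.bracket_local(1) same by (auto simp: H_def)
  have wa: "bracket w = (\<Sum>g\<in>H. \<Sum>k\<in>a.strand_colorings g. qpow (\<Sum>u\<in>UNIV. a.local_degree g k u))"
    by (rule a.bracket_local(2)[OF H]) (auto simp: H_def)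
  have wb: "bracket w' = (\<Sum>g\<in>H. \<Sum>k\<in>b.strand_colorings g. qpow (\<Sum>u\<in>UNIV. b.local_degree g k u))"
    by (rule b.bracket_local(2)) (use H same in \<open>auto simp: H_def\<close>)
  have "(\<Sum>k\<in>a.strand_colorings g. qpow (\<Sum>u\<in>UNIV. a.local_degree g k u)) =
      quantum_int 2 * (\<Sum>k\<in>b.strand_colorings g. qpow (\<Sum>u\<in>UNIV. b.local_degree g k u))" if gH: "g \<in> H" for g
  proof -
    have g: "g \<in> ?G" using gH H by blast
    define x where "x = g S"
    obtain y z where xyz: "x \<noteq> y" "x \<noteq> z" "y \<noteq> z" using other_colors .
    have xzy: "x \<noteq> z" "x \<noteq> y" "z \<noteq> y" using xyz by auto
    show ?thesis
    proof (cases "g N = x")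
      case False
      then show ?thesis using a_colorings_eq[where g = g, OF xyz x_def[symmetric]] b_colorings_eq[of g] by (simp add: x_def)
    next
      case True
      have ne: "listed [y, z, x, x] \<noteq> listed [z, y, x, x]" using xyz by (simp add: listed_inject)
      have ea: "a.strand_colorings g = {listed [y, z, x, x], listed [z, y, x, x]}"
        using a_colorings_eq[where g = g, OF xyz x_def[symmetric]] True by simp
      have eb: "b.strand_colorings g = {listed [x]}" using b_colorings_eq[of g] True by (simp add: x_def)
      note d1 = degree[OF g x_def[symmetric] True xyz] and d2 = degree[OF g x_def[symmetric] True xzy]
      define d where "d = (\<Sum>u\<in>UNIV. b.local_degree g (listed [x]) u)"
      \<comment> \<open>Exactly one of \<open>y\<close> and \<open>z\<close> is the greatest color
        without \<open>x\<close>, so exchanging them changes the sign with which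
        \<open>bigon\<close> enters. The exponents are \<open>d + 1\<close> and \<open>d - 1\<close>
        in one order or the other.\<close>
      have "(\<Sum>k\<in>a.strand_colorings g. qpow (\<Sum>u\<in>UNIV. a.local_degree g k u)) = qpow (d + 1) + qpow (d + - 1)"
        unfolding ea using ne d1 d2 Max_without_third[OF xyz(3), of x] xyz loop_sign_cases[of bigon]
        by (auto simp: d_def[symmetric])
      also have "\<dots> = quantum_int 2 * qpow d"
        unfolding quantum_int_2 qpow_add by (simp add: algebra_simps)
      finally show ?thesis unfolding eb by (simp add: d_def)
    qed
  qed
  then have "bracket w = (\<Sum>g\<in>H. quantum_int 2 * (\<Sum>k\<in>b.strand_colorings g. qpow (\<Sum>u\<in>UNIV. b.local_degree g k u)))"
    unfolding wa by (rule sum.cong[OF refl])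
  then show ?thesis unfolding wb by (simp only: sum_distrib_left)
qed

end

lemma bracket_digon:
  assumes "closed_web w" "closed_web w'" "closed_disc D" "S \<noteq> N" "coincide_outside D w w'" "a \<noteq> b"
    "inside_disc D w {S, N} {a, b} [(b, a), (b, a), (S, a), (b, N)]" "inside_disc D w' {S, N} {} [(S, N)]"
  shows "bracket w = quantum_int 2 * bracket w'"
proof -
  obtain As where As: "web_disc w D {S, N} {a, b} [(b, a), (b, a), (S, a), (b, N)] As"
    by (rule inside_disc_web_disc[OF assms(1,3,7)]) auto
  obtain As' where As': "web_disc w' D {S, N} {} [(S, N)] As'"
    by (rule inside_disc_web_disc[OF assms(2,3,8)]) auto
  interpret digon w w' D S N a b As As'
    using As As' assms(4-6) by (simp add: digon_def digon_axioms_def)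
  show ?thesis by (rule bracket)
qed

section \<open>The square relation\<close>

context two_discs
begin

text \<open>In the square this is the situation where the deleted color occurs on one side and on
  the two legs away from it: the five remaining strands run through all four vertices.\<close>

lemma local_degree_zigzag5:
  assumes i: "i < length ends" "j < length ends" "l < length ends" "m < length ends" "n < length ends"
      "distinct [i, j, l, m, n]"
    and e: "a.tgt i = a.tgt j" "a.src j = a.src l" "a.tgt l = a.tgt m" "a.src m = a.src n"
      "distinct [a.src i, a.tgt j, a.src j, a.tgt l, a.src m, a.tgt n]"
    and col: "k i = c" "k j = c'" "k l = c" "k m = c'" "k n = c" "c \<noteq> c'" "c \<noteq> u" "c' \<noteq> u"
      "{i. i < length ends \<and> k i \<noteq> u} = {i, j, l, m, n}"
    and h: "h < length ends'" "k' h = c" "{i. i < length ends' \<and> k' i \<noteq> u} = {h}"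
      "b.src h = a.src i" "b.tgt h = a.tgt n"
  shows "a.local_degree g k u = b.local_degree g k' u"
proof -
  obtain p where p: "arc p" "pathstart p = a.src i" "pathfinish p = a.tgt n"
    "path_image p = path_image (a.strand i) \<union> path_image (a.strand j) \<union> path_image (a.strand l) \<union>
      path_image (a.strand m) \<union> path_image (a.strand n)"
    "a.directed_along u c p (point_field u (a.glue g k) (flow w))"
    by (rule a.zigzag5[OF g k i e col(1-8)])
  note s = b.strand_facts(1-3)[OF h(1)]
  show ?thesis
  proof (rule local_degree_crosscut[OF p(1,5) _ s(1)])
    show "b.directed_along u c (b.strand h) (point_field u (b.glue g k') (flow w'))"
      using b.strand_directed[OF g' k' h(1), of u] h(2) col(7) by simp
  qed (use p s h col(9) in auto)
qed

text \<open>In the square this is the situation where the deleted color occurs on two opposite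
  sides: each of the other two sides connects two legs.\<close>

lemma local_degree_two_zigzags:
  assumes i: "i < length ends" "j < length ends" "l < length ends" "m < length ends" "n < length ends"
      "r < length ends" "distinct [i, j, l, m, n, r]"
    and e: "a.tgt i = a.tgt j" "a.src j = a.src l" "a.tgt m = a.tgt n" "a.src n = a.src r"
      "distinct [a.src i, a.tgt j, a.src j, a.tgt l, a.src m, a.tgt n, a.src n, a.tgt r]"
    and col: "k i = c" "k j = c'" "k l = c" "c \<noteq> c'" "c \<noteq> u" "c' \<noteq> u"
      "k m = e" "k n = e'" "k r = e" "e \<noteq> e'" "e \<noteq> u" "e' \<noteq> u"
      "{i. i < length ends \<and> k i \<noteq> u} = {i, j, l, m, n, r}"
    and h: "h < length ends'" "h' < length ends'" "h \<noteq> h'" "k' h = c" "k' h' = e"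
      "{i. i < length ends' \<and> k' i \<noteq> u} = {h, h'}"
      "b.src h = a.src i" "b.tgt h = a.tgt l" "b.src h' = a.src m" "b.tgt h' = a.tgt r"
  shows "a.local_degree g k u = b.local_degree g k' u"
proof -
  have d: "distinct [i, j, l]" "distinct [m, n, r]" "distinct [a.src i, a.tgt j, a.src j, a.tgt l]"
    "distinct [a.src m, a.tgt n, a.src n, a.tgt r]" using i(7) e(5) by auto
  obtain p where p: "arc p" "pathstart p = a.src i" "pathfinish p = a.tgt l"
    "path_image p = path_image (a.strand i) \<union> path_image (a.strand j) \<union> path_image (a.strand l)"
    "a.directed_along u c p (point_field u (a.glue g k) (flow w))"
    by (rule a.zigzag3[OF g k i(1-3) d(1) e(1,2) d(3) col(1-6)])
  obtain q where q: "arc q" "pathstart q = a.src m" "pathfinish q = a.tgt r"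
    "path_image q = path_image (a.strand m) \<union> path_image (a.strand n) \<union> path_image (a.strand r)"
    "a.directed_along u e q (point_field u (a.glue g k) (flow w))"
    by (rule a.zigzag3[OF g k i(4-6) d(2) e(3,4) d(4) col(7-12)])
  have "path_image (a.strand x) \<inter> path_image (a.strand y) = {}"
    if xy: "x \<in> {i, j, l}" "y \<in> {m, n, r}" for x y
  proof -
    have "x < length ends" "y < length ends" "x \<noteq> y" using xy i by auto
    then have "path_image (a.strand x) \<inter> path_image (a.strand y)
        \<subseteq> {a.src x, a.tgt x} \<inter> {a.src y, a.tgt y}" by (rule a.strand_intersection)
    moreover have "{a.src x, a.tgt x} \<subseteq> {a.src i, a.tgt j, a.src j, a.tgt l}"
      using xy(1) e(1,2) by auto
    moreover have "{a.src y, a.tgt y} \<subseteq> {a.src m, a.tgt n, a.src n, a.tgt r}"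
      using xy(2) e(3,4) by auto
    moreover have "{a.src i, a.tgt j, a.src j, a.tgt l} \<inter> {a.src m, a.tgt n, a.src n, a.tgt r} = {}"
      using e(5) by auto
    ultimately show ?thesis by blast
  qed
  then have pq: "path_image p \<inter> path_image q = {}" unfolding p(4) q(4) by blast
  note s = b.strand_facts(1-3)[OF h(1)] b.strand_facts(1-3)[OF h(2)]
  show ?thesis
  proof (rule local_degree_two_crosscuts[OF p(1,5) q(1,5) _ pq s(1) _ s(4)])
    show "b.directed_along u c (b.strand h) (point_field u (b.glue g k') (flow w'))"
      using b.strand_directed[OF g' k' h(1), of u] h(4) col(5) by simp
    show "b.directed_along u e (b.strand h') (point_field u (b.glue g k') (flow w'))"
      using b.strand_directed[OF g' k' h(2), of u] h(5) col(11) by simp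
    show "path_image (b.strand h) \<inter> path_image (b.strand h') = {}"
      using b.strand_intersection[OF h(1-3)] h(7-10) e(5) by auto
    show "(\<Union>i\<in>{i. i < length ends \<and> k i \<noteq> u}. path_image (a.strand i)) = path_image p \<union> path_image q"
      unfolding col(13) p(4) q(4) by auto
    show "(\<Union>i\<in>{i. i < length ends' \<and> k' i \<noteq> u}. path_image (b.strand i))
        = path_image (b.strand h) \<union> path_image (b.strand h')" unfolding h(6) by auto
  qed (use p q s h in auto)
qed

text \<open>The strands themselves are the crosscuts of \<open>cycle_degree_saddle\<close>, except
  that all of them are reversed if \<open>z\<close> is the greatest color.\<close>

lemma local_degree_saddle:
  assumes ord: "boundary_order D \<sigma> A B C E" and P4: "P = {A, B, C, E}"
    and ends4: "ends = [(A, B), (C, E)]" "ends' = [(A, E), (C, B)]"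
    and col: "k 0 = z" "k 1 = z" "k' 0 = z" "k' 1 = z" "z \<noteq> u"
  shows "b.local_degree g k' u = a.local_degree g k u + (if z = Max (colors_without u) then - \<sigma> else \<sigma>)"
proof -
  obtain \<Gamma> where \<Gamma>: "loop_decomposition \<Gamma> (point_support u (a.glue g k) (flow w) (verts w))
      (point_field u (a.glue g k) (flow w))"
    using a.local_structure(6)[OF g k] by blast
  have src: "a.src 0 = A" "a.tgt 0 = B" "a.src 1 = C" "a.tgt 1 = E"
    "b.src 0 = A" "b.tgt 0 = E" "b.src 1 = C" "b.tgt 1 = B"
    unfolding a.src_def a.tgt_def b.src_def b.tgt_def unfolding ends4 by simp_all
  have len: "(0 :: nat) < length ends" "1 < length ends" "(0 :: nat) < length ends'" "1 < length ends'"
    by (simp_all add: ends4)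
  note s = a.strand_facts(1-3)[OF len(1)] a.strand_facts(1-3)[OF len(2)]
    b.strand_facts(1-3)[OF len(3)] b.strand_facts(1-3)[OF len(4)]
  have fr: "path_image (a.strand 0) \<inter> frontier D = {A, B}" "path_image (a.strand 1) \<inter> frontier D = {C, E}"
    "path_image (b.strand 0) \<inter> frontier D = {A, E}" "path_image (b.strand 1) \<inter> frontier D = {C, B}"
    using a.strand_disc(2)[OF len(1)] a.strand_disc(2)[OF len(2)] b.strand_disc(2)[OF len(3)]
      b.strand_disc(2)[OF len(4)] src P4 by auto
  have ABCE: "distinct [A, B, C, E]"
  proof -
    have "A \<noteq> B" "C \<noteq> E" "A \<noteq> E" "C \<noteq> B" using s src arc_distinct_ends by metis+
    moreover have "A \<noteq> C" "B \<noteq> E"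
      using ord unfolding boundary_order_def
      by (metis disjoint_iff pathstart_in_path_image)+
    ultimately show ?thesis by auto
  qed
  have disj: "path_image (a.strand 0) \<inter> path_image (a.strand 1) = {}"
    "path_image (b.strand 0) \<inter> path_image (b.strand 1) = {}"
  proof -
    have "{A, B} \<inter> {C, E} = {}" "{A, E} \<inter> {C, B} = {}" using ABCE by auto
    then show "path_image (a.strand 0) \<inter> path_image (a.strand 1) = {}"
      "path_image (b.strand 0) \<inter> path_image (b.strand 1) = {}"
      using a.strand_intersection[OF len(1,2) zero_neq_one] b.strand_intersection[OF len(3,4) zero_neq_one]
      unfolding src by blast+
  qed
  have idx: "{i. i < length ends \<and> k i \<noteq> u} = {0, 1}" "{i. i < length ends' \<and> k' i \<noteq> u} = {0, 1}"
    using col by (auto simp: ends4 less_Suc_eq)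
  have M: "point_support u (a.glue g k) (flow w) (verts w) \<inter> D = path_image (a.strand 0) \<union> path_image (a.strand 1)"
    "point_support u (b.glue g k') (flow w') (verts w') \<inter> D = path_image (b.strand 0) \<union> path_image (b.strand 1)"
    using a.local_structure(1)[OF g k, of u] b.local_structure(1)[OF g' k', of u] unfolding idx by auto
  have dir: "a.directed_along u z (a.strand 0) (point_field u (a.glue g k) (flow w))"
    "a.directed_along u z (a.strand 1) (point_field u (a.glue g k) (flow w))"
    "b.directed_along u z (b.strand 0) (point_field u (b.glue g k') (flow w'))"
    "b.directed_along u z (b.strand 1) (point_field u (b.glue g k') (flow w'))"
    using a.strand_directed[OF g k len(1), of u] a.strand_directed[OF g k len(2), of u]
      b.strand_directed[OF g' k' len(3), of u] b.strand_directed[OF g' k' len(4), of u] col by simp_all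
  note saddle = cycle_degree_saddle[OF \<Gamma> a.local_structure(7)[OF g k] b.local_structure(7)[OF g' k']
      a.disc agree]
  show ?thesis
  proof (cases "z = Max (colors_without u)")
    case False
    then have fol: "follows (a.strand 0) (point_field u (a.glue g k) (flow w))"
      "follows (a.strand 1) (point_field u (a.glue g k) (flow w))"
      "follows (b.strand 0) (point_field u (b.glue g k') (flow w'))"
      "follows (b.strand 1) (point_field u (b.glue g k') (flow w'))"
      using dir by (simp_all add: a.directed_along_def b.directed_along_def)
    have "b.local_degree g k' u = a.local_degree g k u + \<sigma>"
      unfolding a.local_degree_def b.local_degree_def
      by (rule saddle[OF ord s(1) fol(1) s(4) fol(2) M(1) disj(1) _ _ _ _ fr(1,2)
          s(7) fol(3) s(10) fol(4) M(2) disj(2) _ _ _ _ fr(3,4)]) (use s src in simp_all)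
    then show ?thesis using False by simp
  next
    case True
    \<comment> \<open>The reversed crosscuts run from \<open>B\<close> to \<open>A\<close> and from
      \<open>E\<close> to \<open>C\<close>, which calls for the ends in the order \<open>B\<close>,
      \<open>A\<close>, \<open>E\<close>, \<open>C\<close>, of sign \<open>- \<sigma>\<close>. For
      the same reason the new strands are interchanged below.\<close>
    have ord': "boundary_order D (- \<sigma>) B A E C"
      using boundary_order_rotate[OF boundary_order_rotate[OF boundary_order_rotate[OF boundary_order_reverse[OF ord]]]] .
    let ?r = "reversepath"
    have fol: "follows (?r (a.strand 0)) (point_field u (a.glue g k) (flow w))"
      "follows (?r (a.strand 1)) (point_field u (a.glue g k) (flow w))"
      "follows (?r (b.strand 0)) (point_field u (b.glue g k') (flow w'))"
      "follows (?r (b.strand 1)) (point_field u (b.glue g k') (flow w'))"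
      using dir True by (simp_all add: a.directed_along_def b.directed_along_def)
    have "b.local_degree g k' u = a.local_degree g k u + (- \<sigma>)"
      unfolding a.local_degree_def b.local_degree_def
      by (rule saddle[OF ord', of "?r (a.strand 0)" "?r (a.strand 1)" "?r (b.strand 1)" "?r (b.strand 0)"])
        (use s src fol M disj fr in \<open>simp_all add: arc_reversepath insert_commute Un_commute Int_commute\<close>)
    then show ?thesis using True by simp
  qed
qed

end

lemma boundary_order_distinct:
  assumes "boundary_order D \<sigma> A B C E"
  shows "distinct [A, B, C, E]"
proof -
  have "A \<noteq> B" "B \<noteq> C" "C \<noteq> E" "E \<noteq> A"
    using assms unfolding boundary_order_def by (metis arc_distinct_ends)+
  moreover have "A \<noteq> C" "B \<noteq> E"
    using assms unfolding boundary_order_def by (metis disjoint_iff pathstart_in_path_image)+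
  ultimately show ?thesis by auto
qed

text \<open>The colors \<open>p0\<close> to \<open>p3\<close> are those of the sides in cyclic
  order, the others those of the legs. Neighboring sides differ, so with three colors at least one
  pair of opposite sides has equal colors; each leg has the color missing on the two sides that it
  meets.\<close>

lemma four_cycle_colors:
  fixes p0 p1 p2 p3 p4 p5 p6 p7 :: color
  assumes "p0 \<noteq> p3" "p0 \<noteq> p4" "p3 \<noteq> p4" "p0 \<noteq> p1" "p0 \<noteq> p6" "p1 \<noteq> p6"
    "p1 \<noteq> p2" "p1 \<noteq> p5" "p2 \<noteq> p5" "p2 \<noteq> p3" "p2 \<noteq> p7" "p3 \<noteq> p7"
  obtains x y z where "x \<noteq> y" "x \<noteq> z" "y \<noteq> z"
    "[p0, p1, p2, p3, p4, p5, p6, p7] \<in> {[x, y, x, y, z, z, z, z], [x, y, x, z, y, z, z, y], [z, x, y, x, y, z, y, z]}"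
proof -
  have e: "p4 = q" if "q \<noteq> p0" "q \<noteq> p3" for q using third_color[of p0 p3 q p4] assms that by metis
  have f: "p5 = q" if "q \<noteq> p1" "q \<noteq> p2" for q using third_color[of p1 p2 q p5] assms that by metis
  have h: "p6 = q" if "q \<noteq> p0" "q \<noteq> p1" for q using third_color[of p0 p1 q p6] assms that by metis
  have i: "p7 = q" if "q \<noteq> p2" "q \<noteq> p3" for q using third_color[of p2 p3 q p7] assms that by metis
  consider "p0 = p2" "p1 = p3" | "p0 = p2" "p1 \<noteq> p3" | "p0 \<noteq> p2" "p1 = p3"
    using third_color[of p0 p2 p1 p3] assms by metis
  then show ?thesis
  proof cases
    case 1
    have "p5 = p4" "p6 = p4" "p7 = p4" using f[of p4] h[of p4] i[of p4] assms 1 by auto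
    then show ?thesis using that[of p0 p1 p4] assms 1 by simp
  next
    case 2
    have "p4 = p1" "p5 = p3" "p6 = p3" "p7 = p1" using e[of p1] f[of p3] h[of p3] i[of p1] assms 2 by auto
    then show ?thesis using that[of p0 p1 p3] assms 2 by auto
  next
    case 3
    have "p4 = p2" "p5 = p0" "p6 = p2" "p7 = p0" using e[of p2] f[of p0] h[of p2] i[of p0] assms 3 by auto
    then show ?thesis using that[of p1 p2 p0] assms 3 by auto
  qed
qed

text \<open>In the theorem's notation, \<open>A\<close>, \<open>B\<close>, \<open>C\<close>, \<open>E\<close> are \<open>SW\<close>, \<open>SE\<close>, \<open>NE\<close>, \<open>NW\<close>.  The instances
  \<open>sq\<close>, \<open>hz\<close>, \<open>vt\<close> belong to the square and to its two resolutions.\<close>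

locale square =
  sq: web_disc w D "{A, B, C, E}" "{a, b, c, d}"
    "[(b, a), (b, c), (d, c), (d, a), (A, a), (C, c), (b, B), (d, E)]" As +
  hz: web_disc w' D "{A, B, C, E}" "{}" "[(A, B), (C, E)]" As' +
  vt: web_disc w'' D "{A, B, C, E}" "{}" "[(A, E), (C, B)]" As''
  for w w' w'' D A B C E a b c d As As' As'' +
  fixes \<sigma> :: int
  assumes co': "coincide_outside D w w'" and co'': "coincide_outside D w w''"
    and abcd: "distinct [a, b, c, d]" and ord: "boundary_order D \<sigma> A B C E"
begin

lemma distinct_points: "distinct [A, B, C, E, a, b, c, d]"
proof -
  have "{A, B, C, E} \<inter> {a, b, c, d} = {}"
    using sq.V(2) sq.P_frontier interior_frontier_disjoint[of D] by blast
  then show ?thesis using boundary_order_distinct[OF ord] abcd by auto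
qed

lemma ends_simps:
  "sq.src 0 = b" "sq.tgt 0 = a" "sq.src 1 = b" "sq.tgt 1 = c" "sq.src 2 = d" "sq.tgt 2 = c"
  "sq.src 3 = d" "sq.tgt 3 = a" "sq.src 4 = A" "sq.tgt 4 = a" "sq.src 5 = C" "sq.tgt 5 = c"
  "sq.src 6 = b" "sq.tgt 6 = B" "sq.src 7 = d" "sq.tgt 7 = E"
  "hz.src 0 = A" "hz.tgt 0 = B" "hz.src 1 = C" "hz.tgt 1 = E"
  "vt.src 0 = A" "vt.tgt 0 = E" "vt.src 1 = C" "vt.tgt 1 = B"
  "sq.src (Suc 0) = b" "sq.tgt (Suc 0) = c" "hz.src (Suc 0) = C" "hz.tgt (Suc 0) = E"
  "vt.src (Suc 0) = C" "vt.tgt (Suc 0) = B"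
  by (simp_all add: sq.src_def sq.tgt_def hz.src_def hz.tgt_def vt.src_def vt.tgt_def)

lemma strand_index:
  "{i. i < length [(b, a), (b, c), (d, c), (d, a), (A, a), (C, c), (b, B), (d, E)] \<and> Q i} = {i \<in> {0, 1, 2, 3, 4, 5, 6, 7}. Q i}"
  by (auto simp: less_Suc_eq)

lemma sq_colorings: "listed [p0, p1, p2, p3, p4, p5, p6, p7] \<in> sq.strand_colorings g \<longleftrightarrow>
    g A = p4 \<and> g C = p5 \<and> g B = p6 \<and> g E = p7 \<and>
    {p0, p3, p4} = UNIV \<and> {p0, p1, p6} = UNIV \<and> {p1, p2, p5} = UNIV \<and> {p2, p3, p7} = UNIV"
proof -
  let ?E = "[(b, a), (b, c), (d, c), (d, a), (A, a), (C, c), (b, B), (d, E)]"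
  let ?k = "listed [p0, p1, p2, p3, p4, p5, p6, p7]"
  note p = distinct_points[simplified]
  have nth: "?k 0 = p0" "?k 1 = p1" "?k 2 = p2" "?k 3 = p3" "?k 4 = p4" "?k 5 = p5" "?k 6 = p6" "?k 7 = p7"
    "?k (Suc 0) = p1"
    by (simp_all add: listed_def)
  have all: "(\<forall>i<length ?E. Q i) \<longleftrightarrow> Q 0 \<and> Q 1 \<and> Q 2 \<and> Q 3 \<and> Q 4 \<and> Q 5 \<and> Q 6 \<and> Q 7" for Q
    by (simp add: All_less_Suc eval_nat_numeral conj_ac)
  have P: "{b, a} \<inter> {A, B, C, E} = {}" "{b, c} \<inter> {A, B, C, E} = {}" "{d, c} \<inter> {A, B, C, E} = {}"
    "{d, a} \<inter> {A, B, C, E} = {}" "{A, a} \<inter> {A, B, C, E} = {A}" "{C, c} \<inter> {A, B, C, E} = {C}"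
    "{b, B} \<inter> {A, B, C, E} = {B}" "{d, E} \<inter> {A, B, C, E} = {E}"
    using p by auto
  have V: "{i. i < length ?E \<and> a \<in> {sq.src i, sq.tgt i}} = {0, 3, 4}"
    "{i. i < length ?E \<and> b \<in> {sq.src i, sq.tgt i}} = {0, 1, 6}"
    "{i. i < length ?E \<and> c \<in> {sq.src i, sq.tgt i}} = {1, 2, 5}"
    "{i. i < length ?E \<and> d \<in> {sq.src i, sq.tgt i}} = {2, 3, 7}"
    unfolding strand_index using p by (auto simp: ends_simps)
  have "?k \<in> {..<length ?E} \<rightarrow>\<^sub>E UNIV" unfolding PiE_listed by (intro exI[of _ "[p0, p1, p2, p3, p4, p5, p6, p7]"] conjI refl) simp
  then show ?thesis
    unfolding sq.strand_colorings_def mem_Collect_eq all ends_simps P ball_simps(5,7) V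
    by (simp add: nth del: length_Cons list.size)
qed

lemma hz_colorings: "listed [r, s] \<in> hz.strand_colorings g \<longleftrightarrow> g A = r \<and> g B = r \<and> g C = s \<and> g E = s"
  unfolding hz.strand_colorings_def using distinct_points
  by (auto simp: hz.src_def hz.tgt_def strand_simps)

lemma vt_colorings: "listed [r, s] \<in> vt.strand_colorings g \<longleftrightarrow> g A = r \<and> g E = r \<and> g C = s \<and> g B = s"
  unfolding vt.strand_colorings_def using distinct_points
  by (auto simp: vt.src_def vt.tgt_def strand_simps)

lemma sq_coloring_cases:
  assumes "k \<in> sq.strand_colorings g"
  obtains x y z where "x \<noteq> y" "x \<noteq> z" "y \<noteq> z"
    "k \<in> {listed [x, y, x, y, z, z, z, z], listed [x, y, x, z, y, z, z, y], listed [z, x, y, x, y, z, y, z]}"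
proof -
  have "k \<in> {..<length [(b, a), (b, c), (d, c), (d, a), (A, a), (C, c), (b, B), (d, E)]} \<rightarrow>\<^sub>E UNIV"
    using assms unfolding sq.strand_colorings_def by blast
  then obtain xs where "length xs = Suc (Suc (Suc (Suc (Suc (Suc (Suc (Suc 0)))))))" "k = listed xs"
    unfolding PiE_listed by auto
  then obtain p0 p1 p2 p3 p4 p5 p6 p7 where k: "k = listed [p0, p1, p2, p3, p4, p5, p6, p7]"
    by (auto simp: length_Suc_conv)
  have "p0 \<noteq> p3" "p0 \<noteq> p4" "p3 \<noteq> p4" "p0 \<noteq> p1" "p0 \<noteq> p6" "p1 \<noteq> p6"
    "p1 \<noteq> p2" "p1 \<noteq> p5" "p2 \<noteq> p5" "p2 \<noteq> p3" "p2 \<noteq> p7" "p3 \<noteq> p7"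
    using assms unfolding k sq_colorings UNIV_color_iff by simp_all
  then obtain x y z where xyz: "x \<noteq> y" "x \<noteq> z" "y \<noteq> z"
    "[p0, p1, p2, p3, p4, p5, p6, p7] \<in> {[x, y, x, y, z, z, z, z], [x, y, x, z, y, z, z, y], [z, x, y, x, y, z, y, z]}"
    by (rule four_cycle_colors)
  show ?thesis by (rule that[OF xyz(1-3)]) (use xyz(4) k in blast)
qed

lemma hz_coloring_cases:
  assumes "k \<in> hz.strand_colorings g"
  shows "k = listed [g A, g C]" "g B = g A" "g E = g C"
proof -
  have "k \<in> {..<length [(A, B), (C, E)]} \<rightarrow>\<^sub>E UNIV" using assms unfolding hz.strand_colorings_def by blast
  then obtain xs where "length xs = Suc (Suc 0)" "k = listed xs" unfolding PiE_listed by auto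
  then obtain r s where "k = listed [r, s]" by (auto simp: length_Suc_conv)
  then show "k = listed [g A, g C]" "g B = g A" "g E = g C" using assms hz_colorings by auto
qed

lemma vt_coloring_cases:
  assumes "k \<in> vt.strand_colorings g"
  shows "k = listed [g A, g C]" "g E = g A" "g B = g C"
proof -
  have "k \<in> {..<length [(A, E), (C, B)]} \<rightarrow>\<^sub>E UNIV" using assms unfolding vt.strand_colorings_def by blast
  then obtain xs where "length xs = Suc (Suc 0)" "k = listed xs" unfolding PiE_listed by auto
  then obtain r s where "k = listed [r, s]" by (auto simp: length_Suc_conv)
  then show "k = listed [g A, g C]" "g E = g A" "g B = g C" using assms vt_colorings by auto
qed

text \<open>The order of the vertices is \<open>b\<close>, \<open>a\<close>, \<open>d\<close>,
  \<open>c\<close>. Strands 3 and 1 are run backwards, so that when the sides alternate in color the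
  loop is directed like strands 0 and 2.\<close>

definition "cycle = (sq.strand 0 +++ reversepath (sq.strand 3)) +++ (sq.strand 2 +++ reversepath (sq.strand 1))"

lemma strand_inter:
  assumes "i < 8" "j < 8" "i \<noteq> j"
  shows "path_image (sq.strand i) \<inter> path_image (sq.strand j) \<subseteq> {sq.src i, sq.tgt i} \<inter> {sq.src j, sq.tgt j}"
  using sq.strand_intersection[of i j] assms by simp

lemma strand_ends:
  assumes "i < 8"
  shows "arc (sq.strand i)" "pathstart (sq.strand i) = sq.src i" "pathfinish (sq.strand i) = sq.tgt i"
  using sq.strand_facts(1-3)[of i] assms by simp_all

lemma cycle:
  "simple_loop cycle"
  "path_image cycle = path_image (sq.strand 0) \<union> path_image (reversepath (sq.strand 3)) \<union>
    path_image (sq.strand 2) \<union> path_image (reversepath (sq.strand 1))"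
  "z \<notin> path_image cycle \<Longrightarrow> winding_number cycle z = winding_number (sq.strand 0) z +
    winding_number (reversepath (sq.strand 3)) z + winding_number (sq.strand 2) z +
    winding_number (reversepath (sq.strand 1)) z"
proof -
  have arcs: "arc (sq.strand 0)" "arc (reversepath (sq.strand 3))" "arc (sq.strand 2)" "arc (reversepath (sq.strand 1))"
    using strand_ends(1) by (simp_all add: arc_reversepath)
  have e: "pathfinish (sq.strand 0) = pathstart (reversepath (sq.strand 3))"
    "pathfinish (reversepath (sq.strand 3)) = pathstart (sq.strand 2)"
    "pathfinish (sq.strand 2) = pathstart (reversepath (sq.strand 1))"
    "pathfinish (reversepath (sq.strand 1)) = pathstart (sq.strand 0)"
    using strand_ends(2,3) ends_simps by simp_all
  have i: "path_image (sq.strand 0) \<inter> path_image (reversepath (sq.strand 3)) \<subseteq> {pathstart (reversepath (sq.strand 3))}"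
    "path_image (reversepath (sq.strand 3)) \<inter> path_image (sq.strand 2) \<subseteq> {pathstart (sq.strand 2)}"
    "path_image (sq.strand 2) \<inter> path_image (reversepath (sq.strand 1)) \<subseteq> {pathstart (reversepath (sq.strand 1))}"
    "path_image (reversepath (sq.strand 1)) \<inter> path_image (sq.strand 0) \<subseteq> {pathstart (sq.strand 0)}"
    "path_image (sq.strand 0) \<inter> path_image (sq.strand 2) = {}"
    "path_image (reversepath (sq.strand 3)) \<inter> path_image (reversepath (sq.strand 1)) = {}"
  proof -
    have "path_image (sq.strand 0) \<inter> path_image (sq.strand 3) \<subseteq> {a}"
      "path_image (sq.strand 3) \<inter> path_image (sq.strand 2) \<subseteq> {d}"
      using strand_inter[of 0 3] strand_inter[of 3 2] abcd unfolding ends_simps by auto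
    moreover have "path_image (sq.strand 2) \<inter> path_image (sq.strand 1) \<subseteq> {c}"
      "path_image (sq.strand 1) \<inter> path_image (sq.strand 0) \<subseteq> {b}"
      using strand_inter[of 2 1] strand_inter[of 1 0] abcd unfolding ends_simps by auto
    moreover have "path_image (sq.strand 0) \<inter> path_image (sq.strand 2) = {}"
      "path_image (sq.strand 3) \<inter> path_image (sq.strand 1) = {}"
      using strand_inter[of 0 2] strand_inter[of 3 1] abcd unfolding ends_simps by auto
    ultimately show
      "path_image (sq.strand 0) \<inter> path_image (reversepath (sq.strand 3)) \<subseteq> {pathstart (reversepath (sq.strand 3))}"
      "path_image (reversepath (sq.strand 3)) \<inter> path_image (sq.strand 2) \<subseteq> {pathstart (sq.strand 2)}"
      "path_image (sq.strand 2) \<inter> path_image (reversepath (sq.strand 1)) \<subseteq> {pathstart (reversepath (sq.strand 1))}"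
      "path_image (reversepath (sq.strand 1)) \<inter> path_image (sq.strand 0) \<subseteq> {pathstart (sq.strand 0)}"
      "path_image (sq.strand 0) \<inter> path_image (sq.strand 2) = {}"
      "path_image (reversepath (sq.strand 3)) \<inter> path_image (reversepath (sq.strand 1)) = {}"
      using strand_ends(2)[of 0] strand_ends(2)[of 2] strand_ends(3)[of 1] strand_ends(3)[of 3]
      unfolding ends_simps by simp_all
  qed
  show "simple_loop cycle"
    "path_image cycle = path_image (sq.strand 0) \<union> path_image (reversepath (sq.strand 3)) \<union>
    path_image (sq.strand 2) \<union> path_image (reversepath (sq.strand 1))"
    "z \<notin> path_image cycle \<Longrightarrow> winding_number cycle z = winding_number (sq.strand 0) z +
    winding_number (reversepath (sq.strand 3)) z + winding_number (sq.strand 2) z +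
    winding_number (reversepath (sq.strand 1)) z"
    unfolding cycle_def by (rule simple_loop_join4[OF arcs e i]; assumption)+
qed

text \<open>The legs are the spokes: they join \<open>b\<close>, \<open>a\<close>, \<open>d\<close>,
  \<open>c\<close> to \<open>B\<close>, \<open>A\<close>, \<open>E\<close>, \<open>C\<close>, and
  this is the cyclic order of the four ends read backwards.\<close>

lemma cycle_sign: "loop_sign cycle = - \<sigma>"
proof -
  have ord': "boundary_order D (- \<sigma>) B A E C"
    using boundary_order_rotate[OF boundary_order_rotate[OF boundary_order_rotate[OF boundary_order_reverse[OF ord]]]] .
  note p = distinct_points
  have p': "distinct [d, c, b, a, E, C, B, A]" using p by auto
  have disc: "path_image (sq.strand i) \<subseteq> D" "path_image (sq.strand i) \<inter> frontier D = {sq.src i, sq.tgt i} \<inter> {A, B, C, E}"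
    if "i < 8" for i using sq.strand_disc[of i] that by simp_all
  have int: "path_image (sq.strand i) \<subseteq> interior D" if "i < 4" for i
  proof -
    have "i = 0 \<or> i = 1 \<or> i = 2 \<or> i = 3" using that by auto
    then have "path_image (sq.strand i) \<inter> frontier D = {}" using disc(2)[of i] p ends_simps by auto
    then show ?thesis using disc(1)[of i] sq.D_eq that by fastforce
  qed
  have I: "path_image (sq.strand i) \<inter> path_image (sq.strand j) = {sq.src i, sq.tgt i} \<inter> {sq.src j, sq.tgt j}"
    if ij: "i < 8" "j < 8" "i \<noteq> j" for i j
  proof
    show "{sq.src i, sq.tgt i} \<inter> {sq.src j, sq.tgt j} \<subseteq> path_image (sq.strand i) \<inter> path_image (sq.strand j)"
      using strand_ends(2,3)[OF ij(1)] strand_ends(2,3)[OF ij(2)]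
      by (metis Int_mono empty_subsetI insert_subset pathfinish_in_path_image pathstart_in_path_image)
  qed (rule strand_inter[OF ij])
  have vertex: "x \<notin> path_image (sq.strand i)" if "i < 8" "x \<in> {a, b, c, d}" "x \<noteq> sq.src i" "x \<noteq> sq.tgt i" for x i
    using sq.strand_facts(5)[of i] sq.arc_locus_facts(1)[of i] sq.ends_not_in_arc[of i x] that by auto
  have im: "path_image cycle = path_image (sq.strand 0) \<union> path_image (sq.strand 3) \<union>
    path_image (sq.strand 2) \<union> path_image (sq.strand 1)"
    unfolding cycle(2) by simp
  show ?thesis
  proof (rule spoked_loop_sign[OF sq.disc ord', of "sq.strand 0" "reversepath (sq.strand 3)" "sq.strand 2"
        "reversepath (sq.strand 1)" b a d c cycle "sq.strand 6" "reversepath (sq.strand 4)" "sq.strand 7"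
        "reversepath (sq.strand 5)"])
    show "path_image cycle \<subseteq> interior D" unfolding im using int by simp
    show "path_image (sq.strand 6) \<union> path_image (reversepath (sq.strand 4)) \<union> path_image (sq.strand 7) \<union>
        path_image (reversepath (sq.strand 5)) \<subseteq> D" using disc(1) by simp
    show "path_image (sq.strand 6) \<inter> path_image cycle = {b}"
      unfolding im Int_Un_distrib using I p p' by (simp add: ends_simps)
    show "path_image (reversepath (sq.strand 4)) \<inter> path_image cycle = {a}"
      unfolding im Int_Un_distrib using I p p' by (simp add: ends_simps)
    show "path_image (sq.strand 7) \<inter> path_image cycle = {d}"
      unfolding im Int_Un_distrib using I p p' by (simp add: ends_simps)
    show "path_image (reversepath (sq.strand 5)) \<inter> path_image cycle = {c}"
      unfolding im Int_Un_distrib using I p p' by (simp add: ends_simps)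
  qed (use strand_ends p p' disc(2) I vertex cycle in \<open>simp_all add: arc_reversepath ends_simps\<close>)
qed

lemma same_outer: "hz.outer = sq.outer" "vt.outer = sq.outer" "verts w' - D = verts w - D" "verts w'' - D = verts w - D"
  using agree_outside_local(1,2)[OF sq.web_disc_axioms hz.web_disc_axioms co']
    agree_outside_local(1,2)[OF sq.web_disc_axioms vt.web_disc_axioms co''] by simp_all

lemma two_discs_hz:
  assumes "g \<in> outer_colorings sq.outer (verts w - D)" "k \<in> sq.strand_colorings g" "k' \<in> hz.strand_colorings g"
  shows "two_discs w w' D {A, B, C, E} {a, b, c, d} {}
    [(b, a), (b, c), (d, c), (d, a), (A, a), (C, c), (b, B), (d, E)] [(A, B), (C, E)] As As' g k k'"
  by unfold_locales (use assms co' in auto)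

lemma two_discs_vt:
  assumes "g \<in> outer_colorings sq.outer (verts w - D)" "k \<in> sq.strand_colorings g" "k' \<in> vt.strand_colorings g"
  shows "two_discs w w'' D {A, B, C, E} {a, b, c, d} {}
    [(b, a), (b, c), (d, c), (d, a), (A, a), (C, c), (b, B), (d, E)] [(A, E), (C, B)] As As'' g k k'"
  by unfold_locales (use assms co'' in auto)

lemma two_discs_hz_vt:
  assumes "g \<in> outer_colorings sq.outer (verts w - D)" "k \<in> hz.strand_colorings g" "k' \<in> vt.strand_colorings g"
  shows "two_discs w' w'' D {A, B, C, E} {} {} [(A, B), (C, E)] [(A, E), (C, B)] As' As'' g k k'"
proof unfold_locales
  show "coincide_outside D w' w''" using co' co'' by (simp add: coincide_outside_def)
qed (use assms same_outer in auto)

lemma nth8: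
  "listed [p0, p1, p2, p3, p4, p5, p6, p7] 0 = p0" "listed [p0, p1, p2, p3, p4, p5, p6, p7] 1 = p1"
  "listed [p0, p1, p2, p3, p4, p5, p6, p7] 2 = p2" "listed [p0, p1, p2, p3, p4, p5, p6, p7] 3 = p3"
  "listed [p0, p1, p2, p3, p4, p5, p6, p7] 4 = p4" "listed [p0, p1, p2, p3, p4, p5, p6, p7] 5 = p5"
  "listed [p0, p1, p2, p3, p4, p5, p6, p7] 6 = p6" "listed [p0, p1, p2, p3, p4, p5, p6, p7] 7 = p7"
  by (simp_all add: listed_def)

lemma nth2: "listed [r, s] 0 = r" "listed [r, s] 1 = s"
  by (simp_all add: listed_def)

lemma strand_index2: "{i. i < length [(A, p), (C, q)] \<and> Q i} = {i \<in> {0, 1}. Q i}"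
  by (auto simp: less_Suc_eq)

text \<open>Whichever color is deleted, the remaining strands form zigzags with the ends and colors
  of the remaining strands of \<open>w''\<close>: two zigzags if \<open>x\<close> is deleted, one
  through all four vertices if \<open>y\<close> or \<open>z\<close> is.\<close>

lemma degree_vt:
  assumes g: "g \<in> outer_colorings sq.outer (verts w - D)" "g A = y" "g C = z" "g B = z" "g E = y"
    and xyz: "x \<noteq> y" "x \<noteq> z" "y \<noteq> z"
  shows "(\<Sum>u\<in>UNIV. sq.local_degree g (listed [x, y, x, z, y, z, z, y]) u) =
    (\<Sum>u\<in>UNIV. vt.local_degree g (listed [y, z]) u)"
proof -
  have k: "listed [x, y, x, z, y, z, z, y] \<in> sq.strand_colorings g"
    using g xyz by (auto simp: sq_colorings UNIV_color_iff)
  have k': "listed [y, z] \<in> vt.strand_colorings g" using g by (simp add: vt_colorings)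
  interpret t: two_discs w w'' D "{A, B, C, E}" "{a, b, c, d}" "{}"
    "[(b, a), (b, c), (d, c), (d, a), (A, a), (C, c), (b, B), (d, E)]" "[(A, E), (C, B)]" As As'' g
    "listed [x, y, x, z, y, z, z, y]" "listed [y, z]"
    by (rule two_discs_vt[OF g(1) k k'])
  have "sq.local_degree g (listed [x, y, x, z, y, z, z, y]) x = vt.local_degree g (listed [y, z]) x"
  proof (rule t.local_degree_two_zigzags[of 4 3 7 5 1 6 y z x z y 0 1])
    show "{i. i < length [(b, a), (b, c), (d, c), (d, a), (A, a), (C, c), (b, B), (d, E)] \<and> listed [x, y, x, z, y, z, z, y] i \<noteq> x} = {4, 3, 7, 5, 1, 6}"
      unfolding strand_index using xyz by (auto simp: nth8)
    show "{i. i < length [(A, E), (C, B)] \<and> listed [y, z] i \<noteq> x} = {0, 1}"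
      unfolding strand_index2 using xyz by (auto simp: nth2)
  qed (use xyz distinct_points in \<open>auto simp: nth8 nth2 ends_simps\<close>)
  moreover have "sq.local_degree g (listed [x, y, x, z, y, z, z, y]) y = vt.local_degree g (listed [y, z]) y"
  proof (rule t.local_degree_zigzag5[of 5 2 3 0 6 z x y 1])
    show "{i. i < length [(b, a), (b, c), (d, c), (d, a), (A, a), (C, c), (b, B), (d, E)] \<and> listed [x, y, x, z, y, z, z, y] i \<noteq> y} = {5, 2, 3, 0, 6}"
      unfolding strand_index using xyz by (auto simp: nth8)
    show "{i. i < length [(A, E), (C, B)] \<and> listed [y, z] i \<noteq> y} = {1}"
      unfolding strand_index2 using xyz by (auto simp: nth2)
  qed (use xyz distinct_points in \<open>auto simp: nth8 nth2 ends_simps\<close>)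
  moreover have "sq.local_degree g (listed [x, y, x, z, y, z, z, y]) z = vt.local_degree g (listed [y, z]) z"
  proof (rule t.local_degree_zigzag5[of 4 0 1 2 7 y x z 0])
    show "{i. i < length [(b, a), (b, c), (d, c), (d, a), (A, a), (C, c), (b, B), (d, E)] \<and> listed [x, y, x, z, y, z, z, y] i \<noteq> z} = {4, 0, 1, 2, 7}"
      unfolding strand_index using xyz by (auto simp: nth8)
    show "{i. i < length [(A, E), (C, B)] \<and> listed [y, z] i \<noteq> z} = {0}"
      unfolding strand_index2 using xyz by (auto simp: nth2)
  qed (use xyz distinct_points in \<open>auto simp: nth8 nth2 ends_simps\<close>)
  ultimately show ?thesis unfolding sum_color_triple[OF xyz] by simp
qed

lemma degree_hz:
  assumes g: "g \<in> outer_colorings sq.outer (verts w - D)" "g A = y" "g C = z" "g B = y" "g E = z"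
    and xyz: "x \<noteq> y" "x \<noteq> z" "y \<noteq> z"
  shows "(\<Sum>u\<in>UNIV. sq.local_degree g (listed [z, x, y, x, y, z, y, z]) u) =
    (\<Sum>u\<in>UNIV. hz.local_degree g (listed [y, z]) u)"
proof -
  have k: "listed [z, x, y, x, y, z, y, z] \<in> sq.strand_colorings g"
    using g xyz by (auto simp: sq_colorings UNIV_color_iff)
  have k': "listed [y, z] \<in> hz.strand_colorings g" using g by (simp add: hz_colorings)
  interpret t: two_discs w w' D "{A, B, C, E}" "{a, b, c, d}" "{}"
    "[(b, a), (b, c), (d, c), (d, a), (A, a), (C, c), (b, B), (d, E)]" "[(A, B), (C, E)]" As As' g
    "listed [z, x, y, x, y, z, y, z]" "listed [y, z]"
    by (rule two_discs_hz[OF g(1) k k'])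
  have "sq.local_degree g (listed [z, x, y, x, y, z, y, z]) x = hz.local_degree g (listed [y, z]) x"
  proof (rule t.local_degree_two_zigzags[of 4 0 6 5 2 7 y z x z y 0 1])
    show "{i. i < length [(b, a), (b, c), (d, c), (d, a), (A, a), (C, c), (b, B), (d, E)] \<and> listed [z, x, y, x, y, z, y, z] i \<noteq> x} = {4, 0, 6, 5, 2, 7}"
      unfolding strand_index using xyz by (auto simp: nth8)
    show "{i. i < length [(A, B), (C, E)] \<and> listed [y, z] i \<noteq> x} = {0, 1}"
      unfolding strand_index2 using xyz by (auto simp: nth2)
  qed (use xyz distinct_points in \<open>auto simp: nth8 nth2 ends_simps\<close>)
  moreover have "sq.local_degree g (listed [z, x, y, x, y, z, y, z]) y = hz.local_degree g (listed [y, z]) y"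
  proof (rule t.local_degree_zigzag5[of 5 1 0 3 7 z x y 1])
    show "{i. i < length [(b, a), (b, c), (d, c), (d, a), (A, a), (C, c), (b, B), (d, E)] \<and> listed [z, x, y, x, y, z, y, z] i \<noteq> y} = {5, 1, 0, 3, 7}"
      unfolding strand_index using xyz by (auto simp: nth8)
    show "{i. i < length [(A, B), (C, E)] \<and> listed [y, z] i \<noteq> y} = {1}"
      unfolding strand_index2 using xyz by (auto simp: nth2)
  qed (use xyz distinct_points in \<open>auto simp: nth8 nth2 ends_simps\<close>)
  moreover have "sq.local_degree g (listed [z, x, y, x, y, z, y, z]) z = hz.local_degree g (listed [y, z]) z"
  proof (rule t.local_degree_zigzag5[of 4 3 2 1 6 y x z 0])
    show "{i. i < length [(b, a), (b, c), (d, c), (d, a), (A, a), (C, c), (b, B), (d, E)] \<and> listed [z, x, y, x, y, z, y, z] i \<noteq> z} = {4, 3, 2, 1, 6}"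
      unfolding strand_index using xyz by (auto simp: nth8)
    show "{i. i < length [(A, B), (C, E)] \<and> listed [y, z] i \<noteq> z} = {0}"
      unfolding strand_index2 using xyz by (auto simp: nth2)
  qed (use xyz distinct_points in \<open>auto simp: nth8 nth2 ends_simps\<close>)
  ultimately show ?thesis unfolding sum_color_triple[OF xyz] by simp
qed

end

section \<open>Four ends of a single color, and the comparison of the three sums\<close>

context square
begin

text \<open>Different resolutions enter for different deleted colors. Without \<open>x\<close> the
  sides of color \<open>y\<close> connect the legs as in \<open>w''\<close>; without
  \<open>y\<close> the sides of color \<open>x\<close> connect them as in \<open>w'\<close>; without
  \<open>z\<close> the square is a separate loop, directed like its sides of color
  \<open>x\<close>.\<close>

lemma degree_cycle:
  assumes g: "g \<in> outer_colorings sq.outer (verts w - D)" "g A = z" "g B = z" "g C = z" "g E = z"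
    and xyz: "x \<noteq> y" "x \<noteq> z" "y \<noteq> z"
  shows "(\<Sum>u\<in>UNIV. sq.local_degree g (listed [x, y, x, y, z, z, z, z]) u) =
    vt.local_degree g (listed [z, z]) x + hz.local_degree g (listed [z, z]) y +
    (hz.local_degree g (listed [z, z]) z + (if x = Max (colors_without z) then \<sigma> else - \<sigma>))"
proof -
  let ?k = "listed [x, y, x, y, z, z, z, z]"
  have k: "?k \<in> sq.strand_colorings g"
    using g xyz by (auto simp: sq_colorings UNIV_color_iff)
  have kv: "listed [z, z] \<in> vt.strand_colorings g" and kh: "listed [z, z] \<in> hz.strand_colorings g"
    using g by (simp_all add: vt_colorings hz_colorings)
  interpret v: two_discs w w'' D "{A, B, C, E}" "{a, b, c, d}" "{}"
    "[(b, a), (b, c), (d, c), (d, a), (A, a), (C, c), (b, B), (d, E)]" "[(A, E), (C, B)]" As As'' g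
    ?k "listed [z, z]"
    by (rule two_discs_vt[OF g(1) k kv])
  interpret h: two_discs w w' D "{A, B, C, E}" "{a, b, c, d}" "{}"
    "[(b, a), (b, c), (d, c), (d, a), (A, a), (C, c), (b, B), (d, E)]" "[(A, B), (C, E)]" As As' g
    ?k "listed [z, z]"
    by (rule two_discs_hz[OF g(1) k kh])
  have "sq.local_degree g ?k x = vt.local_degree g (listed [z, z]) x"
  proof (rule v.local_degree_two_zigzags[of 4 3 7 5 1 6 z y x z y 0 1])
    show "{i. i < length [(b, a), (b, c), (d, c), (d, a), (A, a), (C, c), (b, B), (d, E)] \<and> ?k i \<noteq> x} = {4, 3, 7, 5, 1, 6}"
      unfolding strand_index using xyz by (auto simp: nth8)
    show "{i. i < length [(A, E), (C, B)] \<and> listed [z, z] i \<noteq> x} = {0, 1}"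
      unfolding strand_index2 using xyz by (auto simp: nth2)
  qed (use xyz distinct_points in \<open>auto simp: nth8 nth2 ends_simps\<close>)
  moreover have "sq.local_degree g ?k y = hz.local_degree g (listed [z, z]) y"
  proof (rule h.local_degree_two_zigzags[of 4 0 6 5 2 7 z x y z x 0 1])
    show "{i. i < length [(b, a), (b, c), (d, c), (d, a), (A, a), (C, c), (b, B), (d, E)] \<and> ?k i \<noteq> y} = {4, 0, 6, 5, 2, 7}"
      unfolding strand_index using xyz by (auto simp: nth8)
    show "{i. i < length [(A, B), (C, E)] \<and> listed [z, z] i \<noteq> y} = {0, 1}"
      unfolding strand_index2 using xyz by (auto simp: nth2)
  qed (use xyz distinct_points in \<open>auto simp: nth8 nth2 ends_simps\<close>)
  moreover have "sq.local_degree g ?k z = hz.local_degree g (listed [z, z]) z +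
      (if x = Max (colors_without z) then - loop_sign cycle else loop_sign cycle)"
  proof (rule h.local_degree_loop[OF cycle(1)])
    let ?F = "point_field z (sq.glue g ?k) (flow w)"
    have dir: "sq.directed_along z (?k i) (sq.strand i) ?F" if "i < 8" "?k i \<noteq> z" for i
      using sq.strand_directed[OF g(1) k, of i z] that by simp
    have "sq.directed_along z x (sq.strand 0 +++ reversepath (sq.strand 3)) ?F"
      by (rule sq.directed_along_join_reverse[where c' = y])
        (use dir[of 0] dir[of 3] strand_ends(3)[of 0] strand_ends(3)[of 3] xyz in \<open>simp_all add: nth8 ends_simps\<close>)
    moreover have "sq.directed_along z x (sq.strand 2 +++ reversepath (sq.strand 1)) ?F"
      by (rule sq.directed_along_join_reverse[where c' = y])
        (use dir[of 2] dir[of 1] strand_ends(3)[of 2] strand_ends(3)[of 1] xyz in \<open>simp_all add: nth8[unfolded One_nat_def] ends_simps\<close>)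
    ultimately show "sq.directed_along z x cycle ?F"
      unfolding cycle_def
      by (rule sq.directed_along_join)
        (use strand_ends(2)[of 2] strand_ends(2)[of 3] in \<open>simp add: ends_simps\<close>)
    have "{i. i < length [(b, a), (b, c), (d, c), (d, a), (A, a), (C, c), (b, B), (d, E)] \<and> ?k i \<noteq> z} = {0, 3, 2, 1}"
      unfolding strand_index using xyz by (auto simp: nth8)
    then show "(\<Union>i\<in>{i. i < length [(b, a), (b, c), (d, c), (d, a), (A, a), (C, c), (b, B), (d, E)] \<and> ?k i \<noteq> z}.
        path_image (sq.strand i)) = path_image cycle"
      unfolding cycle(2) by (simp only:) auto
    show "listed [z, z] i = z" if "i < length [(A, B), (C, E)]" for i
      using that by (auto simp: less_Suc_eq nth2 nth2[unfolded One_nat_def])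
  qed
  ultimately show ?thesis unfolding sum_color_triple[OF xyz] cycle_sign by simp
qed

text \<open>As all strands have color \<open>z\<close>, the two resolutions differ by a saddle when
  another color is deleted, and both leave the disc empty when \<open>z\<close> is deleted.\<close>

lemma degree_saddle:
  assumes g: "g \<in> outer_colorings sq.outer (verts w - D)" "g A = z" "g B = z" "g C = z" "g E = z"
  shows "u \<noteq> z \<Longrightarrow> vt.local_degree g (listed [z, z]) u =
      hz.local_degree g (listed [z, z]) u + (if z = Max (colors_without u) then - \<sigma> else \<sigma>)"
    and "vt.local_degree g (listed [z, z]) z = hz.local_degree g (listed [z, z]) z"
proof -
  have kv: "listed [z, z] \<in> vt.strand_colorings g" and kh: "listed [z, z] \<in> hz.strand_colorings g"
    using g by (simp_all add: vt_colorings hz_colorings)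
  interpret t: two_discs w' w'' D "{A, B, C, E}" "{}" "{}" "[(A, B), (C, E)]" "[(A, E), (C, B)]" As' As'' g
    "listed [z, z]" "listed [z, z]"
    by (rule two_discs_hz_vt[OF g(1) kh kv])
  show "vt.local_degree g (listed [z, z]) u =
      hz.local_degree g (listed [z, z]) u + (if z = Max (colors_without u) then - \<sigma> else \<sigma>)" if "u \<noteq> z"
    by (rule t.local_degree_saddle[OF ord]) (use that in \<open>auto simp: nth2\<close>)
  have "listed [z, z] i = z" if "i < 2" for i
    using that by (auto simp: less_2_cases_iff nth2)
  then show "vt.local_degree g (listed [z, z]) z = hz.local_degree g (listed [z, z]) z"
    by (intro t.local_degree_no_strands[symmetric]) auto
qed

lemma local_sum:
  assumes g: "g \<in> outer_colorings sq.outer (verts w - D)"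
  shows "(\<Sum>k\<in>sq.strand_colorings g. qpow (\<Sum>u\<in>UNIV. sq.local_degree g k u)) =
    (\<Sum>k\<in>hz.strand_colorings g. qpow (\<Sum>u\<in>UNIV. hz.local_degree g k u)) +
    (\<Sum>k\<in>vt.strand_colorings g. qpow (\<Sum>u\<in>UNIV. vt.local_degree g k u))"
proof -
  have hz: "hz.strand_colorings g = (if g B = g A \<and> g E = g C then {listed [g A, g C]} else {})"
    using hz_coloring_cases[of _ g] hz_colorings[of "g A" "g C" g] by auto
  have vt: "vt.strand_colorings g = (if g E = g A \<and> g B = g C then {listed [g A, g C]} else {})"
    using vt_coloring_cases[of _ g] vt_colorings[of "g A" "g C" g] by auto
  have sq: "(g A = z \<and> g B = z \<and> g C = z \<and> g E = z \<and> k = listed [x, y, x, y, z, z, z, z]) \<or>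
      (g A = y \<and> g C = z \<and> g B = z \<and> g E = y \<and> k = listed [x, y, x, z, y, z, z, y]) \<or>
      (g A = y \<and> g C = z \<and> g B = y \<and> g E = z \<and> k = listed [z, x, y, x, y, z, y, z])"
    if k: "k \<in> sq.strand_colorings g" and "k \<in> {listed [x, y, x, y, z, z, z, z], listed [x, y, x, z, y, z, z, y], listed [z, x, y, x, y, z, y, z]}"
    for k x y z
    using that(2) k by (elim insertE emptyE) (simp_all add: sq_colorings)
  consider (same) z where "g A = z" "g B = z" "g C = z" "g E = z"
    | (vertical) y z where "y \<noteq> z" "g A = y" "g C = z" "g B = z" "g E = y"
    | (horizontal) y z where "y \<noteq> z" "g A = y" "g C = z" "g B = y" "g E = z"
    | (none) "\<not> (g B = g A \<and> g E = g C)" "\<not> (g E = g A \<and> g B = g C)"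
    by metis
  then show ?thesis
  proof cases
    case same
    obtain x y where xyz: "x \<noteq> y" "x \<noteq> z" "y \<noteq> z" using other_colors[of z] by metis
    have yxz: "y \<noteq> x" "y \<noteq> z" "x \<noteq> z" using xyz by auto
    let ?k = "listed [x, y, x, y, z, z, z, z]" and ?k' = "listed [y, x, y, x, z, z, z, z]"
    have "sq.strand_colorings g = {?k, ?k'}"
    proof
      show "{?k, ?k'} \<subseteq> sq.strand_colorings g"
        using same xyz by (auto simp: sq_colorings UNIV_color_iff)
      show "sq.strand_colorings g \<subseteq> {?k, ?k'}"
      proof
        fix k assume k: "k \<in> sq.strand_colorings g"
        then obtain x' y' z' where d: "x' \<noteq> y'" "x' \<noteq> z'" "y' \<noteq> z'"
          and k': "k \<in> {listed [x', y', x', y', z', z', z', z'], listed [x', y', x', z', y', z', z', y'],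
            listed [z', x', y', x', y', z', y', z']}" by (rule sq_coloring_cases)
        have *: "z' = z" "k = listed [x', y', x', y', z', z', z', z']"
          using sq[OF k k'] same d by auto
        have "x' = x \<or> x' = y" using third_color[of x z y x'] d * xyz by metis
        then have "x' = x \<and> y' = y \<or> x' = y \<and> y' = x"
          using third_color[of z x y y'] third_color[of z y x y'] d * xyz by metis
        then show "k \<in> {?k, ?k'}" using * by auto
      qed
    qed
    moreover have "?k \<noteq> ?k'" using xyz by (simp add: listed_inject)
    ultimately have sq_sum: "(\<Sum>k\<in>sq.strand_colorings g. qpow (\<Sum>u\<in>UNIV. sq.local_degree g k u)) =
        qpow (\<Sum>u\<in>UNIV. sq.local_degree g ?k u) + qpow (\<Sum>u\<in>UNIV. sq.local_degree g ?k' u)" by simp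
    have one: "hz.strand_colorings g = {listed [z, z]}" "vt.strand_colorings g = {listed [z, z]}"
      unfolding hz vt using same by simp_all
    define m where "m = (\<Sum>u\<in>UNIV. hz.local_degree g (listed [z, z]) u)"
    \<comment> \<open>\<open>ex\<close> and \<open>ey\<close> are the changes of degree from
      \<open>w'\<close> to \<open>w''\<close> when \<open>x\<close> and \<open>y\<close> are
      deleted; \<open>ez\<close> is the sign of the square in the coloring \<open>?k\<close> when
      \<open>z\<close> is deleted. Exchanging \<open>x\<close> and \<open>y\<close>, which leads to
      \<open>?k'\<close>, negates \<open>ez\<close>.\<close>
    define ex where "ex = (if z = Max (colors_without x) then - \<sigma> else \<sigma>)"
    define ey where "ey = (if z = Max (colors_without y) then - \<sigma> else \<sigma>)"
    define ez where "ez = (if x = Max (colors_without z) then \<sigma> else - \<sigma>)"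
    have ez': "(if y = Max (colors_without z) then \<sigma> else - \<sigma>) = - ez"
      using Max_without_third[OF xyz] by (auto simp: ez_def)
    note s = degree_saddle(1)[OF g same xyz(2), folded ex_def] degree_saddle(1)[OF g same xyz(3), folded ey_def]
      degree_saddle(2)[OF g same]
    note hz_triple = sum_color_triple[OF xyz, of "hz.local_degree g (listed [z, z])"]
      and vt_triple = sum_color_triple[OF xyz, of "vt.local_degree g (listed [z, z])"]
    have vt_sum: "(\<Sum>u\<in>UNIV. vt.local_degree g (listed [z, z]) u) = m + (ex + ey)"
      unfolding vt_triple m_def hz_triple s by simp
    have sum_k: "(\<Sum>u\<in>UNIV. sq.local_degree g ?k u) = m + (ex + ez)"
      unfolding degree_cycle[OF g same xyz] m_def hz_triple s by (simp add: ez_def)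
    have sum_k': "(\<Sum>u\<in>UNIV. sq.local_degree g ?k' u) = m + (ey - ez)"
      unfolding degree_cycle[OF g same yxz] m_def hz_triple s ez' by simp
    \<comment> \<open>Otherwise the three maxima would order the colors cyclically.\<close>
    have "ez = - ex \<or> ez = ey"
      using xyz unfolding ex_def ey_def ez_def
      by (cases x; cases y; cases z) (simp_all add: Max_color)
    then show ?thesis unfolding sq_sum one sum_k sum_k' by (auto simp: vt_sum m_def add.commute)
  next
    case vertical
    obtain x where xyz: "x \<noteq> y" "x \<noteq> z" "y \<noteq> z" using other_colors vertical(1) by metis
    let ?k = "listed [x, y, x, z, y, z, z, y]"
    have "sq.strand_colorings g = {?k}"
    proof
      show "{?k} \<subseteq> sq.strand_colorings g"
        using vertical xyz by (auto simp: sq_colorings UNIV_color_iff)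
      show "sq.strand_colorings g \<subseteq> {?k}"
      proof
        fix k assume k: "k \<in> sq.strand_colorings g"
        then obtain x' y' z' where d: "x' \<noteq> y'" "x' \<noteq> z'" "y' \<noteq> z'"
          and k': "k \<in> {listed [x', y', x', y', z', z', z', z'], listed [x', y', x', z', y', z', z', y'],
            listed [z', x', y', x', y', z', y', z']}" by (rule sq_coloring_cases)
        have *: "z' = z" "y' = y" "k = listed [x', y', x', z', y', z', z', y']"
          using sq[OF k k'] vertical d by auto
        have "x' = x" using third_color[of y z x x'] d * xyz by metis
        then show "k \<in> {?k}" using * by simp
      qed
    qed
    moreover have "hz.strand_colorings g = {}" "vt.strand_colorings g = {listed [y, z]}"
      unfolding hz vt using vertical by simp_all
    moreover note degree_vt[OF g vertical(2-5) xyz]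
    ultimately show ?thesis by simp
  next
    case horizontal
    obtain x where xyz: "x \<noteq> y" "x \<noteq> z" "y \<noteq> z" using other_colors horizontal(1) by metis
    let ?k = "listed [z, x, y, x, y, z, y, z]"
    have "sq.strand_colorings g = {?k}"
    proof
      show "{?k} \<subseteq> sq.strand_colorings g"
        using horizontal xyz by (auto simp: sq_colorings UNIV_color_iff)
      show "sq.strand_colorings g \<subseteq> {?k}"
      proof
        fix k assume k: "k \<in> sq.strand_colorings g"
        then obtain x' y' z' where d: "x' \<noteq> y'" "x' \<noteq> z'" "y' \<noteq> z'"
          and k': "k \<in> {listed [x', y', x', y', z', z', z', z'], listed [x', y', x', z', y', z', z', y'],
            listed [z', x', y', x', y', z', y', z']}" by (rule sq_coloring_cases)
        have *: "z' = z" "y' = y" "k = listed [z', x', y', x', y', z', y', z']"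
          using sq[OF k k'] horizontal d by auto
        have "x' = x" using third_color[of y z x x'] d * xyz by metis
        then show "k \<in> {?k}" using * by simp
      qed
    qed
    moreover have "hz.strand_colorings g = {listed [y, z]}" "vt.strand_colorings g = {}"
      unfolding hz vt using horizontal by simp_all
    moreover note degree_hz[OF g horizontal(2-5) xyz]
    ultimately show ?thesis by simp
  next
    case none
    have "sq.strand_colorings g = {}"
    proof -
      have False if k: "k \<in> sq.strand_colorings g" for k
      proof -
        from k obtain x' y' z' where
          k': "k \<in> {listed [x', y', x', y', z', z', z', z'], listed [x', y', x', z', y', z', z', y'],
            listed [z', x', y', x', y', z', y', z']}" by (rule sq_coloring_cases)
        show False using sq[OF k k'] none by auto
      qed
      then show ?thesis by blast
    qed
    then show ?thesis unfolding hz vt if_not_P[OF none(1)] if_not_P[OF none(2)] by simp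
  qed
qed

lemma bracket: "bracket w = bracket w' + bracket w''"
proof -
  let ?G = "outer_colorings sq.outer (verts w - D)"
  define H where "H = {g \<in> ?G. sq.strand_colorings g \<noteq> {}} \<union> {g \<in> ?G. hz.strand_colorings g \<noteq> {}} \<union>
    {g \<in> ?G. vt.strand_colorings g \<noteq> {}}"
  have H: "finite H" "H \<subseteq> ?G"
    using sq.bracket_local(1) hz.bracket_local(1) vt.bracket_local(1) same_outer by (auto simp: H_def)
  have sq: "bracket w = (\<Sum>g\<in>H. \<Sum>k\<in>sq.strand_colorings g. qpow (\<Sum>u\<in>UNIV. sq.local_degree g k u))"
    by (rule sq.bracket_local(2)[OF H]) (auto simp: H_def)
  have hz: "bracket w' = (\<Sum>g\<in>H. \<Sum>k\<in>hz.strand_colorings g. qpow (\<Sum>u\<in>UNIV. hz.local_degree g k u))"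
    by (rule hz.bracket_local(2)) (use H same_outer in \<open>auto simp: H_def\<close>)
  have vt: "bracket w'' = (\<Sum>g\<in>H. \<Sum>k\<in>vt.strand_colorings g. qpow (\<Sum>u\<in>UNIV. vt.local_degree g k u))"
    by (rule vt.bracket_local(2)) (use H same_outer in \<open>auto simp: H_def\<close>)
  show ?thesis unfolding sq hz vt sum.distrib[symmetric]
    by (rule sum.cong[OF refl], rule local_sum) (use H(2) in blast)
qed

end

lemma bracket_square:
  assumes "closed_web w" "closed_web w'" "closed_web w''" "closed_disc D" "cyclic_on_boundary D SW SE NE NW"
    "coincide_outside D w w'" "coincide_outside D w w''" "distinct [a, b, c, d]"
    "inside_disc D w {SW, SE, NE, NW} {a, b, c, d}
      [(b, a), (b, c), (d, c), (d, a), (SW, a), (NE, c), (b, SE), (d, NW)]"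
    "inside_disc D w' {SW, SE, NE, NW} {} [(SW, SE), (NE, NW)]"
    "inside_disc D w'' {SW, SE, NE, NW} {} [(SW, NW), (NE, SE)]"
  shows "bracket w = bracket w' + bracket w''"
proof -
  obtain As where As: "web_disc w D {SW, SE, NE, NW} {a, b, c, d}
      [(b, a), (b, c), (d, c), (d, a), (SW, a), (NE, c), (b, SE), (d, NW)] As"
    by (rule inside_disc_web_disc[OF assms(1,4,9)]) auto
  obtain As' where As': "web_disc w' D {SW, SE, NE, NW} {} [(SW, SE), (NE, NW)] As'"
    by (rule inside_disc_web_disc[OF assms(2,4,10)]) auto
  obtain As'' where As'': "web_disc w'' D {SW, SE, NE, NW} {} [(SW, NW), (NE, SE)] As''"
    by (rule inside_disc_web_disc[OF assms(3,4,11)]) auto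
  obtain \<sigma> where "boundary_order D \<sigma> SW SE NE NW" using boundary_order_if_cyclic(2)[OF assms(5)] by blast
  then interpret square w w' w'' D SW SE NE NW a b c d As As' As'' \<sigma>
    using As As' As'' assms(6-8) by (simp add: square_def square_axioms_def)
  show ?thesis by (rule bracket)
qed

theorem theorem1p11:
  shows
    "(\<forall>w w1 w2. closed_web w \<and> closed_web w1 \<and> closed_web w2 \<and> disjoint_union w w1 w2 \<longrightarrow>
        bracket w = bracket w1 * bracket w2)
   \<and> (\<forall>w w' w'' D SW SE NE NW a b c d.
        closed_web w \<and> closed_web w' \<and> closed_web w'' \<and>
        closed_disc D \<and> cyclic_on_boundary D SW SE NE NW \<and>
        coincide_outside D w w' \<and> coincide_outside D w w'' \<and>
        distinct [a, b, c, d] \<and>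
        inside_disc D w {SW, SE, NE, NW} {a, b, c, d}
          [(b, a), (b, c), (d, c), (d, a), (SW, a), (NE, c), (b, SE), (d, NW)] \<and>
        inside_disc D w' {SW, SE, NE, NW} {} [(SW, SE), (NE, NW)] \<and>
        inside_disc D w'' {SW, SE, NE, NW} {} [(SW, NW), (NE, SE)] \<longrightarrow>
        bracket w = bracket w' + bracket w'')
   \<and> (\<forall>w w' D S N a b.
        closed_web w \<and> closed_web w' \<and> closed_disc D \<and> S \<noteq> N \<and>
        coincide_outside D w w' \<and> a \<noteq> b \<and>
        inside_disc D w {S, N} {a, b} [(b, a), (b, a), (S, a), (b, N)] \<and>
        inside_disc D w' {S, N} {} [(S, N)] \<longrightarrow>
        bracket w = quantum_int 2 * bracket w')
   \<and> (\<forall>w C. closed_web w \<and> w = \<lparr>verts = {}, edges = {}, circles = {C}\<rparr> \<longrightarrow>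
        bracket w = quantum_int 3)"
proof (intro conjI allI impI; elim conjE)
qed (rule bracket_disjoint_union bracket_square bracket_digon bracket_circle; assumption)+

end
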